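(* Let $p\ge 2$, let $T>0$, let $\Omega\subset\mathbb{R}^n$ be a bounded Lipschitz domain, $\Omega_T=\Omega\times(0,T)$, and let $\psi\in C^2(\overline{\Omega_T})$. Then a weak solution of Trudinger's equation $\partial_t(|u|^{p-2}u)=\operatorname{div}(|\nabla u|^{p-2}\nabla u)$ in $\Omega_T$ with boundary values $\psi$ is unique: if $u$ and $v$ are two weak solutions with boundary values $\psi$, then $u=v$ almost everywhere in $\Omega_T$.
   Context: Notation: $b(z):=|z|^{p-2}z$ with $b(0)=0$; $\nabla$ is the spatial gradient. Solutions may change sign. The space $L^p(0,T;W^{1,p}(\Omega))$ consists of measurable $u:\Omega_T\to\mathbb{R}$ such that $x\mapsto u(x,t)$ belongs to $W^{1,p}(\Omega)$ for a.e. $t\in(0,T)$ and $\int_0^T\int_\Omega(|u|^p+|\nabla u|^p)\,dx\,dt<\infty$; $L^p(0,T;W^{1,p}_0(\Omega))$ is defined analogously. Weak solution: let $\psi\in C(\overline{\Omega_T})\cap L^p(0,T;W^{1,p}(\Omega))$ and $u\in L^p(0,T;W^{1,p}(\Omega))$. Then $u$ is a weak solution with boundary values $\psi$ if (1) $u-\psi\in L^p(0,T;W_0^{1,p}(\Omega))$; (2) for every $\gamma\in C_0^\infty(\Omega_T)$, $\int_0^T\int_\Omega\bigl(-b(u)\,\partial_t\gamma+\langle|\nabla u|^{p-2}\nabla u,\nabla\gamma\rangle\bigr)\,dx\,dt=0$; (3) $\lim_{t\to0+}\int_\Omega|b(u(x,t))-b(\psi(x,t))|\,dx=0$. *)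

theory Defs
  imports "HOL-Analysis.Analysis"
begin

section \<open>Smooth functions\<close>

text \<open>
  \<open>partials [b\<^sub>1, \<dots>, b\<^sub>m] f\<close> is the iterated directional derivative
  of \<open>f\<close>, with \<open>b\<^sub>m\<close> applied first. It is meaningful only where the derivatives exist; in
  the definitions below existence is required separately.
\<close>

primrec partials :: "'a list \<Rightarrow> ('a::euclidean_space \<Rightarrow> real) \<Rightarrow> 'a \<Rightarrow> real" where
  "partials [] f = f"
| "partials (b # bs) f = (\<lambda>x. frechet_derivative (partials bs f) (at x) b)"

text \<open>\<open>C\<^sup>k(S)\<close>, intended for open \<open>S\<close>.\<close>

definition Ck_on :: "nat \<Rightarrow> 'a::euclidean_space set \<Rightarrow> ('a \<Rightarrow> real) set" where
  "Ck_on k S =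
    {f. \<forall>bs. set bs \<subseteq> Basis \<and> length bs \<le> k \<longrightarrow>
          continuous_on S (partials bs f) \<and>
          (length bs < k \<longrightarrow> (\<forall>x\<in>S. partials bs f differentiable (at x)))}"

text \<open>
  \<open>C\<^sup>k\<close> up to the boundary, for open \<open>S\<close>: all derivatives of order at most \<open>k\<close> extend
  continuously to the closure of \<open>S\<close>, and \<open>f\<close> itself is given there by its extension.
\<close>

definition Ck_closure :: "nat \<Rightarrow> 'a::euclidean_space set \<Rightarrow> ('a \<Rightarrow> real) set" where
  "Ck_closure k S =
    {f \<in> Ck_on k S. continuous_on (closure S) f \<and>
       (\<forall>bs. set bs \<subseteq> Basis \<and> length bs \<le> k \<longrightarrow>
          (\<exists>g. continuous_on (closure S) g \<and> (\<forall>x\<in>S. g x = partials bs f x)))}"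

text \<open>\<open>C\<^sub>0\<^sup>\<infinity>(S)\<close>; its elements are represented by their extensions by zero to the whole space.\<close>

definition test_functions :: "'a::euclidean_space set \<Rightarrow> ('a \<Rightarrow> real) set" where
  "test_functions S =
    {\<phi>. (\<forall>k. \<phi> \<in> Ck_on k UNIV) \<and>
         compact (closure {x. \<phi> x \<noteq> 0}) \<and> closure {x. \<phi> x \<noteq> 0} \<subseteq> S}"

definition grad :: "('a::euclidean_space \<Rightarrow> real) \<Rightarrow> 'a \<Rightarrow> 'a" where
  "grad f x = (\<Sum>b\<in>Basis. frechet_derivative f (at x) b *\<^sub>R b)"


section \<open>Lipschitz domains\<close>

text \<open>
  Near every boundary point, after a rigid motion making the unit vector \<open>e\<close> the last
  coordinate direction, \<open>\<Omega>\<close> is the set above the graph of a Lipschitz function \<open>g\<close> of the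
  remaining coordinates, i.e. of the orthogonal projection onto the hyperplane normal to \<open>e\<close>.
\<close>

definition lipschitz_domain :: "'a::euclidean_space set \<Rightarrow> bool" where
  "lipschitz_domain \<Omega> \<longleftrightarrow>
     open \<Omega> \<and> connected \<Omega> \<and> \<Omega> \<noteq> {} \<and>
     (\<forall>x0\<in>frontier \<Omega>. \<exists>r>0. \<exists>e g L. norm e = 1 \<and> L-lipschitz_on {z. z \<bullet> e = 0} g \<and>
        (\<forall>y\<in>ball x0 r. y \<in> \<Omega> \<longleftrightarrow> g (y - (y \<bullet> e) *\<^sub>R e) < y \<bullet> e))"


section \<open>Sobolev spaces\<close>

text \<open>
  Elements of the function spaces are functions, not equivalence classes; only their values on
  the underlying set matter.
\<close>

definition Lp_on :: "real \<Rightarrow> 'a::euclidean_space set \<Rightarrow> ('a \<Rightarrow> 'b::euclidean_space) set" where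
  "Lp_on p S = {f \<in> borel_measurable (lebesgue_on S).
                  integrable (lebesgue_on S) (\<lambda>x. norm (f x) powr p)}"

definition has_weak_gradient ::
  "'a::euclidean_space set \<Rightarrow> ('a \<Rightarrow> real) \<Rightarrow> ('a \<Rightarrow> 'a) \<Rightarrow> bool" where
  "has_weak_gradient \<Omega> f G \<longleftrightarrow>
     (\<forall>K. compact K \<and> K \<subseteq> \<Omega> \<longrightarrow> integrable (lebesgue_on K) f \<and> integrable (lebesgue_on K) G) \<and>
     (\<forall>\<phi>\<in>test_functions \<Omega>. \<forall>b\<in>Basis.
        (LINT x|lebesgue_on \<Omega>. f x * frechet_derivative \<phi> (at x) b)
          = - (LINT x|lebesgue_on \<Omega>. (G x \<bullet> b) * \<phi> x))"

definition W1p :: "real \<Rightarrow> 'a::euclidean_space set \<Rightarrow> ('a \<Rightarrow> real) set" where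
  "W1p p \<Omega> = {f \<in> Lp_on p \<Omega>. \<exists>G\<in>Lp_on p \<Omega>. has_weak_gradient \<Omega> f G}"

text \<open>The closure of the test functions in the Sobolev norm.\<close>

definition W1p_0 :: "real \<Rightarrow> 'a::euclidean_space set \<Rightarrow> ('a \<Rightarrow> real) set" where
  "W1p_0 p \<Omega> = {f \<in> Lp_on p \<Omega>. \<exists>G\<in>Lp_on p \<Omega>. has_weak_gradient \<Omega> f G \<and>
     (\<exists>\<phi>. (\<forall>k::nat. \<phi> k \<in> test_functions \<Omega>) \<and>
       (\<lambda>k. LINT x|lebesgue_on \<Omega>. \<bar>\<phi> k x - f x\<bar> powr p) \<longlonglongrightarrow> 0 \<and>
       (\<lambda>k. LINT x|lebesgue_on \<Omega>. norm (grad (\<phi> k) x - G x) powr p) \<longlonglongrightarrow> 0)}"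


section \<open>Parabolic spaces\<close>

text \<open>Points of space-time are pairs \<open>(x, t)\<close>.\<close>

abbreviation cylinder :: "'a::euclidean_space set \<Rightarrow> real \<Rightarrow> ('a \<times> real) set" where
  "cylinder \<Omega> T \<equiv> \<Omega> \<times> {0<..<T}"

text \<open>
  A jointly measurable version of the slicewise weak gradient. It is determined up to a null
  subset of the cylinder.
\<close>

definition has_spatial_gradient ::
  "'a::euclidean_space set \<Rightarrow> real \<Rightarrow> ('a \<times> real \<Rightarrow> real) \<Rightarrow> ('a \<times> real \<Rightarrow> 'a) \<Rightarrow> bool" where
  "has_spatial_gradient \<Omega> T u Du \<longleftrightarrow>
     Du \<in> borel_measurable (lebesgue_on (cylinder \<Omega> T)) \<and>
     (AE t in lebesgue_on {0<..<T}. has_weak_gradient \<Omega> (\<lambda>x. u (x, t)) (\<lambda>x. Du (x, t)))"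

text \<open>\<open>L\<^sup>p(0,T;X)\<close> for \<open>X\<close> either \<^term>\<open>W1p p \<Omega>\<close> or \<^term>\<open>W1p_0 p \<Omega>\<close>.\<close>

definition Lp_time ::
  "real \<Rightarrow> 'a::euclidean_space set \<Rightarrow> real \<Rightarrow> ('a \<Rightarrow> real) set \<Rightarrow> ('a \<times> real \<Rightarrow> real) set" where
  "Lp_time p \<Omega> T X =
    {u \<in> borel_measurable (lebesgue_on (cylinder \<Omega> T)).
       (AE t in lebesgue_on {0<..<T}. (\<lambda>x. u (x, t)) \<in> X) \<and>
       (\<exists>Du. has_spatial_gradient \<Omega> T u Du \<and>
          integrable (lebesgue_on (cylinder \<Omega> T)) (\<lambda>z. \<bar>u z\<bar> powr p + norm (Du z) powr p))}"


section \<open>Trudinger's equation\<close>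

text \<open>\<open>b(z) = |z|\<^sup>p\<^sup>-\<^sup>2 z\<close>; since \<^term>\<open>0 powr s = (0::real)\<close>, also \<open>b(0) = 0\<close>.\<close>

definition b_fun :: "real \<Rightarrow> real \<Rightarrow> real" where
  "b_fun p z = \<bar>z\<bar> powr (p - 2) * z"

definition time_deriv :: "('a::euclidean_space \<times> real \<Rightarrow> real) \<Rightarrow> 'a \<times> real \<Rightarrow> real" where
  "time_deriv \<gamma> z = frechet_derivative \<gamma> (at z) (0, 1)"

definition space_grad :: "('a::euclidean_space \<times> real \<Rightarrow> real) \<Rightarrow> 'a \<times> real \<Rightarrow> 'a" where
  "space_grad \<gamma> z = (\<Sum>b\<in>Basis. frechet_derivative \<gamma> (at z) (b, 0) *\<^sub>R b)"

text \<open>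
  The integrand of the weak formulation is integrable because
  \<open>u \<in> L\<^sup>p(0,T;W\<^sup>1\<^sup>,\<^sup>p(\<Omega>))\<close>. The initial condition uses the nonnegative integral so that a
  non-integrable time slice is not assigned the value 0.
\<close>

definition trudinger_weak_solution ::
  "real \<Rightarrow> 'a::euclidean_space set \<Rightarrow> real \<Rightarrow> ('a \<times> real \<Rightarrow> real) \<Rightarrow> ('a \<times> real \<Rightarrow> real) \<Rightarrow> bool" where
  "trudinger_weak_solution p \<Omega> T \<psi> u \<longleftrightarrow>
     continuous_on (closure (cylinder \<Omega> T)) \<psi> \<and> \<psi> \<in> Lp_time p \<Omega> T (W1p p \<Omega>) \<and>
     u \<in> Lp_time p \<Omega> T (W1p p \<Omega>) \<and>
     (\<lambda>z. u z - \<psi> z) \<in> Lp_time p \<Omega> T (W1p_0 p \<Omega>) \<and>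
     (\<exists>Du. has_spatial_gradient \<Omega> T u Du \<and>
        (\<forall>\<gamma>\<in>test_functions (cylinder \<Omega> T).
           (LINT z|lebesgue_on (cylinder \<Omega> T).
              - b_fun p (u z) * time_deriv \<gamma> z
              + (norm (Du z) powr (p - 2) *\<^sub>R Du z) \<bullet> space_grad \<gamma> z) = 0)) \<and>
     ((\<lambda>t. \<integral>\<^sup>+x. ennreal \<bar>b_fun p (u (x, t)) - b_fun p (\<psi> (x, t))\<bar> \<partial>lebesgue_on \<Omega>) \<longlongrightarrow> 0)
       (at_right 0)"

end

theory Submission imports Defs begin

text \<open>
 Formally, test the difference of the two equations with a smooth approximation of the indicator of
 \<open>{v < u}\<close>. The difference of the fluxes contributes a nonnegative term, since
 \<open>\<xi> \<mapsto> |\<xi>|\<^sup>p\<^sup>-\<^sup>2 \<xi>\<close> is monotone, and what remains says that \<open>\<integral> (b(u) - b(v))\<^sup>+ dx\<close> does not increase in time.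
 It vanishes initially, so \<open>u \<le> v\<close>, and \<open>u = v\<close> by symmetry.

 This function cannot be inserted directly. A weak solution has no time derivative, so the parabolic term
 is treated by convexity: an increment of \<open>b(u)\<close>, times a nondecreasing function of \<open>u\<close> at the later time, is at
 least the increment of an entropy. That fails if \<open>v\<close> varies simultaneously. The remedy is to double the time variable, but not
 the space variable, and to compare \<open>u(x,t)\<close> with \<open>v(x,s)\<close> for \<open>s = t - \<epsilon>\<tau>\<close>, \<open>|\<tau>| \<le> 1\<close>. In each of the two
 equations the other solution is then frozen, and the difference of two time slices can be tested
 directly. The test function is \<open>step((u(x,t) - v(x,s) - \<epsilon>L)/\<epsilon>)\<close>, where \<open>L\<close> is a Lipschitz constant of \<open>\<psi>\<close>
 in time. On the lateral boundary \<open>u(x,t) - v(x,s) = \<psi>(x,t) - \<psi>(x,s) \<le> \<epsilon>L\<close>, so that the shift by \<open>\<epsilon>L\<close>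
 makes the test function vanish there. The lemma \<open>chain_zero\<close> makes this precise by approximating
 \<open>u - \<psi>\<close> and \<open>v - \<psi>\<close> with test functions; this is where the boundary condition enters.

 The equation holds between almost all pairs of times (\<open>weak_in_time\<close>). Testing it with the function
 above and using convexity of the entropies \<open>ent1\<close> and \<open>ent2\<close> gives \<open>slice_inequality\<close> for time steps of
 length \<open>h\<close>. Multiplying by cutoffs \<open>\<omega>(t)\<close> and \<open>\<eta>(\<tau>)\<close>, integrating, moving the time differences to the
 cutoffs, and letting \<open>h \<rightarrow> 0\<close>, the time averages of the fluxes converge to the fluxes themselves,
 where monotonicity gives their sign; the result is \<open>entropy_inequality\<close>.

 Finally \<open>\<epsilon> \<rightarrow> 0\<close>. The derivative of the cutoff in \<open>\<tau>\<close> carries a factor \<open>1/\<epsilon>\<close>, but it multiplies the difference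
 \<open>ent1 - ent2\<close>, which is of order \<open>\<epsilon>\<close> because \<open>b\<close> is continuously differentiable for \<open>p \<ge> 2\<close>
 (\<open>ent_diff_tendsto\<close>). Its limit does not depend on \<open>\<tau>\<close>, and so it is killed by \<open>\<integral> \<eta>' = 0\<close>. This yields
 \<open>time_inequality\<close>: \<open>\<integral> (b(u) - b(v))\<^sup>+ dx\<close> is nonincreasing in the sense of distributions. Together with
 the initial condition it gives \<open>comparison\<close>.

 The whole argument is carried out for Borel representatives that vanish outside the cylinder, and with
 integrals over the whole space; \<open>borel_representative\<close> supplies these for a weak solution.
\<close>

lemmas integrable_dominated = Bochner_Integration.integrable_bound

section \<open>Smooth functions\<close>

lemma partials_append: "partials (bs @ cs) f = partials bs (partials cs f)"
 by (induction bs) auto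

lemma Ck_on_0_iff: "f \<in> Ck_on 0 S \<longleftrightarrow> continuous_on S f"
 by (auto simp: Ck_on_def)

text \<open>
 The iterated derivatives of a derivative are those whose list ends in that direction; this makes
 induction on the order of differentiability possible.
\<close>

lemma Ck_on_Suc_iff:
 fixes f :: "'a::euclidean_space \<Rightarrow> real"
 shows "f \<in> Ck_on (Suc k) S \<longleftrightarrow> continuous_on S f \<and> (\<forall>x\<in>S. f differentiable at x) \<and>
   (\<forall>b\<in>Basis. (\<lambda>x. frechet_derivative f (at x) b) \<in> Ck_on k S)"
proof
 assume f: "f \<in> Ck_on (Suc k) S"
 show "continuous_on S f \<and> (\<forall>x\<in>S. f differentiable at x) \<and>
   (\<forall>b\<in>Basis. (\<lambda>x. frechet_derivative f (at x) b) \<in> Ck_on k S)"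
 proof (intro conjI ballI)
  show "continuous_on S f" using f[unfolded Ck_on_def, simplified, rule_format, of "[]"] by simp
  show "f differentiable at x" if "x \<in> S" for x
   using f[unfolded Ck_on_def, simplified, rule_format, of "[]"] that by simp
  fix b :: 'a assume b: "b \<in> Basis"
  show "(\<lambda>x. frechet_derivative f (at x) b) \<in> Ck_on k S"
   unfolding Ck_on_def
  proof (clarify)
   fix bs :: "'a list" assume bs: "set bs \<subseteq> Basis" "length bs \<le> k"
   have "continuous_on S (partials (bs @ [b]) f) \<and> (length (bs@[b]) < Suc k \<longrightarrow> (\<forall>x\<in>S. partials (bs@[b]) f differentiable at x))"
    using f bs b unfolding Ck_on_def by (simp del: partials.simps)
   then show "continuous_on S (partials bs (\<lambda>x. frechet_derivative f (at x) b)) \<and>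
     (length bs < k \<longrightarrow> (\<forall>x\<in>S. partials bs (\<lambda>x. frechet_derivative f (at x) b) differentiable at x))"
    by (simp add: partials_append)
  qed
 qed
next
 assume f: "continuous_on S f \<and> (\<forall>x\<in>S. f differentiable at x) \<and>
   (\<forall>b\<in>Basis. (\<lambda>x. frechet_derivative f (at x) b) \<in> Ck_on k S)"
 show "f \<in> Ck_on (Suc k) S"
  unfolding Ck_on_def
 proof clarify
  fix bs :: "'a list" assume bs: "set bs \<subseteq> Basis" "length bs \<le> Suc k"
  show "continuous_on S (partials bs f) \<and> (length bs < Suc k \<longrightarrow> (\<forall>x\<in>S. partials bs f differentiable at x))"
  proof (cases bs rule: rev_cases)
   case Nil then show ?thesis using f by auto
  next
   case (snoc cs b)
   then show ?thesis using f bs by (auto simp: partials_append Ck_on_def)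
  qed
 qed
qed

lemma Ck_on_SucI:
 fixes f :: "'a::euclidean_space \<Rightarrow> real"
 assumes "\<And>x. (f has_derivative D x) (at x)" "\<And>b. b \<in> Basis \<Longrightarrow> (\<lambda>x. D x b) \<in> Ck_on k UNIV"
 shows "f \<in> Ck_on (Suc k) UNIV"
proof -
 have "frechet_derivative f (at x) = D x" for x using assms(1) frechet_derivative_at by metis
 moreover have "continuous_on UNIV f"
  using assms(1) has_derivative_continuous continuous_at_imp_continuous_on by blast
 moreover have "f differentiable at x" for x using assms(1) differentiable_def by blast
 ultimately show ?thesis unfolding Ck_on_Suc_iff using assms(2) by simp
qed

lemma Ck_on_SucD:
 fixes f :: "'a::euclidean_space \<Rightarrow> real"
 assumes "f \<in> Ck_on (Suc k) UNIV"
 shows "(f has_derivative frechet_derivative f (at x)) (at x)"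
  "b \<in> Basis \<Longrightarrow> (\<lambda>x. frechet_derivative f (at x) b) \<in> Ck_on k UNIV"
 using assms frechet_derivative_works[of f "at x"] by (simp_all add: Ck_on_Suc_iff)

lemma Ck_on_Suc_mono: "f \<in> Ck_on (Suc k) S \<Longrightarrow> f \<in> Ck_on k S"
 unfolding Ck_on_def by auto

lemma Ck_on_const: "(\<lambda>x::'a::euclidean_space. c) \<in> Ck_on k UNIV"
proof (induction k arbitrary: c)
 case 0 then show ?case by (simp add: Ck_on_0_iff)
next
 case (Suc k)
 show ?case by (rule Ck_on_SucI[where D="\<lambda>_ _. 0"]) (rule has_derivative_const, rule Suc)
qed

lemma Ck_on_add:
 fixes f g :: "'a::euclidean_space \<Rightarrow> real"
 shows "f \<in> Ck_on k UNIV \<Longrightarrow> g \<in> Ck_on k UNIV \<Longrightarrow> (\<lambda>x. f x + g x) \<in> Ck_on k UNIV"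
proof (induction k arbitrary: f g)
 case 0 then show ?case by (simp add: Ck_on_0_iff continuous_on_add)
next
 case (Suc k)
 show ?case
  by (rule Ck_on_SucI[where D="\<lambda>x b. frechet_derivative f (at x) b + frechet_derivative g (at x) b"])
   (auto intro!: has_derivative_add Ck_on_SucD(1) Suc.IH Ck_on_SucD(2) Suc.prems)
qed

lemma Ck_on_mult:
 fixes f g :: "'a::euclidean_space \<Rightarrow> real"
 shows "f \<in> Ck_on k UNIV \<Longrightarrow> g \<in> Ck_on k UNIV \<Longrightarrow> (\<lambda>x. f x * g x) \<in> Ck_on k UNIV"
proof (induction k arbitrary: f g)
 case 0 then show ?case by (simp add: Ck_on_0_iff continuous_on_mult)
next
 case (Suc k)
 show ?case
  by (rule Ck_on_SucI[where D="\<lambda>x b. f x * frechet_derivative g (at x) b + frechet_derivative f (at x) b * g x"])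
   (auto intro!: has_derivative_mult Ck_on_SucD(1) Ck_on_add Suc.IH Ck_on_SucD(2) Suc.prems
     Ck_on_Suc_mono[OF Suc.prems(1)] Ck_on_Suc_mono[OF Suc.prems(2)])
qed

lemma Ck_on_sum:
 fixes f :: "'i \<Rightarrow> 'a::euclidean_space \<Rightarrow> real"
 assumes "\<And>i. i \<in> I \<Longrightarrow> f i \<in> Ck_on k UNIV"
 shows "(\<lambda>x. \<Sum>i\<in>I. f i x) \<in> Ck_on k UNIV"
 using assms by (induction I rule: infinite_finite_induct) (auto intro!: Ck_on_const Ck_on_add)

lemma Ck_on_prod:
 fixes f :: "'i \<Rightarrow> 'a::euclidean_space \<Rightarrow> real"
 assumes "\<And>i. i \<in> I \<Longrightarrow> f i \<in> Ck_on k UNIV"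
 shows "(\<lambda>x. \<Prod>i\<in>I. f i x) \<in> Ck_on k UNIV"
 using assms by (induction I rule: infinite_finite_induct) (auto intro!: Ck_on_const Ck_on_mult)

lemma frechet_derivative_euclidean:
 fixes f :: "'a::euclidean_space \<Rightarrow> real"
 assumes "f differentiable at x"
 shows "frechet_derivative f (at x) h = (\<Sum>b\<in>Basis. (h \<bullet> b) * frechet_derivative f (at x) b)"
proof -
 interpret linear "frechet_derivative f (at x)" using assms by (rule linear_frechet_derivative)
 have "frechet_derivative f (at x) h = frechet_derivative f (at x) (\<Sum>b\<in>Basis. (h \<bullet> b) *\<^sub>R b)"
  by (simp add: euclidean_representation)
 then show ?thesis by (simp add: sum scaleR)
qed

lemma Ck_on_compose_affine:
 fixes f :: "'b::euclidean_space \<Rightarrow> real" and L :: "'a::euclidean_space \<Rightarrow> 'b"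
 assumes L: "bounded_linear L"
 shows "f \<in> Ck_on k UNIV \<Longrightarrow> (\<lambda>x. f (L x + c)) \<in> Ck_on k UNIV"
proof (induction k arbitrary: f)
 case 0
 have "continuous_on UNIV (\<lambda>x. L x + c)"
  by (intro continuous_intros linear_continuous_on L)
 then show ?case using 0 by (auto simp: Ck_on_0_iff intro: continuous_on_compose2)
next
 case (Suc k)
 have d: "f differentiable at x" for x using Suc.prems by (auto simp: Ck_on_Suc_iff)
 have "((\<lambda>x. f (L x + c)) has_derivative (\<lambda>h. frechet_derivative f (at (L x + c)) (L h))) (at x)" for x
 proof -
  have "((\<lambda>x. L x + c) has_derivative L) (at x)"
   using bounded_linear.has_derivative[OF L has_derivative_ident] by (auto intro!: derivative_eq_intros)
  from has_derivative_compose[OF this Ck_on_SucD(1)[OF Suc.prems]] show ?thesis by simp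
 qed
 then show ?case
  by (rule Ck_on_SucI) (subst frechet_derivative_euclidean[OF d],
    auto intro!: Ck_on_sum Ck_on_mult Ck_on_const Suc.IH Ck_on_SucD(2)[OF Suc.prems])
qed

text \<open>
 Products of these functions are the building blocks of all test functions. The powers of \<open>1/x\<close> are
 included so that the family is closed under differentiation.
\<close>

definition flat :: "nat \<Rightarrow> real \<Rightarrow> real" where
 "flat m x = (if x > 0 then exp (- (1/x)) / x ^ m else 0)"

lemma flat_tendsto_0: "(flat m \<longlongrightarrow> 0) (at_right 0)"
proof -
 have "((\<lambda>y::real. y ^ m / exp y) \<longlongrightarrow> 0) at_top" by (rule tendsto_power_div_exp_0)
 then have "((\<lambda>x::real. (inverse x) ^ m / exp (inverse x)) \<longlongrightarrow> 0) (at_right 0)"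
  by (rule filterlim_compose) (rule filterlim_inverse_at_top_right)
 then show ?thesis
 proof (rule Lim_transform_eventually)
  show "\<forall>\<^sub>F x in at_right 0. inverse x ^ m / exp (inverse x) = flat m x"
   unfolding eventually_at_right_field
   by (intro exI[of _ 1]) (auto simp: flat_def exp_minus field_simps)
 qed
qed

lemma flat_has_derivative:
 "(flat m has_real_derivative flat (m+2) x - m * flat (m+1) x) (at x)"
proof -
 consider "x > 0" | "x < 0" | "x = 0" by linarith
 then show ?thesis
 proof cases
  case 1
  have "((\<lambda>x. exp (- (1/x)) / x ^ m) has_real_derivative flat (m+2) x - m * flat (m+1) x) (at x)"
   using 1
   apply (auto intro!: derivative_eq_intros simp: flat_def)
   apply (cases m) apply (auto simp: field_simps power2_eq_square)
   done
  then show ?thesis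
   by (rule has_field_derivative_transform_within_open[where S="{0<..}"]) (use 1 in \<open>auto simp: flat_def\<close>)
 next
  case 2
  have "((\<lambda>x::real. 0) has_real_derivative flat (m+2) x - m * flat (m+1) x) (at x)"
   using 2 by (auto simp: flat_def)
  then show ?thesis
   by (rule has_field_derivative_transform_within_open[where S="{..<0}"]) (use 2 in \<open>auto simp: flat_def\<close>)
 next
  case 3
  have "((\<lambda>y. (flat m y - flat m 0) / (y - 0)) \<longlongrightarrow> 0) (at 0)"
  proof (rule filterlim_split_at)
   show "((\<lambda>y. (flat m y - flat m 0) / (y - 0)) \<longlongrightarrow> 0) (at_left 0)"
    by (rule tendsto_eventually) (auto simp: eventually_at_left_field flat_def intro: exI[of _ "-1"])
   show "((\<lambda>y. (flat m y - flat m 0) / (y - 0)) \<longlongrightarrow> 0) (at_right 0)"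
    by (rule Lim_transform_eventually[OF flat_tendsto_0[of "m+1"]])
     (auto simp: eventually_at_right_field flat_def intro: exI[of _ "1"])
  qed
  then show ?thesis using 3 by (simp add: has_field_derivative_iff flat_def)
 qed
qed

lemma flat_Ck: "flat m \<in> Ck_on k UNIV"
proof (induction k arbitrary: m)
 case 0 then show ?case
  by (auto simp: Ck_on_0_iff intro!: continuous_at_imp_continuous_on DERIV_isCont flat_has_derivative)
next
 case (Suc k)
 have "(\<lambda>x. flat (m+2) x + (- real m) * flat (m+1) x) \<in> Ck_on k UNIV"
  by (intro Ck_on_add Ck_on_mult Ck_on_const Suc)
 then show ?case
  by (intro Ck_on_SucI[where D="\<lambda>x h. (flat (m+2) x - m * flat (m+1) x) * h"])
   (use flat_has_derivative[of m] in \<open>auto simp: has_field_derivative_def\<close>)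
qed

section \<open>The fundamental lemma of the calculus of variations\<close>

lemma test_functionsI:
 assumes "\<And>k. \<phi> \<in> Ck_on k UNIV" "compact K" "K \<subseteq> S" "\<And>x. x \<notin> K \<Longrightarrow> \<phi> x = 0"
 shows "\<phi> \<in> test_functions S"
proof -
 have "closure {x. \<phi> x \<noteq> 0} \<subseteq> K"
  by (rule closure_minimal) (use assms compact_imp_closed in auto)
 then show ?thesis unfolding test_functions_def using assms
  by (auto simp: compact_eq_bounded_closed intro: bounded_subset)
qed

lemma test_functionsE:
 assumes "\<phi> \<in> test_functions S"
 obtains K where "compact K" "K \<subseteq> S" "\<And>x. x \<notin> K \<Longrightarrow> \<phi> x = 0"
  "\<And>k. \<phi> \<in> Ck_on k UNIV"
 using assms that[of "closure {x. \<phi> x \<noteq> 0}"] closure_subset[of "{x. \<phi> x \<noteq> 0}"]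
 unfolding test_functions_def by blast

lemma flat_0_bounds: "0 \<le> flat 0 x" "flat 0 x \<le> 1"
 by (auto simp: flat_def)

text \<open>
 As \<open>k\<close> grows, these smooth functions increase to the indicator of an open box.
\<close>

definition box_bump :: "nat \<Rightarrow> 'a::euclidean_space \<Rightarrow> 'a \<Rightarrow> 'a \<Rightarrow> real" where
 "box_bump k a b x = (\<Prod>i\<in>Basis. flat 0 (real k * (x \<bullet> i - a \<bullet> i)) * flat 0 (real k * (b \<bullet> i - x \<bullet> i)))"

lemma box_bump_Ck: "box_bump k a b \<in> Ck_on m UNIV"
proof -
 have "(\<lambda>x. flat 0 (real k * (x \<bullet> i - a \<bullet> i))) \<in> Ck_on m UNIV" for i
 proof -
  have "bounded_linear (\<lambda>x::'a. real k * (x \<bullet> i))"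
   by (intro bounded_linear_mult_right bounded_linear_const_mult bounded_linear_inner_left)
  from Ck_on_compose_affine[OF this flat_Ck, where c="- (real k * (a \<bullet> i))"]
  show ?thesis by (simp add: algebra_simps)
 qed
 moreover have "(\<lambda>x. flat 0 (real k * (b \<bullet> i - x \<bullet> i))) \<in> Ck_on m UNIV" for i
 proof -
  have "bounded_linear (\<lambda>x::'a. - real k * (x \<bullet> i))"
   by (intro bounded_linear_mult_right bounded_linear_const_mult bounded_linear_inner_left)
  from Ck_on_compose_affine[OF this flat_Ck, where c="(real k * (b \<bullet> i))"]
  show ?thesis by (simp add: algebra_simps)
 qed
 ultimately show ?thesis unfolding box_bump_def[abs_def]
  by (intro Ck_on_prod Ck_on_mult)
qed

lemma box_bump_bounds: "0 \<le> box_bump k a b x" "box_bump k a b x \<le> 1"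
 unfolding box_bump_def by (auto intro!: prod_nonneg prod_le_1 mult_le_one simp: flat_0_bounds)

lemma box_bump_outside: "x \<notin> box a b \<Longrightarrow> box_bump k a b x = 0"
 unfolding box_bump_def mem_box
 by (auto simp: flat_def not_less zero_less_mult_iff; force)

lemma box_bump_test: "cbox a b \<subseteq> S \<Longrightarrow> box_bump k a b \<in> test_functions S"
 using box_subset_cbox[of a b]
 by (intro test_functionsI[where K="cbox a b"]) (auto simp: box_bump_Ck intro: box_bump_outside)

lemma flat_0_tendsto:
 assumes "y > 0" shows "(\<lambda>k. flat 0 (real k * y)) \<longlonglongrightarrow> 1"
proof -
 have "(\<lambda>k. exp (- ((1 / y) * inverse (real k)))) \<longlonglongrightarrow> exp (- ((1/y) * 0))"
  by (intro tendsto_intros LIMSEQ_inverse_real_of_nat LIMSEQ_inverse_real_of_nat[THEN filterlim_sequentially_Suc[THEN iffD1]])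
 then have "(\<lambda>k. exp (- ((1 / y) * inverse (real k)))) \<longlonglongrightarrow> 1" by simp
 then show ?thesis
  by (rule Lim_transform_eventually)
   (use assms in \<open>auto simp: flat_def eventually_sequentially field_simps intro!: exI[of _ 1]\<close>)
qed

lemma box_bump_tendsto: "(\<lambda>k. box_bump k a b x) \<longlonglongrightarrow> indicator (box a b) x"
proof (cases "x \<in> box a b")
 case True
 have "(\<lambda>k. box_bump k a b x) \<longlonglongrightarrow> (\<Prod>i\<in>(Basis::'a set). 1 * 1)"
  unfolding box_bump_def using True
  by (intro tendsto_prod tendsto_mult flat_0_tendsto) (auto simp: mem_box)
 then show ?thesis using True by simp
qed (simp add: box_bump_outside)

text \<open>
 The measures with densities the positive and the negative part of \<open>g\<close> agree on boxes, which form an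
 intersection-stable generator of the Borel sets; hence they agree, and so do the densities.
\<close>

lemma AE_zero_if_box_integrals_zero:
 fixes g :: "'a::euclidean_space \<Rightarrow> real"
 assumes g: "integrable lebesgue g"
  and 0: "\<And>c d. (LINT x|lebesgue. indicator (box c d) x * g x) = 0"
 shows "AE x in lebesgue. g x = 0"
proof -
 obtain f where f[measurable]: "f \<in> borel_measurable lborel" and gf: "AE x in lborel. g x = f x"
  using completion_ex_borel_measurable_real[of g lborel] g by auto
 have gf': "AE x in lebesgue. g x = f x" using gf by (rule AE_completion)
 have gm: "g \<in> borel_measurable lebesgue" using g by auto
 have fm: "f \<in> borel_measurable lebesgue" using f by (rule measurable_completion)
 have fint: "integrable lborel f"
 proof -
  have "integrable lebesgue f"
   by (rule integrable_cong_AE_imp[OF g]) (use gf' fm in auto)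
  then show ?thesis using integrable_completion[OF f] by simp
 qed
 have f0: "(LBINT x. indicator (box c d) x * f x) = 0" for c d
 proof -
  have "(LBINT x. indicator (box c d) x * f x) = (LINT x|lebesgue. indicator (box c d) x * f x)"
   by (rule integral_completion[symmetric]) measurable
  also have "\<dots> = (LINT x|lebesgue. indicator (box c d) x * g x)"
   by (rule integral_cong_AE) (use gf' in \<open>auto intro!: borel_measurable_times borel_measurable_indicator gm fm\<close>)
  finally show ?thesis using 0 by simp
 qed
 let ?P = "\<lambda>x. ennreal (f x)" and ?N = "\<lambda>x. ennreal (- f x)"
 have fin: "(\<integral>\<^sup>+x. ennreal (f x) \<partial>lborel) < \<infinity>"
  using integrableD(2)[OF fint] by (simp add: less_top)
 have eqbox: "emeasure (density lborel ?P) (box c d) = emeasure (density lborel ?N) (box c d)" for c d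
 proof -
  have i: "integrable lborel (\<lambda>x. indicator (box c d) x * f x)"
   using integrable_mult_indicator[of "box c d" lborel f] fint by simp
  have e: "(\<integral>\<^sup>+x. ennreal (f x) * indicator (box c d) x \<partial>lborel) = (\<integral>\<^sup>+x. ennreal (indicator (box c d) x * f x) \<partial>lborel)"
    "(\<integral>\<^sup>+x. ennreal (- f x) * indicator (box c d) x \<partial>lborel) = (\<integral>\<^sup>+x. ennreal (- (indicator (box c d) x * f x)) \<partial>lborel)"
   by (auto intro!: nn_integral_cong simp: indicator_def)
  have "enn2real (\<integral>\<^sup>+x. ennreal (indicator (box c d) x * f x) \<partial>lborel) =
   enn2real (\<integral>\<^sup>+x. ennreal (- (indicator (box c d) x * f x)) \<partial>lborel)"
   using f0[of c d] real_lebesgue_integral_def[OF i] by simp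
  moreover have "(\<integral>\<^sup>+x. ennreal (indicator (box c d) x * f x) \<partial>lborel) < top"
   "(\<integral>\<^sup>+x. ennreal (- (indicator (box c d) x * f x)) \<partial>lborel) < top"
   using real_integrable_def[of lborel "\<lambda>x. indicator (box c d) x * f x"] i
   by (auto simp: less_top)
  ultimately have "(\<integral>\<^sup>+x. ennreal (indicator (box c d) x * f x) \<partial>lborel) = (\<integral>\<^sup>+x. ennreal (- (indicator (box c d) x * f x)) \<partial>lborel)"
   by (metis ennreal_enn2real)
  then show ?thesis by (simp add: emeasure_density e)
 qed
 have "density lborel ?P = density lborel ?N"
 proof (rule measure_eqI_generator_eq[where E="range (\<lambda>(a, b). box a b)" and \<Omega>=UNIV and
    A="\<lambda>n. box (- (real n *\<^sub>R One)) (real n *\<^sub>R One)"])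
  show "Int_stable (range (\<lambda>(a, b). box a b::'a set))"
   by (auto simp: Int_stable_def box_Int_box)
  show "emeasure (density lborel ?P) X = emeasure (density lborel ?N) X" if "X \<in> range (\<lambda>(a, b). box a b)" for X
   using that eqbox by auto
  show "sets (density lborel ?P) = sigma_sets UNIV (range (\<lambda>(a, b). box a b))"
   "sets (density lborel ?N) = sigma_sets UNIV (range (\<lambda>(a, b). box a b))"
   by (simp_all add: borel_eq_box)
  show "(\<Union>i. box (- (real i *\<^sub>R One)) (real i *\<^sub>R One)) = (UNIV::'a set)"
   by (rule UN_box_eq_UNIV)
  show "emeasure (density lborel ?P) (box (- (real i *\<^sub>R One)) (real i *\<^sub>R One)) \<noteq> \<infinity>" for i
  proof -
   have "emeasure (density lborel ?P) (box (- (real i *\<^sub>R One)) (real i *\<^sub>R One)) \<le> (\<integral>\<^sup>+x. ennreal (f x) \<partial>lborel)"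
    by (auto simp: emeasure_density indicator_def intro!: nn_integral_mono)
   then show ?thesis using fin by (auto simp: top_unique)
  qed
 qed auto
 then have "AE x in lborel. ?P x = ?N x"
  by (subst (asm) sigma_finite_measure.density_unique_iff[OF sigma_finite_lborel]) auto
 then have "AE x in lborel. g x = 0" using gf
 proof eventually_elim
  case (elim x)
  have "f x = 0"
  proof (rule ccontr)
   assume "f x \<noteq> 0"
   then consider "f x > 0" | "f x < 0" by linarith
   then show False using elim(1) by cases (auto simp: ennreal_neg)
  qed
  then show ?case using elim by simp
 qed
 then show ?thesis by (rule AE_completion)
qed

text \<open>
 Box bumps turn the hypothesis into the vanishing of integrals over boxes inside \<open>S\<close>; an open set is a
 countable union of closed boxes.
\<close>

theorem fundamental_lemma:
 fixes f :: "'a::euclidean_space \<Rightarrow> real"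
 assumes S: "open S"
  and int: "\<And>K. compact K \<Longrightarrow> K \<subseteq> S \<Longrightarrow> set_integrable lebesgue K f"
  and 0: "\<And>\<phi>. \<phi> \<in> test_functions S \<Longrightarrow> (LINT x|lebesgue. f x * \<phi> x) = 0"
 shows "AE x in lebesgue. x \<in> S \<longrightarrow> f x = 0"
proof -
 have box0: "(LINT x|lebesgue. indicator (box p q) x * f x) = 0" if "cbox p q \<subseteq> S" for p q
 proof -
  have i: "integrable lebesgue (\<lambda>x. indicator (cbox p q) x * f x)"
   using int[OF compact_cbox that] by (simp add: set_integrable_def)
  have i2: "integrable lebesgue (\<lambda>x. norm (indicator (cbox p q) x * f x))"
   using i by (rule integrable_norm)
  have meas: "(\<lambda>x. f x * box_bump k p q x) \<in> borel_measurable lebesgue" for k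
  proof -
   have "box_bump k p q \<in> borel_measurable lborel"
    using box_bump_Ck[of k p q 0] by (simp add: Ck_on_0_iff borel_measurable_continuous_onI)
   then have "(\<lambda>x. (indicator (cbox p q) x * f x) * box_bump k p q x) \<in> borel_measurable lebesgue"
    by (intro borel_measurable_times borel_measurable_integrable[OF i] measurable_completion)
   also have "(\<lambda>x. (indicator (cbox p q) x * f x) * box_bump k p q x) = (\<lambda>x. f x * box_bump k p q x)"
    using box_subset_cbox[of p q] by (auto simp: fun_eq_iff indicator_def) (metis box_bump_outside subsetD)
   finally show ?thesis .
  qed
  have ib: "integrable lebesgue (\<lambda>x. indicator (box p q) x * f x)"
  proof -
   have "(\<lambda>x. indicator (box p q) x * (indicator (cbox p q) x * f x)) = (\<lambda>x. indicator (box p q) x * f x)"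
    using box_subset_cbox[of p q] by (auto simp: fun_eq_iff indicator_def)
   then show ?thesis using integrable_mult_indicator[of "box p q" lebesgue, OF _ i] by simp
  qed
  have "(\<lambda>k. LINT x|lebesgue. f x * box_bump k p q x) \<longlonglongrightarrow> (LINT x|lebesgue. indicator (box p q) x * f x)"
  proof (rule integral_dominated_convergence[OF _ meas i2])
   show "AE x in lebesgue. (\<lambda>k. f x * box_bump k p q x) \<longlonglongrightarrow> indicator (box p q) x * f x"
    using tendsto_mult[OF tendsto_const box_bump_tendsto, of "f x" p q x for x]
    by (simp add: mult.commute)
   show "AE x in lebesgue. norm (f x * box_bump k p q x) \<le> norm (indicator (cbox p q) x * f x)" for k
   proof (intro AE_I2)
    fix x
    have le: "norm (f x) * norm (box_bump k p q x) \<le> norm (f x) * 1"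
     by (intro mult_left_mono) (use box_bump_bounds[of k p q x] in auto)
    show "norm (f x * box_bump k p q x) \<le> norm (indicator (cbox p q) x * f x)"
    proof (cases "x \<in> cbox p q")
     case True
     then show ?thesis using le unfolding norm_mult by simp
    next
     case False
     then have "x \<notin> box p q" using box_subset_cbox by blast
     then show ?thesis using False by (simp add: box_bump_outside)
    qed
   qed
   show "(\<lambda>x. indicator (box p q) x * f x) \<in> borel_measurable lebesgue" using ib by auto
  qed
  moreover have "(LINT x|lebesgue. f x * box_bump k p q x) = 0" for k
   using 0[OF box_bump_test[OF that]] .
  ultimately show ?thesis by (simp add: LIMSEQ_const_iff)
 qed
 have cboxz: "AE x in lebesgue. x \<in> cbox p q \<longrightarrow> f x = 0" if pq: "cbox p q \<subseteq> S" for p q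
 proof -
  have i: "integrable lebesgue (\<lambda>x. indicator (cbox p q) x * f x)"
   using int[OF compact_cbox that] by (simp add: set_integrable_def)
  have null: "AE x in lebesgue. x \<in> cbox p q \<longrightarrow> x \<in> box p q"
  proof -
   have "cbox p q - box p q \<in> null_sets lebesgue"
    using negligible_frontier_interval[of p q] negligible_iff_null_sets by blast
   from AE_not_in[OF this] show ?thesis by eventually_elim auto
  qed
  have "AE x in lebesgue. indicator (cbox p q) x * f x = 0"
  proof (rule AE_zero_if_box_integrals_zero[OF i])
   fix c d
   obtain c' d' where cd: "box p q \<inter> box c d = box c' d'" by (auto simp: box_Int_box)
   have "cbox c' d' \<subseteq> S \<or> box c' d' = {}"
   proof (cases "box c' d' = {}")
    case False
    then have "cbox c' d' = closure (box c' d')" by simp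
    also have "\<dots> \<subseteq> cbox p q"
     using cd box_subset_cbox[of p q] by (intro closure_minimal) auto
    finally show ?thesis using pq by auto
   qed simp
   then have z: "(LINT x|lebesgue. indicator (box c' d') x * f x) = 0" using box0 by auto
   have "(LINT x|lebesgue. indicator (box c d) x * (indicator (cbox p q) x * f x))
     = (LINT x|lebesgue. indicator (box c d) x * (indicator (box p q) x * (indicator (cbox p q) x * f x)))"
   proof (rule integral_cong_AE)
    have ind: "(indicator (box a b) :: 'a \<Rightarrow> real) \<in> borel_measurable lebesgue" for a b
     by (rule borel_measurable_indicator) simp
    note m = borel_measurable_integrable[OF i]
    show "(\<lambda>x. indicator (box c d) x * (indicator (cbox p q) x * f x)) \<in> borel_measurable lebesgue"
     "(\<lambda>x. indicator (box c d) x * (indicator (box p q) x * (indicator (cbox p q) x * f x))) \<in> borel_measurable lebesgue"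
     by (rule borel_measurable_times[OF ind m], rule borel_measurable_times[OF ind borel_measurable_times[OF ind m]])
    show "AE x in lebesgue. indicator (box c d) x * (indicator (cbox p q) x * f x) =
      indicator (box c d) x * (indicator (box p q) x * (indicator (cbox p q) x * f x))"
     using null by eventually_elim (simp add: indicator_def)
   qed
   also have "\<dots> = (LINT x|lebesgue. indicator (box c' d') x * f x)"
    using box_subset_cbox[of p q] unfolding cd[symmetric]
    by (intro Bochner_Integration.integral_cong) (auto simp: indicator_def)
   finally show "(LINT x|lebesgue. indicator (box c d) x * (indicator (cbox p q) x * f x)) = 0"
    using z by simp
  qed
  then show ?thesis by eventually_elim (auto simp: indicator_def)
 qed
 obtain \<D> where D: "countable \<D>" "\<D> \<subseteq> Pow S" "\<And>X. X \<in> \<D> \<Longrightarrow> \<exists>a b. X = cbox a b" "\<Union>\<D> = S"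
  using open_countable_Union_open_cbox[OF S] by metis
 have "AE x in lebesgue. \<forall>X\<in>\<D>. x \<in> X \<longrightarrow> f x = 0"
  unfolding AE_ball_countable[OF D(1)]
 proof
  fix X assume "X \<in> \<D>"
  then obtain a b where "X = cbox a b" "X \<subseteq> S" using D by blast
  then show "AE x in lebesgue. x \<in> X \<longrightarrow> f x = 0" using cboxz by auto
 qed
 then show ?thesis using D(4) by (auto elim!: eventually_mono)
qed

section \<open>Test functions and the lemma of du Bois-Reymond\<close>

lemma test_functions_has_derivative:
 assumes "\<phi> \<in> test_functions S"
 shows "(\<phi> has_derivative frechet_derivative \<phi> (at x)) (at x)"
 using assms Ck_on_SucD(1)[of \<phi> 0] by (auto simp: test_functions_def)

lemma test_functions_frechet_derivative_continuous:
 assumes "\<phi> \<in> test_functions S" "b \<in> Basis"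
 shows "continuous_on UNIV (\<lambda>x. frechet_derivative \<phi> (at x) b)"
 using assms Ck_on_SucD(2)[of \<phi> 0 b] by (auto simp: test_functions_def Ck_on_0_iff)

lemma test_functions_continuous: "\<phi> \<in> test_functions S \<Longrightarrow> continuous_on UNIV \<phi>"
 using test_functions_def Ck_on_0_iff by blast

lemma frechet_derivative_eq_0_outside:
 assumes "closed K" "\<And>x. x \<notin> K \<Longrightarrow> \<phi> x = 0" "x \<notin> K"
 shows "frechet_derivative \<phi> (at x) = (\<lambda>_. 0)"
proof -
 have "(\<phi> has_derivative (\<lambda>_. 0)) (at x)"
  by (rule has_derivative_transform_within_open[where f="\<lambda>_. 0" and s="- K"]) (use assms in auto)
 then show ?thesis using frechet_derivative_at by metis
qed

lemma integrable_continuous_compact_support: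
 fixes f :: "'a::euclidean_space \<Rightarrow> 'b::{banach,second_countable_topology}"
 assumes "continuous_on UNIV f" "compact K" "\<And>x. x \<notin> K \<Longrightarrow> f x = 0"
 shows "integrable lborel f"
proof -
 have "integrable lborel (\<lambda>x. indicator K x *\<^sub>R f x)"
  by (rule borel_integrable_compact) (use assms in \<open>auto intro: continuous_on_subset\<close>)
 moreover have "(\<lambda>x. indicator K x *\<^sub>R f x) = f" using assms(3) by (auto simp: indicator_def)
 ultimately show ?thesis by simp
qed

lemma bounded_continuous_compact_support:
 fixes f :: "'a::euclidean_space \<Rightarrow> 'b::real_normed_vector"
 assumes "continuous_on UNIV f" "compact K" "\<And>x. x \<notin> K \<Longrightarrow> f x = 0"
 obtains B where "B > 0" "\<And>x. norm (f x) \<le> B"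
proof -
 have "bounded (f ` K)" using assms by (meson compact_continuous_image compact_imp_bounded continuous_on_subset subset_UNIV)
 then obtain B where "B > 0" "\<And>x. x \<in> K \<Longrightarrow> norm (f x) \<le> B" unfolding bounded_pos by auto
 then show thesis using assms(3) by (intro that[of B]) (metis norm_zero less_imp_le)+
qed

lemma test_real_DERIV:
 fixes \<theta> :: "real \<Rightarrow> real"
 assumes "\<theta> \<in> test_functions S"
 shows "(\<theta> has_real_derivative frechet_derivative \<theta> (at t) 1) (at t)"
proof -
 note d = test_functions_has_derivative[OF assms, of t]
 from has_derivative_linear[OF d] have "frechet_derivative \<theta> (at t) = (*) (frechet_derivative \<theta> (at t) 1)"
  by (intro ext) (metis linear_cmul mult.commute mult.right_neutral real_scaleR_def)
 with d show ?thesis by (simp add: has_field_derivative_def)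
qed

lemma lborel_Fubini_snd:
 fixes f :: "'a::euclidean_space \<times> 'b::euclidean_space \<Rightarrow> 'c::{banach, second_countable_topology}"
 assumes "integrable lborel f"
 shows "AE t in lborel. integrable lborel (\<lambda>x. f (x, t))"
  "integrable lborel (\<lambda>t. LBINT x. f (x, t))"
  "(LBINT t. LBINT x. f (x, t)) = (LBINT z. f z)"
proof -
 have "integrable (lborel \<Otimes>\<^sub>M lborel) (\<lambda>(x, y). f (x, y))" using assms by (simp add: lborel_prod)
 from lborel_pair.AE_integrable_snd[OF this] lborel_pair.integrable_snd[OF this] lborel_pair.integral_snd[OF this]
 show "AE t in lborel. integrable lborel (\<lambda>x. f (x, t))"
  "integrable lborel (\<lambda>t. LBINT x. f (x, t))"
  "(LBINT t. LBINT x. f (x, t)) = (LBINT z. f z)"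
  by (auto simp: lborel_prod)
qed

lemma lborel_Fubini_fst:
 fixes f :: "'a::euclidean_space \<times> 'b::euclidean_space \<Rightarrow> 'c::{banach, second_countable_topology}"
 assumes "integrable lborel f"
 shows "AE x in lborel. integrable lborel (\<lambda>t. f (x, t))"
  "integrable lborel (\<lambda>x. LBINT t. f (x, t))"
  "(LBINT x. LBINT t. f (x, t)) = (LBINT z. f z)"
proof -
 have "integrable (lborel \<Otimes>\<^sub>M lborel) (\<lambda>(x, y). f (x, y))" using assms by (simp add: lborel_prod)
 from lborel_pair.AE_integrable_fst[OF this] lborel_pair.integrable_fst[OF this] lborel_pair.integral_fst[OF this]
 show "AE x in lborel. integrable lborel (\<lambda>t. f (x, t))"
  "integrable lborel (\<lambda>x. LBINT t. f (x, t))"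
  "(LBINT x. LBINT t. f (x, t)) = (LBINT z. f z)"
  by (auto simp: lborel_prod)
qed

lemma test_integral_deriv_tail:
 fixes \<theta> :: "real \<Rightarrow> real"
 assumes "\<theta> \<in> test_functions S"
 shows "(LBINT t. indicator {r..} t * frechet_derivative \<theta> (at t) 1) = - \<theta> r"
proof -
 obtain K where K: "compact K" "\<And>x. x \<notin> K \<Longrightarrow> \<theta> x = 0" using assms by (auto elim: test_functionsE)
 obtain B where B: "\<And>x. x \<in> K \<Longrightarrow> \<bar>x\<bar> \<le> B" using compact_imp_bounded[OF K(1)] by (auto simp: bounded_iff)
 define M where "M = max r (B + 1)"
 have M: "x \<notin> K" if "x \<ge> M" for x using B[of x] that by (auto simp: M_def)
 have z: "frechet_derivative \<theta> (at t) 1 = 0" if "t \<notin> K" for t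
  using frechet_derivative_eq_0_outside[OF compact_imp_closed[OF K(1)] K(2) that] by simp
 have "(LBINT t. indicator {r..} t * frechet_derivative \<theta> (at t) 1) = (LBINT t. frechet_derivative \<theta> (at t) 1 * indicator {r..M} t)"
  by (intro Bochner_Integration.integral_cong) (use M z in \<open>auto simp: indicator_def\<close>)
 also have "\<dots> = \<theta> M - \<theta> r"
  by (rule integral_FTC_Icc_real)
   (use test_functions_frechet_derivative_continuous[OF assms, of 1] test_real_DERIV[OF assms] in
    \<open>simp_all add: M_def continuous_on_eq_continuous_at\<close>)
 finally show ?thesis using K(2) M[of M] by simp
qed

text \<open>
 The primitive \<open>\<integral>\<^sub>0\<^sup>t \<zeta>\<close> vanishes to the right of the support of \<open>\<zeta>\<close> exactly because the total integral is zero.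
\<close>

lemma test_primitive:
 fixes \<zeta> :: "real \<Rightarrow> real"
 assumes \<zeta>: "\<zeta> \<in> test_functions {0<..<T}" and 0: "(LBINT t. \<zeta> t) = 0"
 obtains \<theta> where "\<theta> \<in> test_functions {0<..<T}" "\<And>t. frechet_derivative \<theta> (at t) 1 = \<zeta> t"
proof -
 obtain K where K: "compact K" "K \<subseteq> {0<..<T}" "\<And>x. x \<notin> K \<Longrightarrow> \<zeta> x = 0" "\<And>k. \<zeta> \<in> Ck_on k UNIV"
  using \<zeta> by (auto elim: test_functionsE)
 have cont: "continuous_on A \<zeta>" for A using K(4)[of 0] by (auto simp: Ck_on_0_iff intro: continuous_on_subset)
 obtain a b where ab: "0 < a" "b < T" "K \<subseteq> {a..b}" "a \<le> b" if "K \<noteq> {}"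
 proof (cases "K = {}")
  case False
  obtain a b where "a \<in> K" "b \<in> K" "\<And>x. x \<in> K \<Longrightarrow> a \<le> x" "\<And>x. x \<in> K \<Longrightarrow> x \<le> b"
   using compact_attains_inf[OF K(1) False] compact_attains_sup[OF K(1) False] by metis
  then show ?thesis using K(2) by (intro that[of a b]) auto
 qed (use that in auto)
 show thesis
 proof (cases "K = {}")
  case True
  then have "\<zeta> = (\<lambda>_. 0)" using K(3) by auto
  moreover have "(\<lambda>_. 0) \<in> test_functions {0<..<T}" by (rule test_functionsI[where K="{}"]) (auto intro: Ck_on_const)
  ultimately show ?thesis using that[of "\<lambda>_. 0"] by simp
 next
  case False
  note ab = ab[OF False]
  define \<theta> where "\<theta> = (\<lambda>t. integral {0..t} \<zeta>)"
  have \<zeta>0: "\<zeta> x = 0" if "x < a \<or> x > b" for x using that ab K(3) by force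
  have low: "\<theta> t = 0" if "t \<le> a" for t
  proof -
   have "\<theta> t = integral {0..t} (\<lambda>_. 0)" unfolding \<theta>_def
    by (rule integral_spike[of "{a}"]) (use that \<zeta>0 in auto)
   then show ?thesis by simp
  qed
  have int_eq: "(LBINT t. \<zeta> t) = integral UNIV \<zeta>"
   using integral_lborel[OF integrable_continuous_compact_support[OF cont K(1) K(3)]] by simp
  have high: "\<theta> t = 0" if "t \<ge> b" for t
  proof -
   have "integral {0..t} \<zeta> = integral UNIV (\<lambda>x. if x \<in> {0..t} then \<zeta> x else 0)" by (rule integral_restrict_UNIV[symmetric])
   also have "(\<lambda>x. if x \<in> {0..t} then \<zeta> x else 0) = \<zeta>" using \<zeta>0 that ab by (auto simp: fun_eq_iff)
   finally show ?thesis using 0 int_eq by (simp add: \<theta>_def)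
  qed
  have der: "(\<theta> has_real_derivative \<zeta> t) (at t)" for t
  proof -
   consider "t < a" | "t > b" | "a \<le> t" "t \<le> b" by linarith
   then show ?thesis
   proof cases
    case 1
    have "((\<lambda>_. 0) has_real_derivative \<zeta> t) (at t)" using \<zeta>0 1 by simp
    then show ?thesis by (rule has_field_derivative_transform_within_open[where S="{..<a}"]) (use 1 low in auto)
   next
    case 2
    have "((\<lambda>_. 0) has_real_derivative \<zeta> t) (at t)" using \<zeta>0 2 by simp
    then show ?thesis by (rule has_field_derivative_transform_within_open[where S="{b<..}"]) (use 2 high in auto)
   next
    case 3
    have "(\<theta> has_real_derivative \<zeta> t) (at t within {0..T})"
     unfolding \<theta>_def by (rule integral_has_real_derivative[OF cont]) (use 3 ab in auto)
    moreover have "at t within {0..T} = at t" using 3 ab by (intro at_within_interior) auto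
    ultimately show ?thesis by simp
   qed
  qed
  have fd: "frechet_derivative \<theta> (at t) = (*) (\<zeta> t)" for t
   using der[of t] frechet_derivative_at has_field_derivative_def by metis
  have "\<theta> \<in> Ck_on k UNIV" for k
  proof -
   have "\<theta> \<in> Ck_on (Suc k) UNIV"
    by (rule Ck_on_SucI[where D="\<lambda>t. (*) (\<zeta> t)"]) (use der K(4) in \<open>auto simp: has_field_derivative_def\<close>)
   then show ?thesis by (rule Ck_on_Suc_mono)
  qed
  then have "\<theta> \<in> test_functions {0<..<T}"
   by (intro test_functionsI[where K="{a..b}"]) (use ab low high in auto)
  then show ?thesis using that fd by simp
 qed
qed

lemma test_functions_diff_scaled:
 assumes "\<phi> \<in> test_functions S" "\<psi> \<in> test_functions S"
 shows "(\<lambda>x. \<phi> x - c * \<psi> x) \<in> test_functions S"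
proof -
 obtain K where K: "compact K" "K \<subseteq> S" "\<And>x. x \<notin> K \<Longrightarrow> \<phi> x = 0" "\<And>k. \<phi> \<in> Ck_on k UNIV"
  using assms(1) by (auto elim: test_functionsE)
 obtain L where L: "compact L" "L \<subseteq> S" "\<And>x. x \<notin> L \<Longrightarrow> \<psi> x = 0" "\<And>k. \<psi> \<in> Ck_on k UNIV"
  using assms(2) by (auto elim: test_functionsE)
 have "(\<lambda>x. \<phi> x + (- c) * \<psi> x) \<in> Ck_on k UNIV" for k
  by (intro Ck_on_add Ck_on_mult Ck_on_const K L)
 then show ?thesis
  by (intro test_functionsI[where K="K \<union> L"]) (use K L in auto)
qed

lemma test_function_unit_integral:
 assumes "(T::real) > 0"
 obtains \<zeta> where "\<zeta> \<in> test_functions {0<..<T}" "(LBINT t. \<zeta> t) = 1"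
proof -
 let ?\<beta> = "box_bump 1 (T/3) (2*T/3)"
 have sub: "cbox (T/3) (2*T/3) \<subseteq> {0<..<T}" using assms by auto
 have t: "?\<beta> \<in> test_functions {0<..<T}" by (rule box_bump_test[OF sub])
 have c: "continuous_on UNIV ?\<beta>" by (rule test_functions_continuous[OF t])
 have z: "?\<beta> x = 0" if "x \<notin> cbox (T/3) (2*T/3)" for x using that box_subset_cbox box_bump_outside by blast
 have i: "integrable lborel ?\<beta>"
  by (rule integrable_continuous_compact_support[OF c compact_cbox z])
 have "(LBINT t. ?\<beta> t) \<noteq> 0"
 proof
  assume "(LBINT t. ?\<beta> t) = 0"
  then have "AE t in lborel. ?\<beta> t = 0" using integral_nonneg_eq_0_iff_AE[OF i] by (simp add: box_bump_bounds)
  then have "AE t in lborel. t \<notin> {T/3<..<2*T/3}"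
  proof eventually_elim
   case (elim t)
   then show ?case by (auto simp: box_bump_def flat_def split: if_splits)
  qed
  then have "emeasure lborel {T/3<..<2*T/3} = 0" using AE_iff_null_sets[of "{T/3<..<2*T/3}" lborel] by auto
  then show False using assms by simp
 qed
 then show thesis
  using test_functions_diff_scaled[OF _ t, of "\<lambda>_. 0" "- 1 / (LBINT t. ?\<beta> t)"] that
   test_functionsI[of "\<lambda>_. 0" "{}" "{0<..<T}"] by (auto simp: Ck_on_const)
qed

text \<open>
 By Fubini, a primitive of \<open>g\<close> can be integrated by parts against a test function. So \<open>f\<close> plus this primitive
 annihilates all derivatives of test functions, which are the test functions of mean zero, and is
 therefore constant.
\<close>

theorem du_Bois_Reymond:
 fixes f g :: "real \<Rightarrow> real"
 assumes T: "T > 0" and f: "integrable lborel f" and g: "integrable lborel g"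
  and eq: "\<And>\<theta>. \<theta> \<in> test_functions {0<..<T} \<Longrightarrow>
    (LBINT t. f t * frechet_derivative \<theta> (at t) 1) = (LBINT t. g t * \<theta> t)"
 shows "\<exists>c. AE t in lborel. t \<in> {0<..<T} \<longrightarrow> f t = c - (LBINT r. indicator {0..t} r * g r)"
proof -
 define G where "G t = (LBINT r. indicator {0..t} r * g r)" for t
 have [measurable]: "g \<in> borel_measurable borel" "f \<in> borel_measurable borel" using f g by auto
 have meas2: "Measurable.pred (borel \<Otimes>\<^sub>M borel) (\<lambda>x::real\<times>real. snd x \<in> {0..fst x})"
  by simp measurable
 have G_meas[measurable]: "G \<in> borel_measurable borel"
 proof -
  have "(\<lambda>t. LBINT r. (\<lambda>(t, r). (if 0 \<le> r \<and> r \<le> t then g r else 0)) (t, r)) \<in> borel_measurable borel"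
   by measurable
  moreover have "G = (\<lambda>t. LBINT r. (\<lambda>(t, r). (if 0 \<le> r \<and> r \<le> t then g r else 0)) (t, r))"
   unfolding G_def by (intro ext Bochner_Integration.integral_cong) (auto simp: indicator_def)
  ultimately show ?thesis by simp
 qed
 have gn: "integrable lborel (\<lambda>r. \<bar>g r\<bar>)" using g by auto
 have G_bound: "\<bar>G t\<bar> \<le> (LBINT r. \<bar>g r\<bar>)" for t
 proof -
  have i: "integrable lborel (\<lambda>r. indicator {0..t} r * g r)"
   using integrable_mult_indicator[of "{0..t}" lborel g] g by simp
  have "\<bar>G t\<bar> \<le> (LBINT r. \<bar>indicator {0..t} r * g r\<bar>)"
   unfolding G_def by (rule integral_abs_bound)
  also have "\<dots> \<le> (LBINT r. \<bar>g r\<bar>)"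
   by (rule integral_mono) (use i gn in \<open>auto simp: indicator_def\<close>)
  finally show ?thesis .
 qed
 define F where "F t = f t + G t" for t
 have [measurable]: "F \<in> borel_measurable borel" unfolding F_def by measurable
 have prod_int: "integrable lborel (\<lambda>t. h t * \<zeta> t)"
  if hy: "continuous_on UNIV \<zeta>" "compact K" "\<And>t. t \<notin> K \<Longrightarrow> \<zeta> t = 0" "integrable lborel h" for h \<zeta> :: "real \<Rightarrow> real" and K
 proof -
  obtain B where B: "\<And>x. norm (\<zeta> x) \<le> B" using bounded_continuous_compact_support[OF hy(1-3)] by metis
  have [measurable]: "\<zeta> \<in> borel_measurable borel" using hy(1) by (rule borel_measurable_continuous_onI)
  have [measurable]: "h \<in> borel_measurable borel" using hy(4) by auto
  have "integrable lborel (\<lambda>t. B * h t)" using hy(4) by auto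
  then show ?thesis
   by (rule integrable_dominated)
    (auto simp: abs_mult intro!: AE_I2, metis B abs_ge_zero abs_mult abs_ge_self mult.commute mult_left_mono order_trans real_norm_def mult_right_mono)
 qed
 have prodG_int: "integrable lborel (\<lambda>t. G t * \<zeta> t)"
  if hy: "continuous_on UNIV \<zeta>" "compact K" "\<And>t. t \<notin> K \<Longrightarrow> \<zeta> t = 0" for \<zeta> K
 proof -
  have [measurable]: "\<zeta> \<in> borel_measurable borel" using hy(1) by (rule borel_measurable_continuous_onI)
  have "integrable lborel (\<lambda>t. (LBINT r. \<bar>g r\<bar>) * \<zeta> t)"
   using integrable_continuous_compact_support[OF hy] by auto
  then show ?thesis
   by (rule integrable_dominated)
    (auto simp: abs_mult intro!: AE_I2 mult_right_mono G_bound)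
 qed
 have Ibp: "(LBINT t. G t * frechet_derivative \<theta> (at t) 1) = - (LBINT t. g t * \<theta> t)"
  if \<theta>: "\<theta> \<in> test_functions {0<..<T}" for \<theta>
 proof -
  obtain K where K: "compact K" "K \<subseteq> {0<..<T}" "\<And>x. x \<notin> K \<Longrightarrow> \<theta> x = 0"
   using \<theta> by (auto elim: test_functionsE)
  let ?d = "\<lambda>t. frechet_derivative \<theta> (at t) 1"
  have dc: "continuous_on UNIV ?d" by (rule test_functions_frechet_derivative_continuous[OF \<theta>]) simp
  have d0: "?d t = 0" if "t \<notin> K" for t
   using frechet_derivative_eq_0_outside[OF compact_imp_closed[OF K(1)] K(3) that] by simp
  have [measurable]: "?d \<in> borel_measurable borel" using dc by (rule borel_measurable_continuous_onI)
  have di: "integrable lborel ?d" by (rule integrable_continuous_compact_support[OF dc K(1) d0])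
  let ?h = "\<lambda>(t, r). (if 0 \<le> r \<and> r \<le> t then g r * ?d t else 0)"
  have hi: "integrable lborel ?h"
  proof -
   have "integrable (lborel \<Otimes>\<^sub>M lborel) (\<lambda>(t, r). ?d t * g r)"
   proof (rule lborel_pair.Fubini_integrable)
    show "(\<lambda>(t, r). ?d t * g r) \<in> borel_measurable (lborel \<Otimes>\<^sub>M lborel)" by measurable
    have "integrable lborel (\<lambda>t. \<bar>?d t\<bar> * (LBINT r. \<bar>g r\<bar>))" using di by auto
    then show "integrable lborel (\<lambda>x. LBINT y. norm (case (x, y) of (t, r) \<Rightarrow> ?d t * g r))"
     by (simp add: abs_mult)
    show "AE x in lborel. integrable lborel (\<lambda>y. case (x, y) of (t, r) \<Rightarrow> ?d t * g r)"
     using g by simp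
   qed
   then have "integrable lborel (\<lambda>(t, r). ?d t * g r)" by (simp add: lborel_prod)
   then show ?thesis
    by (rule integrable_dominated) (auto simp: lborel_prod[symmetric] abs_mult)
  qed
  have "(LBINT t. G t * ?d t) = (LBINT t. LBINT r. ?h (t, r))"
  proof (rule Bochner_Integration.integral_cong)
   fix t
   have "G t * ?d t = (LBINT r. (indicator {0..t} r * g r) * ?d t)"
    unfolding G_def by (rule integral_mult_left_zero[symmetric])
   also have "\<dots> = (LBINT r. ?h (t, r))"
    by (intro Bochner_Integration.integral_cong) (auto simp: indicator_def)
   finally show "G t * ?d t = (LBINT r. ?h (t, r))" .
  qed simp
  also have "\<dots> = (LBINT r. LBINT t. ?h (t, r))"
   using lborel_Fubini_fst(3)[OF hi] lborel_Fubini_snd(3)[OF hi] by simp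
  also have "\<dots> = (LBINT r. - (g r * \<theta> r))"
  proof (rule Bochner_Integration.integral_cong)
   fix r
   show "(LBINT t. ?h (t, r)) = - (g r * \<theta> r)"
   proof (cases "0 \<le> r")
    case True
    have "(LBINT t. ?h (t, r)) = (LBINT t. g r * (indicator {r..} t * ?d t))"
     by (intro Bochner_Integration.integral_cong) (use True in \<open>auto simp: indicator_def\<close>)
    also have "\<dots> = g r * (LBINT t. indicator {r..} t * ?d t)" by (rule integral_mult_right_zero)
    also have "\<dots> = - (g r * \<theta> r)" by (simp add: test_integral_deriv_tail[OF \<theta>])
    finally show ?thesis .
   next
    case False
    then have "r \<notin> K" using K(2) by auto
    then show ?thesis using False K(3) by simp
   qed
  qed simp
  finally show ?thesis by simp
 qed
 have F0: "(LBINT t. F t * \<zeta> t) = 0" if \<zeta>: "\<zeta> \<in> test_functions {0<..<T}" and z: "(LBINT t. \<zeta> t) = 0" for \<zeta>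
 proof -
  obtain K where K: "compact K" "\<And>x. x \<notin> K \<Longrightarrow> \<zeta> x = 0"
   using \<zeta> by (auto elim: test_functionsE)
  obtain \<theta> where \<theta>: "\<theta> \<in> test_functions {0<..<T}" "\<And>t. frechet_derivative \<theta> (at t) 1 = \<zeta> t"
   using test_primitive[OF \<zeta> z] by metis
  have "(LBINT t. F t * \<zeta> t) = (LBINT t. f t * \<zeta> t + G t * \<zeta> t)"
   by (simp add: F_def algebra_simps)
  also have "\<dots> = (LBINT t. f t * \<zeta> t) + (LBINT t. G t * \<zeta> t)"
   by (intro Bochner_Integration.integral_add prod_int[OF test_functions_continuous[OF \<zeta>] K f]
    prodG_int[OF test_functions_continuous[OF \<zeta>] K])
  also have "\<dots> = 0" using eq[OF \<theta>(1)] Ibp[OF \<theta>(1)] \<theta>(2) by simp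
  finally show ?thesis .
 qed
 obtain \<zeta>1 where \<zeta>1: "\<zeta>1 \<in> test_functions {0<..<T}" "(LBINT t. \<zeta>1 t) = 1"
  using test_function_unit_integral[OF T] by metis
 define c where "c = (LBINT t. F t * \<zeta>1 t)"
 have Fint: "integrable lborel (\<lambda>t. F t * \<zeta> t)" "integrable lborel \<zeta>" if \<zeta>: "\<zeta> \<in> test_functions {0<..<T}" for \<zeta>
 proof -
  obtain K where K: "compact K" "\<And>x. x \<notin> K \<Longrightarrow> \<zeta> x = 0"
   using \<zeta> by (auto elim: test_functionsE)
  show "integrable lborel \<zeta>" by (rule integrable_continuous_compact_support[OF test_functions_continuous[OF \<zeta>] K])
  show "integrable lborel (\<lambda>t. F t * \<zeta> t)"
   using Bochner_Integration.integrable_add[OF prod_int[OF test_functions_continuous[OF \<zeta>] K f]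
    prodG_int[OF test_functions_continuous[OF \<zeta>] K]] by (simp add: F_def algebra_simps)
 qed
 have Fc: "(LBINT t. (F t - c) * \<zeta> t) = 0" if \<zeta>: "\<zeta> \<in> test_functions {0<..<T}" for \<zeta>
 proof -
  let ?m = "LBINT t. \<zeta> t"
  let ?\<xi> = "\<lambda>t. \<zeta> t - ?m * \<zeta>1 t"
  have t: "?\<xi> \<in> test_functions {0<..<T}" by (rule test_functions_diff_scaled[OF \<zeta> \<zeta>1(1)])
  have "(LBINT t. ?\<xi> t) = ?m - ?m * 1"
   by (subst Bochner_Integration.integral_diff) (use Fint(2)[OF \<zeta>] Fint(2)[OF \<zeta>1(1)] \<zeta>1(2) in auto)
  then have "0 = (LBINT t. F t * ?\<xi> t)" using F0[OF t] by simp
  also have "\<dots> = (LBINT t. F t * \<zeta> t - ?m * (F t * \<zeta>1 t))" by (simp add: algebra_simps)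
  also have "\<dots> = (LBINT t. F t * \<zeta> t) - ?m * c" unfolding c_def
   by (subst Bochner_Integration.integral_diff) (use Fint(1)[OF \<zeta>] Fint(1)[OF \<zeta>1(1)] in auto)
  also have "\<dots> = (LBINT t. F t * \<zeta> t - c * \<zeta> t)"
   by (subst Bochner_Integration.integral_diff) (use Fint[OF \<zeta>] in auto)
  finally show ?thesis by (simp add: algebra_simps)
 qed
 have "AE t in lebesgue. t \<in> {0<..<T} \<longrightarrow> F t - c = 0"
 proof (rule fundamental_lemma)
  show "set_integrable lebesgue K (\<lambda>t. F t - c)" if K: "compact K" for K
  proof -
   have Kb: "K \<in> sets borel" using K compact_imp_closed borel_closed by blast
   have Kf: "emeasure lborel K < \<infinity>" using K compact_imp_bounded emeasure_bounded_finite by blast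
   have "integrable lborel (\<lambda>t. indicator K t *\<^sub>R f t + (indicator K t * (G t - c)))"
   proof (rule Bochner_Integration.integrable_add)
    show "integrable lborel (\<lambda>t. indicator K t *\<^sub>R f t)" by (rule integrable_mult_indicator) (use Kb f in auto)
    have "integrable lborel (\<lambda>t. indicator K t * ((LBINT r. \<bar>g r\<bar>) + \<bar>c\<bar>))"
     using Kb Kf by (auto simp: integrable_real_indicator)
    then show "integrable lborel (\<lambda>t. indicator K t * (G t - c))"
     by (rule integrable_dominated)
      (use Kb G_bound in \<open>auto simp: indicator_def abs_mult intro!: AE_I2 order_trans[OF abs_triangle_ineq4] order_trans[OF _ abs_ge_self] add_mono\<close>)
   qed
   also have "(\<lambda>t. indicator K t *\<^sub>R f t + (indicator K t * (G t - c))) = (\<lambda>t. indicator K t *\<^sub>R (F t - c))"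
    by (auto simp: F_def algebra_simps)
   finally show ?thesis unfolding set_integrable_def using Kb by (subst integrable_completion) auto
  qed
  show "(LINT t|lebesgue. (F t - c) * \<zeta> t) = 0" if "\<zeta> \<in> test_functions {0<..<T}" for \<zeta>
  proof -
   have [measurable]: "\<zeta> \<in> borel_measurable borel"
    using test_functions_continuous[OF that] by (rule borel_measurable_continuous_onI)
   show ?thesis using Fc[OF that] by (subst integral_completion) auto
  qed
 qed auto
 then have "AE t in lborel. t \<in> {0<..<T} \<longrightarrow> F t - c = 0" by (simp add: AE_completion_iff)
 then have "AE t in lborel. t \<in> {0<..<T} \<longrightarrow> f t = c - G t"
  by eventually_elim (auto simp: F_def)
 then show ?thesis unfolding G_def by auto
qed

section \<open>Approximation of compactly supported functions by test functions\<close>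

text \<open>
 Besides test functions, compositions with functions that are merely once continuously differentiable
 have to be inserted into the equation. The gradient is carried along as a separate argument.
\<close>

definition C1c :: "'a::euclidean_space set \<Rightarrow> ('a \<Rightarrow> real) \<Rightarrow> ('a \<Rightarrow> 'a) \<Rightarrow> bool" where
 "C1c K f f' \<longleftrightarrow> compact K \<and> (\<forall>x. (f has_derivative (\<lambda>h. f' x \<bullet> h)) (at x)) \<and>
   continuous_on UNIV f' \<and> (\<forall>x. x \<notin> K \<longrightarrow> f x = 0)"

lemma C1cD:
 assumes "C1c K f f'"
 shows "compact K" "(f has_derivative (\<lambda>h. f' x \<bullet> h)) (at x)" "continuous_on UNIV f'" "x \<notin> K \<Longrightarrow> f x = 0"
  "continuous_on UNIV f"
proof -
 show d: "(f has_derivative (\<lambda>h. f' x \<bullet> h)) (at x)" for x using assms unfolding C1c_def by simp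
 show "continuous_on UNIV f"
  by (rule continuous_at_imp_continuous_on) (use has_derivative_continuous[OF d] in simp)
qed (use assms in \<open>simp_all add: C1c_def\<close>)

lemma C1c_grad_outside:
 assumes "C1c K f f'" "x \<notin> K" shows "f' x = 0"
proof -
 have "frechet_derivative f (at x) = (\<lambda>_. 0)"
  using frechet_derivative_eq_0_outside[of K f x] assms by (auto simp: C1c_def compact_imp_closed)
 moreover have "frechet_derivative f (at x) = (\<lambda>h. f' x \<bullet> h)" using C1cD(2)[OF assms(1)] frechet_derivative_at by metis
 ultimately have "(\<lambda>h. f' x \<bullet> h) = (\<lambda>_. 0)" by simp
 from fun_cong[OF this, of "f' x"] show ?thesis by simp
qed

lemma uniformly_continuous_compact_support:
 fixes f :: "'a::euclidean_space \<Rightarrow> 'b::real_normed_vector"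
 assumes c: "continuous_on UNIV f" and K: "compact K" and z: "\<And>x. x \<notin> K \<Longrightarrow> f x = 0" and e: "e > 0"
 obtains d where "d > 0" "\<And>x y. dist x y < d \<Longrightarrow> norm (f x - f y) < e"
proof -
 define K1 where "K1 = {x + y |x y. x \<in> K \<and> y \<in> cball 0 1}"
 have "compact K1" unfolding K1_def by (rule compact_sums) (use K in auto)
 then have "uniformly_continuous_on K1 f"
  using compact_uniformly_continuous[of K1 f] continuous_on_subset[OF c] by blast
 then obtain d where d: "d > 0" "\<And>x y. x \<in> K1 \<Longrightarrow> y \<in> K1 \<Longrightarrow> dist y x < d \<Longrightarrow> dist (f y) (f x) < e"
  unfolding uniformly_continuous_on_def using e by blast
 have in1: "x \<in> K1" if "z \<in> K" "dist x z < 1" for x z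
  unfolding K1_def by (rule CollectI, rule exI[of _ z], rule exI[of _ "x - z"]) (use that in \<open>simp add: dist_norm norm_minus_commute\<close>)
 show ?thesis
 proof (rule that[of "min d 1"])
  fix x y :: 'a assume xy: "dist x y < min d 1"
  show "norm (f x - f y) < e"
  proof (cases "x \<in> K \<or> y \<in> K")
   case True
   then have "x \<in> K1 \<and> y \<in> K1" using in1[of x y] in1[of y x] in1[of x x] in1[of y y] xy
    by (metis dist_commute dist_self min_less_iff_conj zero_less_one)
   then show ?thesis using d(2)[of y x] xy by (simp add: dist_norm)
  qed (use z e in auto)
 qed (use d in auto)
qed

lemma C1c_uniform_remainder:
 assumes f: "C1c K f f'" and e: "e > 0"
 obtains d where "d > 0" "\<And>x h. norm h < d \<Longrightarrow> \<bar>f (x + h) - f x - f' x \<bullet> h\<bar> \<le> e * norm h"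
proof -
 obtain d where d: "d > 0" "\<And>x y. dist x y < d \<Longrightarrow> norm (f' x - f' y) < e"
  using uniformly_continuous_compact_support[OF C1cD(3)[OF f] C1cD(1)[OF f] C1c_grad_outside[OF f] e] by metis
 show ?thesis
 proof (rule that[OF d(1)])
  fix x h :: 'a assume h: "norm h < d"
  let ?g = "\<lambda>y. f y - f' x \<bullet> y"
  have "norm (?g (x + h) - ?g x) \<le> e * norm ((x + h) - x)"
  proof (rule differentiable_bound[where S="ball x d" and f'="\<lambda>y h. (f' y - f' x) \<bullet> h"])
   fix y assume y: "y \<in> ball x d"
   have "(?g has_derivative (\<lambda>h. f' y \<bullet> h - f' x \<bullet> h)) (at y)"
    by (intro has_derivative_diff C1cD(2)[OF f] has_derivative_inner_right has_derivative_ident)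
   then show "(?g has_derivative (\<lambda>h. (f' y - f' x) \<bullet> h)) (at y within ball x d)"
    by (simp add: inner_diff_left has_derivative_at_withinI)
   show "onorm (\<lambda>h. (f' y - f' x) \<bullet> h) \<le> e"
   proof (rule onorm_le)
    fix h
    have "norm ((f' y - f' x) \<bullet> h) \<le> norm (f' y - f' x) * norm h" by (simp add: Cauchy_Schwarz_ineq2)
    also have "\<dots> \<le> e * norm h" using d(2)[of y x] y by (intro mult_right_mono) (auto simp: dist_commute)
    finally show "norm ((f' y - f' x) \<bullet> h) \<le> e * norm h" .
   qed
  qed (use h d in \<open>auto simp: dist_norm\<close>)
  then show "\<bar>f (x + h) - f x - f' x \<bullet> h\<bar> \<le> e * norm h" by (simp add: inner_add_right algebra_simps)
 qed
qed

lemma lborel_integral_shift: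
 fixes f :: "'a::euclidean_space \<Rightarrow> 'b::{banach, second_countable_topology}"
 assumes [measurable]: "f \<in> borel_measurable borel"
 shows "(LBINT x. f (x + c)) = (LBINT x. f x)"
proof -
 have "(LBINT x. f x) = (LINT x|distr lborel borel ((+) c). f x)" by (simp add: lborel_distr_plus)
 also have "\<dots> = (LBINT x. f (c + x))" by (rule integral_distr) auto
 finally show ?thesis by (simp add: add.commute)
qed

lemma lborel_integrable_shift:
 fixes f :: "'a::euclidean_space \<Rightarrow> 'b::{banach, second_countable_topology}"
 assumes "integrable lborel f"
 shows "integrable lborel (\<lambda>x. f (x + c))"
proof -
 have "integrable (distr lborel borel ((+) c)) f" using assms by (simp add: lborel_distr_plus)
 then have "integrable lborel (\<lambda>x. f (c + x))" by (subst (asm) integrable_distr_eq) (use assms in auto)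
 then show ?thesis by (simp add: add.commute)
qed

lemma lborel_integral_reflect:
 fixes f :: "'a::euclidean_space \<Rightarrow> 'b::{banach, second_countable_topology}"
 assumes [measurable]: "f \<in> borel_measurable borel"
 shows "(LBINT y. f (x - y)) = (LBINT y. f y)"
proof -
 have "lborel = distr lborel borel (\<lambda>y. x + (-1) *\<^sub>R (y::'a))"
  using lborel_affine[of "-1" x] by (simp add: density_1)
 then have "(LBINT y. f y) = (LINT y|distr lborel borel (\<lambda>y. x + (-1) *\<^sub>R (y::'a)). f y)" by simp
 also have "\<dots> = (LBINT y. f (x + (-1) *\<^sub>R y))" by (rule integral_distr) auto
 finally show ?thesis by simp
qed

text \<open>
 Difference quotients have integral zero by translation invariance, and they converge uniformly on a
 fixed compact set.
\<close>

lemma C1c_integral_gradient_zero: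
 assumes f: "C1c K f f'"
 shows "(LBINT x. f' x \<bullet> b) = 0"
proof (cases "b = 0")
 case False
 define K1 where "K1 = {x + y |x y. x \<in> K \<and> y \<in> cball 0 1}"
 have cK: "compact K1" unfolding K1_def by (rule compact_sums) (use C1cD(1)[OF f] in auto)
 have Kb[measurable]: "K1 \<in> sets borel" using compact_imp_closed[OF cK] by (rule borel_closed)
 have Kf: "emeasure lborel K1 < \<infinity>" using compact_imp_bounded[OF cK] by (rule emeasure_bounded_finite)
 have KK: "x \<in> K1" if "x \<in> K" for x
  unfolding K1_def by (rule CollectI, rule exI[of _ x], rule exI[of _ 0]) (use that in simp)
 have KK2: "x \<in> K1" if "x + h \<in> K" "norm h \<le> 1" for x h
  unfolding K1_def by (rule CollectI, rule exI[of _ "x + h"], rule exI[of _ "- h"]) (use that in simp)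
 have fi: "integrable lborel f" by (rule integrable_continuous_compact_support[OF C1cD(5,1,4)[OF f]])
 have [measurable]: "f \<in> borel_measurable borel" using fi by auto
 have f'i: "integrable lborel (\<lambda>x. f' x \<bullet> h)" for h
  using integrable_continuous_compact_support[OF C1cD(3,1)[OF f] C1c_grad_outside[OF f]] by auto
 have "\<bar>LBINT x. f' x \<bullet> b\<bar> \<le> e * (norm b * measure lborel K1)" if e: "e > 0" for e
 proof -
  obtain d where d: "d > 0" "\<And>x h. norm h < d \<Longrightarrow> \<bar>f (x + h) - f x - f' x \<bullet> h\<bar> \<le> e * norm h"
   using C1c_uniform_remainder[OF f e] by metis
  define t where "t = min (d / 2) 1 / norm b"
  have t: "t > 0" "norm (t *\<^sub>R b) < d" "norm (t *\<^sub>R b) \<le> 1"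
   using d False by (auto simp: t_def min_def)
  let ?h = "t *\<^sub>R b"
  have i: "integrable lborel (\<lambda>x. f (x + ?h) - f x - f' x \<bullet> ?h)"
   using lborel_integrable_shift[OF fi] fi f'i by auto
  have "(LBINT x. f (x + ?h) - f x - f' x \<bullet> ?h) = - (LBINT x. f' x \<bullet> ?h)"
   using lborel_integrable_shift[OF fi, of ?h] fi f'i[of ?h] by (simp add: lborel_integral_shift)
  then have "t * \<bar>LBINT x. f' x \<bullet> b\<bar> = \<bar>LBINT x. f (x + ?h) - f x - f' x \<bullet> ?h\<bar>"
   using t by (simp add: abs_mult)
  also have "\<dots> \<le> (LBINT x. \<bar>f (x + ?h) - f x - f' x \<bullet> ?h\<bar>)" by (rule integral_abs_bound)
  also have "\<dots> \<le> (LBINT x. indicator K1 x * (e * norm ?h))"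
  proof (rule integral_mono)
   show "integrable lborel (\<lambda>x. \<bar>f (x + ?h) - f x - f' x \<bullet> ?h\<bar>)" using i by auto
   show "integrable lborel (\<lambda>x. indicator K1 x * (e * norm ?h))" using Kf by (auto simp: integrable_real_indicator)
   show "\<bar>f (x + ?h) - f x - f' x \<bullet> ?h\<bar> \<le> indicator K1 x * (e * norm ?h)" for x
   proof (cases "x \<in> K1")
    case True then show ?thesis using d(2)[OF t(2), of x] by simp
   next
    case False
    then have "x \<notin> K" "x + ?h \<notin> K" using KK KK2[OF _ t(3)] by blast+
    then show ?thesis using C1cD(4)[OF f] C1c_grad_outside[OF f] False by simp
   qed
  qed
  also have "\<dots> = t * (e * (norm b * measure lborel K1))" using t by simp
  finally show ?thesis using t by simp
 qed
 note * = this
 have "\<bar>LBINT x. f' x \<bullet> b\<bar> \<le> 0 + e" if e: "e > 0" for e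
 proof -
  let ?c = "norm b * measure lborel K1"
  have c: "?c \<ge> 0" by simp
  have c1: "?c + 1 > 0" using c by linarith
  from *[OF divide_pos_pos[OF e c1]] have "\<bar>LBINT x. f' x \<bullet> b\<bar> \<le> e * (?c / (?c + 1))" by simp
  also have "\<dots> \<le> e * 1" by (rule mult_left_mono) (use c c1 e in \<open>simp_all add: divide_le_eq_1\<close>)
  finally show ?thesis by simp
 qed
 then have "\<bar>LBINT x. f' x \<bullet> b\<bar> \<le> 0" by (rule field_le_epsilon)
 then show ?thesis by simp
qed simp

lemma grad_inner:
 assumes "\<phi> \<in> test_functions S"
 shows "frechet_derivative \<phi> (at x) = (\<lambda>h. grad \<phi> x \<bullet> h)"
proof
 fix h
 have "\<phi> differentiable at x" by (rule differentiableI[OF test_functions_has_derivative[OF assms]])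
 from frechet_derivative_euclidean[OF this, of h]
 show "frechet_derivative \<phi> (at x) h = grad \<phi> x \<bullet> h"
  unfolding grad_def inner_sum_left by (simp add: mult.commute inner_commute[of h])
qed

lemma test_functions_C1c:
 assumes "\<phi> \<in> test_functions S"
 obtains K where "K \<subseteq> S" "C1c K \<phi> (grad \<phi>)"
proof -
 obtain K where K: "compact K" "K \<subseteq> S" "\<And>x. x \<notin> K \<Longrightarrow> \<phi> x = 0" using assms by (auto elim: test_functionsE)
 have "continuous_on UNIV (grad \<phi>)"
  unfolding grad_def[abs_def]
  by (intro continuous_on_sum continuous_on_scaleR test_functions_frechet_derivative_continuous[OF assms] continuous_on_const)
 then have "C1c K \<phi> (grad \<phi>)"
  unfolding C1c_def using K test_functions_has_derivative[OF assms] by (simp add: grad_inner[OF assms])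
 then show ?thesis by (rule that[OF K(2)])
qed

lemma test_functions_partial:
 assumes "\<phi> \<in> test_functions S" "b \<in> Basis"
 shows "(\<lambda>x. frechet_derivative \<phi> (at x) b) \<in> test_functions S"
proof -
 obtain K where K: "compact K" "K \<subseteq> S" "\<And>x. x \<notin> K \<Longrightarrow> \<phi> x = 0" "\<And>k. \<phi> \<in> Ck_on k UNIV"
  using assms(1) by (auto elim: test_functionsE)
 show ?thesis
  by (rule test_functionsI[OF Ck_on_SucD(2)[OF K(4) assms(2)] K(1,2)])
   (simp add: frechet_derivative_eq_0_outside[OF compact_imp_closed[OF K(1)] K(3)])
qed

lemma integrable_mult_bounded:
 fixes w :: "'b \<Rightarrow> real" and g :: "'b \<Rightarrow> 'c::{banach, second_countable_topology}"
 assumes w: "integrable M w" and [measurable]: "g \<in> borel_measurable M" and B: "\<And>x. norm (g x) \<le> B"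
 shows "integrable M (\<lambda>x. w x *\<^sub>R g x)"
proof -
 have i: "integrable M (\<lambda>x. B * norm (w x))" using w by auto
 have [measurable]: "w \<in> borel_measurable M" using w by auto
 have le: "norm (w x *\<^sub>R g x) \<le> norm (B * norm (w x))" for x
 proof -
  have "norm (w x *\<^sub>R g x) \<le> norm (w x) * B" using B by (simp add: mult_left_mono)
  also have "\<dots> \<le> norm (B * norm (w x))" by (metis abs_ge_self mult.commute real_norm_def)
  finally show ?thesis .
 qed
 show ?thesis by (rule integrable_dominated[OF i]) (measurable, simp only: le AE_I2)
qed

text \<open>
 Differentiation under the integral sign; the uniform remainder of \<open>\<rho>\<close> replaces a dominating function.
\<close>

lemma C1c_convolution_derivative:
 fixes w :: "'a::euclidean_space \<Rightarrow> real"
 assumes r: "C1c K \<rho> \<rho>'" and w: "integrable lborel w"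
 shows "((\<lambda>x. LBINT y. w y * \<rho> (x - y)) has_derivative (\<lambda>h. (LBINT y. w y *\<^sub>R \<rho>' (x - y)) \<bullet> h)) (at x)"
proof -
 have [measurable]: "\<rho> \<in> borel_measurable borel" "\<rho>' \<in> borel_measurable borel"
  using C1cD(3,5)[OF r] by (auto intro: borel_measurable_continuous_onI)
 have [measurable]: "w \<in> borel_measurable borel" using w by auto
 obtain B where B: "\<And>x. norm (\<rho> x) \<le> B" using bounded_continuous_compact_support[OF C1cD(5,1,4)[OF r]] by metis
 obtain B' where B': "\<And>x. norm (\<rho>' x) \<le> B'"
  using bounded_continuous_compact_support[OF C1cD(3,1)[OF r] C1c_grad_outside[OF r]] by metis
 have i1: "integrable lborel (\<lambda>y. w y * \<rho> (x - y))" for x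
  using integrable_mult_bounded[OF w, of "\<lambda>y. \<rho> (x - y)" B] B by simp
 have i2: "integrable lborel (\<lambda>y. w y *\<^sub>R \<rho>' (x - y))" for x
  by (rule integrable_mult_bounded[OF w, of "\<lambda>y. \<rho>' (x - y)" B']) (use B' in auto)
 show ?thesis
  unfolding has_derivative_at_alt
 proof (intro conjI allI impI)
  show "bounded_linear ((\<bullet>) (LBINT y. w y *\<^sub>R \<rho>' (x - y)))" by (rule bounded_linear_inner_right)
  fix e :: real assume e: "e > 0"
  let ?W = "(LBINT y. \<bar>w y\<bar>) + 1"
  have W: "?W > 0" by (simp add: add_nonneg_pos)
  obtain d where d: "d > 0" "\<And>x h. norm h < d \<Longrightarrow> \<bar>\<rho> (x + h) - \<rho> x - \<rho>' x \<bullet> h\<bar> \<le> (e / ?W) * norm h"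
   using C1c_uniform_remainder[OF r, of "e / ?W"] e W by auto
  have "\<bar>(LBINT y. w y * \<rho> (z - y)) - (LBINT y. w y * \<rho> (x - y)) - (LBINT y. w y *\<^sub>R \<rho>' (x - y)) \<bullet> (z - x)\<bar>
    \<le> e * norm (z - x)" if z: "norm (z - x) < d" for z
  proof -
   have rem: "\<bar>\<rho> (z - y) - \<rho> (x - y) - \<rho>' (x - y) \<bullet> (z - x)\<bar> \<le> (e / ?W) * norm (z - x)" for y
    using d(2)[OF z, of "x - y"] by (simp add: algebra_simps)
   have i3: "integrable lborel (\<lambda>y. w y * (\<rho>' (x - y) \<bullet> (z - x)))"
    using integrable_inner_left[OF i2[of x], of "z - x"] by simp
   have i4: "integrable lborel (\<lambda>y. w y * \<rho> (z - y) - w y * \<rho> (x - y) - w y * (\<rho>' (x - y) \<bullet> (z - x)))"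
    using i1[of z] i1[of x] i3 by auto
   have "(LBINT y. w y *\<^sub>R \<rho>' (x - y)) \<bullet> (z - x) = (LBINT y. w y * (\<rho>' (x - y) \<bullet> (z - x)))"
    using integral_inner_left[OF i2[of x], of "z - x"] by simp
   then have eq: "(LBINT y. w y * \<rho> (z - y)) - (LBINT y. w y * \<rho> (x - y)) - (LBINT y. w y *\<^sub>R \<rho>' (x - y)) \<bullet> (z - x)
    = (LBINT y. w y * \<rho> (z - y) - w y * \<rho> (x - y) - w y * (\<rho>' (x - y) \<bullet> (z - x)))"
    using i1[of z] i1[of x] i3 by simp
   have "\<bar>LBINT y. w y * \<rho> (z - y) - w y * \<rho> (x - y) - w y * (\<rho>' (x - y) \<bullet> (z - x))\<bar> \<le> (LBINT y. \<bar>w y * \<rho> (z - y) - w y * \<rho> (x - y) - w y * (\<rho>' (x - y) \<bullet> (z - x))\<bar>)"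
    by (rule integral_abs_bound)
   also have "\<dots> \<le> (LBINT y. \<bar>w y\<bar> * ((e / ?W) * norm (z - x)))"
   proof (rule integral_mono)
    show "integrable lborel (\<lambda>y. \<bar>w y * \<rho> (z - y) - w y * \<rho> (x - y) - w y * (\<rho>' (x - y) \<bullet> (z - x))\<bar>)"
     using i4 by (rule integrable_abs)
    show "integrable lborel (\<lambda>y. \<bar>w y\<bar> * ((e / ?W) * norm (z - x)))"
     by (intro integrable_mult_left integrable_abs w)
    fix y
    have "\<bar>w y * \<rho> (z - y) - w y * \<rho> (x - y) - w y * (\<rho>' (x - y) \<bullet> (z - x))\<bar>
     = \<bar>w y\<bar> * \<bar>\<rho> (z - y) - \<rho> (x - y) - \<rho>' (x - y) \<bullet> (z - x)\<bar>"
     by (simp only: abs_mult[symmetric] right_diff_distrib)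
    also have "\<dots> \<le> \<bar>w y\<bar> * ((e / ?W) * norm (z - x))" by (intro mult_left_mono rem) auto
    finally show "\<bar>w y * \<rho> (z - y) - w y * \<rho> (x - y) - w y * (\<rho>' (x - y) \<bullet> (z - x))\<bar> \<le> \<bar>w y\<bar> * ((e / ?W) * norm (z - x))" .
   qed
   also have "\<dots> = (LBINT y. \<bar>w y\<bar>) * ((e / ?W) * norm (z - x))" by (rule integral_mult_left_zero)
   also have "\<dots> \<le> ?W * ((e / ?W) * norm (z - x))"
    by (intro mult_right_mono mult_nonneg_nonneg divide_nonneg_nonneg) (use W e in simp_all)
   also have "\<dots> = e * norm (z - x)" using W by simp
   finally show ?thesis unfolding eq .
  qed
  then show "\<exists>d>0. \<forall>z. norm (z - x) < d \<longrightarrow>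
    norm ((LBINT y. w y * \<rho> (z - y)) - (LBINT y. w y * \<rho> (x - y)) - (LBINT y. w y *\<^sub>R \<rho>' (x - y)) \<bullet> (z - x)) \<le> e * norm (z - x)"
   using d(1) by (auto simp only: real_norm_def)
 qed
qed

lemma convolution_Ck:
 fixes w :: "'a::euclidean_space \<Rightarrow> real"
 assumes w: "integrable lborel w"
 shows "\<rho> \<in> test_functions UNIV \<Longrightarrow> (\<lambda>x. LBINT y. w y * \<rho> (x - y)) \<in> Ck_on k UNIV"
proof (induction k arbitrary: \<rho>)
 case 0
 obtain K where "C1c K \<rho> (grad \<rho>)" using test_functions_C1c[OF 0] by metis
 from C1c_convolution_derivative[OF this w] show ?case
  unfolding Ck_on_0_iff by (intro continuous_at_imp_continuous_on ballI has_derivative_continuous)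
next
 case (Suc k)
 obtain K where K: "C1c K \<rho> (grad \<rho>)" using test_functions_C1c[OF Suc.prems] by metis
 have [measurable]: "grad \<rho> \<in> borel_measurable borel"
  using C1cD(3)[OF K] by (auto intro: borel_measurable_continuous_onI)
 obtain B' where B': "\<And>x. norm (grad \<rho> x) \<le> B'"
  using bounded_continuous_compact_support[OF C1cD(3,1)[OF K] C1c_grad_outside[OF K]] by metis
 have i2: "integrable lborel (\<lambda>y. w y *\<^sub>R grad \<rho> (x - y))" for x
  by (rule integrable_mult_bounded[OF w, of "\<lambda>y. grad \<rho> (x - y)" B']) (use B' in auto)
 show ?case
 proof (rule Ck_on_SucI[OF C1c_convolution_derivative[OF K w]])
  fix b :: 'a assume b: "b \<in> Basis"
  have "(LBINT y. w y *\<^sub>R grad \<rho> (x - y)) \<bullet> b = (LBINT y. w y * frechet_derivative \<rho> (at (x - y)) b)" for x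
   using integral_inner_left[OF i2[of x], of b] by (simp add: grad_inner[OF Suc.prems])
  then show "(\<lambda>x. (LBINT y. w y *\<^sub>R grad \<rho> (x - y)) \<bullet> b) \<in> Ck_on k UNIV"
   using Suc.IH[OF test_functions_partial[OF Suc.prems b]] by simp
 qed
qed

lemma mollifier:
 assumes "r > 0"
 obtains \<rho> :: "'a::euclidean_space \<Rightarrow> real" where "\<rho> \<in> test_functions UNIV" "\<And>x. \<rho> x \<ge> 0"
  "\<And>x. x \<notin> cball 0 r \<Longrightarrow> \<rho> x = 0" "(LBINT x. \<rho> x) = 1"
proof -
 define s where "s = r / DIM('a)"
 have s: "s > 0" using assms by (simp add: s_def)
 let ?a = "- (s *\<^sub>R One) :: 'a" and ?b = "s *\<^sub>R One :: 'a"
 let ?\<beta> = "box_bump 1 ?a ?b"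
 have t: "?\<beta> \<in> test_functions UNIV" by (rule box_bump_test) simp
 have c: "continuous_on UNIV ?\<beta>" by (rule test_functions_continuous[OF t])
 have z: "?\<beta> x = 0" if "x \<notin> cbox ?a ?b" for x using that box_subset_cbox box_bump_outside by blast
 have sub: "cbox ?a ?b \<subseteq> cball 0 r"
 proof
  fix x assume "x \<in> cbox ?a ?b"
  then have "\<bar>x \<bullet> i\<bar> \<le> s" if "i \<in> Basis" for i using that by (auto simp: mem_box abs_le_iff)
  then have "norm x \<le> (\<Sum>i\<in>(Basis::'a set). s)"
   using order_trans[OF norm_le_l1[of x] sum_mono[of Basis "\<lambda>i. \<bar>x \<bullet> i\<bar>" "\<lambda>_. s"]] by blast
  then show "x \<in> cball 0 r" by (simp add: s_def)
 qed
 have i: "integrable lborel ?\<beta>"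
  by (rule integrable_continuous_compact_support[OF c compact_cbox z])
 let ?I = "LBINT x. ?\<beta> x"
 have I0: "?I \<ge> 0" by (intro Bochner_Integration.integral_nonneg) (simp add: box_bump_bounds)
 have "?I \<noteq> 0"
 proof
  assume "?I = 0"
  then have "AE x in lborel. ?\<beta> x = 0" using integral_nonneg_eq_0_iff_AE[OF i] by (simp add: box_bump_bounds)
  then have "AE x in lborel. x \<notin> box ?a ?b"
  proof eventually_elim
   case (elim x)
   then show ?case by (auto simp: box_bump_def flat_def mem_box split: if_splits) force+
  qed
  then have "emeasure lborel (box ?a ?b) = 0" using AE_iff_null_sets[of "box ?a ?b" lborel] by auto
  moreover have "emeasure lborel (box ?a ?b) > 0"
  proof -
   have "emeasure lborel (box ?a ?b) = ennreal (\<Prod>i\<in>Basis. (?b - ?a) \<bullet> i)"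
    by (rule emeasure_lborel_box) (use s in auto)
   also have "(\<Prod>i\<in>Basis. (?b - ?a) \<bullet> i) = (\<Prod>i\<in>(Basis::'a set). 2 * s)"
    by (rule prod.cong) (auto simp: inner_diff_left inner_add_left)
   finally show ?thesis using s by simp
  qed
  ultimately show False by simp
 qed
 then have I: "?I > 0" using I0 by simp
 let ?\<rho> = "\<lambda>x. 0 - (- 1 / ?I) * ?\<beta> x"
 show ?thesis
 proof (rule that[of ?\<rho>])
  show "?\<rho> \<in> test_functions UNIV"
   using test_functions_diff_scaled[OF _ t, of "\<lambda>_. 0" "- 1 / ?I"] test_functionsI[of "\<lambda>_. 0" "{}" UNIV] by (auto simp: Ck_on_const)
  show "?\<rho> x \<ge> 0" for x using I box_bump_bounds[of 1 ?a ?b x] by simp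
  show "?\<rho> x = 0" if "x \<notin> cball 0 r" for x
  proof -
   have "x \<notin> cbox ?a ?b" using sub that by blast
   then show ?thesis using z[of x] by (simp del: One_nat_def)
  qed
  show "(LBINT x. ?\<rho> x) = 1" using I by simp
 qed
qed

text \<open>
 Mollification; the support stays inside \<open>\<Omega>\<close> if the radius is below the distance of \<open>K\<close> to the complement.
\<close>

theorem C1c_approx_test:
 assumes f: "C1c K f f'" and K: "K \<subseteq> \<Omega>" "open \<Omega>" and e: "e > 0"
 obtains \<phi> where "\<phi> \<in> test_functions \<Omega>" "\<And>x. \<bar>\<phi> x - f x\<bar> \<le> e" "\<And>x. norm (grad \<phi> x - f' x) \<le> e"
proof -
 obtain d1 where d1: "d1 > 0" "\<And>x y. dist x y < d1 \<Longrightarrow> norm (f' x - f' y) < e"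
  using uniformly_continuous_compact_support[OF C1cD(3)[OF f] C1cD(1)[OF f] C1c_grad_outside[OF f] e] by metis
 obtain d2 where d2: "d2 > 0" "\<And>x y. dist x y < d2 \<Longrightarrow> norm (f x - f y) < e"
  using uniformly_continuous_compact_support[OF C1cD(5)[OF f] C1cD(1)[OF f] C1cD(4)[OF f] e] by metis
 obtain d3 where d3: "d3 > 0" "(\<Union>x\<in>K. cball x d3) \<subseteq> \<Omega>"
  using compact_subset_open_imp_cball_epsilon_subset[OF C1cD(1)[OF f] K(2) K(1)] by metis
 \<comment> \<open>Below the moduli of continuity of \<open>f'\<close> and \<open>f\<close> and the distance to the complement of \<open>\<Omega>\<close>.\<close>
 define r where "r = min (min d1 d2 / 2) d3"
 have r: "r > 0" "r < d1" "r < d2" "r \<le> d3" using d1(1) d2(1) d3(1) by (auto simp: r_def min_def)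
 obtain \<rho> :: "'a \<Rightarrow> real" where \<rho>: "\<rho> \<in> test_functions UNIV" "\<And>x. \<rho> x \<ge> 0"
  "\<And>x. x \<notin> cball 0 r \<Longrightarrow> \<rho> x = 0" "(LBINT x. \<rho> x) = 1" using mollifier[OF r(1)] by metis
 have \<rho>c: "continuous_on UNIV \<rho>" by (rule test_functions_continuous[OF \<rho>(1)])
 have \<rho>i: "integrable lborel \<rho>" by (rule integrable_continuous_compact_support[OF \<rho>c compact_cball \<rho>(3)])
 have fi: "integrable lborel f" by (rule integrable_continuous_compact_support[OF C1cD(5,1,4)[OF f]])
 have [measurable]: "f \<in> borel_measurable borel" "f' \<in> borel_measurable borel" "\<rho> \<in> borel_measurable borel"
  using C1cD(3,5)[OF f] \<rho>c by (auto intro: borel_measurable_continuous_onI)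
 let ?\<phi> = "\<lambda>x. LBINT y. f y * \<rho> (x - y)"
 have alt: "?\<phi> x = (LBINT y. \<rho> y * f (x - y))" for x
  using lborel_integral_reflect[of "\<lambda>y. \<rho> y * f (x - y)" x] by (simp add: mult.commute)
 have Bf: "integrable lborel (\<lambda>y. \<rho> y * f (x - y))" for x
 proof -
  obtain B where B: "\<And>x. norm (f x) \<le> B" using bounded_continuous_compact_support[OF C1cD(5,1,4)[OF f]] by metis
  show ?thesis using integrable_mult_bounded[OF \<rho>i, of "\<lambda>y. f (x - y)" B] B by simp
 qed
 have Bf': "integrable lborel (\<lambda>y. \<rho> y *\<^sub>R f' (x - y))" for x
 proof -
  obtain B where B: "\<And>x. norm (f' x) \<le> B"
   using bounded_continuous_compact_support[OF C1cD(3,1)[OF f] C1c_grad_outside[OF f]] by metis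
  show ?thesis using integrable_mult_bounded[OF \<rho>i, of "\<lambda>y. f' (x - y)" B] B by simp
 qed
 let ?K = "{x + y |x y. x \<in> K \<and> y \<in> cball 0 r}"
 have test: "?\<phi> \<in> test_functions \<Omega>"
 proof (rule test_functionsI[OF convolution_Ck[OF fi \<rho>(1)]])
  show "compact ?K" by (rule compact_sums) (use C1cD(1)[OF f] in auto)
  have "x + y \<in> \<Omega>" if "x \<in> K" "norm y \<le> r" for x y
  proof -
   have "x + y \<in> cball x d3" using that r(4) by (simp add: dist_norm)
   then show ?thesis using d3(2) that by blast
  qed
  then show "?K \<subseteq> \<Omega>" by auto
  show "?\<phi> x = 0" if "x \<notin> ?K" for x
  proof -
   have "\<rho> y * f (x - y) = 0" for y
   proof (rule ccontr)
    assume "\<rho> y * f (x - y) \<noteq> 0"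
    then have "y \<in> cball 0 r" "x - y \<in> K" using \<rho>(3) C1cD(4)[OF f] by auto
    then have "x \<in> ?K" by (intro CollectI exI[of _ "x - y"] exI[of _ y]) simp
    then show False using that by blast
   qed
   then have "(\<lambda>y. \<rho> y * f (x - y)) = (\<lambda>_. 0)" by (intro ext)
   then show ?thesis unfolding alt by simp
  qed
 qed
 have "grad ?\<phi> x = (LBINT y. \<rho> y *\<^sub>R f' (x - y))" for x
 proof -
  have "(?\<phi> has_derivative (\<lambda>h. (LBINT y. \<rho> y *\<^sub>R f' (x - y)) \<bullet> h)) (at x)"
   unfolding alt by (rule C1c_convolution_derivative[OF f \<rho>i])
  then have "frechet_derivative ?\<phi> (at x) = (\<lambda>h. (LBINT y. \<rho> y *\<^sub>R f' (x - y)) \<bullet> h)"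
   using frechet_derivative_at by metis
  then show ?thesis by (simp add: grad_def euclidean_representation)
 qed
 moreover have "norm ((LBINT y. \<rho> y *\<^sub>R f' (x - y)) - f' x) \<le> e" for x
 proof -
  have "(LBINT y. \<rho> y *\<^sub>R f' (x - y)) - f' x = (LBINT y. \<rho> y *\<^sub>R f' (x - y)) - (LBINT y. \<rho> y *\<^sub>R f' x)"
   using \<rho>i \<rho>(4) by simp
  also have "\<dots> = (LBINT y. \<rho> y *\<^sub>R (f' (x - y) - f' x))"
   using Bf' \<rho>i by (simp add: scaleR_diff_right)
  finally have eq: "(LBINT y. \<rho> y *\<^sub>R f' (x - y)) - f' x = (LBINT y. \<rho> y *\<^sub>R (f' (x - y) - f' x))" .
  have "norm (LBINT y. \<rho> y *\<^sub>R (f' (x - y) - f' x)) \<le> (LBINT y. \<rho> y * e)"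
  proof (rule Bochner_Integration.integral_norm_bound_integral)
   show "integrable lborel (\<lambda>y. \<rho> y *\<^sub>R (f' (x - y) - f' x))" using Bf' \<rho>i by (simp add: scaleR_diff_right)
   show "integrable lborel (\<lambda>y. \<rho> y * e)" using \<rho>i by simp
   fix y
   show "norm (\<rho> y *\<^sub>R (f' (x - y) - f' x)) \<le> \<rho> y * e"
   proof (cases "y \<in> cball 0 r")
    case True
    then have "norm (f' (x - y) - f' x) \<le> e" using d1(2)[of "x - y" x] r(2) by (simp add: dist_norm)
    then show ?thesis using \<rho>(2)[of y] by (simp add: mult_left_mono)
   qed (simp add: \<rho>(3))
  qed
  also have "\<dots> = e" using \<rho>(4) by simp
  finally show ?thesis unfolding eq .
 qed
 moreover have "\<bar>?\<phi> x - f x\<bar> \<le> e" for x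
 proof -
  have "?\<phi> x - f x = (LBINT y. \<rho> y * f (x - y)) - (LBINT y. \<rho> y * f x)"
   using \<rho>i \<rho>(4) alt by simp
  also have "\<dots> = (LBINT y. \<rho> y * (f (x - y) - f x))"
   using Bf \<rho>i by (simp add: right_diff_distrib)
  finally have eq: "?\<phi> x - f x = (LBINT y. \<rho> y * (f (x - y) - f x))" .
  have "norm (LBINT y. \<rho> y * (f (x - y) - f x)) \<le> (LBINT y. \<rho> y * e)"
  proof (rule Bochner_Integration.integral_norm_bound_integral)
   show "integrable lborel (\<lambda>y. \<rho> y * (f (x - y) - f x))" using Bf \<rho>i by (simp add: right_diff_distrib)
   show "integrable lborel (\<lambda>y. \<rho> y * e)" using \<rho>i by simp
   fix y
   show "norm (\<rho> y * (f (x - y) - f x)) \<le> \<rho> y * e"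
   proof (cases "y \<in> cball 0 r")
    case True
    then have "\<bar>f (x - y) - f x\<bar> \<le> e" using d2(2)[of "x - y" x] r(3) by (simp add: dist_norm)
    then show ?thesis using \<rho>(2)[of y] by (simp add: mult_left_mono abs_mult)
   qed (simp add: \<rho>(3))
  qed
  also have "\<dots> = e" using \<rho>(4) by simp
  finally show ?thesis unfolding eq by simp
 qed
 ultimately show ?thesis using that[OF test] by simp
qed

section \<open>First-order functionals and countable families of test functions\<close>

text \<open>
 Separability of the uniformly continuous functions on a bounded set: record the values at the centres
 of a finite cover by small balls, up to a small error, in a countable dense set, and pick one member of
 the family for each record. Choosing inside the family itself keeps the
 representatives admissible as test functions.
\<close>

lemma countable_uniformly_dense_subfamily:
 fixes \<Phi> :: "'i \<Rightarrow> 'a::euclidean_space \<Rightarrow> 'b::euclidean_space"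
 assumes bd: "bounded \<Omega>"
  and uc: "\<And>i e. i \<in> I \<Longrightarrow> e > 0 \<Longrightarrow> \<exists>d>0. \<forall>x y. dist x y < d \<longrightarrow> dist (\<Phi> i x) (\<Phi> i y) < e"
 obtains D where "countable D" "D \<subseteq> I" "\<And>i e. i \<in> I \<Longrightarrow> e > 0 \<Longrightarrow> \<exists>j\<in>D. \<forall>x\<in>\<Omega>. dist (\<Phi> i x) (\<Phi> j x) < e"
proof -
 define \<epsilon> where "\<epsilon> k = 1 / real (Suc k)" for k
 have \<epsilon>: "\<epsilon> k > 0" for k by (simp add: \<epsilon>_def)
 obtain Q :: "'b set" where Q: "countable Q" "\<And>X. open X \<Longrightarrow> X \<noteq> {} \<Longrightarrow> \<exists>d\<in>Q. d \<in> X"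
  using countable_dense_exists by metis
 have "\<exists>P. finite P \<and> \<Omega> \<subseteq> (\<Union>p\<in>P. ball p (\<epsilon> n))" for n
 proof -
  have "compact (closure \<Omega>)" using bd by (simp add: compact_closure)
  then have "\<exists>P. finite P \<and> closure \<Omega> \<subseteq> (\<Union>p\<in>P. ball p (\<epsilon> n))"
   using compact_eq_totally_bounded[of "closure \<Omega>"] \<epsilon>[of n] by blast
  then show ?thesis using closure_subset[of \<Omega>] by (meson order_trans)
 qed
 then obtain P where P: "\<And>n. finite (P n)" "\<And>n. \<Omega> \<subseteq> (\<Union>p\<in>P n. ball p (\<epsilon> n))" by metis
 define J where "J n k = {i\<in>I. \<forall>x y. dist x y < \<epsilon> n \<longrightarrow> dist (\<Phi> i x) (\<Phi> i y) < \<epsilon> k}" for n k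
 define near where "near n k \<tau> i \<longleftrightarrow> i \<in> J n k \<and> (\<forall>p\<in>P n. dist (\<Phi> i p) (\<tau> p) < \<epsilon> k)" for n k \<tau> i
 define ch where "ch = (\<lambda>(n, k, \<tau>). SOME i. near n k \<tau> i)"
 define X where "X = Sigma (UNIV::nat set) (\<lambda>n. (UNIV::nat set) \<times> (PiE (P n) (\<lambda>_. Q)))"
 define D where "D = ch ` {w\<in>X. \<exists>i. near (fst w) (fst (snd w)) (snd (snd w)) i}"
 have cX: "countable X" unfolding X_def
  by (rule countable_SIGMA[OF countableI_type], rule countable_SIGMA[OF countableI_type], rule countable_PiE[OF P(1)]) (rule Q(1))
 have cD: "countable D" unfolding D_def by (rule countable_image, rule countable_subset[OF _ cX]) blast
 have near_ch: "near n k \<tau> (ch (n, k, \<tau>))" if "near n k \<tau> i" for n k \<tau> i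
  using someI[of "near n k \<tau>", OF that] unfolding ch_def by simp
 show thesis
 proof (rule that[OF cD])
  show "D \<subseteq> I"
  proof
   fix j assume "j \<in> D"
   then obtain n k \<tau> i where "near n k \<tau> i" "j = ch (n, k, \<tau>)" unfolding D_def by auto
   then show "j \<in> I" using near_ch[of n k \<tau> i] by (simp add: near_def J_def)
  qed
  fix i and e :: real assume i: "i \<in> I" and e: "e > 0"
  obtain k where k: "\<epsilon> k < e / 4" using reals_Archimedean[of "e / 4"] e by (auto simp: \<epsilon>_def inverse_eq_divide)
  obtain d where d: "d > 0" "\<And>x y. dist x y < d \<Longrightarrow> dist (\<Phi> i x) (\<Phi> i y) < \<epsilon> k" using uc[OF i \<epsilon>[of k]] by blast
  obtain n where n: "\<epsilon> n < d" using reals_Archimedean[of d] d by (auto simp: \<epsilon>_def inverse_eq_divide)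
  have iJ: "i \<in> J n k" using i d(2) n by (auto simp: J_def)
  have "\<forall>p. \<exists>q\<in>Q. q \<in> ball (\<Phi> i p) (\<epsilon> k)" using Q(2)[of "ball _ (\<epsilon> k)"] \<epsilon>[of k] by simp
  then have "\<forall>p. \<exists>q. q \<in> Q \<and> dist (\<Phi> i p) q < \<epsilon> k" unfolding mem_ball by blast
  then obtain q where q: "\<And>p. q p \<in> Q" "\<And>p. dist (\<Phi> i p) (q p) < \<epsilon> k" by metis
  define \<tau> where "\<tau> = restrict q (P n)"
  have ni: "near n k \<tau> i" using iJ q(2) by (simp add: near_def \<tau>_def)
  have "(n, k, \<tau>) \<in> X" using q(1) by (simp add: X_def \<tau>_def)
  then have jD: "ch (n, k, \<tau>) \<in> D" unfolding D_def using ni by (intro imageI) auto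
  let ?j = "ch (n, k, \<tau>)"
  have nj: "near n k \<tau> ?j" by (rule near_ch[OF ni])
  have "dist (\<Phi> i x) (\<Phi> ?j x) < e" if x: "x \<in> \<Omega>" for x
  proof -
   obtain p where p: "p \<in> P n" "dist p x < \<epsilon> n" using P(2)[of n] x by auto
   have "dist (\<Phi> i p) (\<Phi> i x) < \<epsilon> k" "dist (\<Phi> ?j p) (\<Phi> ?j x) < \<epsilon> k" "dist (\<Phi> i p) (\<tau> p) < \<epsilon> k" "dist (\<Phi> ?j p) (\<tau> p) < \<epsilon> k"
    using ni nj p unfolding near_def J_def by auto
   then show ?thesis using k dist_triangle[of "\<Phi> i x" "\<Phi> ?j x" "\<Phi> i p"] dist_triangle[of "\<Phi> i p" "\<Phi> ?j x" "\<Phi> ?j p"]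
     dist_triangle[of "\<Phi> i p" "\<Phi> ?j p" "\<tau> p"] by (simp add: dist_commute)
  qed
  then show "\<exists>j\<in>D. \<forall>x\<in>\<Omega>. dist (\<Phi> i x) (\<Phi> j x) < e" using jD by blast
 qed
qed

text \<open>
 The pairing of a function and its gradient with a density \<open>B\<close> and a field \<open>A\<close>. It vanishes on all test
 functions iff \<open>B = div A\<close> in the sense of distributions.
\<close>

definition Lam :: "('a::euclidean_space \<Rightarrow> real) \<Rightarrow> ('a \<Rightarrow> 'a) \<Rightarrow> ('a \<Rightarrow> real) \<Rightarrow> ('a \<Rightarrow> 'a) \<Rightarrow> real" where
 "Lam B A f f' = (LBINT x. B x * f x + A x \<bullet> f' x)"

lemma integrable_inner_bounded:
 fixes A g :: "'b \<Rightarrow> 'c::euclidean_space"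
 assumes A: "integrable M A" and [measurable]: "g \<in> borel_measurable M" and B: "\<And>x. norm (g x) \<le> B"
 shows "integrable M (\<lambda>x. A x \<bullet> g x)"
proof (rule integrable_dominated)
 show "integrable M (\<lambda>x. B * norm (A x))" using A by auto
 have [measurable]: "A \<in> borel_measurable M" using A by auto
 show "(\<lambda>x. A x \<bullet> g x) \<in> borel_measurable M" by measurable
 have "norm (A x \<bullet> g x) \<le> norm (B * norm (A x))" for x
 proof -
  have "norm (A x \<bullet> g x) \<le> norm (A x) * norm (g x)" by (simp add: Cauchy_Schwarz_ineq2)
  also have "\<dots> \<le> norm (A x) * B" using B by (simp add: mult_left_mono)
  also have "\<dots> \<le> norm (B * norm (A x))" by (metis abs_ge_self mult.commute real_norm_def)
  finally show ?thesis .
 qed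
 then show "AE x in M. norm (A x \<bullet> g x) \<le> norm (B * norm (A x))" by simp
qed

lemma Lam_integrable_C1c:
 fixes B :: "'a::euclidean_space \<Rightarrow> real"
 assumes "integrable lborel B" "integrable lborel A" "C1c K f f'"
 shows "integrable lborel (\<lambda>x. B x * f x + A x \<bullet> f' x)"
proof -
 note f = assms(3)
 have m: "f \<in> borel_measurable lborel" "f' \<in> borel_measurable lborel"
  using C1cD(3,5)[OF f] by (auto intro: borel_measurable_continuous_onI)
 obtain C where C: "\<And>x. norm (f x) \<le> C" using bounded_continuous_compact_support[OF C1cD(5,1,4)[OF f]] by metis
 obtain C' where C': "\<And>x. norm (f' x) \<le> C'"
  using bounded_continuous_compact_support[OF C1cD(3,1)[OF f] C1c_grad_outside[OF f]] by metis
 show ?thesis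
  using integrable_mult_bounded[OF assms(1) m(1) C] integrable_inner_bounded[OF assms(2) m(2) C']
  by (auto intro: Bochner_Integration.integrable_add)
qed

lemma Lam_close:
 fixes B :: "'a::euclidean_space \<Rightarrow> real"
 assumes B: "integrable lborel B" and A: "integrable lborel A" and f: "C1c K f f'" and g: "C1c L g g'"
  and c: "\<And>x. \<bar>f x - g x\<bar> \<le> e" "\<And>x. norm (f' x - g' x) \<le> e"
 shows "\<bar>Lam B A f f' - Lam B A g g'\<bar> \<le> e * (LBINT x. \<bar>B x\<bar> + norm (A x))"
proof -
 have eq: "Lam B A f f' - Lam B A g g' = (LBINT x. (B x * f x + A x \<bullet> f' x) - (B x * g x + A x \<bullet> g' x))"
  unfolding Lam_def using Lam_integrable_C1c[OF B A f] Lam_integrable_C1c[OF B A g]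
  by (rule Bochner_Integration.integral_diff[symmetric])
 have "norm (LBINT x. (B x * f x + A x \<bullet> f' x) - (B x * g x + A x \<bullet> g' x)) \<le> (LBINT x. e * (\<bar>B x\<bar> + norm (A x)))"
 proof (rule Bochner_Integration.integral_norm_bound_integral)
  show "integrable lborel (\<lambda>x. (B x * f x + A x \<bullet> f' x) - (B x * g x + A x \<bullet> g' x))"
   using Lam_integrable_C1c[OF B A f] Lam_integrable_C1c[OF B A g] by (rule Bochner_Integration.integrable_diff)
  show "integrable lborel (\<lambda>x. e * (\<bar>B x\<bar> + norm (A x)))" using A B by auto
  fix x
  have "(B x * f x + A x \<bullet> f' x) - (B x * g x + A x \<bullet> g' x) = B x * (f x - g x) + A x \<bullet> (f' x - g' x)"
   by (simp add: algebra_simps inner_diff_right)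
  moreover have "\<bar>B x * (f x - g x)\<bar> \<le> e * \<bar>B x\<bar>" using mult_left_mono[OF c(1)[of x], of "\<bar>B x\<bar>"] by (simp add: abs_mult mult.commute)
  moreover have "\<bar>A x \<bullet> (f' x - g' x)\<bar> \<le> e * norm (A x)"
   using order_trans[OF Cauchy_Schwarz_ineq2 mult_left_mono[OF c(2)[of x] norm_ge_zero[of "A x"]]] by (simp add: mult.commute)
  ultimately show "norm ((B x * f x + A x \<bullet> f' x) - (B x * g x + A x \<bullet> g' x)) \<le> e * (\<bar>B x\<bar> + norm (A x))"
   by (simp add: distrib_left)
 qed
 then show ?thesis unfolding eq by simp
qed

lemma real_zero_if_le_eps:
 assumes "\<And>e. e > 0 \<Longrightarrow> \<bar>a::real\<bar> \<le> e * C"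
 shows "a = 0"
proof -
 have C: "C \<ge> 0" using assms[of 1] by simp
 have "\<bar>a\<bar> \<le> 0 + e" if e: "e > 0" for e
 proof -
  have "\<bar>a\<bar> \<le> (e / (C + 1)) * C" using assms[of "e / (C + 1)"] C e by simp
  also have "\<dots> = e * (C / (C + 1))" by simp
  also have "\<dots> \<le> e * 1" by (rule mult_left_mono) (use C e in simp_all)
  finally show ?thesis by simp
 qed
 then have "\<bar>a\<bar> \<le> 0" by (rule field_le_epsilon)
 then show ?thesis by simp
qed

lemma Lam_zero_C1c:
 fixes B :: "'a::euclidean_space \<Rightarrow> real"
 assumes B: "integrable lborel B" and A: "integrable lborel A" and \<Omega>: "open \<Omega>"
  and z: "\<And>\<phi>. \<phi> \<in> test_functions \<Omega> \<Longrightarrow> Lam B A \<phi> (grad \<phi>) = 0"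
  and f: "C1c K f f'" "K \<subseteq> \<Omega>"
 shows "Lam B A f f' = 0"
proof (rule real_zero_if_le_eps)
 fix e :: real assume e: "e > 0"
 obtain \<phi> where \<phi>: "\<phi> \<in> test_functions \<Omega>" "\<And>x. \<bar>\<phi> x - f x\<bar> \<le> e" "\<And>x. norm (grad \<phi> x - f' x) \<le> e"
  using C1c_approx_test[OF f \<Omega> e] by metis
 obtain L where L: "C1c L \<phi> (grad \<phi>)" using test_functions_C1c[OF \<phi>(1)] by metis
 show "\<bar>Lam B A f f'\<bar> \<le> e * (LBINT x. \<bar>B x\<bar> + norm (A x))"
  using Lam_close[OF B A L f(1) \<phi>(2,3)] z[OF \<phi>(1)] by simp
qed

lemma test_functions_countable_dense:
 fixes \<Omega> :: "'a::euclidean_space set"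
 assumes "bounded \<Omega>"
 obtains D where "countable D" "D \<subseteq> test_functions \<Omega>"
  "\<And>\<phi> e. \<phi> \<in> test_functions \<Omega> \<Longrightarrow> e > 0 \<Longrightarrow> \<exists>\<psi>\<in>D. \<forall>x. \<bar>\<phi> x - \<psi> x\<bar> \<le> e \<and> norm (grad \<phi> x - grad \<psi> x) \<le> e"
proof -
 have "\<exists>d>0. \<forall>x y. dist x y < d \<longrightarrow> dist (\<phi> x, grad \<phi> x) (\<phi> y, grad \<phi> y) < e"
  if \<phi>: "\<phi> \<in> test_functions \<Omega>" and e: "e > 0" for \<phi> and e :: real
 proof -
  obtain K where K: "C1c K \<phi> (grad \<phi>)" using test_functions_C1c[OF \<phi>] by metis
  have c: "continuous_on UNIV (\<lambda>x. (\<phi> x, grad \<phi> x))" using C1cD(3,5)[OF K] by (rule continuous_on_Pair[rotated])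
  have z: "(\<phi> x, grad \<phi> x) = 0" if "x \<notin> K" for x
   using C1cD(4)[OF K that] C1c_grad_outside[OF K that] by (simp add: zero_prod_def)
  obtain d where "d > 0" "\<And>x y. dist x y < d \<Longrightarrow> norm ((\<phi> x, grad \<phi> x) - (\<phi> y, grad \<phi> y)) < e"
   using uniformly_continuous_compact_support[OF c C1cD(1)[OF K] z e] by metis
  then show ?thesis unfolding dist_norm by blast
 qed
 then obtain D where D: "countable D" "D \<subseteq> test_functions \<Omega>"
  "\<And>\<phi> e. \<phi> \<in> test_functions \<Omega> \<Longrightarrow> e > 0 \<Longrightarrow> \<exists>\<psi>\<in>D. \<forall>x\<in>\<Omega>. dist (\<phi> x, grad \<phi> x) (\<psi> x, grad \<psi> x) < e"
  using countable_uniformly_dense_subfamily[OF assms, of "test_functions \<Omega>" "\<lambda>\<phi> x. (\<phi> x, grad \<phi> x)"] by metis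
 show thesis
 proof (rule that[OF D(1,2)])
  fix \<phi> and e :: real assume \<phi>: "\<phi> \<in> test_functions \<Omega>" and e: "e > 0"
  obtain \<psi> where \<psi>: "\<psi> \<in> D" "\<And>x. x \<in> \<Omega> \<Longrightarrow> dist (\<phi> x, grad \<phi> x) (\<psi> x, grad \<psi> x) < e" using D(3)[OF \<phi> e] by blast
  have z: "\<eta> x = 0 \<and> grad \<eta> x = 0" if \<eta>: "\<eta> \<in> test_functions \<Omega>" and x: "x \<notin> \<Omega>" for \<eta> x
  proof -
   obtain K where K: "K \<subseteq> \<Omega>" "C1c K \<eta> (grad \<eta>)" using test_functions_C1c[OF \<eta>] by metis
   then have "x \<notin> K" using x by blast
   then show ?thesis using C1cD(4)[OF K(2)] C1c_grad_outside[OF K(2)] by blast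
  qed
  have "\<bar>\<phi> x - \<psi> x\<bar> \<le> e \<and> norm (grad \<phi> x - grad \<psi> x) \<le> e" for x
  proof (cases "x \<in> \<Omega>")
   case True
   have "dist (\<phi> x) (\<psi> x) \<le> dist (\<phi> x, grad \<phi> x) (\<psi> x, grad \<psi> x)"
    "dist (grad \<phi> x) (grad \<psi> x) \<le> dist (\<phi> x, grad \<phi> x) (\<psi> x, grad \<psi> x)"
    using dist_fst_le[of "(\<phi> x, grad \<phi> x)" "(\<psi> x, grad \<psi> x)"] dist_snd_le[of "(\<phi> x, grad \<phi> x)" "(\<psi> x, grad \<psi> x)"] by simp_all
   then show ?thesis using \<psi>(2)[OF True] by (simp add: dist_norm)
  next
   case False
   have "\<psi> \<in> test_functions \<Omega>" using D(2) \<psi>(1) by blast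
   then show ?thesis using z[OF \<phi> False] z[of \<psi>, OF _ False] e by simp
  qed
  then show "\<exists>\<psi>\<in>D. \<forall>x. \<bar>\<phi> x - \<psi> x\<bar> \<le> e \<and> norm (grad \<phi> x - grad \<psi> x) \<le> e" using \<psi>(1) by blast
 qed
qed

text \<open>
 Separating the variables in the test function reduces the space-time equation to ordinary
 differential equations in time.
\<close>

lemma tensor_test:
 fixes \<phi> :: "'a::euclidean_space \<Rightarrow> real" and \<theta> :: "real \<Rightarrow> real"
 assumes \<phi>: "\<phi> \<in> test_functions \<Omega>" and \<theta>: "\<theta> \<in> test_functions J"
 shows "(\<lambda>z. \<phi> (fst z) * \<theta> (snd z)) \<in> test_functions (\<Omega> \<times> J)"
  and "time_deriv (\<lambda>z. \<phi> (fst z) * \<theta> (snd z)) (x, t) = \<phi> x * frechet_derivative \<theta> (at t) 1"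
  and "space_grad (\<lambda>z. \<phi> (fst z) * \<theta> (snd z)) (x, t) = \<theta> t *\<^sub>R grad \<phi> x"
proof -
 let ?\<gamma> = "\<lambda>z::'a \<times> real. \<phi> (fst z) * \<theta> (snd z)"
 obtain K where K: "compact K" "K \<subseteq> \<Omega>" "\<And>x. x \<notin> K \<Longrightarrow> \<phi> x = 0" "\<And>k. \<phi> \<in> Ck_on k UNIV"
  using \<phi> by (auto elim: test_functionsE)
 obtain L where L: "compact L" "L \<subseteq> J" "\<And>x. x \<notin> L \<Longrightarrow> \<theta> x = 0" "\<And>k. \<theta> \<in> Ck_on k UNIV"
  using \<theta> by (auto elim: test_functionsE)
 have "(\<lambda>z::'a \<times> real. \<phi> (fst z)) \<in> Ck_on k UNIV" "(\<lambda>z::'a \<times> real. \<theta> (snd z)) \<in> Ck_on k UNIV" for k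
  using Ck_on_compose_affine[OF bounded_linear_fst K(4), where c=0] Ck_on_compose_affine[OF bounded_linear_snd L(4), where c=0] by simp_all
 then have "?\<gamma> \<in> Ck_on k UNIV" for k by (intro Ck_on_mult)
 moreover have "K \<times> L \<subseteq> \<Omega> \<times> J" using K L by blast
 moreover have "?\<gamma> z = 0" if "z \<notin> K \<times> L" for z
  using that K(3)[of "fst z"] L(3)[of "snd z"] by (cases z) auto
 ultimately show "?\<gamma> \<in> test_functions (\<Omega> \<times> J)"
  by (intro test_functionsI[where K="K \<times> L"] compact_Times K(1) L(1))
 have "(?\<gamma> has_derivative (\<lambda>h. \<phi> x * frechet_derivative \<theta> (at t) (snd h) + frechet_derivative \<phi> (at x) (fst h) * \<theta> t)) (at (x, t))"
 proof -
  have 1: "((\<lambda>z::'a\<times>real. \<phi> (fst z)) has_derivative (\<lambda>h. frechet_derivative \<phi> (at x) (fst h))) (at (x, t))"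
   using has_derivative_compose[OF bounded_linear.has_derivative[OF bounded_linear_fst has_derivative_ident], of \<phi> _ "(x,t)" UNIV]
    test_functions_has_derivative[OF \<phi>, of x] by simp
  have 2: "((\<lambda>z::'a\<times>real. \<theta> (snd z)) has_derivative (\<lambda>h. frechet_derivative \<theta> (at t) (snd h))) (at (x, t))"
   using has_derivative_compose[OF bounded_linear.has_derivative[OF bounded_linear_snd has_derivative_ident], of \<theta> _ "(x,t)" UNIV]
    test_functions_has_derivative[OF \<theta>, of t] by simp
  show ?thesis using has_derivative_mult[OF 1 2] by simp
 qed
 then have fd: "frechet_derivative ?\<gamma> (at (x, t)) = (\<lambda>h. \<phi> x * frechet_derivative \<theta> (at t) (snd h) + frechet_derivative \<phi> (at x) (fst h) * \<theta> t)"
  by (rule frechet_derivative_at[symmetric])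
 have l: "linear (frechet_derivative \<theta> (at t))" "linear (frechet_derivative \<phi> (at x))"
  by (rule has_derivative_linear[OF test_functions_has_derivative[OF \<theta>]], rule has_derivative_linear[OF test_functions_has_derivative[OF \<phi>]])
 show "time_deriv ?\<gamma> (x, t) = \<phi> x * frechet_derivative \<theta> (at t) 1"
  unfolding time_deriv_def fd using linear_0[OF l(2)] by simp
 show "space_grad ?\<gamma> (x, t) = \<theta> t *\<^sub>R grad \<phi> x"
 proof -
  have "space_grad ?\<gamma> (x, t) = (\<Sum>b\<in>Basis. (frechet_derivative \<phi> (at x) b * \<theta> t) *\<^sub>R b)"
   unfolding space_grad_def fd using linear_0[OF l(1)] by simp
  also have "\<dots> = (\<Sum>b\<in>Basis. \<theta> t *\<^sub>R (frechet_derivative \<phi> (at x) b *\<^sub>R b))"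
   by (rule sum.cong) (simp_all only: scaleR_scaleR mult.commute)
  finally show ?thesis unfolding grad_def scaleR_sum_right .
 qed
qed

section \<open>The equation between two times\<close>

lemma borel_measurable_fst_borel [measurable]:
 "fst \<in> borel_measurable (borel :: ('a::second_countable_topology \<times> 'b::second_countable_topology) measure)"
 by (intro borel_measurable_continuous_onI continuous_intros)

lemma borel_measurable_snd_borel [measurable]:
 "snd \<in> borel_measurable (borel :: ('a::second_countable_topology \<times> 'b::second_countable_topology) measure)"
 by (intro borel_measurable_continuous_onI continuous_intros)

text \<open>
 Test functions \<open>\<phi>(x) \<theta>(t)\<close> turn the equation into the hypothesis of the lemma of du Bois-Reymond.
\<close>

lemma weak_in_time_scalar:
 fixes \<beta> :: "'a::euclidean_space \<times> real \<Rightarrow> real"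
 assumes T: "T > 0" and \<beta>: "integrable lborel \<beta>" and A: "integrable lborel A"
  and eq: "\<And>\<gamma>. \<gamma> \<in> test_functions (cylinder \<Omega> T) \<Longrightarrow> (LBINT z. - \<beta> z * time_deriv \<gamma> z + A z \<bullet> space_grad \<gamma> z) = 0"
  and \<phi>: "\<phi> \<in> test_functions \<Omega>"
 shows "\<exists>c. AE t in lborel. t \<in> {0<..<T} \<longrightarrow>
   (LBINT x. \<beta> (x, t) * \<phi> x) = c - (LBINT r. indicator {0..t} r * (LBINT x. A (x, r) \<bullet> grad \<phi> x))"
proof -
 obtain K where K: "C1c K \<phi> (grad \<phi>)" using test_functions_C1c[OF \<phi>] by metis
 have [measurable]: "\<phi> \<in> borel_measurable borel" "grad \<phi> \<in> borel_measurable borel"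
  using C1cD(3,5)[OF K] by (auto intro: borel_measurable_continuous_onI)
 obtain C where C: "\<And>x. norm (\<phi> x) \<le> C" using bounded_continuous_compact_support[OF C1cD(5,1,4)[OF K]] by metis
 obtain C' where C': "\<And>x. norm (grad \<phi> x) \<le> C'"
  using bounded_continuous_compact_support[OF C1cD(3,1)[OF K] C1c_grad_outside[OF K]] by metis
 have i1: "integrable lborel (\<lambda>z. \<beta> z * \<phi> (fst z))"
  using integrable_mult_bounded[OF \<beta>, of "\<lambda>z. \<phi> (fst z)" C] C by simp
 have i2: "integrable lborel (\<lambda>z. A z \<bullet> grad \<phi> (fst z))"
  using integrable_inner_bounded[OF A, of "\<lambda>z. grad \<phi> (fst z)" C'] C' by simp
 define f where "f t = (LBINT x. \<beta> (x, t) * \<phi> x)" for t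
 define g where "g t = (LBINT x. A (x, t) \<bullet> grad \<phi> x)" for t
 have fi: "integrable lborel f" using lborel_Fubini_snd(2)[OF i1] by (simp add: f_def[abs_def])
 have gi: "integrable lborel g" using lborel_Fubini_snd(2)[OF i2] by (simp add: g_def[abs_def])
 have "(LBINT t. f t * frechet_derivative \<theta> (at t) 1) = (LBINT t. g t * \<theta> t)"
  if \<theta>: "\<theta> \<in> test_functions {0<..<T}" for \<theta>
 proof -
  let ?d = "\<lambda>t. frechet_derivative \<theta> (at t) 1"
  obtain L where L: "compact L" "\<And>x. x \<notin> L \<Longrightarrow> \<theta> x = 0" using \<theta> by (auto elim: test_functionsE)
  have \<theta>c: "continuous_on UNIV \<theta>" "continuous_on UNIV ?d"
   using test_functions_continuous[OF \<theta>] test_functions_frechet_derivative_continuous[OF \<theta>, of 1] by auto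
  have d0: "?d t = 0" if "t \<notin> L" for t
   using frechet_derivative_eq_0_outside[OF compact_imp_closed[OF L(1)] L(2) that] by simp
  have [measurable]: "\<theta> \<in> borel_measurable borel" "?d \<in> borel_measurable borel"
   using \<theta>c by (auto intro: borel_measurable_continuous_onI)
  obtain E where E: "\<And>x. norm (\<theta> x) \<le> E" using bounded_continuous_compact_support[OF \<theta>c(1) L] by metis
  obtain E' where E': "\<And>x. norm (?d x) \<le> E'" using bounded_continuous_compact_support[OF \<theta>c(2) L(1) d0] by metis
  have j1: "integrable lborel (\<lambda>z. (\<beta> z * \<phi> (fst z)) * ?d (snd z))"
   using integrable_mult_bounded[OF i1, of "\<lambda>z. ?d (snd z)" E'] E' by simp
  have j2: "integrable lborel (\<lambda>z. (A z \<bullet> grad \<phi> (fst z)) * \<theta> (snd z))"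
   using integrable_mult_bounded[OF i2, of "\<lambda>z. \<theta> (snd z)" E] E by simp
  have "0 = (LBINT z. (A z \<bullet> grad \<phi> (fst z)) * \<theta> (snd z) - (\<beta> z * \<phi> (fst z)) * ?d (snd z))"
  proof -
   have "(\<lambda>z. - \<beta> z * time_deriv (\<lambda>z. \<phi> (fst z) * \<theta> (snd z)) z + A z \<bullet> space_grad (\<lambda>z. \<phi> (fst z) * \<theta> (snd z)) z)
    = (\<lambda>z. (A z \<bullet> grad \<phi> (fst z)) * \<theta> (snd z) - (\<beta> z * \<phi> (fst z)) * ?d (snd z))"
   proof
    fix z show "- \<beta> z * time_deriv (\<lambda>z. \<phi> (fst z) * \<theta> (snd z)) z + A z \<bullet> space_grad (\<lambda>z. \<phi> (fst z) * \<theta> (snd z)) z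
     = (A z \<bullet> grad \<phi> (fst z)) * \<theta> (snd z) - (\<beta> z * \<phi> (fst z)) * ?d (snd z)"
     by (cases z) (simp add: tensor_test(2,3)[OF \<phi> \<theta>])
   qed
   then show ?thesis using eq[OF tensor_test(1)[OF \<phi> \<theta>]] by simp
  qed
  also have "\<dots> = (LBINT z. (A z \<bullet> grad \<phi> (fst z)) * \<theta> (snd z)) - (LBINT z. (\<beta> z * \<phi> (fst z)) * ?d (snd z))"
   by (rule Bochner_Integration.integral_diff[OF j2 j1])
  also have "(LBINT z. (A z \<bullet> grad \<phi> (fst z)) * \<theta> (snd z)) = (LBINT t. g t * \<theta> t)"
   unfolding lborel_Fubini_snd(3)[OF j2, symmetric] g_def by simp
  also have "(LBINT z. (\<beta> z * \<phi> (fst z)) * ?d (snd z)) = (LBINT t. f t * ?d t)"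
   unfolding lborel_Fubini_snd(3)[OF j1, symmetric] f_def by simp
  finally show ?thesis by simp
 qed
 from du_Bois_Reymond[OF T fi gi this] show ?thesis unfolding f_def g_def .
qed

text \<open>
 For a fixed spatial test function the equation is solved in time by the lemma of du Bois-Reymond,
 but with an exceptional set depending on that function. A countable dense family gives a common null
 set, and both sides are continuous with respect to uniform convergence of function and gradient.
\<close>

theorem weak_in_time:
 fixes \<beta> :: "'a::euclidean_space \<times> real \<Rightarrow> real"
 assumes T: "T > 0" and \<beta>: "integrable lborel \<beta>" and A: "integrable lborel A" and bd: "bounded \<Omega>"
  and eq: "\<And>\<gamma>. \<gamma> \<in> test_functions (cylinder \<Omega> T) \<Longrightarrow> (LBINT z. - \<beta> z * time_deriv \<gamma> z + A z \<bullet> space_grad \<gamma> z) = 0"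
 obtains N where "N \<in> null_sets lborel" "\<And>t. t \<notin> N \<Longrightarrow> integrable lborel (\<lambda>x. \<beta> (x, t))"
  "\<And>t1 t2 \<phi>. 0 < t1 \<Longrightarrow> t1 < t2 \<Longrightarrow> t2 < T \<Longrightarrow> t1 \<notin> N \<Longrightarrow> t2 \<notin> N \<Longrightarrow> \<phi> \<in> test_functions \<Omega> \<Longrightarrow>
    Lam (\<lambda>x. \<beta> (x, t2) - \<beta> (x, t1)) (\<lambda>x. LBINT r. indicator {t1..t2} r *\<^sub>R A (x, r)) \<phi> (grad \<phi>) = 0"
proof -
 obtain D where D: "countable D" "D \<subseteq> test_functions \<Omega>"
  "\<And>\<phi> e. \<phi> \<in> test_functions \<Omega> \<Longrightarrow> e > 0 \<Longrightarrow> \<exists>\<psi>\<in>D. \<forall>x. \<bar>\<phi> x - \<psi> x\<bar> \<le> e \<and> norm (grad \<phi> x - grad \<psi> x) \<le> e"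
  using test_functions_countable_dense[OF bd] by metis
 define g where "g \<phi> r = (LBINT x. A (x, r) \<bullet> grad \<phi> x)" for \<phi> r
 have "\<forall>\<phi>\<in>D. \<exists>c. AE t in lborel. t \<in> {0<..<T} \<longrightarrow> (LBINT x. \<beta> (x, t) * \<phi> x) = c - (LBINT r. indicator {0..t} r * g \<phi> r)"
 proof
  fix \<phi> assume "\<phi> \<in> D"
  then have "\<phi> \<in> test_functions \<Omega>" using D(2) by blast
  from weak_in_time_scalar[OF T \<beta> A eq this]
  show "\<exists>c. AE t in lborel. t \<in> {0<..<T} \<longrightarrow> (LBINT x. \<beta> (x, t) * \<phi> x) = c - (LBINT r. indicator {0..t} r * g \<phi> r)"
   unfolding g_def .
 qed
 from bchoice[OF this] obtain c where c: "\<And>\<phi>. \<phi> \<in> D \<Longrightarrow> AE t in lborel. t \<in> {0<..<T} \<longrightarrow> (LBINT x. \<beta> (x, t) * \<phi> x) = c \<phi> - (LBINT r. indicator {0..t} r * g \<phi> r)"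
  by blast
 define P where "P t \<longleftrightarrow> integrable lborel (\<lambda>x. \<beta> (x, t)) \<and>
  (\<forall>\<phi>\<in>D. t \<in> {0<..<T} \<longrightarrow> (LBINT x. \<beta> (x, t) * \<phi> x) = c \<phi> - (LBINT r. indicator {0..t} r * g \<phi> r))" for t
 have "AE t in lborel. \<forall>\<phi>\<in>D. t \<in> {0<..<T} \<longrightarrow> (LBINT x. \<beta> (x, t) * \<phi> x) = c \<phi> - (LBINT r. indicator {0..t} r * g \<phi> r)"
  unfolding AE_ball_countable[OF D(1)] using c by blast
 then have "AE t in lborel. P t" using lborel_Fubini_snd(1)[OF \<beta>]
  by eventually_elim (simp add: P_def)
 then obtain N where N: "N \<in> null_sets lborel" "\<And>t. t \<notin> N \<Longrightarrow> P t"
  unfolding eventually_ae_filter by auto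
 show thesis
 proof (rule that[OF N(1)])
  show "integrable lborel (\<lambda>x. \<beta> (x, t))" if "t \<notin> N" for t using N(2)[OF that] by (simp add: P_def)
  fix t1 t2 \<phi> assume t: "0 < t1" "t1 < t2" "t2 < T" "t1 \<notin> N" "t2 \<notin> N" and \<phi>: "\<phi> \<in> test_functions \<Omega>"
  let ?B = "\<lambda>x. \<beta> (x, t2) - \<beta> (x, t1)"
  let ?A = "\<lambda>x. LBINT r. indicator {t1..t2} r *\<^sub>R A (x, r)"
  have b1: "integrable lborel (\<lambda>x. \<beta> (x, t1))" and b2: "integrable lborel (\<lambda>x. \<beta> (x, t2))"
   using N(2)[OF t(4)] N(2)[OF t(5)] by (simp_all add: P_def)
  have Bi: "integrable lborel ?B" using b1 b2 by auto
  have Aind: "integrable lborel (\<lambda>z. indicator {t1..t2} (snd z) *\<^sub>R A z)"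
  proof -
   have "integrable lborel (\<lambda>z. indicator (UNIV \<times> {t1..t2}) z *\<^sub>R A z)"
    by (rule integrable_mult_indicator) (use A in \<open>auto intro: borel_closed closed_Times\<close>)
   moreover have "(\<lambda>z. indicator (UNIV \<times> {t1..t2}) z *\<^sub>R A z) = (\<lambda>z. indicator {t1..t2} (snd z) *\<^sub>R A z)"
    by (auto simp: indicator_def fun_eq_iff)
   ultimately show ?thesis by simp
  qed
  have Ai: "integrable lborel ?A" using lborel_Fubini_fst(2)[OF Aind] by simp
  have zeroD: "Lam ?B ?A \<psi> (grad \<psi>) = 0" if \<psi>: "\<psi> \<in> D" for \<psi>
  proof -
   have \<psi>t: "\<psi> \<in> test_functions \<Omega>" using D(2) \<psi> by blast
   obtain K where K: "C1c K \<psi> (grad \<psi>)" using test_functions_C1c[OF \<psi>t] by metis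
   have [measurable]: "\<psi> \<in> borel_measurable borel" "grad \<psi> \<in> borel_measurable borel"
    using C1cD(3,5)[OF K] by (auto intro: borel_measurable_continuous_onI)
   obtain C where C: "\<And>x. norm (\<psi> x) \<le> C" using bounded_continuous_compact_support[OF C1cD(5,1,4)[OF K]] by metis
   obtain C' where C': "\<And>x. norm (grad \<psi> x) \<le> C'"
    using bounded_continuous_compact_support[OF C1cD(3,1)[OF K] C1c_grad_outside[OF K]] by metis
   have s1: "integrable lborel (\<lambda>x. \<beta> (x, t1) * \<psi> x)" using integrable_mult_bounded[OF b1 _ C] by simp
   have s2: "integrable lborel (\<lambda>x. \<beta> (x, t2) * \<psi> x)" using integrable_mult_bounded[OF b2 _ C] by simp
   have s3: "integrable lborel (\<lambda>x. ?A x \<bullet> grad \<psi> x)" using integrable_inner_bounded[OF Ai _ C'] by simp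
   have gi: "integrable lborel (g \<psi>)"
   proof -
    have "integrable lborel (\<lambda>z. A z \<bullet> grad \<psi> (fst z))"
     using integrable_inner_bounded[OF A, of "\<lambda>z. grad \<psi> (fst z)" C'] C' by simp
    from lborel_Fubini_snd(2)[OF this] show ?thesis by (simp add: g_def[abs_def])
   qed
   have gI: "integrable lborel (\<lambda>r. indicator S r * g \<psi> r)" if "S \<in> sets borel" for S
    using integrable_mult_indicator[of S lborel "g \<psi>"] gi that by simp
   have swap: "(LBINT x. ?A x \<bullet> grad \<psi> x) = (LBINT r. indicator {t1..t2} r * g \<psi> r)"
   proof -
    have i: "integrable lborel (\<lambda>z. (indicator {t1..t2} (snd z) *\<^sub>R A z) \<bullet> grad \<psi> (fst z))"
     using integrable_inner_bounded[OF Aind, of "\<lambda>z. grad \<psi> (fst z)" C'] C' by simp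
    have "(LBINT x. ?A x \<bullet> grad \<psi> x) = (LBINT x. LBINT r. (indicator {t1..t2} r *\<^sub>R A (x, r)) \<bullet> grad \<psi> x)"
    proof (rule integral_cong_AE)
     show "AE x in lborel. ?A x \<bullet> grad \<psi> x = (LBINT r. (indicator {t1..t2} r *\<^sub>R A (x, r)) \<bullet> grad \<psi> x)"
      using lborel_Fubini_fst(1)[OF Aind]
     proof eventually_elim
      case (elim x)
      then have "integrable lborel (\<lambda>r. indicator {t1..t2} r *\<^sub>R A (x, r))" by simp
      from integral_inner_left[OF this] show ?case by simp
     qed
     show "(\<lambda>x. LBINT r. (indicator {t1..t2} r *\<^sub>R A (x, r)) \<bullet> grad \<psi> x) \<in> borel_measurable lborel"
      using lborel_Fubini_fst(2)[OF i] by auto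
    qed (use s3 in auto)
    also have "\<dots> = (LBINT z. (indicator {t1..t2} (snd z) *\<^sub>R A z) \<bullet> grad \<psi> (fst z))"
     using lborel_Fubini_fst(3)[OF i] by simp
    also have "\<dots> = (LBINT r. LBINT x. (indicator {t1..t2} r *\<^sub>R A (x, r)) \<bullet> grad \<psi> x)"
     using lborel_Fubini_snd(3)[OF i] by simp
    also have "\<dots> = (LBINT r. indicator {t1..t2} r * g \<psi> r)"
     unfolding g_def by simp
    finally show ?thesis .
   qed
   have "(LBINT r. indicator {t1..t2} r * g \<psi> r) = (LBINT r. indicator {0..t2} r * g \<psi> r - indicator {0..t1} r * g \<psi> r)"
   proof (rule integral_cong_AE)
    have "AE r in lborel. r \<noteq> t1" by (rule AE_lborel_singleton)
    then show "AE r in lborel. indicator {t1..t2} r * g \<psi> r = indicator {0..t2} r * g \<psi> r - indicator {0..t1} r * g \<psi> r"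
     by eventually_elim (use t in \<open>auto simp: indicator_def\<close>)
    show "(\<lambda>r. indicator {t1..t2} r * g \<psi> r) \<in> borel_measurable lborel"
     using gI by auto
    show "(\<lambda>r. indicator {0..t2} r * g \<psi> r - indicator {0..t1} r * g \<psi> r) \<in> borel_measurable lborel"
     using gI[of "{0..t2}"] gI[of "{0..t1}"] by auto
   qed
   also have "\<dots> = (LBINT r. indicator {0..t2} r * g \<psi> r) - (LBINT r. indicator {0..t1} r * g \<psi> r)"
    by (rule Bochner_Integration.integral_diff) (use gI in auto)
   also have "\<dots> = (LBINT x. \<beta> (x, t1) * \<psi> x) - (LBINT x. \<beta> (x, t2) * \<psi> x)"
    using N(2)[OF t(4)] N(2)[OF t(5)] \<psi> t by (simp add: P_def)
   finally have key: "(LBINT x. ?A x \<bullet> grad \<psi> x) = (LBINT x. \<beta> (x, t1) * \<psi> x) - (LBINT x. \<beta> (x, t2) * \<psi> x)"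
    using swap by simp
   have "Lam ?B ?A \<psi> (grad \<psi>) = (LBINT x. (\<beta> (x, t2) * \<psi> x - \<beta> (x, t1) * \<psi> x) + ?A x \<bullet> grad \<psi> x)"
    unfolding Lam_def by (simp add: left_diff_distrib)
   also have "\<dots> = (LBINT x. \<beta> (x, t2) * \<psi> x - \<beta> (x, t1) * \<psi> x) + (LBINT x. ?A x \<bullet> grad \<psi> x)"
    by (rule Bochner_Integration.integral_add[OF Bochner_Integration.integrable_diff[OF s2 s1] s3])
   also have "\<dots> = 0" unfolding key Bochner_Integration.integral_diff[OF s2 s1] by simp
   finally show ?thesis .
  qed
  obtain K where K: "C1c K \<phi> (grad \<phi>)" using test_functions_C1c[OF \<phi>] by metis
  show "Lam ?B ?A \<phi> (grad \<phi>) = 0"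
  proof (rule real_zero_if_le_eps)
   fix e :: real assume "e > 0"
   then obtain \<psi> where \<psi>: "\<psi> \<in> D" "\<And>x. \<bar>\<phi> x - \<psi> x\<bar> \<le> e" "\<And>x. norm (grad \<phi> x - grad \<psi> x) \<le> e" using D(3)[OF \<phi>] by blast
   have "\<psi> \<in> test_functions \<Omega>" using D(2) \<psi>(1) by blast
   then obtain L where L: "C1c L \<psi> (grad \<psi>)" using test_functions_C1c by metis
   show "\<bar>Lam ?B ?A \<phi> (grad \<phi>)\<bar> \<le> e * (LBINT x. \<bar>?B x\<bar> + norm (?A x))"
    using Lam_close[OF Bi Ai K L \<psi>(2,3)] zeroD[OF \<psi>(1)] by simp
  qed
 qed
qed

section \<open>A chain rule for first-order functionals\<close>

text \<open>
 The weight \<open>\<eta>\<close> allows absorbing the first term; the exponent \<open>p/(p - 1)\<close> is the one of the flux.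
\<close>

lemma young_powr:
 fixes a d :: real
 assumes p: "p > 1" and \<eta>: "\<eta> > 0" and a: "a \<ge> 0" and d: "d \<ge> 0"
 shows "a * d \<le> \<eta> * a powr (p / (p - 1)) + \<eta> powr (1 - p) * d powr p"
proof -
 define m where "m = a powr (1 / (p - 1))"
 have m: "m \<ge> 0" by (simp add: m_def)
 have am: "a = m powr (p - 1)" using p a by (simp add: m_def powr_powr)
 have mp: "a powr (p / (p - 1)) = m powr p" using p by (simp add: m_def powr_powr)
 have mul: "y powr (p - 1) * y = y powr p" if "y \<ge> 0" for y :: real
  using that powr_mult_base[of y "p - 1"] by (simp add: mult.commute)
 have nn: "0 \<le> \<eta> * a powr (p / (p - 1))" "0 \<le> \<eta> powr (1 - p) * d powr p" using \<eta> by auto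
 show ?thesis
 proof (cases "d \<le> \<eta> * m")
  case True
  have "a * d \<le> a * (\<eta> * m)" using True a by (rule mult_left_mono)
  also have "\<dots> = \<eta> * (m powr (p - 1) * m)" by (subst am) simp
  also have "\<dots> = \<eta> * a powr (p / (p - 1))" using mul[OF m] mp by simp
  finally show ?thesis using nn by linarith
 next
  case False
  then have "m \<le> d / \<eta>" using \<eta> by (simp add: field_simps)
  then have "m powr (p - 1) \<le> (d / \<eta>) powr (p - 1)" using m p by (intro powr_mono2) auto
  then have "a * d \<le> (d / \<eta>) powr (p - 1) * d" using d am by (metis mult_right_mono)
  also have "\<dots> = \<eta> powr (1 - p) * (d powr (p - 1) * d)"
   using d \<eta> by (simp add: powr_divide powr_minus_divide[of \<eta> "p - 1", simplified])
  also have "\<dots> = \<eta> powr (1 - p) * d powr p" using mul[OF d] by simp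
  finally show ?thesis using nn by linarith
 qed
qed

lemma powr_tendsto_0D:
 assumes "(\<lambda>k. \<bar>y k :: real\<bar> powr p) \<longlonglongrightarrow> 0" "p > 0"
 shows "y \<longlonglongrightarrow> 0"
proof -
 have "(\<lambda>k. (\<bar>y k\<bar> powr p) powr (1 / p)) \<longlonglongrightarrow> 0 powr (1 / p)"
  by (rule tendsto_powr'[OF assms(1) tendsto_const]) (use assms(2) in auto)
 then have "(\<lambda>k. \<bar>y k\<bar>) \<longlonglongrightarrow> 0" using assms(2) by (simp add: powr_powr)
 then show ?thesis by (rule tendsto_rabs_zero_cancel)
qed

text \<open>
 The equation \<open>B = div A\<close> may be tested with \<open>H(f)\<close> when \<open>f\<close> has boundary values \<open>g \<le> c0\<close> and \<open>H\<close> vanishes on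
 \<open>(-\<infinity>, c0]\<close>. Indeed \<open>f\<close> is approximated by \<open>\<phi> k + g\<close>; the function \<open>H(\<phi> k + g)\<close> vanishes wherever \<open>\<phi> k\<close> does,
 so it is a compactly supported \<open>C\<^sup>1\<close> function. In the limit the term with \<open>A\<close> is controlled by the duality of the
 exponents \<open>p\<close> and \<open>p/(p - 1)\<close>, and the bounded factors by dominated convergence. Without the bound on \<open>H\<close>
 the density \<open>B\<close>, which is only integrable, could not be handled.
\<close>

theorem Lam_zero_chain:
 fixes B :: "'a::euclidean_space \<Rightarrow> real"
 assumes p: "p > 1" and \<Omega>: "open \<Omega>"
  and B: "integrable lborel B" and A: "integrable lborel A" and Ap: "integrable lborel (\<lambda>x. norm (A x) powr (p / (p - 1)))"
  and z: "\<And>\<phi>. \<phi> \<in> test_functions \<Omega> \<Longrightarrow> Lam B A \<phi> (grad \<phi>) = 0"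
  and g: "\<And>x. x \<in> \<Omega> \<Longrightarrow> (g has_derivative (\<lambda>h. g' x \<bullet> h)) (at x)" "continuous_on \<Omega> g'" "\<And>x. x \<in> \<Omega> \<Longrightarrow> g x \<le> c0"
  and \<phi>: "\<And>k::nat. \<phi> k \<in> test_functions \<Omega>"
  and f[measurable]: "f \<in> borel_measurable borel" and G[measurable]: "G \<in> borel_measurable borel"
  and Gp: "integrable lborel (\<lambda>x. indicator \<Omega> x * norm (G x) powr p)"
  and i1: "\<And>k. integrable lborel (\<lambda>x. indicator \<Omega> x * \<bar>\<phi> k x + g x - f x\<bar> powr p)"
  and l1: "(\<lambda>k. LBINT x. indicator \<Omega> x * \<bar>\<phi> k x + g x - f x\<bar> powr p) \<longlonglongrightarrow> 0"
  and i2: "\<And>k. integrable lborel (\<lambda>x. indicator \<Omega> x * norm (grad (\<phi> k) x + g' x - G x) powr p)"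
  and l2: "(\<lambda>k. LBINT x. indicator \<Omega> x * norm (grad (\<phi> k) x + g' x - G x) powr p) \<longlonglongrightarrow> 0"
  and H: "\<And>y. (H has_real_derivative H' y) (at y)" "continuous_on UNIV H'" "\<And>y. y \<le> c0 \<Longrightarrow> H y = 0"
   "\<And>y. \<bar>H y\<bar> \<le> 1" "\<And>y. \<bar>H' y\<bar> \<le> M"
 shows "Lam B A (\<lambda>x. if x \<in> \<Omega> then H (f x) else 0) (\<lambda>x. if x \<in> \<Omega> then H' (f x) *\<^sub>R G x else 0) = 0"
proof -
 have M: "M \<ge> 0" using H(5)[of 0] by linarith
 have [measurable]: "\<Omega> \<in> sets borel" using \<Omega> by auto
 have [measurable]: "B \<in> borel_measurable borel" "A \<in> borel_measurable borel" using A B by auto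
 have Hc: "continuous_on UNIV H" using H(1) DERIV_isCont continuous_at_imp_continuous_on by blast
 have Hm[measurable]: "H \<in> borel_measurable borel" "H' \<in> borel_measurable borel"
  using Hc H(2) by (auto intro: borel_measurable_continuous_onI)
 have gc: "continuous_on \<Omega> g"
  by (rule continuous_at_imp_continuous_on) (use has_derivative_continuous[OF g(1)] in simp)
 \<comment> \<open>Admissible test functions that converge to the desired one.\<close>
 define hk where "hk k x = (if x \<in> \<Omega> then H (\<phi> k x + g x) else 0)" for k x
 define hk' where "hk' k x = (if x \<in> \<Omega> then H' (\<phi> k x + g x) *\<^sub>R (grad (\<phi> k) x + g' x) else 0)" for k x
 have m\<phi>[measurable]: "\<phi> k \<in> borel_measurable borel" "grad (\<phi> k) \<in> borel_measurable borel" for k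
 proof -
  obtain K where K: "C1c K (\<phi> k) (grad (\<phi> k))" using test_functions_C1c[OF \<phi>] by metis
  show "\<phi> k \<in> borel_measurable borel" "grad (\<phi> k) \<in> borel_measurable borel"
   using C1cD(3,5)[OF K] by (auto intro: borel_measurable_continuous_onI)
 qed
 have C: "\<exists>K\<subseteq>\<Omega>. C1c K (hk k) (hk' k)" for k
 proof -
  obtain K where K: "K \<subseteq> \<Omega>" "C1c K (\<phi> k) (grad (\<phi> k))" using test_functions_C1c[OF \<phi>] by metis
  have cK: "open (- K)" using compact_imp_closed[OF C1cD(1)[OF K(2)]] by auto
  have out: "hk k x = 0" if "x \<notin> K" for x
   using C1cD(4)[OF K(2) that] H(3)[of "g x"] g(3)[of x] by (simp add: hk_def)
  have derin: "(hk k has_derivative (\<lambda>h. hk' k x \<bullet> h)) (at x)" if x: "x \<in> \<Omega>" for x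
  proof -
   have 1: "((\<lambda>x. \<phi> k x + g x) has_derivative (\<lambda>h. (grad (\<phi> k) x + g' x) \<bullet> h)) (at x)"
    using has_derivative_add[OF C1cD(2)[OF K(2)] g(1)[OF x]] by (simp add: inner_add_left)
   have "((\<lambda>x. H (\<phi> k x + g x)) has_derivative (\<lambda>h. H' (\<phi> k x + g x) * ((grad (\<phi> k) x + g' x) \<bullet> h))) (at x)"
    using has_derivative_compose[OF 1 H(1)[of "\<phi> k x + g x", unfolded has_field_derivative_def]] by simp
   then have "((\<lambda>x. H (\<phi> k x + g x)) has_derivative (\<lambda>h. hk' k x \<bullet> h)) (at x)"
    using x by (simp add: hk'_def)
   then show ?thesis
    by (rule has_derivative_transform_within_open[where s=\<Omega>]) (use \<Omega> x in \<open>auto simp: hk_def\<close>)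
  qed
  have hk'out: "hk' k x = 0" if x: "x \<notin> K" for x
  proof (cases "x \<in> \<Omega>")
   case True
   have "(hk k has_derivative (\<lambda>_. 0)) (at x)"
    by (rule has_derivative_transform_within_open[where f="\<lambda>_. 0" and s="- K"]) (use cK x out in auto)
   from has_derivative_unique[OF derin[OF True] this] have "hk' k x \<bullet> hk' k x = 0" by (rule fun_cong)
   then show ?thesis by simp
  qed (simp add: hk'_def)
  have der: "(hk k has_derivative (\<lambda>h. hk' k x \<bullet> h)) (at x)" for x
  proof (cases "x \<in> \<Omega>")
   case False
   then have "x \<notin> K" using K by blast
   have "(hk k has_derivative (\<lambda>_. 0)) (at x)"
    by (rule has_derivative_transform_within_open[where f="\<lambda>_. 0" and s="- K"]) (use cK \<open>x \<notin> K\<close> out in auto)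
   then show ?thesis using hk'out[OF \<open>x \<notin> K\<close>] by simp
  qed (rule derin)
  have "continuous_on \<Omega> (\<lambda>x. H' (\<phi> k x + g x) *\<^sub>R (grad (\<phi> k) x + g' x))"
   by (intro continuous_on_scaleR continuous_on_add g(2) gc continuous_on_compose2[OF H(2)]
     continuous_on_subset[OF C1cD(3)[OF K(2)]] continuous_on_subset[OF C1cD(5)[OF K(2)]]) auto
  then have c1: "continuous_on \<Omega> (hk' k)" by (rule continuous_on_eq) (simp add: hk'_def)
  have c2: "continuous_on (- K) (hk' k)" by (rule continuous_on_eq[OF continuous_on_const[of _ 0]]) (simp add: hk'out)
  have "continuous_on (\<Omega> \<union> (- K)) (hk' k)" by (rule continuous_on_open_Un[OF \<Omega> cK c1 c2])
  moreover have "\<Omega> \<union> (- K) = UNIV" using K by blast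
  ultimately have "continuous_on UNIV (hk' k)" by simp
  then have "C1c K (hk k) (hk' k)" unfolding C1c_def using C1cD(1)[OF K(2)] der out by blast
  then show ?thesis using K(1) by blast
 qed
 have hk_meas[measurable]: "hk k \<in> borel_measurable borel" "hk' k \<in> borel_measurable borel" for k
  using C[of k] C1cD(3,5) borel_measurable_continuous_onI by blast+
 have zk: "(LBINT x. B x * hk k x + A x \<bullet> hk' k x) = 0" and zi: "integrable lborel (\<lambda>x. B x * hk k x + A x \<bullet> hk' k x)" for k
  using C[of k] Lam_zero_C1c[OF B A \<Omega> z] Lam_integrable_C1c[OF B A] unfolding Lam_def by blast+
 have l1': "(\<lambda>k. LBINT x. norm (indicator \<Omega> x * \<bar>\<phi> k x + g x - f x\<bar> powr p)) \<longlonglongrightarrow> 0"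
  using l1 by simp
 from tendsto_L1_AE_subseq[of lborel "\<lambda>k x. indicator \<Omega> x * \<bar>\<phi> k x + g x - f x\<bar> powr p", OF i1 l1']
 obtain r where r: "strict_mono (r::nat\<Rightarrow>nat)" "AE x in lborel. (\<lambda>k. indicator \<Omega> x * \<bar>\<phi> (r k) x + g x - f x\<bar> powr p) \<longlonglongrightarrow> 0"
  by blast
 have aeconv: "AE x in lborel. x \<in> \<Omega> \<longrightarrow> (\<lambda>k. \<phi> (r k) x + g x) \<longlonglongrightarrow> f x"
  using r(2)
 proof eventually_elim
  case (elim x)
  show ?case
  proof
   assume "x \<in> \<Omega>"
   then have "(\<lambda>k. \<bar>\<phi> (r k) x + g x - f x\<bar> powr p) \<longlonglongrightarrow> 0" using elim by simp
   then have "(\<lambda>k. \<phi> (r k) x + g x - f x) \<longlonglongrightarrow> 0" by (rule powr_tendsto_0D) (use p in simp)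
   then show "(\<lambda>k. \<phi> (r k) x + g x) \<longlonglongrightarrow> f x" by (rule LIM_zero_cancel)
  qed
 qed
 define gk where "gk k x = (if x \<in> \<Omega> then H' (\<phi> k x + g x) else 0)" for k x
 have gm[measurable]: "(\<lambda>x. indicator \<Omega> x * g x) \<in> borel_measurable borel"
  using borel_measurable_continuous_on_indicator[OF _ gc] by simp
 have gk_m[measurable]: "gk k \<in> borel_measurable borel" for k
 proof -
  have "gk k = (\<lambda>x. indicator \<Omega> x * H' (\<phi> k x + indicator \<Omega> x * g x))" by (auto simp: gk_def fun_eq_iff)
  moreover have "(\<lambda>x. indicator \<Omega> x * H' (\<phi> k x + indicator \<Omega> x * g x)) \<in> borel_measurable borel" by measurable
  ultimately show ?thesis by simp
 qed
 define dk where "dk k x = (if x \<in> \<Omega> then grad (\<phi> k) x + g' x - G x else 0)" for k x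
 have g'm[measurable]: "(\<lambda>x. indicator \<Omega> x *\<^sub>R g' x) \<in> borel_measurable borel"
  using g(2) by (rule borel_measurable_continuous_on_indicator[rotated]) measurable
 have dk_m[measurable]: "dk k \<in> borel_measurable borel" for k
 proof -
  have "dk k = (\<lambda>x. indicator \<Omega> x *\<^sub>R (grad (\<phi> k) x + indicator \<Omega> x *\<^sub>R g' x - G x))" by (auto simp: dk_def fun_eq_iff)
  moreover have "(\<lambda>x. indicator \<Omega> x *\<^sub>R (grad (\<phi> k) x + indicator \<Omega> x *\<^sub>R g' x - G x)) \<in> borel_measurable borel" by measurable
  ultimately show ?thesis by simp
 qed
 have hk'_split: "hk' k x = (gk k x * indicator \<Omega> x) *\<^sub>R G x + gk k x *\<^sub>R dk k x" for k x
  by (simp add: hk'_def gk_def dk_def algebra_simps scaleR_diff_right)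
 have gkM: "\<bar>gk k x\<bar> \<le> M" for k x using H(5) M by (simp add: gk_def)
 define dom where "dom x = \<bar>B x\<bar> + M * (norm (A x) powr (p / (p - 1)) + indicator \<Omega> x * norm (G x) powr p)" for x
 have domi: "integrable lborel dom" unfolding dom_def using B Ap Gp by auto
 have AG: "\<bar>A x \<bullet> G x\<bar> * indicator \<Omega> x \<le> norm (A x) powr (p / (p - 1)) + indicator \<Omega> x * norm (G x) powr p" for x
 proof (cases "x \<in> \<Omega>")
  case True
  have "\<bar>A x \<bullet> G x\<bar> \<le> norm (A x) * norm (G x)" by (rule Cauchy_Schwarz_ineq2)
  also have "\<dots> \<le> 1 * norm (A x) powr (p / (p - 1)) + 1 powr (1 - p) * norm (G x) powr p" by (rule young_powr[OF p]) auto
  finally show ?thesis using True by simp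
 qed simp
 have bound: "\<bar>B x * b + (m * indicator \<Omega> x) * (A x \<bullet> G x)\<bar> \<le> dom x" if "\<bar>b\<bar> \<le> 1" "\<bar>m\<bar> \<le> M" for x b m
 proof -
  have "\<bar>B x * b\<bar> \<le> \<bar>B x\<bar>" using that(1) by (simp add: abs_mult mult_left_le)
  moreover have "\<bar>(m * indicator \<Omega> x) * (A x \<bullet> G x)\<bar> = \<bar>m\<bar> * (\<bar>A x \<bullet> G x\<bar> * indicator \<Omega> x)" by (simp add: abs_mult)
  moreover have "\<bar>m\<bar> * (\<bar>A x \<bullet> G x\<bar> * indicator \<Omega> x) \<le> M * (norm (A x) powr (p / (p - 1)) + indicator \<Omega> x * norm (G x) powr p)"
   using that(2) AG[of x] M by (intro mult_mono) auto
  ultimately show ?thesis unfolding dom_def by linarith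
 qed
 let ?I = "\<lambda>k x. B x * hk k x + (gk k x * indicator \<Omega> x) * (A x \<bullet> G x)"
 let ?L = "\<lambda>x. B x * (if x \<in> \<Omega> then H (f x) else 0) + A x \<bullet> (if x \<in> \<Omega> then H' (f x) *\<^sub>R G x else 0)"
 have hk1: "\<bar>hk k x\<bar> \<le> 1" for k x using H(4) by (simp add: hk_def)
 have lim: "(\<lambda>k. LBINT x. ?I (r k) x) \<longlonglongrightarrow> (LBINT x. ?L x)"
 proof (rule integral_dominated_convergence[OF _ _ domi])
  show "?L \<in> borel_measurable lborel" by measurable
  show "?I (r k) \<in> borel_measurable lborel" for k by measurable
  show "AE x in lborel. norm (?I (r k) x) \<le> dom x" for k using bound[OF hk1 gkM] by simp
  show "AE x in lborel. (\<lambda>k. ?I (r k) x) \<longlonglongrightarrow> ?L x" using aeconv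
  proof eventually_elim
   case (elim x)
   show ?case
   proof (cases "x \<in> \<Omega>")
    case True
    then have c: "(\<lambda>k. \<phi> (r k) x + g x) \<longlonglongrightarrow> f x" using elim by simp
    have "(\<lambda>k. B x * H (\<phi> (r k) x + g x) + H' (\<phi> (r k) x + g x) * (A x \<bullet> G x)) \<longlonglongrightarrow> B x * H (f x) + H' (f x) * (A x \<bullet> G x)"
     using continuous_on_tendsto_compose[OF Hc c] continuous_on_tendsto_compose[OF H(2) c]
     by (intro tendsto_intros) auto
    then show ?thesis using True by (simp add: hk_def gk_def)
   qed (simp add: hk_def gk_def)
  qed
 qed
 have Ii: "integrable lborel (?I k)" for k
  by (rule integrable_dominated[OF domi])
   (measurable, use bound[OF hk1 gkM] in \<open>auto intro!: AE_I2 order_trans[OF _ abs_ge_self]\<close>)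
 define a where "a = (LBINT x. norm (A x) powr (p / (p - 1)))"
 define \<epsilon> where "\<epsilon> k = (LBINT x. indicator \<Omega> x * norm (grad (\<phi> k) x + g' x - G x) powr p)" for k
 have est: "\<bar>LBINT x. ?I k x\<bar> \<le> M * (\<eta> * a + \<eta> powr (1 - p) * \<epsilon> k)" if \<eta>: "\<eta> > 0" for k \<eta>
 proof -
  let ?R = "\<lambda>x. gk k x * (A x \<bullet> dk k x)"
  let ?D = "\<lambda>x. M * (\<eta> * norm (A x) powr (p / (p - 1)) + \<eta> powr (1 - p) * (indicator \<Omega> x * norm (grad (\<phi> k) x + g' x - G x) powr p))"
  have Di: "integrable lborel ?D" using Ap i2[of k] by auto
  have Rb: "\<bar>?R x\<bar> \<le> ?D x" for x
  proof -
   have "\<bar>A x \<bullet> dk k x\<bar> \<le> norm (A x) * norm (dk k x)" by (rule Cauchy_Schwarz_ineq2)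
   also have "\<dots> \<le> \<eta> * norm (A x) powr (p / (p - 1)) + \<eta> powr (1 - p) * norm (dk k x) powr p" by (rule young_powr[OF p \<eta>]) auto
   also have "norm (dk k x) powr p = indicator \<Omega> x * norm (grad (\<phi> k) x + g' x - G x) powr p" by (simp add: dk_def)
   finally have 1: "\<bar>A x \<bullet> dk k x\<bar> \<le> \<eta> * norm (A x) powr (p / (p - 1)) + \<eta> powr (1 - p) * (indicator \<Omega> x * norm (grad (\<phi> k) x + g' x - G x) powr p)" .
   show ?thesis unfolding abs_mult by (rule mult_mono[OF gkM 1 M]) simp
  qed
  have Ri: "integrable lborel ?R"
   by (rule integrable_dominated[OF Di])
    (measurable, use Rb in \<open>auto intro!: AE_I2 order_trans[OF _ abs_ge_self]\<close>)
  have sp: "?I k x + ?R x = B x * hk k x + A x \<bullet> hk' k x" for x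
   unfolding hk'_split by (simp add: inner_add_right)
  have "0 = (LBINT x. ?I k x + ?R x)" unfolding sp using zk[of k] by simp
  also have "\<dots> = (LBINT x. ?I k x) + (LBINT x. ?R x)" by (rule Bochner_Integration.integral_add[OF Ii Ri])
  finally have eq: "(LBINT x. ?I k x) = - (LBINT x. ?R x)" by simp
  have "norm (LBINT x. ?R x) \<le> (LBINT x. ?D x)"
   by (rule Bochner_Integration.integral_norm_bound_integral[OF Ri Di]) (use Rb in simp)
  also have "(LBINT x. ?D x) = M * (\<eta> * a + \<eta> powr (1 - p) * \<epsilon> k)"
   unfolding a_def \<epsilon>_def using Ap i2[of k] by simp
  finally show ?thesis unfolding eq by simp
 qed
 have "(LBINT x. ?L x) = 0"
 proof (rule real_zero_if_le_eps)
  fix \<eta> :: real assume \<eta>: "\<eta> > 0"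
  have "(\<lambda>k. \<bar>LBINT x. ?I (r k) x\<bar>) \<longlonglongrightarrow> \<bar>LBINT x. ?L x\<bar>" using lim by (rule tendsto_rabs)
  moreover have "(\<lambda>k. M * (\<eta> * a + \<eta> powr (1 - p) * \<epsilon> (r k))) \<longlonglongrightarrow> M * (\<eta> * a + \<eta> powr (1 - p) * 0)"
   using LIMSEQ_subseq_LIMSEQ[OF l2 r(1)] unfolding \<epsilon>_def o_def by (intro tendsto_intros)
  ultimately have "\<bar>LBINT x. ?L x\<bar> \<le> M * (\<eta> * a + \<eta> powr (1 - p) * 0)"
   by (rule LIMSEQ_le) (use est[OF \<eta>] in blast)
  then show "\<bar>LBINT x. ?L x\<bar> \<le> \<eta> * (M * a)" by (simp add: algebra_simps)
 qed
 then show ?thesis unfolding Lam_def .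
qed

section \<open>Continuity of translations\<close>

text \<open>
 Dominating functions may depend on \<open>k\<close> if they converge together with their integrals. Translates of a
 fixed integrable function are of this kind, and have no common majorant. The proof is
 Fatou's lemma for \<open>G k + g - |s k - f|\<close>.
\<close>

theorem generalized_dominated_convergence:
 fixes f :: "'a \<Rightarrow> 'b::{banach, second_countable_topology}"
 assumes fm[measurable]: "f \<in> borel_measurable M" "\<And>k. s k \<in> borel_measurable M"
  and g: "integrable M g" and gk: "\<And>k. integrable M (G k)"
  and lim: "AE x in M. (\<lambda>k. s k x) \<longlonglongrightarrow> f x" and glim: "AE x in M. (\<lambda>k. G k x) \<longlonglongrightarrow> g x"
  and bound: "\<And>k. AE x in M. norm (s k x) \<le> G k x"
  and gint: "(\<lambda>k. LINT x|M. G k x) \<longlonglongrightarrow> (LINT x|M. g x)"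
 shows "integrable M f" "\<And>k. integrable M (s k)" "(\<lambda>k. LINT x|M. norm (s k x - f x)) \<longlonglongrightarrow> 0"
  "(\<lambda>k. LINT x|M. s k x) \<longlonglongrightarrow> (LINT x|M. f x)"
proof -
 have [measurable]: "g \<in> borel_measurable M" "\<And>k. G k \<in> borel_measurable M" using g gk by auto
 have bound': "AE x in M. \<forall>k. norm (s k x) \<le> G k x" using bound by (simp add: AE_all_countable)
 have fg: "AE x in M. norm (f x) \<le> g x" using lim glim bound'
 proof eventually_elim
  case (elim x)
  show ?case by (rule LIMSEQ_le[OF tendsto_norm[OF elim(1)] elim(2)]) (use elim(3) in auto)
 qed
 show fi: "integrable M f"
  by (rule integrable_dominated[OF g]) (use fg in \<open>auto elim!: eventually_mono\<close>)
 show si: "integrable M (s k)" for k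
  by (rule integrable_dominated[OF gk[of k]]) (use bound[of k] in \<open>auto elim!: eventually_mono\<close>)
 define d where "d k x = norm (s k x - f x)" for k x
 have di: "integrable M (d k)" for k unfolding d_def using si fi by auto
 have [measurable]: "d k \<in> borel_measurable M" for k using di by auto
 define h where "h k x = G k x + g x - d k x" for k x
 have hi: "integrable M (h k)" for k unfolding h_def using gk g di by auto
 have [measurable]: "h k \<in> borel_measurable M" for k using hi by auto
 have h0: "AE x in M. 0 \<le> h k x" for k using bound[of k] fg
 proof eventually_elim
  case (elim x)
  then show ?case using norm_triangle_ineq4[of "s k x" "f x"] by (simp add: h_def d_def)
 qed
 have hint: "(LINT x|M. h k x) = (LINT x|M. G k x) + (LINT x|M. g x) - (LINT x|M. d k x)" for k
  unfolding h_def using gk g di by simp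
 have g0: "(LINT x|M. g x) \<ge> 0"
  by (rule integral_nonneg_AE) (use fg in \<open>auto elim!: eventually_mono intro: order_trans[OF norm_ge_zero]\<close>)
 have fatou: "ennreal (2 * (LINT x|M. g x)) \<le> liminf (\<lambda>k. ennreal (LINT x|M. h k x))"
 proof -
  have "ennreal (2 * (LINT x|M. g x)) = (\<integral>\<^sup>+x. ennreal (2 * g x) \<partial>M)"
   by (subst nn_integral_eq_integral) (use g fg in \<open>auto elim!: eventually_mono intro: order_trans[OF norm_ge_zero]\<close>)
  also have "\<dots> = (\<integral>\<^sup>+x. liminf (\<lambda>k. ennreal (h k x)) \<partial>M)"
  proof (rule nn_integral_cong_AE)
   show "AE x in M. ennreal (2 * g x) = liminf (\<lambda>k. ennreal (h k x))" using lim glim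
   proof eventually_elim
    case (elim x)
    have "(\<lambda>k. G k x + g x - norm (s k x - f x)) \<longlonglongrightarrow> g x + g x - norm (f x - f x)"
     using elim by (intro tendsto_intros)
    then have "(\<lambda>k. ennreal (h k x)) \<longlonglongrightarrow> ennreal (2 * g x)"
     by (intro tendsto_ennrealI) (simp add: h_def d_def)
    then show ?case using lim_imp_Liminf[OF sequentially_bot] by metis
   qed
  qed
  also have "\<dots> \<le> liminf (\<lambda>k. \<integral>\<^sup>+x. ennreal (h k x) \<partial>M)" by (rule nn_integral_liminf) simp
  also have "(\<lambda>k. \<integral>\<^sup>+x. ennreal (h k x) \<partial>M) = (\<lambda>k. ennreal (LINT x|M. h k x))"
   by (intro ext nn_integral_eq_integral hi h0)
  finally show ?thesis .
 qed
 show L: "(\<lambda>k. LINT x|M. norm (s k x - f x)) \<longlonglongrightarrow> 0"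
 proof (rule tendstoI)
  fix e :: real assume e: "e > 0"
  have d0: "(LINT x|M. d k x) \<ge> 0" for k by (rule Bochner_Integration.integral_nonneg) (simp add: d_def)
  have ev1: "\<forall>\<^sub>F k in sequentially. (LINT x|M. h k x) > 2 * (LINT x|M. g x) - e / 2"
  proof (cases "2 * (LINT x|M. g x) - e / 2 < 0")
   case True
   have "(LINT x|M. h k x) \<ge> 0" for k by (rule integral_nonneg_AE[OF h0])
   then show ?thesis using True by (intro always_eventually allI) (meson less_le_trans)
  next
   case False
   have "ennreal (2 * (LINT x|M. g x) - e / 2) < ennreal (2 * (LINT x|M. g x))"
    using False e g0 by (intro ennreal_lessI) auto
   then have "ennreal (2 * (LINT x|M. g x) - e / 2) < liminf (\<lambda>k. ennreal (LINT x|M. h k x))" using fatou by (rule less_le_trans)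
   from less_LiminfD[OF this] show ?thesis
    by eventually_elim (use False in \<open>simp add: ennreal_less_iff\<close>)
  qed
  have ev2: "\<forall>\<^sub>F k in sequentially. (LINT x|M. G k x) < (LINT x|M. g x) + e / 2"
   using order_tendstoD(2)[OF gint, of "(LINT x|M. g x) + e / 2"] e by simp
  show "\<forall>\<^sub>F k in sequentially. dist (LINT x|M. norm (s k x - f x)) 0 < e"
   using ev1 ev2
  proof eventually_elim
   case (elim k)
   then have "(LINT x|M. d k x) < e" using hint[of k] by linarith
   then show ?case using d0[of k] by (simp add: d_def[symmetric])
  qed
 qed
 show "(\<lambda>k. LINT x|M. s k x) \<longlonglongrightarrow> (LINT x|M. f x)"
 proof (rule LIM_zero_cancel, rule Lim_null_comparison[OF _ L], rule always_eventually, rule allI)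
  fix k
  have "norm (LINT x|M. s k x - f x) \<le> (LINT x|M. norm (s k x - f x))" by (rule integral_norm_bound)
  then show "norm ((LINT x|M. s k x) - (LINT x|M. f x)) \<le> (LINT x|M. norm (s k x - f x))"
   using si fi by simp
 qed
qed

lemma translation_L1_approx:
 fixes f :: "'a::euclidean_space \<Rightarrow> 'b::{banach, second_countable_topology}"
 assumes f: "integrable lborel f"
  and ap: "\<And>e. e > 0 \<Longrightarrow> \<exists>g. integrable lborel g \<and> (LBINT x. norm (f x - g x)) < e \<and> (\<lambda>k. LBINT x. norm (g (x + v k) - g x)) \<longlonglongrightarrow> 0"
 shows "(\<lambda>k. LBINT x. norm (f (x + v k) - f x)) \<longlonglongrightarrow> 0"
proof (rule tendstoI)
 fix e :: real assume e: "e > 0"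
 obtain g where g: "integrable lborel g" "(LBINT x. norm (f x - g x)) < e / 3"
  "(\<lambda>k. LBINT x. norm (g (x + v k) - g x)) \<longlonglongrightarrow> 0" using ap[of "e / 3"] e by auto
 have "\<forall>\<^sub>F k in sequentially. (LBINT x. norm (g (x + v k) - g x)) < e / 3"
  by (rule order_tendstoD(2)[OF g(3)]) (use e in simp)
 then show "\<forall>\<^sub>F k in sequentially. dist (LBINT x. norm (f (x + v k) - f x)) 0 < e"
 proof eventually_elim
  case (elim k)
  have fgi: "integrable lborel (\<lambda>x. norm (f x - g x))" using f g(1) by auto
  have s1: "integrable lborel (\<lambda>x. norm (f (x + v k) - g (x + v k)))"
   using lborel_integrable_shift[OF fgi, of "v k"] .
  have s2: "integrable lborel (\<lambda>x. norm (g (x + v k) - g x))"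
   using lborel_integrable_shift[OF g(1), of "v k"] g(1) by auto
  have s3: "integrable lborel (\<lambda>x. norm (f (x + v k) - f x))"
   using lborel_integrable_shift[OF f, of "v k"] f by auto
  have "(LBINT x. norm (f (x + v k) - f x)) \<le>
   (LBINT x. norm (f (x + v k) - g (x + v k)) + norm (g (x + v k) - g x) + norm (f x - g x))"
  proof (rule integral_mono[OF s3])
   show "integrable lborel (\<lambda>x. norm (f (x + v k) - g (x + v k)) + norm (g (x + v k) - g x) + norm (f x - g x))"
    using s1 s2 fgi by auto
   fix x
   have "f (x + v k) - f x = (f (x + v k) - g (x + v k)) + (g (x + v k) - g x) - (f x - g x)" by simp
   then show "norm (f (x + v k) - f x) \<le> norm (f (x + v k) - g (x + v k)) + norm (g (x + v k) - g x) + norm (f x - g x)"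
    by (metis norm_triangle_ineq norm_triangle_ineq4 add_right_mono order_trans)
  qed
  also have "\<dots> = (LBINT x. norm (f (x + v k) - g (x + v k))) + (LBINT x. norm (g (x + v k) - g x)) + (LBINT x. norm (f x - g x))"
   using s1 s2 fgi by simp
  also have "(LBINT x. norm (f (x + v k) - g (x + v k))) = (LBINT x. norm (f x - g x))"
   by (rule lborel_integral_shift[of "\<lambda>x. norm (f x - g x)"]) (use fgi in auto)
  finally have "(LBINT x. norm (f (x + v k) - f x)) < e" using g(2) elim by linarith
  moreover have "0 \<le> (LBINT x. norm (f (x + v k) - f x))" by (rule Bochner_Integration.integral_nonneg) simp
  ultimately show ?case by simp
 qed
qed

text \<open>
 For an open set, translates of the indicator are bounded below by it in the limit, by openness; since
 the measures of the translates are equal, nothing can be lost above.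
\<close>

lemma translation_L1_open:
 fixes U :: "'a::euclidean_space set" and c :: "'b::{banach, second_countable_topology}"
 assumes U: "open U" "emeasure lborel U < \<infinity>" and v: "v \<longlonglongrightarrow> (0::'a)"
 shows "(\<lambda>k::nat. LBINT x. norm (indicator U (x + v k) *\<^sub>R c - indicator U x *\<^sub>R c)) \<longlonglongrightarrow> 0"
proof -
 have [measurable]: "U \<in> sets borel" using U by auto
 have i: "integrable lborel (\<lambda>x. indicator U x :: real)" using U by (simp add: integrable_real_indicator)
 have ish: "integrable lborel (\<lambda>x. indicator U (x + w) :: real)" for w
  using lborel_integrable_shift[OF i] .
 have ei: "(LBINT x. indicator U (x + w) :: real) = (LBINT x. indicator U x)" for w
  by (rule lborel_integral_shift) simp
 let ?m = "\<lambda>k x. max 0 (indicator U x - indicator U (x + v k) :: real)"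
 have mi: "integrable lborel (?m k)" for k using i ish by (intro integrable_max) auto
 have lim: "(\<lambda>k. LBINT x. ?m k x) \<longlonglongrightarrow> (LINT x|(lborel::'a measure). 0 :: real)"
 proof (rule integral_dominated_convergence[OF _ _ i])
  show "AE x in lborel. (\<lambda>k. ?m k x) \<longlonglongrightarrow> 0"
  proof (rule AE_I2)
   fix x
   show "(\<lambda>k. ?m k x) \<longlonglongrightarrow> 0"
   proof (cases "x \<in> U")
    case True
    have "(\<lambda>k. x + v k) \<longlonglongrightarrow> x + 0" by (intro tendsto_intros v)
    then have "\<forall>\<^sub>F k in sequentially. x + v k \<in> U" using topological_tendstoD[OF _ U(1)] True by simp
    then have "\<forall>\<^sub>F k in sequentially. ?m k x = 0" by eventually_elim simp
    then show ?thesis by (rule tendsto_eventually)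
   qed simp
  qed
  show "AE x in lborel. norm (?m k x) \<le> indicator U x" for k
   by (rule AE_I2) (simp add: indicator_def)
 qed (use mi in auto)
 have "(LBINT x. norm (indicator U (x + v k) *\<^sub>R c - indicator U x *\<^sub>R c)) = norm c * (2 * (LBINT x. ?m k x))" for k
 proof -
  have pt: "norm (indicator U (x + v k) *\<^sub>R c - indicator U x *\<^sub>R c) = norm c * (2 * ?m k x + (indicator U (x + v k) - indicator U x))" for x
   by (simp add: indicator_def)
  have "(LBINT x. norm (indicator U (x + v k) *\<^sub>R c - indicator U x *\<^sub>R c))
   = (LBINT x. norm c * (2 * ?m k x + (indicator U (x + v k) - indicator U x)))" by (simp only: pt)
  also have "\<dots> = norm c * (2 * (LBINT x. ?m k x))"
   using mi[of k] ish[of "v k"] i by (simp add: ei)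
  finally show ?thesis .
 qed
 moreover have "(\<lambda>k. norm c * (2 * (LBINT x. ?m k x))) \<longlonglongrightarrow> norm c * (2 * 0)"
  using lim by (intro tendsto_intros) simp
 ultimately show ?thesis by simp
qed

text \<open>
 The property passes from open sets to Borel sets by regularity, to simple functions by linearity, and to
 integrable functions by density.
\<close>

theorem translation_L1:
 fixes f :: "'a::euclidean_space \<Rightarrow> 'b::{banach, second_countable_topology}"
 assumes f: "integrable lborel f" and v: "v \<longlonglongrightarrow> (0::'a)"
 shows "(\<lambda>k::nat. LBINT x. norm (f (x + v k) - f x)) \<longlonglongrightarrow> 0"
 using f
proof (induction f rule: integrable_induct)
 case (base A c)
 have A[measurable]: "A \<in> sets borel" using base(1) by simp
 have Ai: "integrable lborel (\<lambda>x. indicator A x *\<^sub>R c)"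
  using base by (intro integrable_scaleR_left) (auto simp: integrable_real_indicator)
 show ?case
 proof (rule translation_L1_approx[OF Ai])
  fix e :: real assume e: "e > 0"
  have "0 < e / (norm c + 1)" using e by (intro divide_pos_pos) (auto simp: add_nonneg_pos)
  then obtain U where U: "open U" "A \<subseteq> U" "emeasure lborel (U - A) < ennreal (e / (norm c + 1))"
   using outer_regular_lborel[OF A] by metis
  have Um[measurable]: "U \<in> sets borel" using U by auto
  have "emeasure lborel U \<le> emeasure lborel A + emeasure lborel (U - A)"
   using emeasure_subadditive[of A lborel "U - A"] U(2) by (simp add: Un_absorb1)
  also have "\<dots> < \<infinity>" using base(2) U(3) by (simp add: ennreal_add_eq_top less_top top.not_eq_extremum) (metis infinity_ennreal_def ennreal_less_top order_less_trans)
  finally have Uf: "emeasure lborel U < \<infinity>" .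
  let ?g = "\<lambda>x. indicator U x *\<^sub>R c"
  have gi: "integrable lborel ?g" using Uf by (intro integrable_scaleR_left) (auto simp: integrable_real_indicator)
  have "(LBINT x. norm (indicator A x *\<^sub>R c - ?g x)) = (LBINT x. indicator (U - A) x * norm c)"
   using U(2) by (intro Bochner_Integration.integral_cong) (auto simp: indicator_def)
  also have "\<dots> = measure lborel (U - A) * norm c" by simp
  also have "\<dots> \<le> (e / (norm c + 1)) * norm c"
   using U(3) e by (intro mult_right_mono) (auto simp: measure_def intro!: enn2real_leI)
  also have "\<dots> < e"
  proof -
   have "norm c / (norm c + 1) < 1" by (simp add: divide_less_eq_1 add_nonneg_pos)
   then have "e * (norm c / (norm c + 1)) < e * 1" using e by (rule mult_strict_left_mono)
   then show ?thesis by simp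
  qed
  finally show "\<exists>g. integrable lborel g \<and> (LBINT x. norm (indicator A x *\<^sub>R c - g x)) < e \<and>
    (\<lambda>k. LBINT x. norm (g (x + v k) - g x)) \<longlonglongrightarrow> 0"
   using gi translation_L1_open[OF U(1) Uf v, of c] by blast
 qed
next
 case (add f g)
 show ?case
 proof (rule Lim_null_comparison)
  show "(\<lambda>k. (LBINT x. norm (f (x + v k) - f x)) + (LBINT x. norm (g (x + v k) - g x))) \<longlonglongrightarrow> 0"
   using tendsto_add[OF add.IH(1) add.IH(2)] by simp
  show "\<forall>\<^sub>F k in sequentially. norm (LBINT x. norm (f (x + v k) + g (x + v k) - (f x + g x)))
    \<le> (LBINT x. norm (f (x + v k) - f x)) + (LBINT x. norm (g (x + v k) - g x))"
  proof (rule always_eventually, rule allI)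
   fix k
   have i1: "integrable lborel (\<lambda>x. norm (f (x + v k) - f x))" "integrable lborel (\<lambda>x. norm (g (x + v k) - g x))"
    "integrable lborel (\<lambda>x. norm (f (x + v k) + g (x + v k) - (f x + g x)))"
    using lborel_integrable_shift[OF add.hyps(1), of "v k"] lborel_integrable_shift[OF add.hyps(2), of "v k"] add.hyps by auto
   have "(LBINT x. norm (f (x + v k) + g (x + v k) - (f x + g x))) \<le> (LBINT x. norm (f (x + v k) - f x) + norm (g (x + v k) - g x))"
    by (rule integral_mono[OF i1(3)]) (use i1 in \<open>auto intro: norm_diff_triangle_ineq\<close>)
   moreover have "0 \<le> (LBINT x. norm (f (x + v k) + g (x + v k) - (f x + g x)))" by (rule Bochner_Integration.integral_nonneg) simp
   ultimately show "norm (LBINT x. norm (f (x + v k) + g (x + v k) - (f x + g x)))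
    \<le> (LBINT x. norm (f (x + v k) - f x)) + (LBINT x. norm (g (x + v k) - g x))"
    using i1 by simp
  qed
 qed
next
 case (lim f s)
 show ?case
 proof (rule translation_L1_approx[OF lim.hyps(4)])
  fix e :: real assume e: "e > 0"
  have [measurable]: "f \<in> borel_measurable borel" "\<And>i. s i \<in> borel_measurable borel" using lim.hyps(1,4) by auto
  have "(\<lambda>i. LBINT x. norm (f x - s i x)) \<longlonglongrightarrow> (LINT x|(lborel::'a measure). 0::real)"
  proof (rule integral_dominated_convergence)
   show "integrable lborel (\<lambda>x. 3 * norm (f x))" using lim.hyps(4) by auto
   show "AE x in lborel. (\<lambda>i. norm (f x - s i x)) \<longlonglongrightarrow> 0"
   proof (rule AE_I2)
    fix x
    have "(\<lambda>i. norm (f x - s i x)) \<longlonglongrightarrow> norm (f x - f x)" by (intro tendsto_intros lim.hyps(2)) simp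
    then show "(\<lambda>i. norm (f x - s i x)) \<longlonglongrightarrow> 0" by simp
   qed
   show "AE x in lborel. norm (norm (f x - s i x)) \<le> 3 * norm (f x)" for i
   proof (rule AE_I2)
    fix x
    show "norm (norm (f x - s i x)) \<le> 3 * norm (f x)"
     using lim.hyps(3)[of x i] norm_triangle_ineq4[of "f x" "s i x"] by simp
   qed
  qed auto
  then have "\<forall>\<^sub>F i in sequentially. (LBINT x. norm (f x - s i x)) < e" using order_tendstoD(2) e by force
  then obtain i where "(LBINT x. norm (f x - s i x)) < e" unfolding eventually_sequentially by auto
  then show "\<exists>g. integrable lborel g \<and> (LBINT x. norm (f x - g x)) < e \<and>
    (\<lambda>k. LBINT x. norm (g (x + v k) - g x)) \<longlonglongrightarrow> 0"
   using lim.hyps(1) lim.IH by blast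
 qed
qed

text \<open>
 On each slice the translation by \<open>b\<close> preserves the integral. All majorants of the doubled problem are of
 this form, so their integrals do not depend on the translations.
\<close>

lemma shear_integral:
 fixes g :: "'z::euclidean_space \<Rightarrow> real" and b :: "'p::euclidean_space \<Rightarrow> 'z"
 assumes g: "integrable lborel g" and b[measurable]: "b \<in> borel_measurable borel"
  and S[measurable]: "S \<in> sets borel" and Sf: "emeasure lborel S < \<infinity>"
 shows "integrable lborel (\<lambda>w. indicator S (fst w) * g (snd w + b (fst w)))"
  and "(LBINT w. indicator S (fst w) * g (snd w + b (fst w))) = measure lborel S * (LBINT z. g z)"
proof -
 have [measurable]: "g \<in> borel_measurable borel" using g by auto
 have gs: "integrable lborel (\<lambda>z. g (z + b \<omega>))" for \<omega> by (rule lborel_integrable_shift[OF g])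
 have inorm: "(LBINT z. norm (indicator S \<omega> * g (z + b \<omega>))) = indicator S \<omega> * (LBINT z. \<bar>g z\<bar>)" for \<omega>
  using lborel_integral_shift[of "\<lambda>z. \<bar>g z\<bar>" "b \<omega>"] by (simp add: abs_mult)
 have Si: "integrable lborel (\<lambda>\<omega>. indicator S \<omega> * (C::real))" for C
  using Sf by (auto simp: integrable_real_indicator)
 have "integrable (lborel \<Otimes>\<^sub>M lborel) (\<lambda>w. indicator S (fst w) * g (snd w + b (fst w)))"
 proof (rule lborel_pair.Fubini_integrable)
  show "(\<lambda>w. indicator S (fst w) * g (snd w + b (fst w))) \<in> borel_measurable (lborel \<Otimes>\<^sub>M lborel)" by measurable
  show "integrable lborel (\<lambda>\<omega>. LBINT z. norm (indicator S (fst (\<omega>, z)) * g (snd (\<omega>, z) + b (fst (\<omega>, z)))))"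
   using Si inorm by simp
  show "AE \<omega> in lborel. integrable lborel (\<lambda>z. indicator S (fst (\<omega>, z)) * g (snd (\<omega>, z) + b (fst (\<omega>, z))))"
   using gs by simp
 qed
 then show i: "integrable lborel (\<lambda>w. indicator S (fst w) * g (snd w + b (fst w)))" by (simp add: lborel_prod)
 have "(LBINT w. indicator S (fst w) * g (snd w + b (fst w))) = (LBINT \<omega>. LBINT z. indicator S \<omega> * g (z + b \<omega>))"
  using lborel_Fubini_fst(3)[OF i] by simp
 also have "\<dots> = (LBINT \<omega>. indicator S \<omega> * (LBINT z. g z))"
  by (simp add: lborel_integral_shift)
 finally show "(LBINT w. indicator S (fst w) * g (snd w + b (fst w))) = measure lborel S * (LBINT z. g z)"
  by simp
qed

text \<open>
 Translations that tend to zero pointwise, with a parameter, converge in \<open>L\<^sup>1\<close> after integration over the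
 parameter, hence almost everywhere along a subsequence.
\<close>

theorem shear_AE_subseq:
 fixes f :: "'z::euclidean_space \<Rightarrow> 'b::{banach, second_countable_topology}" and a :: "'p::euclidean_space \<Rightarrow> 'z"
 assumes f: "integrable lborel f" and a[measurable]: "a \<in> borel_measurable borel"
  and c[measurable]: "\<And>k::nat. c k \<in> borel_measurable borel"
  and S[measurable]: "S \<in> sets borel" and Sf: "emeasure lborel S < \<infinity>"
  and lim: "\<And>\<omega>. \<omega> \<in> S \<Longrightarrow> (\<lambda>k. c k \<omega>) \<longlonglongrightarrow> 0"
 obtains r :: "nat \<Rightarrow> nat" where "strict_mono r"
  "AE w in lborel. fst w \<in> S \<longrightarrow> (\<lambda>k. f (snd w + a (fst w) + c (r k) (fst w))) \<longlonglongrightarrow> f (snd w + a (fst w))"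
proof -
 have [measurable]: "f \<in> borel_measurable borel" using f by auto
 let ?F = "\<lambda>k w. indicator S (fst w) *\<^sub>R (f (snd w + a (fst w) + c k (fst w)) - f (snd w + a (fst w)))"
 define m where "m v = (LBINT z. norm (f (z + v) - f z))" for v
 have shift_i: "integrable lborel (\<lambda>z. f (z + v))" for v by (rule lborel_integrable_shift[OF f])
 have inner: "(LBINT z. norm (f (z + a \<omega> + c k \<omega>) - f (z + a \<omega>))) = m (c k \<omega>)" for \<omega> k
  unfolding m_def using lborel_integral_shift[of "\<lambda>z. norm (f (z + c k \<omega>) - f z)" "a \<omega>"] by simp
 have m_bound: "0 \<le> m v" "m v \<le> 2 * (LBINT z. norm (f z))" for v
 proof -
  show "0 \<le> m v" unfolding m_def by (rule Bochner_Integration.integral_nonneg) simp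
  have n: "integrable lborel (\<lambda>z. norm (f z))" using f by auto
  have "m v \<le> (LBINT z. norm (f (z + v)) + norm (f z))"
   unfolding m_def by (rule integral_mono) (use shift_i f in \<open>auto intro: norm_triangle_ineq4\<close>)
  also have "\<dots> = 2 * (LBINT z. norm (f z))"
   using lborel_integral_shift[of "\<lambda>z. norm (f z)" v] lborel_integrable_shift[OF n, of v] n by simp
  finally show "m v \<le> 2 * (LBINT z. norm (f z))" .
 qed
 have m_meas[measurable]: "(\<lambda>\<omega>. m (c k \<omega>)) \<in> borel_measurable borel" for k
 proof -
  have "(\<lambda>\<omega>. LBINT z. (\<lambda>(\<omega>, z). norm (f (z + c k \<omega>) - f z)) (\<omega>, z)) \<in> borel_measurable borel"
   by measurable
  then show ?thesis by (simp add: m_def)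
 qed
 have Si: "integrable lborel (\<lambda>\<omega>. indicator S \<omega> * (C::real))" for C
  using Sf by (auto simp: integrable_real_indicator)
 have Fi: "integrable lborel (?F k)" for k
 proof -
  have "integrable (lborel \<Otimes>\<^sub>M lborel) (?F k)"
  proof (rule lborel_pair.Fubini_integrable)
   show "?F k \<in> borel_measurable (lborel \<Otimes>\<^sub>M lborel)" by measurable
   have "integrable lborel (\<lambda>\<omega>. indicator S \<omega> * m (c k \<omega>))"
    by (rule integrable_dominated[OF Si[of "2 * (LBINT z. norm (f z))"]])
     (measurable, use m_bound in \<open>auto simp: indicator_def intro!: AE_I2 order_trans[OF _ abs_ge_self]\<close>)
   then show "integrable lborel (\<lambda>\<omega>. LBINT z. norm (?F k (\<omega>, z)))"
    by (simp add: inner)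
   show "AE \<omega> in lborel. integrable lborel (\<lambda>z. ?F k (\<omega>, z))"
    using shift_i by (auto simp: add.assoc)
  qed
  then show ?thesis by (simp add: lborel_prod)
 qed
 have Fint: "(LBINT w. norm (?F k w)) = (LBINT \<omega>. indicator S \<omega> * m (c k \<omega>))" for k
 proof -
  have "integrable lborel (\<lambda>w. norm (?F k w))" using Fi by (rule integrable_norm)
  from lborel_Fubini_fst(3)[OF this, symmetric] show ?thesis by (simp add: inner)
 qed
 have "(\<lambda>k. LBINT \<omega>. indicator S \<omega> * m (c k \<omega>)) \<longlonglongrightarrow> (LINT \<omega>|(lborel::'p measure). 0)"
 proof (rule integral_dominated_convergence[OF _ _ Si[of "2 * (LBINT z. norm (f z))"]])
  show "AE \<omega> in lborel. (\<lambda>k. indicator S \<omega> * m (c k \<omega>)) \<longlonglongrightarrow> 0"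
  proof (rule AE_I2)
   fix \<omega>
   show "(\<lambda>k. indicator S \<omega> * m (c k \<omega>)) \<longlonglongrightarrow> 0"
   proof (cases "\<omega> \<in> S")
    case True
    from translation_L1[OF f lim[OF True]] show ?thesis using True by (simp add: m_def)
   qed simp
  qed
  show "AE \<omega> in lborel. norm (indicator S \<omega> * m (c k \<omega>)) \<le> indicator S \<omega> * (2 * (LBINT z. norm (f z)))" for k
   using m_bound by (auto simp: indicator_def intro!: AE_I2)
 qed auto
 then have "(\<lambda>k. LBINT w. norm (?F k w)) \<longlonglongrightarrow> 0" unfolding Fint by simp
 from tendsto_L1_AE_subseq[OF Fi this] obtain r where r: "strict_mono (r::nat\<Rightarrow>nat)" "AE w in lborel. (\<lambda>k. ?F (r k) w) \<longlonglongrightarrow> 0" by blast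
 show thesis
 proof (rule that[OF r(1)])
  show "AE w in lborel. fst w \<in> S \<longrightarrow> (\<lambda>k. f (snd w + a (fst w) + c (r k) (fst w))) \<longlonglongrightarrow> f (snd w + a (fst w))"
   using r(2)
  proof eventually_elim
   case (elim w)
   then show ?case by (auto simp: LIM_zero_iff)
  qed
 qed
qed

section \<open>The nonlinearities of the equation\<close>

text \<open>
 The case distinction is needed since \<open>0 powr 0 = 0\<close>, while the derivative of the identity at \<open>0\<close> is \<open>1\<close>.
\<close>

definition b_deriv :: "real \<Rightarrow> real \<Rightarrow> real" where
 "b_deriv p z = (if p = 2 then 1 else (p - 1) * \<bar>z\<bar> powr (p - 2))"

lemma b_fun_pos: "z \<ge> 0 \<Longrightarrow> b_fun p z = z powr (p - 1)"
 using powr_mult_base[of z "p - 2"] by (simp add: b_fun_def mult.commute)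

lemma b_fun_minus: "b_fun p (- z) = - b_fun p z"
 by (simp add: b_fun_def)

lemma abs_b_fun: "\<bar>b_fun p z\<bar> = \<bar>z\<bar> powr (p - 1)"
 using powr_mult_base[of "\<bar>z\<bar>" "p - 2"] by (simp add: b_fun_def abs_mult mult.commute)

lemma b_fun_2: "b_fun 2 z = z"
 by (simp add: b_fun_def powr_def)

lemma b_fun_0 [simp]: "b_fun p 0 = 0" by (simp add: b_fun_def)

lemma b_deriv_nonneg: "p \<ge> 2 \<Longrightarrow> 0 \<le> b_deriv p z" by (simp add: b_deriv_def)

lemma b_fun_DERIV:
 assumes p: "p \<ge> 2"
 shows "(b_fun p has_real_derivative b_deriv p z) (at z)"
proof (cases "p = 2")
 case True
 have "b_fun 2 = (\<lambda>z. z)" by (intro ext b_fun_2)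
 then show ?thesis using True by (simp add: b_deriv_def)
next
 case False
 then have p2: "p > 2" using p by simp
 have pos: "(b_fun p has_real_derivative b_deriv p y) (at y)" if "y > 0" for y
 proof -
  have "((\<lambda>z. z powr (p - 1)) has_real_derivative (p - 1) * y powr (p - 1 - 1)) (at y)"
   using that by (rule has_real_derivative_powr)
  then have "((\<lambda>z. z powr (p - 1)) has_real_derivative b_deriv p y) (at y)"
   using False that by (simp add: b_deriv_def)
  then show ?thesis
   by (rule has_field_derivative_transform_within_open[where S="{0<..}"]) (use that b_fun_pos in auto)
 qed
 consider "z > 0" | "z < 0" | "z = 0" by linarith
 then show ?thesis
 proof cases
  case 1 then show ?thesis by (rule pos)
 next
  case 2
  have "((\<lambda>z. b_fun p (- z)) has_real_derivative b_deriv p (- z) * - 1) (at z)"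
   by (rule DERIV_chain2[OF pos]) (use 2 in \<open>auto intro!: derivative_eq_intros\<close>)
  then have "((\<lambda>z. - b_fun p (- z)) has_real_derivative - (b_deriv p (- z) * - 1)) (at z)" by (rule DERIV_minus)
  moreover have "b_deriv p (- z) = b_deriv p z" by (simp add: b_deriv_def)
  ultimately show ?thesis by (simp add: b_fun_minus)
 next
  case 3
  have "((\<lambda>h::real. \<bar>h\<bar> powr (p - 2)) \<longlongrightarrow> \<bar>0\<bar> powr (p - 2)) (at 0)"
   by (rule tendsto_powr'[OF tendsto_rabs tendsto_const]) (use p2 in auto)
  then have "((\<lambda>h::real. \<bar>h\<bar> powr (p - 2)) \<longlongrightarrow> 0) (at 0)" by simp
  then have "((\<lambda>h. (b_fun p h - b_fun p 0) / (h - 0)) \<longlongrightarrow> 0) (at 0)"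
   by (rule Lim_transform_eventually) (auto simp: b_fun_def eventually_at intro!: exI[of _ 1])
  then show ?thesis using 3 False by (simp add: has_field_derivative_iff b_deriv_def)
 qed
qed

lemma b_fun_isCont: "p \<ge> 2 \<Longrightarrow> isCont (b_fun p) z"
 using b_fun_DERIV DERIV_isCont by blast

lemma b_deriv_isCont: assumes "p \<ge> 2" shows "isCont (b_deriv p) z"
proof (cases "p = 2")
 case True
 then have "b_deriv p = (\<lambda>_. 1)" by (auto simp: b_deriv_def)
 then show ?thesis by simp
next
 case False
 have "((\<lambda>z. (p - 1) * \<bar>z\<bar> powr (p - 2)) \<longlongrightarrow> (p - 1) * \<bar>z\<bar> powr (p - 2)) (at z)"
  by (intro tendsto_mult tendsto_const tendsto_powr' tendsto_rabs tendsto_ident_at) (use False assms in auto)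
 then show ?thesis using False by (simp add: isCont_def b_deriv_def[abs_def])
qed

lemma b_fun_measurable [measurable]: "b_fun p \<in> borel_measurable borel"
 unfolding b_fun_def[abs_def] by measurable

lemma b_deriv_measurable [measurable]: "b_deriv p \<in> borel_measurable borel"
 unfolding b_deriv_def[abs_def] by measurable

lemma b_fun_strict_mono: assumes "p \<ge> 2" "x < y" shows "b_fun p x < b_fun p y"
proof -
 consider "0 \<le> x" | "x < 0" "0 < y" | "y \<le> 0" using assms by linarith
 then show ?thesis
 proof cases
  case 1 then show ?thesis using assms by (simp add: b_fun_pos powr_less_mono2)
 next
  case 2
  have "0 < (- x) powr (p - 1)" "0 < y powr (p - 1)" using 2 by auto
  moreover have "b_fun p x = - ((- x) powr (p - 1))" using 2 b_fun_minus[of p "- x"] b_fun_pos[of "- x" p] by simp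
  ultimately show ?thesis using b_fun_pos[OF less_imp_le[OF 2(2)], of p] by linarith
 next
  case 3
  have "b_fun p x = - ((- x) powr (p - 1))" "b_fun p y = - ((- y) powr (p - 1))"
   using 3 assms b_fun_minus[of p "- x"] b_fun_pos[of "- x" p] b_fun_minus[of p "- y"] b_fun_pos[of "- y" p] by simp_all
  then show ?thesis using 3 assms powr_less_mono2[of "p - 1" "- y" "- x"] by simp
 qed
qed

lemma b_fun_le_iff: "p \<ge> 2 \<Longrightarrow> b_fun p x \<le> b_fun p y \<longleftrightarrow> x \<le> y"
 using b_fun_strict_mono[of p x y] b_fun_strict_mono[of p y x] by (metis not_le order_less_le linorder_neqE)

lemma b_fun_less_iff: "p \<ge> 2 \<Longrightarrow> b_fun p x < b_fun p y \<longleftrightarrow> x < y"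
 using b_fun_le_iff[of p y x] by linarith

lemma powr_le_one_plus:
 assumes "0 \<le> q" "q \<le> p" "0 \<le> (x::real)" shows "x powr q \<le> 1 + x powr p"
proof (cases "x \<le> 1")
 case True
 then have "x powr q \<le> 1" using powr_mono2[of q x 1] assms by simp
 then show ?thesis using powr_ge_zero[of x p] by linarith
next
 case False
 then have "x powr q \<le> x powr p" using assms by (intro powr_mono) auto
 then show ?thesis by simp
qed

lemma abs_b_fun_le: "p \<ge> 2 \<Longrightarrow> \<bar>b_fun p z\<bar> \<le> 1 + \<bar>z\<bar> powr p"
 unfolding abs_b_fun by (rule powr_le_one_plus) auto

lemma b_deriv_le: assumes "p \<ge> 2" "\<bar>z\<bar> \<le> y" shows "b_deriv p z \<le> p * (1 + y powr p)"
proof (cases "p = 2")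
 case True
 have "1 \<le> p * (1 + y powr p)" using assms powr_ge_zero[of y p] True by (simp add: powr_ge_zero)
 then show ?thesis using True by (simp add: b_deriv_def)
next
 case False
 have "\<bar>z\<bar> powr (p - 2) \<le> y powr (p - 2)" using assms by (intro powr_mono2) auto
 also have "\<dots> \<le> 1 + y powr p" using assms by (intro powr_le_one_plus) auto
 finally have "(p - 1) * \<bar>z\<bar> powr (p - 2) \<le> p * (1 + y powr p)" using assms by (intro mult_mono) auto
 then show ?thesis using False by (simp add: b_deriv_def)
qed

lemma powr_sum3_le:
 assumes "p > 0" "0 \<le> x" "0 \<le> y" "0 \<le> (z::real)"
 shows "(x + y + z) powr p \<le> 3 powr p * (x powr p + y powr p + z powr p)"
proof -
 define m where "m = max x (max y z)"
 have "(x + y + z) powr p \<le> (3 * m) powr p" using assms by (intro powr_mono2) (auto simp: m_def)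
 also have "\<dots> = 3 powr p * m powr p" using assms by (intro powr_mult)
 also have "m powr p \<le> x powr p + y powr p + z powr p"
  by (auto simp: m_def max_def)
 finally show ?thesis by (simp add: mult_left_mono)
qed

definition flux :: "real \<Rightarrow> 'a::euclidean_space \<Rightarrow> 'a" where
 "flux p \<xi> = norm \<xi> powr (p - 2) *\<^sub>R \<xi>"

lemma flux_measurable [measurable]: "flux p \<in> borel_measurable borel"
 unfolding flux_def[abs_def] by measurable

lemma norm_flux: "norm (flux p \<xi>) = norm \<xi> powr (p - 1)"
 using powr_mult_base[of "norm \<xi>" "p - 2"] by (simp add: flux_def mult.commute)

lemma flux_0 [simp]: "flux p 0 = 0" by (simp add: flux_def)

lemma flux_isCont: assumes p: "p \<ge> 2" shows "isCont (flux p) (\<xi>::'a::euclidean_space)"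
proof (cases "p = 2")
 case True
 have "flux 2 = (\<lambda>\<xi>::'a. \<xi>)" by (auto simp: flux_def powr_def fun_eq_iff)
 then show ?thesis using True by simp
next
 case False
 have "((\<lambda>\<xi>. norm \<xi> powr (p - 2) *\<^sub>R \<xi>) \<longlongrightarrow> norm \<xi> powr (p - 2) *\<^sub>R \<xi>) (at \<xi>)"
  by (intro tendsto_scaleR tendsto_ident_at tendsto_powr' tendsto_norm tendsto_const) (use False p in auto)
 then show ?thesis by (simp add: isCont_def flux_def[abs_def])
qed

text \<open>
 Expanding the product and using the Cauchy-Schwarz inequality leaves \<open>(s\<^sup>p\<^sup>-\<^sup>1 - r\<^sup>p\<^sup>-\<^sup>1) (s - r) \<ge> 0\<close> for the norms.
\<close>

lemma flux_monotone: assumes p: "p \<ge> 2" shows "0 \<le> (flux p \<xi> - flux p \<zeta>) \<bullet> (\<xi> - \<zeta>)"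
proof -
 let ?a = "norm \<xi>" and ?b = "norm \<zeta>"
 let ?A = "?a powr (p - 2)" and ?B = "?b powr (p - 2)"
 have "(flux p \<xi> - flux p \<zeta>) \<bullet> (\<xi> - \<zeta>) = ?A * ?a\<^sup>2 + ?B * ?b\<^sup>2 - (?A + ?B) * (\<xi> \<bullet> \<zeta>)"
  unfolding flux_def power2_norm_eq_inner by (simp add: algebra_simps inner_diff_left inner_diff_right inner_commute)
 moreover have "(?A + ?B) * (\<xi> \<bullet> \<zeta>) \<le> (?A + ?B) * (?a * ?b)"
  by (intro mult_left_mono norm_cauchy_schwarz) auto
 moreover have "?A * ?a\<^sup>2 + ?B * ?b\<^sup>2 - (?A + ?B) * (?a * ?b) = (?A * ?a - ?B * ?b) * (?a - ?b)"
  by (simp add: algebra_simps power2_eq_square)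
 moreover have "0 \<le> (?A * ?a - ?B * ?b) * (?a - ?b)"
 proof (cases "?a \<ge> ?b")
  case True
  then have "?B * ?b \<le> ?A * ?a" using p by (intro mult_mono powr_mono2) auto
  then show ?thesis using True by simp
 next
  case False
  then have "?A * ?a \<le> ?B * ?b" using p by (intro mult_mono powr_mono2) auto
  then show ?thesis using False by (intro mult_nonpos_nonpos) auto
 qed
 ultimately show ?thesis by linarith
qed

section \<open>Regularised entropies\<close>

definition pos2 :: "real \<Rightarrow> real" where "pos2 z = (max 0 z)\<^sup>2"

lemma pos2_DERIV: "(pos2 has_real_derivative 2 * max 0 z) (at z)"
proof -
 consider "z > 0" | "z < 0" | "z = 0" by linarith
 then show ?thesis
 proof cases
  case 1
  have "((\<lambda>z. z\<^sup>2) has_real_derivative 2 * max 0 z) (at z)" using 1 by (auto intro!: derivative_eq_intros)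
  then show ?thesis by (rule has_field_derivative_transform_within_open[where S="{0<..}"]) (use 1 in \<open>auto simp: pos2_def\<close>)
 next
  case 2
  have "((\<lambda>z. 0) has_real_derivative 2 * max 0 z) (at z)" using 2 by simp
  then show ?thesis by (rule has_field_derivative_transform_within_open[where S="{..<0}"]) (use 2 in \<open>auto simp: pos2_def\<close>)
 next
  case 3
  have "((\<lambda>h. max 0 h) \<longlongrightarrow> max 0 (0::real)) (at 0)" by (intro tendsto_intros)
  then have "((\<lambda>h. max 0 h) \<longlongrightarrow> (0::real)) (at 0)" by simp
  then have "((\<lambda>h. (pos2 h - pos2 0) / (h - 0)) \<longlongrightarrow> 0) (at 0)"
   by (rule Lim_transform_eventually) (auto simp: pos2_def eventually_at max_def power2_eq_square intro!: exI[of _ 1])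
  then show ?thesis using 3 by (simp add: has_field_derivative_iff)
 qed
qed

text \<open>
 A continuously differentiable transition from \<open>0\<close> at \<open>0\<close> to \<open>1\<close> at \<open>1\<close>.
\<close>

definition step :: "real \<Rightarrow> real" where
 "step z = 2 * pos2 z - 4 * pos2 (z - 1/2) + 2 * pos2 (z - 1)"

definition tent :: "real \<Rightarrow> real" where
 "tent z = 4 * max 0 z - 8 * max 0 (z - 1/2) + 4 * max 0 (z - 1)"

lemma step_DERIV: "(step has_real_derivative tent z) (at z)"
proof -
 have s: "((\<lambda>z. pos2 (z - c)) has_real_derivative 2 * max 0 (z - c)) (at z)" for c
 proof -
  have "((\<lambda>z. z - c) has_real_derivative 1) (at z)" by (auto intro!: derivative_eq_intros)
  from DERIV_chain2[where f=pos2 and g="\<lambda>z. z - c", OF pos2_DERIV this] show ?thesis by simp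
 qed
 have "(step has_real_derivative 2 * (2 * max 0 z) - 4 * (2 * max 0 (z - 1/2)) + 2 * (2 * max 0 (z - 1))) (at z)"
  unfolding step_def[abs_def] by (intro DERIV_add DERIV_diff DERIV_cmult s pos2_DERIV)
 then show ?thesis by (simp add: tent_def)
qed

lemma tent_continuous: "continuous_on UNIV tent"
 unfolding tent_def[abs_def] by (intro continuous_intros)

lemma tent_measurable [measurable]: "tent \<in> borel_measurable borel"
 using tent_continuous by (rule borel_measurable_continuous_onI)

lemma tent_bounds: "0 \<le> tent z" "tent z \<le> 2" by (auto simp: tent_def max_def)

lemma tent_outside: "z \<le> 0 \<or> 1 \<le> z \<Longrightarrow> tent z = 0" by (auto simp: tent_def max_def)

lemma step_le_0: "z \<le> 0 \<Longrightarrow> step z = 0" by (simp add: step_def pos2_def max_def)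

lemma step_ge_1: "z \<ge> 1 \<Longrightarrow> step z = 1" by (simp add: step_def pos2_def max_def power2_eq_square algebra_simps)

lemma step_continuous: "continuous_on UNIV step"
 using step_DERIV DERIV_isCont continuous_at_imp_continuous_on by blast

lemma step_measurable [measurable]: "step \<in> borel_measurable borel"
 using step_continuous by (rule borel_measurable_continuous_onI)

lemma step_mono: "x \<le> y \<Longrightarrow> step x \<le> step y"
 by (rule DERIV_nonneg_imp_nondecreasing) (use step_DERIV tent_bounds in blast)+

lemma step_bounds: "0 \<le> step z" "step z \<le> 1"
 using step_mono[of "min 0 z" z] step_mono[of z "max 1 z"] step_le_0[of "min 0 z"] step_ge_1[of "max 1 z"] by auto

lemma tent_integral:
 "integrable lborel (\<lambda>\<sigma>. tent \<sigma> * (if \<sigma> < z then 1 else 0))"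
 "(LBINT \<sigma>. tent \<sigma> * (if \<sigma> < z then 1 else 0)) = step z"
proof -
 define c where "c = max 0 (min 1 z)"
 have c: "0 \<le> c" "step c = step z"
  using step_le_0[of z] step_le_0[of 0] step_ge_1[of z] step_ge_1[of 1] by (auto simp: c_def min_def max_def)
 have h: "has_bochner_integral lborel (\<lambda>x. indicator {0..c} x *\<^sub>R tent x) (step c - step 0)"
  by (rule has_bochner_integral_FTC_Icc[OF c(1)])
   (use step_DERIV tent_continuous in \<open>auto intro: has_vector_derivative_at_within continuous_on_subset
     simp: has_real_derivative_iff_has_vector_derivative\<close>)
 have ae: "AE \<sigma> in lborel. indicator {0..c} \<sigma> *\<^sub>R tent \<sigma> = tent \<sigma> * (if \<sigma> < z then 1 else 0)"
  using AE_lborel_singleton[of z]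
 proof eventually_elim
  case (elim \<sigma>)
  show ?case
  proof (cases "\<sigma> \<le> 0 \<or> 1 \<le> \<sigma>")
   case True
   then show ?thesis by (simp add: tent_outside)
  next
   case False
   then show ?thesis using elim by (auto simp: c_def indicator_def min_def max_def)
  qed
 qed
 have "has_bochner_integral lborel (\<lambda>\<sigma>. tent \<sigma> * (if \<sigma> < z then 1 else 0)) (step c - step 0)"
  by (rule has_bochner_integral_cong_AE[THEN iffD1, OF _ _ ae h]) measurable
 then show "integrable lborel (\<lambda>\<sigma>. tent \<sigma> * (if \<sigma> < z then 1 else 0))"
  "(LBINT \<sigma>. tent \<sigma> * (if \<sigma> < z then 1 else 0)) = step z"
  using c(2) step_le_0[of 0] by (auto simp: has_bochner_integral_iff)
qed

lemma tent_integrable: "integrable lborel tent" "(LBINT \<sigma>. tent \<sigma>) = 1"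
proof -
 have "(\<lambda>\<sigma>. tent \<sigma> * (if \<sigma> < 1 then 1 else 0)) = tent" using tent_outside by (auto simp: fun_eq_iff)
 then show "integrable lborel tent" "(LBINT \<sigma>. tent \<sigma>) = 1" using tent_integral[of 1] step_ge_1[of 1] by simp_all
qed

text \<open>
 Averages of the Kruzhkov entropies \<open>(b(u) - b(k))\<^sup>+\<close> over \<open>k = v + \<epsilon> (L + \<sigma>)\<close>, with weight \<open>tent \<sigma>\<close>. As a function of
 \<open>b(u)\<close> it is convex with derivative \<open>step((u - v - \<epsilon>L)/\<epsilon>)\<close>.
\<close>

definition ent1 :: "real \<Rightarrow> real \<Rightarrow> real \<Rightarrow> real \<Rightarrow> real \<Rightarrow> real" where
 "ent1 p L \<epsilon> u v = (LBINT \<sigma>. tent \<sigma> * max 0 (b_fun p u - b_fun p (v + \<epsilon> * (L + \<sigma>))))"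

text \<open>
 The counterpart that is convex in \<open>b(v)\<close>; its derivative is minus the same function, so that a single
 test function serves both equations.
\<close>

definition ent2 :: "real \<Rightarrow> real \<Rightarrow> real \<Rightarrow> real \<Rightarrow> real \<Rightarrow> real" where
 "ent2 p L \<epsilon> u v = (LBINT \<sigma>. tent \<sigma> * max 0 (b_fun p (u - \<epsilon> * (L + \<sigma>)) - b_fun p v))"

lemma tent_weighted_integrable:
 assumes [measurable]: "g \<in> borel_measurable borel" and B: "\<And>\<sigma>. 0 < \<sigma> \<Longrightarrow> \<sigma> < 1 \<Longrightarrow> \<bar>g \<sigma>\<bar> \<le> B"
 shows "integrable lborel (\<lambda>\<sigma>. tent \<sigma> * g \<sigma>)"
proof (rule integrable_dominated)
 show "integrable lborel (\<lambda>\<sigma>. tent \<sigma> * B)" using tent_integrable(1) by auto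
 have "norm (tent \<sigma> * g \<sigma>) \<le> norm (tent \<sigma> * B)" for \<sigma>
 proof (cases "0 < \<sigma> \<and> \<sigma> < 1")
  case True
  then have "\<bar>g \<sigma>\<bar> \<le> \<bar>B\<bar>" using B[of \<sigma>] by linarith
  then show ?thesis by (simp add: abs_mult mult_left_mono)
 next
  case False
  then show ?thesis using tent_outside[of \<sigma>] by (simp add: not_less)
 qed
 then show "AE \<sigma> in lborel. norm (tent \<sigma> * g \<sigma>) \<le> norm (tent \<sigma> * B)" by simp
qed measurable

context
 fixes p L \<epsilon> :: real
 assumes p: "p \<ge> 2" and L: "L \<ge> 0" and \<epsilon>: "\<epsilon> > 0"
begin

lemma ent_integrand_bounds:
 assumes "0 < \<sigma>"
 shows "0 \<le> max 0 (b_fun p u - b_fun p (v + \<epsilon> * (L + \<sigma>)))"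
  "max 0 (b_fun p u - b_fun p (v + \<epsilon> * (L + \<sigma>))) \<le> max 0 (b_fun p u - b_fun p v)"
  "0 \<le> max 0 (b_fun p (u - \<epsilon> * (L + \<sigma>)) - b_fun p v)"
  "max 0 (b_fun p (u - \<epsilon> * (L + \<sigma>)) - b_fun p v) \<le> max 0 (b_fun p u - b_fun p v)"
proof -
 have d: "0 \<le> \<epsilon> * (L + \<sigma>)" using L \<epsilon> assms by simp
 then have "b_fun p v \<le> b_fun p (v + \<epsilon> * (L + \<sigma>))" "b_fun p (u - \<epsilon> * (L + \<sigma>)) \<le> b_fun p u"
  by (simp_all add: b_fun_le_iff[OF p])
 then show "max 0 (b_fun p u - b_fun p (v + \<epsilon> * (L + \<sigma>))) \<le> max 0 (b_fun p u - b_fun p v)"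
  "max 0 (b_fun p (u - \<epsilon> * (L + \<sigma>)) - b_fun p v) \<le> max 0 (b_fun p u - b_fun p v)" by linarith+
qed auto

lemma ent_integrable:
 "integrable lborel (\<lambda>\<sigma>. tent \<sigma> * max 0 (b_fun p u - b_fun p (v + \<epsilon> * (L + \<sigma>))))"
 "integrable lborel (\<lambda>\<sigma>. tent \<sigma> * max 0 (b_fun p (u - \<epsilon> * (L + \<sigma>)) - b_fun p v))"
 by (rule tent_weighted_integrable[where B="max 0 (b_fun p u - b_fun p v)"],
   measurable, use ent_integrand_bounds in \<open>simp add: abs_of_nonneg\<close>)+

lemma ent_bounds:
 "0 \<le> ent1 p L \<epsilon> u v" "ent1 p L \<epsilon> u v \<le> max 0 (b_fun p u - b_fun p v)"
 "0 \<le> ent2 p L \<epsilon> u v" "ent2 p L \<epsilon> u v \<le> max 0 (b_fun p u - b_fun p v)"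
proof -
 let ?m = "max 0 (b_fun p u - b_fun p v)"
 have i: "integrable lborel (\<lambda>\<sigma>. tent \<sigma> * ?m)" using tent_integrable(1) by auto
 have I: "(LBINT \<sigma>. tent \<sigma> * ?m) = ?m" using tent_integrable by simp
 show "0 \<le> ent1 p L \<epsilon> u v" "0 \<le> ent2 p L \<epsilon> u v" unfolding ent1_def ent2_def
  by (auto intro!: Bochner_Integration.integral_nonneg mult_nonneg_nonneg tent_bounds)
 have w: "tent \<sigma> * y \<le> tent \<sigma> * ?m" if "0 < \<sigma> \<Longrightarrow> y \<le> ?m" for \<sigma> y
  using that tent_bounds[of \<sigma>] tent_outside[of \<sigma>] by (cases "0 < \<sigma>") (auto intro: mult_left_mono)
 have "ent1 p L \<epsilon> u v \<le> (LBINT \<sigma>. tent \<sigma> * ?m)" unfolding ent1_def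
  by (rule integral_mono[OF ent_integrable(1) i]) (rule w, rule ent_integrand_bounds(2))
 then show "ent1 p L \<epsilon> u v \<le> ?m" by (simp only: I)
 have "ent2 p L \<epsilon> u v \<le> (LBINT \<sigma>. tent \<sigma> * ?m)" unfolding ent2_def
  by (rule integral_mono[OF ent_integrable(2) i]) (rule w, rule ent_integrand_bounds(4))
 then show "ent2 p L \<epsilon> u v \<le> ?m" by (simp only: I)
qed

text \<open>
 The step is the average of the indicators of \<open>{k < u}\<close>, which are the derivatives of the entropies.
\<close>

lemma step_scaled: "step ((u - v - \<epsilon> * L) / \<epsilon>) = (LBINT \<sigma>. tent \<sigma> * (if v + \<epsilon> * (L + \<sigma>) < u then 1 else 0))"
 "integrable lborel (\<lambda>\<sigma>. tent \<sigma> * (if v + \<epsilon> * (L + \<sigma>) < u then 1 else 0))"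
proof -
 have "(\<sigma> < (u - v - \<epsilon> * L) / \<epsilon>) = (v + \<epsilon> * (L + \<sigma>) < u)" for \<sigma>
  using \<epsilon> by (auto simp: field_simps)
 then show "step ((u - v - \<epsilon> * L) / \<epsilon>) = (LBINT \<sigma>. tent \<sigma> * (if v + \<epsilon> * (L + \<sigma>) < u then 1 else 0))"
  "integrable lborel (\<lambda>\<sigma>. tent \<sigma> * (if v + \<epsilon> * (L + \<sigma>) < u then 1 else 0))"
  using tent_integral[of "(u - v - \<epsilon> * L) / \<epsilon>"] by simp_all
qed

text \<open>
 The average of the convexity inequality of \<open>y \<mapsto> (y - b(k))\<^sup>+\<close> at \<open>b(u)\<close>.
\<close>

lemma ent1_convexity:
 "ent1 p L \<epsilon> u v - ent1 p L \<epsilon> u' v \<le> (b_fun p u - b_fun p u') * step ((u - v - \<epsilon> * L) / \<epsilon>)"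
proof -
 let ?k = "\<lambda>\<sigma>. v + \<epsilon> * (L + \<sigma>)"
 have "ent1 p L \<epsilon> u v - ent1 p L \<epsilon> u' v =
  (LBINT \<sigma>. tent \<sigma> * max 0 (b_fun p u - b_fun p (?k \<sigma>)) - tent \<sigma> * max 0 (b_fun p u' - b_fun p (?k \<sigma>)))"
  unfolding ent1_def by (rule Bochner_Integration.integral_diff[symmetric]) (rule ent_integrable)+
 also have "\<dots> \<le> (LBINT \<sigma>. (b_fun p u - b_fun p u') * (tent \<sigma> * (if ?k \<sigma> < u then 1 else 0)))"
 proof (rule integral_mono)
  fix \<sigma>
  have "max 0 (b_fun p u - b_fun p (?k \<sigma>)) - max 0 (b_fun p u' - b_fun p (?k \<sigma>)) \<le> (b_fun p u - b_fun p u') * (if ?k \<sigma> < u then 1 else 0)"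
   using b_fun_le_iff[OF p, of u "?k \<sigma>"] by (auto simp: max_def)
  from mult_left_mono[OF this tent_bounds(1)[of \<sigma>]]
  show "tent \<sigma> * max 0 (b_fun p u - b_fun p (?k \<sigma>)) - tent \<sigma> * max 0 (b_fun p u' - b_fun p (?k \<sigma>))
   \<le> (b_fun p u - b_fun p u') * (tent \<sigma> * (if ?k \<sigma> < u then 1 else 0))"
   by (simp add: algebra_simps)
 qed (intro Bochner_Integration.integrable_diff ent_integrable integrable_mult_right step_scaled(2))+
 also have "\<dots> = (b_fun p u - b_fun p u') * step ((u - v - \<epsilon> * L) / \<epsilon>)"
  unfolding step_scaled(1) by (rule integral_mult_right_zero)
 finally show ?thesis .
qed

lemma ent2_convexity:
 "ent2 p L \<epsilon> u v - ent2 p L \<epsilon> u v' \<le> - (b_fun p v - b_fun p v') * step ((u - v - \<epsilon> * L) / \<epsilon>)"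
proof -
 let ?k = "\<lambda>\<sigma>. u - \<epsilon> * (L + \<sigma>)"
 have "ent2 p L \<epsilon> u v - ent2 p L \<epsilon> u v' =
  (LBINT \<sigma>. tent \<sigma> * max 0 (b_fun p (?k \<sigma>) - b_fun p v) - tent \<sigma> * max 0 (b_fun p (?k \<sigma>) - b_fun p v'))"
  unfolding ent2_def by (rule Bochner_Integration.integral_diff[symmetric]) (rule ent_integrable)+
 also have "\<dots> \<le> (LBINT \<sigma>. - (b_fun p v - b_fun p v') * (tent \<sigma> * (if v + \<epsilon> * (L + \<sigma>) < u then 1 else 0)))"
 proof (rule integral_mono)
  fix \<sigma>
  have "max 0 (b_fun p (?k \<sigma>) - b_fun p v) - max 0 (b_fun p (?k \<sigma>) - b_fun p v') \<le> - (b_fun p v - b_fun p v') * (if v + \<epsilon> * (L + \<sigma>) < u then 1 else 0)"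
   using b_fun_le_iff[OF p, of "?k \<sigma>" v] by (auto simp: max_def)
  from mult_left_mono[OF this tent_bounds(1)[of \<sigma>]]
  show "tent \<sigma> * max 0 (b_fun p (?k \<sigma>) - b_fun p v) - tent \<sigma> * max 0 (b_fun p (?k \<sigma>) - b_fun p v')
   \<le> - (b_fun p v - b_fun p v') * (tent \<sigma> * (if v + \<epsilon> * (L + \<sigma>) < u then 1 else 0))"
   by (simp add: algebra_simps)
 qed (intro Bochner_Integration.integrable_diff ent_integrable integrable_mult_right step_scaled(2))+
 also have "\<dots> = - (b_fun p v - b_fun p v') * step ((u - v - \<epsilon> * L) / \<epsilon>)"
  unfolding step_scaled(1) by (rule integral_mult_right_zero)
 finally show ?thesis .
qed

end

lemma ent_measurable [measurable]:
 assumes [measurable]: "f \<in> borel_measurable M" "g \<in> borel_measurable M"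
 shows "(\<lambda>x. ent1 p L \<epsilon> (f x) (g x)) \<in> borel_measurable M" "(\<lambda>x. ent2 p L \<epsilon> (f x) (g x)) \<in> borel_measurable M"
 unfolding ent1_def ent2_def by measurable

text \<open>
 The limit of \<open>(ent1 - ent2)/\<epsilon>\<close>, up to a constant factor.
\<close>

definition jump :: "real \<Rightarrow> real \<Rightarrow> real \<Rightarrow> real" where
 "jump p u v = (if v < u then b_deriv p u - b_deriv p v else 0)"

lemma jump_measurable [measurable]:
 assumes [measurable]: "f \<in> borel_measurable M" "g \<in> borel_measurable M"
 shows "(\<lambda>x. jump p (f x) (g x)) \<in> borel_measurable M"
 unfolding jump_def by measurable

lemma bounded_of_convergent:
 assumes "(v::nat\<Rightarrow>real) \<longlonglongrightarrow> l" obtains C where "\<And>k. \<bar>v k\<bar> \<le> C"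
 using convergent_imp_Bseq[OF convergentI[OF assms]] that by (auto simp: Bseq_def)

lemma ent1_tendsto:
 assumes p: "p \<ge> 2" and L: "L \<ge> 0" and \<epsilon>: "\<And>k. \<epsilon> k > 0" "\<epsilon> \<longlonglongrightarrow> 0" and v: "v \<longlonglongrightarrow> vl"
 shows "(\<lambda>k. ent1 p L (\<epsilon> k) u (v k)) \<longlonglongrightarrow> max 0 (b_fun p u - b_fun p vl)"
proof -
 have "(\<lambda>k. b_fun p (v k)) \<longlonglongrightarrow> b_fun p vl" by (rule isCont_tendsto_compose[OF b_fun_isCont[OF p] v])
 then obtain C where C: "\<And>k. \<bar>b_fun p (v k)\<bar> \<le> C" using bounded_of_convergent by blast
 have "(\<lambda>k. LBINT \<sigma>. tent \<sigma> * max 0 (b_fun p u - b_fun p (v k + \<epsilon> k * (L + \<sigma>)))) \<longlonglongrightarrow> (LBINT \<sigma>. tent \<sigma> * max 0 (b_fun p u - b_fun p vl))"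
 proof (rule integral_dominated_convergence[where w="\<lambda>\<sigma>. tent \<sigma> * (\<bar>b_fun p u\<bar> + C)"])
  show "integrable lborel (\<lambda>\<sigma>. tent \<sigma> * (\<bar>b_fun p u\<bar> + C))" using tent_integrable(1) by auto
  show "AE \<sigma> in lborel. (\<lambda>k. tent \<sigma> * max 0 (b_fun p u - b_fun p (v k + \<epsilon> k * (L + \<sigma>)))) \<longlonglongrightarrow> tent \<sigma> * max 0 (b_fun p u - b_fun p vl)"
  proof (rule AE_I2)
   fix \<sigma>
   have "(\<lambda>k. v k + \<epsilon> k * (L + \<sigma>)) \<longlonglongrightarrow> vl + 0 * (L + \<sigma>)" by (intro tendsto_intros v \<epsilon>)
   then have "(\<lambda>k. v k + \<epsilon> k * (L + \<sigma>)) \<longlonglongrightarrow> vl" by simp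
   from isCont_tendsto_compose[OF b_fun_isCont[OF p] this]
   show "(\<lambda>k. tent \<sigma> * max 0 (b_fun p u - b_fun p (v k + \<epsilon> k * (L + \<sigma>)))) \<longlonglongrightarrow> tent \<sigma> * max 0 (b_fun p u - b_fun p vl)"
    by (intro tendsto_intros)
  qed
  show "AE \<sigma> in lborel. norm (tent \<sigma> * max 0 (b_fun p u - b_fun p (v k + \<epsilon> k * (L + \<sigma>)))) \<le> tent \<sigma> * (\<bar>b_fun p u\<bar> + C)" for k
  proof (rule AE_I2)
   fix \<sigma>
   show "norm (tent \<sigma> * max 0 (b_fun p u - b_fun p (v k + \<epsilon> k * (L + \<sigma>)))) \<le> tent \<sigma> * (\<bar>b_fun p u\<bar> + C)"
   proof (cases "0 < \<sigma>")
    case True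
    have "max 0 (b_fun p u - b_fun p (v k + \<epsilon> k * (L + \<sigma>))) \<le> \<bar>b_fun p u\<bar> + C"
     using ent_integrand_bounds(2)[OF p L \<epsilon>(1)[of k] True, of u "v k"] C[of k] by linarith
    then show ?thesis using tent_bounds[of \<sigma>] by (simp add: abs_mult mult_left_mono)
   next
    case False then show ?thesis using tent_outside[of \<sigma>] by simp
   qed
  qed
 qed measurable
 then show ?thesis unfolding ent1_def using tent_integrable by simp
qed

text \<open>
 With \<open>d\<close> added to \<open>v\<close> or subtracted from \<open>u\<close>, both entropies are supported in \<open>{v + d < u}\<close>, and their
 difference is a difference of two increments of \<open>b\<close> over intervals of length \<open>d\<close>.
\<close>

lemma ent_integrand_diff:
 assumes p: "p \<ge> 2" and d: "d > 0"
 shows "max 0 (b_fun p u - b_fun p (v + d)) - max 0 (b_fun p (u - d) - b_fun p v) =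
  (if v + d < u then (b_fun p u - b_fun p (u - d)) - (b_fun p (v + d) - b_fun p v) else 0)"
 using b_fun_less_iff[OF p, of "v + d" u] b_fun_less_iff[OF p, of v "u - d"] by (auto simp: max_def)

lemma b_fun_increment_bound:
 assumes p: "p \<ge> 2" and d: "d > 0" and R: "\<bar>x\<bar> + d \<le> R"
 shows "\<bar>b_fun p (x + d) - b_fun p x\<bar> \<le> d * (p * (1 + R powr p))" "\<bar>b_fun p x - b_fun p (x - d)\<bar> \<le> d * (p * (1 + R powr p))"
proof -
 have *: "\<bar>b_fun p b - b_fun p a\<bar> \<le> d * (p * (1 + R powr p))" if ab: "a < b" "b - a = d" "\<bar>a\<bar> \<le> R" "\<bar>b\<bar> \<le> R" for a b
 proof -
  obtain \<xi> where \<xi>: "a < \<xi>" "\<xi> < b" "b_fun p b - b_fun p a = (b - a) * b_deriv p \<xi>"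
   using MVT2[OF ab(1), of "b_fun p" "b_deriv p"] b_fun_DERIV[OF p] by auto
  have "b_deriv p \<xi> \<le> p * (1 + R powr p)" by (rule b_deriv_le[OF p]) (use \<xi> ab in linarith)
  then show ?thesis using \<xi>(3) ab(2) d b_deriv_nonneg[OF p, of \<xi>] by (simp add: abs_mult mult_left_mono)
 qed
 show "\<bar>b_fun p (x + d) - b_fun p x\<bar> \<le> d * (p * (1 + R powr p))" by (rule *) (use d R in auto)
 show "\<bar>b_fun p x - b_fun p (x - d)\<bar> \<le> d * (p * (1 + R powr p))" by (rule *) (use d R in auto)
qed

lemma ent_integrand_diff_bound:
 assumes p: "p \<ge> 2" and L: "L \<ge> 1" and \<epsilon>: "\<epsilon> > 0" "\<epsilon> \<le> 1" and \<sigma>: "0 < \<sigma>" "\<sigma> < 1"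
 shows "\<bar>(max 0 (b_fun p u - b_fun p (v + \<epsilon> * (L + \<sigma>))) - max 0 (b_fun p (u - \<epsilon> * (L + \<sigma>)) - b_fun p v)) / \<epsilon>\<bar>
  \<le> 2 * (L + 1) * p * (1 + (\<bar>u\<bar> + \<bar>v\<bar> + (L + 1)) powr p)"
proof -
 let ?d = "\<epsilon> * (L + \<sigma>)" and ?R = "\<bar>u\<bar> + \<bar>v\<bar> + (L + 1)"
 let ?C = "p * (1 + ?R powr p)"
 have d: "?d > 0" "?d \<le> \<epsilon> * (L + 1)" using assms by (auto simp: mult_left_mono)
 have d3: "?d \<le> L + 1" using mult_mono[of \<epsilon> 1 "L + \<sigma>" "L + 1"] assms by simp
 have C: "?C \<ge> 0" using p powr_ge_zero[of ?R p] by simp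
 have "\<bar>max 0 (b_fun p u - b_fun p (v + ?d)) - max 0 (b_fun p (u - ?d) - b_fun p v)\<bar> \<le> ?d * ?C + ?d * ?C"
 proof -
  have "\<bar>b_fun p u - b_fun p (u - ?d)\<bar> \<le> ?d * ?C" "\<bar>b_fun p (v + ?d) - b_fun p v\<bar> \<le> ?d * ?C"
   using b_fun_increment_bound(2)[OF p d(1), of u ?R] b_fun_increment_bound(1)[OF p d(1), of v ?R] d3 by auto
  moreover have "0 \<le> ?d * ?C" using d C by simp
  ultimately show ?thesis unfolding ent_integrand_diff[OF p d(1)] by (cases "v + ?d < u"; simp only: if_True if_False; linarith)
 qed
 also have "\<dots> = ?d * (2 * ?C)" by simp
 also have "\<dots> \<le> (\<epsilon> * (L + 1)) * (2 * ?C)" by (rule mult_right_mono[OF d(2)]) (use C in simp)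
 finally have "\<bar>max 0 (b_fun p u - b_fun p (v + ?d)) - max 0 (b_fun p (u - ?d) - b_fun p v)\<bar> \<le> \<epsilon> * (2 * (L + 1) * ?C)"
  by (simp only: mult_ac)
 then show ?thesis using \<epsilon> by (simp add: abs_divide pos_divide_le_eq mult_ac)
qed

lemma ent_diff_integral:
 assumes p: "p \<ge> 2" and L: "L \<ge> 0" and \<epsilon>: "\<epsilon> > 0"
 shows "(ent1 p L \<epsilon> u v - ent2 p L \<epsilon> u v) / \<epsilon> = (LBINT \<sigma>. tent \<sigma> *
  ((max 0 (b_fun p u - b_fun p (v + \<epsilon> * (L + \<sigma>))) - max 0 (b_fun p (u - \<epsilon> * (L + \<sigma>)) - b_fun p v)) / \<epsilon>))"
proof -
 have "(ent1 p L \<epsilon> u v - ent2 p L \<epsilon> u v) = (LBINT \<sigma>. tent \<sigma> * max 0 (b_fun p u - b_fun p (v + \<epsilon> * (L + \<sigma>)))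
   - tent \<sigma> * max 0 (b_fun p (u - \<epsilon> * (L + \<sigma>)) - b_fun p v))"
  unfolding ent1_def ent2_def by (rule Bochner_Integration.integral_diff[symmetric]) (rule ent_integrable[OF p L \<epsilon>])+
 then have "(ent1 p L \<epsilon> u v - ent2 p L \<epsilon> u v) / \<epsilon> = (LBINT \<sigma>. tent \<sigma> * max 0 (b_fun p u - b_fun p (v + \<epsilon> * (L + \<sigma>)))
   - tent \<sigma> * max 0 (b_fun p (u - \<epsilon> * (L + \<sigma>)) - b_fun p v)) / \<epsilon>" by (rule arg_cong)
 also have "\<dots> = (LBINT \<sigma>. (tent \<sigma> * max 0 (b_fun p u - b_fun p (v + \<epsilon> * (L + \<sigma>)))
   - tent \<sigma> * max 0 (b_fun p (u - \<epsilon> * (L + \<sigma>)) - b_fun p v)) / \<epsilon>)" by (rule integral_divide_zero[symmetric])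
 finally show ?thesis by (simp add: right_diff_distrib diff_divide_distrib)
qed

lemma ent_diff_bound:
 assumes p: "p \<ge> 2" and L: "L \<ge> 1" and \<epsilon>: "\<epsilon> > 0" "\<epsilon> \<le> 1"
 shows "\<bar>(ent1 p L \<epsilon> u v - ent2 p L \<epsilon> u v) / \<epsilon>\<bar> \<le> 2 * (L + 1) * p * (1 + (\<bar>u\<bar> + \<bar>v\<bar> + (L + 1)) powr p)"
proof -
 let ?q = "\<lambda>\<sigma>. (max 0 (b_fun p u - b_fun p (v + \<epsilon> * (L + \<sigma>))) - max 0 (b_fun p (u - \<epsilon> * (L + \<sigma>)) - b_fun p v)) / \<epsilon>"
 let ?C = "2 * (L + 1) * p * (1 + (\<bar>u\<bar> + \<bar>v\<bar> + (L + 1)) powr p)"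
 have L0: "L \<ge> 0" using L by simp
 have qb: "\<bar>?q \<sigma>\<bar> \<le> ?C" if "0 < \<sigma>" "\<sigma> < 1" for \<sigma> using ent_integrand_diff_bound[OF p L \<epsilon> that] .
 have "norm (LBINT \<sigma>. tent \<sigma> * ?q \<sigma>) \<le> (LBINT \<sigma>. tent \<sigma> * ?C)"
 proof (rule Bochner_Integration.integral_norm_bound_integral)
  show "integrable lborel (\<lambda>\<sigma>. tent \<sigma> * ?q \<sigma>)" by (rule tent_weighted_integrable[OF _ qb]) measurable
  show "integrable lborel (\<lambda>\<sigma>. tent \<sigma> * ?C)" using tent_integrable(1) by (rule integrable_mult_left)
  fix \<sigma>
  show "norm (tent \<sigma> * ?q \<sigma>) \<le> tent \<sigma> * ?C"
  proof (cases "0 < \<sigma> \<and> \<sigma> < 1")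
   case True
   then have "tent \<sigma> * \<bar>?q \<sigma>\<bar> \<le> tent \<sigma> * ?C" using qb tent_bounds[of \<sigma>] by (intro mult_left_mono) auto
   then show ?thesis using tent_bounds[of \<sigma>] unfolding real_norm_def abs_mult by simp
  next
   case False then show ?thesis using tent_outside[of \<sigma>] by (simp add: not_less)
  qed
 qed
 also have "(LBINT \<sigma>. tent \<sigma> * ?C) = ?C" unfolding integral_mult_left_zero tent_integrable(2) by simp
 finally show ?thesis unfolding ent_diff_integral[OF p L0 \<epsilon>(1)] by simp
qed

lemma difference_quotient_tendsto:
 assumes p: "p \<ge> 2" and x: "x \<longlonglongrightarrow> l" and y: "y \<longlonglongrightarrow> l" and xy: "\<And>k::nat. x k < y k"
 shows "(\<lambda>k. (b_fun p (y k) - b_fun p (x k)) / (y k - x k)) \<longlonglongrightarrow> b_deriv p l"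
proof -
 have "\<exists>\<xi>. x k < \<xi> \<and> \<xi> < y k \<and> b_fun p (y k) - b_fun p (x k) = (y k - x k) * b_deriv p \<xi>" for k
  using MVT2[OF xy[of k], of "b_fun p" "b_deriv p"] b_fun_DERIV[OF p] by auto
 then obtain \<xi> where \<xi>: "\<And>k. x k < \<xi> k" "\<And>k. \<xi> k < y k" "\<And>k. b_fun p (y k) - b_fun p (x k) = (y k - x k) * b_deriv p (\<xi> k)" by metis
 have "\<xi> \<longlonglongrightarrow> l" by (rule tendsto_sandwich[OF _ _ x y]) (use \<xi>(1,2) in \<open>auto intro!: always_eventually less_imp_le\<close>)
 from isCont_tendsto_compose[OF b_deriv_isCont[OF p] this]
 have "(\<lambda>k. b_deriv p (\<xi> k)) \<longlonglongrightarrow> b_deriv p l" .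
 moreover have "(b_fun p (y k) - b_fun p (x k)) / (y k - x k) = b_deriv p (\<xi> k)" for k
  using \<xi>(3)[of k] xy[of k] by simp
 ultimately show ?thesis by simp
qed

text \<open>
 The two increments of \<open>b\<close> are divided by their length and tend to the derivatives of \<open>b\<close> at \<open>u\<close> and at the limit of \<open>v\<close>. When
 these points coincide, the support may oscillate, but then both derivatives are equal and the limit is zero anyway.
\<close>

lemma ent_diff_tendsto:
 assumes p: "p \<ge> 2" and L: "L \<ge> 1" and \<epsilon>: "\<And>k. \<epsilon> k > 0" "\<And>k. \<epsilon> k \<le> 1" "\<epsilon> \<longlonglongrightarrow> 0" and v: "v \<longlonglongrightarrow> vl"
 shows "(\<lambda>k. (ent1 p L (\<epsilon> k) u (v k) - ent2 p L (\<epsilon> k) u (v k)) / \<epsilon> k) \<longlonglongrightarrow> (LBINT \<sigma>. tent \<sigma> * (L + \<sigma>)) * jump p u vl"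
proof -
 let ?q = "\<lambda>k \<sigma>. (max 0 (b_fun p u - b_fun p (v k + \<epsilon> k * (L + \<sigma>))) - max 0 (b_fun p (u - \<epsilon> k * (L + \<sigma>)) - b_fun p (v k))) / \<epsilon> k"
 have L0: "L \<ge> 0" using L by simp
 obtain V where V: "\<And>k. \<bar>v k\<bar> \<le> V" using bounded_of_convergent[OF v] by blast
 let ?C = "2 * (L + 1) * p * (1 + (\<bar>u\<bar> + V + (L + 1)) powr p)"
 have qb: "\<bar>?q k \<sigma>\<bar> \<le> ?C" if "0 < \<sigma>" "\<sigma> < 1" for k \<sigma>
 proof -
  have "(\<bar>u\<bar> + \<bar>v k\<bar> + (L + 1)) powr p \<le> (\<bar>u\<bar> + V + (L + 1)) powr p"
   using V[of k] p L by (intro powr_mono2) auto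
  then have "2 * (L + 1) * p * (1 + (\<bar>u\<bar> + \<bar>v k\<bar> + (L + 1)) powr p) \<le> ?C"
   using p L by (intro mult_left_mono) auto
  then show ?thesis using ent_integrand_diff_bound[OF p L \<epsilon>(1)[of k] \<epsilon>(2)[of k] that, of u "v k"] by linarith
 qed
 have "(\<lambda>k. LBINT \<sigma>. tent \<sigma> * ?q k \<sigma>) \<longlonglongrightarrow> (LBINT \<sigma>. tent \<sigma> * ((L + \<sigma>) * jump p u vl))"
 proof (rule integral_dominated_convergence[where w="\<lambda>\<sigma>. tent \<sigma> * ?C"])
  show "integrable lborel (\<lambda>\<sigma>. tent \<sigma> * ?C)" using tent_integrable(1) by (rule integrable_mult_left)
  show "AE \<sigma> in lborel. norm (tent \<sigma> * ?q k \<sigma>) \<le> tent \<sigma> * ?C" for k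
  proof (rule AE_I2)
   fix \<sigma>
   show "norm (tent \<sigma> * ?q k \<sigma>) \<le> tent \<sigma> * ?C"
   proof (cases "0 < \<sigma> \<and> \<sigma> < 1")
    case True
    then have "tent \<sigma> * \<bar>?q k \<sigma>\<bar> \<le> tent \<sigma> * ?C" using qb[of \<sigma> k] tent_bounds[of \<sigma>] by (intro mult_left_mono) auto
    then show ?thesis using tent_bounds[of \<sigma>] unfolding real_norm_def abs_mult by simp
   next
    case False then show ?thesis using tent_outside[of \<sigma>] by (simp add: not_less)
   qed
  qed
  show "AE \<sigma> in lborel. (\<lambda>k. tent \<sigma> * ?q k \<sigma>) \<longlonglongrightarrow> tent \<sigma> * ((L + \<sigma>) * jump p u vl)"
  proof (rule AE_I2)
   fix \<sigma>
   show "(\<lambda>k. tent \<sigma> * ?q k \<sigma>) \<longlonglongrightarrow> tent \<sigma> * ((L + \<sigma>) * jump p u vl)"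
   proof (cases "0 < \<sigma> \<and> \<sigma> < 1")
    case True
    define d where "d k = \<epsilon> k * (L + \<sigma>)" for k
    have d: "d k > 0" for k using \<epsilon>(1)[of k] L True by (simp add: d_def)
    have "(\<lambda>k. \<epsilon> k * (L + \<sigma>)) \<longlonglongrightarrow> 0 * (L + \<sigma>)" by (intro tendsto_intros \<epsilon>)
    then have d0: "d \<longlonglongrightarrow> 0" by (simp add: d_def[abs_def])
    define s where "s k = (b_fun p u - b_fun p (u - d k)) / (u - (u - d k))" for k
    define t where "t k = (b_fun p (v k + d k) - b_fun p (v k)) / ((v k + d k) - v k)" for k
    have s: "s \<longlonglongrightarrow> b_deriv p u" unfolding s_def
     by (rule difference_quotient_tendsto[OF p]) (use d tendsto_diff[OF tendsto_const d0, of u] in auto)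
    have vd: "(\<lambda>k. v k + d k) \<longlonglongrightarrow> vl" using tendsto_add[OF v d0] by simp
    have t: "t \<longlonglongrightarrow> b_deriv p vl" unfolding t_def
     by (rule difference_quotient_tendsto[OF p v vd]) (use d in auto)
    have q_eq: "?q k \<sigma> = (if v k + d k < u then (L + \<sigma>) * (s k - t k) else 0)" for k
    proof -
     have "?q k \<sigma> = (if v k + d k < u then (b_fun p u - b_fun p (u - d k)) - (b_fun p (v k + d k) - b_fun p (v k)) else 0) / \<epsilon> k"
      using ent_integrand_diff[OF p d[of k], of u "v k"] by (simp add: d_def)
     also have "\<dots> = (if v k + d k < u then (L + \<sigma>) * (s k - t k) else 0)"
     proof -
      have "s k - t k = ((b_fun p u - b_fun p (u - d k)) - (b_fun p (v k + d k) - b_fun p (v k))) / d k"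
       by (simp add: s_def t_def diff_divide_distrib)
      then show ?thesis using \<epsilon>(1)[of k] L True by (simp add: d_def)
     qed
     finally show ?thesis .
    qed
    have st: "(\<lambda>k. (L + \<sigma>) * (s k - t k)) \<longlonglongrightarrow> (L + \<sigma>) * (b_deriv p u - b_deriv p vl)" by (intro tendsto_intros s t)
    have "(\<lambda>k. ?q k \<sigma>) \<longlonglongrightarrow> (L + \<sigma>) * jump p u vl"
    proof -
     consider "vl < u" | "u < vl" | "u = vl" by linarith
     then show ?thesis
     proof cases
      case 1
      have "\<forall>\<^sub>F k in sequentially. v k + d k < u" using order_tendstoD(2)[OF vd 1] .
      then have "\<forall>\<^sub>F k in sequentially. (L + \<sigma>) * (s k - t k) = ?q k \<sigma>" by eventually_elim (simp add: q_eq)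
      from Lim_transform_eventually[OF st this] show ?thesis using 1 by (simp add: jump_def)
     next
      case 2
      have "\<forall>\<^sub>F k in sequentially. u < v k + d k" using order_tendstoD(1)[OF vd 2] .
      then have "\<forall>\<^sub>F k in sequentially. ?q k \<sigma> = 0" by eventually_elim (simp add: q_eq)
      then show ?thesis using 2 by (simp add: jump_def tendsto_eventually)
     next
      case 3
      then have z: "(\<lambda>k. (L + \<sigma>) * (s k - t k)) \<longlonglongrightarrow> 0" using st by simp
      have "(\<lambda>k. ?q k \<sigma>) \<longlonglongrightarrow> 0"
       by (rule Lim_null_comparison[OF _ tendsto_rabs_zero[OF z]]) (auto simp: q_eq)
      then show ?thesis using 3 by (simp add: jump_def)
     qed
    qed
    then show ?thesis by (intro tendsto_intros)
   next
    case False then show ?thesis using tent_outside[of \<sigma>] by (simp add: not_less)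
   qed
  qed
 qed measurable
 moreover have "(LBINT \<sigma>. tent \<sigma> * ((L + \<sigma>) * jump p u vl)) = (LBINT \<sigma>. tent \<sigma> * (L + \<sigma>)) * jump p u vl"
  by (simp add: mult.assoc[symmetric])
 ultimately show ?thesis unfolding ent_diff_integral[OF p L0 \<epsilon>(1)] by simp
qed

section \<open>Solutions with Borel representatives\<close>

text \<open>
 Zero boundary values of \<open>f\<close>, with \<open>F\<close> as its gradient; integrability is stated because
 a non-integrable function would have integral zero.
\<close>

definition approximable :: "real \<Rightarrow> 'a::euclidean_space set \<Rightarrow> ('a \<Rightarrow> real) \<Rightarrow> ('a \<Rightarrow> 'a) \<Rightarrow> bool" where
 "approximable p \<Omega> f F \<longleftrightarrow> (\<exists>\<phi>::nat \<Rightarrow> 'a \<Rightarrow> real. (\<forall>k. \<phi> k \<in> test_functions \<Omega>) \<and>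
   (\<forall>k. integrable lborel (\<lambda>x. indicator \<Omega> x * \<bar>\<phi> k x - f x\<bar> powr p)) \<and>
   (\<lambda>k. LBINT x. indicator \<Omega> x * \<bar>\<phi> k x - f x\<bar> powr p) \<longlonglongrightarrow> 0 \<and>
   (\<forall>k. integrable lborel (\<lambda>x. indicator \<Omega> x * norm (grad (\<phi> k) x - F x) powr p)) \<and>
   (\<lambda>k. LBINT x. indicator \<Omega> x * norm (grad (\<phi> k) x - F x) powr p) \<longlonglongrightarrow> 0)"

lemma norm_diff_powr_le:
 assumes "p > 0" shows "norm (x - y) powr p \<le> 3 powr p * (norm x powr p + norm y powr p)"
proof -
 have "norm (x - y) powr p \<le> (norm x + norm y + 0) powr p"
  using assms by (intro powr_mono2) (auto intro: norm_triangle_ineq4)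
 also have "\<dots> \<le> 3 powr p * (norm x powr p + norm y powr p + 0 powr p)" using assms by (intro powr_sum3_le) auto
 finally show ?thesis using assms by simp
qed

lemma Lp_conv_diff:
 fixes X Y Z :: "nat \<Rightarrow> 'a::euclidean_space \<Rightarrow> 'b::{real_normed_vector,second_countable_topology}"
 assumes p: "p > 0" and m: "\<And>k. (\<lambda>x. indicator \<Omega> x * norm (Z k x) powr p) \<in> borel_measurable lborel"
  and Z: "\<And>k x. x \<in> \<Omega> \<Longrightarrow> Z k x = X k x - Y k x"
  and X: "\<And>k. integrable lborel (\<lambda>x. indicator \<Omega> x * norm (X k x) powr p)" "(\<lambda>k. LBINT x. indicator \<Omega> x * norm (X k x) powr p) \<longlonglongrightarrow> 0"
  and Y: "\<And>k. integrable lborel (\<lambda>x. indicator \<Omega> x * norm (Y k x) powr p)" "(\<lambda>k. LBINT x. indicator \<Omega> x * norm (Y k x) powr p) \<longlonglongrightarrow> 0"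
 shows "\<And>k. integrable lborel (\<lambda>x. indicator \<Omega> x * norm (Z k x) powr p)" "(\<lambda>k. LBINT x. indicator \<Omega> x * norm (Z k x) powr p) \<longlonglongrightarrow> 0"
proof -
 let ?D = "\<lambda>k x. 3 powr p * (indicator \<Omega> x * norm (X k x) powr p + indicator \<Omega> x * norm (Y k x) powr p)"
 have D: "integrable lborel (?D k)" for k using X(1)[of k] Y(1)[of k] by auto
 have le: "indicator \<Omega> x * norm (Z k x) powr p \<le> ?D k x" for k x
  using norm_diff_powr_le[OF p, of "X k x" "Y k x"] Z[of x k] by (simp add: indicator_def)
 have nn: "0 \<le> indicator \<Omega> x * norm (Z k x) powr p" for k x by simp
 show i: "integrable lborel (\<lambda>x. indicator \<Omega> x * norm (Z k x) powr p)" for k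
  by (rule integrable_dominated[OF D m]) (use le nn in \<open>auto intro!: AE_I2 order_trans[OF _ abs_ge_self] simp del: zero_le_mult_iff\<close>)
 have "(\<lambda>k. 3 powr p * ((LBINT x. indicator \<Omega> x * norm (X k x) powr p) + (LBINT x. indicator \<Omega> x * norm (Y k x) powr p))) \<longlonglongrightarrow> 3 powr p * (0 + 0)"
  by (intro tendsto_intros X Y)
 then have lim: "(\<lambda>k. 3 powr p * ((LBINT x. indicator \<Omega> x * norm (X k x) powr p) + (LBINT x. indicator \<Omega> x * norm (Y k x) powr p))) \<longlonglongrightarrow> 0" by simp
 show "(\<lambda>k. LBINT x. indicator \<Omega> x * norm (Z k x) powr p) \<longlonglongrightarrow> 0"
 proof (rule Lim_null_comparison[OF always_eventually lim], rule allI)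
  fix k
  have "(LBINT x. indicator \<Omega> x * norm (Z k x) powr p) \<le> (LBINT x. ?D k x)" by (rule integral_mono[OF i D le])
  also have "\<dots> = 3 powr p * ((LBINT x. indicator \<Omega> x * norm (X k x) powr p) + (LBINT x. indicator \<Omega> x * norm (Y k x) powr p))"
   using X(1)[of k] Y(1)[of k] by simp
  finally show "norm (LBINT x. indicator \<Omega> x * norm (Z k x) powr p) \<le> 3 powr p * ((LBINT x. indicator \<Omega> x * norm (X k x) powr p) + (LBINT x. indicator \<Omega> x * norm (Y k x) powr p))"
   using Bochner_Integration.integral_nonneg[of lborel "\<lambda>x. indicator \<Omega> x * norm (Z k x) powr p"] nn by simp
 qed
qed

text \<open>
 By Young's inequality, tested with the power of the average that makes the last term a multiple of the
 left-hand side; for a large weight that term is absorbed.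
\<close>

lemma flux_average_Lq:
 fixes U :: "'a::euclidean_space \<times> real \<Rightarrow> 'a"
 assumes p: "p \<ge> 2" and [measurable]: "U \<in> borel_measurable borel" and Up: "integrable lborel (\<lambda>z. norm (U z) powr p)"
  and Ai: "integrable lborel (\<lambda>z. flux p (U z))" and t: "t1 < t2"
 shows "integrable lborel (\<lambda>x. norm (LBINT r. indicator {t1..t2} r *\<^sub>R flux p (U (x, r))) powr (p / (p - 1)))"
proof -
 define Y where "Y x = (LBINT r. indicator {t1..t2} r *\<^sub>R flux p (U (x, r)))" for x
 have Aind: "integrable lborel (\<lambda>z. indicator {t1..t2} (snd z) *\<^sub>R flux p (U z))"
  by (rule integrable_dominated[OF Ai]) (measurable, auto simp: indicator_def)
 have [measurable]: "Y \<in> borel_measurable borel" using lborel_Fubini_fst(2)[OF Aind] by (simp add: Y_def[abs_def])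
 \<comment> \<open>Chosen so that \<open>\<eta> powr (1 - p) * (t2 - t1) \<le> 1/2\<close>, which allows absorption below.\<close>
 define \<eta> where "\<eta> = max 1 (2 * (t2 - t1))"
 have \<eta>: "\<eta> \<ge> 1" "2 * (t2 - t1) \<le> \<eta>" by (auto simp: \<eta>_def)
 have \<eta>p: "\<eta> powr (1 - p) * (t2 - t1) \<le> 1 / 2"
 proof -
  have "\<eta> powr (1 - p) \<le> \<eta> powr (- 1)" using \<eta> p by (intro powr_mono) auto
  also have "\<dots> = 1 / \<eta>" using \<eta> by (simp add: powr_minus_divide)
  finally have "\<eta> powr (1 - p) * (t2 - t1) \<le> (1 / \<eta>) * (t2 - t1)" using t by (intro mult_right_mono) auto
  also have "\<dots> \<le> 1 / 2" using \<eta> by (simp add: field_simps)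
  finally show ?thesis .
 qed
 have bnd: "AE x in lborel. norm (Y x) powr (p / (p - 1)) \<le> 2 * \<eta> * (LBINT r. norm (U (x, r)) powr p)"
  using lborel_Fubini_fst(1)[OF Up] lborel_Fubini_fst(1)[OF Aind]
 proof eventually_elim
  case (elim x)
  have i1: "integrable lborel (\<lambda>r. indicator {t1..t2} r *\<^sub>R flux p (U (x, r)))" using elim(2) by simp
  define y where "y = norm (Y x)"
  define m where "m = y powr (1 / (p - 1))"
  have y: "y \<ge> 0" and m0: "m \<ge> 0" by (auto simp: y_def m_def)
  have mp: "m powr p = y powr (p / (p - 1))" using p by (simp add: m_def powr_powr)
  have ym: "y * m = y powr (p / (p - 1))"
  proof -
   have "p / (p - 1) = 1 + 1 / (p - 1)" using p by (simp add: field_simps)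
   then show ?thesis using y powr_mult_base[of y "1 / (p - 1)"] by (simp add: m_def add.commute)
  qed
  have pw: "(norm (U (x, r)) powr (p - 1)) powr (p / (p - 1)) = norm (U (x, r)) powr p" for r
   using p by (simp add: powr_powr)
  let ?g = "\<lambda>r. indicator {t1..t2} r * (\<eta> * norm (U (x, r)) powr p + \<eta> powr (1 - p) * m powr p)"
  have i2: "integrable lborel (\<lambda>r. \<eta> * norm (U (x, r)) powr p)" using elim(1) by auto
  have i3: "integrable lborel (\<lambda>r. indicator {t1..t2} r * (\<eta> powr (1 - p) * m powr p))" using t by (intro integrable_mult_left integrable_real_indicator) auto
  have i2': "integrable lborel (\<lambda>r. indicator {t1..t2} r * (\<eta> * norm (U (x, r)) powr p))"
   using integrable_mult_indicator[of "{t1..t2}" lborel, OF _ i2] by simp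
  have "y \<le> (LBINT r. norm (indicator {t1..t2} r *\<^sub>R flux p (U (x, r))))"
   unfolding y_def Y_def by (rule integral_norm_bound)
  then have "y * m \<le> (LBINT r. norm (indicator {t1..t2} r *\<^sub>R flux p (U (x, r)))) * m" using m0 by (rule mult_right_mono)
  also have "\<dots> = (LBINT r. norm (indicator {t1..t2} r *\<^sub>R flux p (U (x, r))) * m)" by simp
  also have "\<dots> \<le> (LBINT r. indicator {t1..t2} r * (\<eta> * norm (U (x, r)) powr p) + indicator {t1..t2} r * (\<eta> powr (1 - p) * m powr p))"
  proof (rule integral_mono)
   show "integrable lborel (\<lambda>r. norm (indicator {t1..t2} r *\<^sub>R flux p (U (x, r))) * m)"
    using integrable_norm[OF i1] by (rule integrable_mult_left)
   show "integrable lborel (\<lambda>r. indicator {t1..t2} r * (\<eta> * norm (U (x, r)) powr p) + indicator {t1..t2} r * (\<eta> powr (1 - p) * m powr p))"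
    using i2' i3 by (rule Bochner_Integration.integrable_add)
   fix r
   have "norm (U (x, r)) powr (p - 1) * m \<le> \<eta> * (norm (U (x, r)) powr (p - 1)) powr (p / (p - 1)) + \<eta> powr (1 - p) * m powr p"
    by (rule young_powr) (use p \<eta> m0 in auto)
   then show "norm (indicator {t1..t2} r *\<^sub>R flux p (U (x, r))) * m \<le>
     indicator {t1..t2} r * (\<eta> * norm (U (x, r)) powr p) + indicator {t1..t2} r * (\<eta> powr (1 - p) * m powr p)"
    unfolding pw by (simp add: indicator_def norm_flux)
  qed
  also have "\<dots> = (LBINT r. indicator {t1..t2} r * (\<eta> * norm (U (x, r)) powr p)) + (LBINT r. indicator {t1..t2} r * (\<eta> powr (1 - p) * m powr p))"
   using i2' i3 by (rule Bochner_Integration.integral_add)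
  also have "(LBINT r. indicator {t1..t2} r * (\<eta> * norm (U (x, r)) powr p)) \<le> (LBINT r. \<eta> * norm (U (x, r)) powr p)"
   by (rule integral_mono[OF i2' i2]) (use \<eta> in \<open>auto simp: indicator_def\<close>)
  also have "(LBINT r. \<eta> * norm (U (x, r)) powr p) = \<eta> * (LBINT r. norm (U (x, r)) powr p)" by simp
  also have "(LBINT r. indicator {t1..t2} r * (\<eta> powr (1 - p) * m powr p)) = (\<eta> powr (1 - p) * (t2 - t1)) * m powr p" using t by simp
  also have "\<dots> \<le> 1 / 2 * m powr p" by (rule mult_right_mono[OF \<eta>p]) simp
  finally have "y powr (p / (p - 1)) \<le> \<eta> * (LBINT r. norm (U (x, r)) powr p) + 1 / 2 * y powr (p / (p - 1))"
   unfolding ym mp by simp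
  then show ?case unfolding y_def[symmetric] by simp
 qed
 have "integrable lborel (\<lambda>x. norm (Y x) powr (p / (p - 1)))"
 proof (rule integrable_dominated)
  show "integrable lborel (\<lambda>x. 2 * \<eta> * (LBINT r. norm (U (x, r)) powr p))" using lborel_Fubini_fst(2)[OF Up] by simp
  show "AE x in lborel. norm (norm (Y x) powr (p / (p - 1))) \<le> norm (2 * \<eta> * (LBINT r. norm (U (x, r)) powr p))"
   using bnd by eventually_elim (metis abs_ge_self abs_of_nonneg order_trans powr_ge_zero real_norm_def)
 qed measurable
 then show ?thesis by (simp add: Y_def)
qed

text \<open>
 \<open>U\<close> is the spatial gradient of \<open>u\<close>, and \<open>D\<psi>\<close> that of \<open>\<psi>\<close>. Values outside the cylinder are zero, so that all
 integrals extend over the whole space and translations in time make sense.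
\<close>

locale borel_solution =
 fixes p T L :: real and \<Omega> :: "'a::euclidean_space set" and \<psi> :: "'a \<times> real \<Rightarrow> real" and D\<psi> :: "'a \<times> real \<Rightarrow> 'a"
  and u :: "'a \<times> real \<Rightarrow> real" and U :: "'a \<times> real \<Rightarrow> 'a"
 assumes p: "p \<ge> 2" and T: "T > 0" and L: "L \<ge> 1" and open_\<Omega>: "open \<Omega>" and bounded_\<Omega>: "bounded \<Omega>"
  and u_borel [measurable]: "u \<in> borel_measurable borel" and U_borel [measurable]: "U \<in> borel_measurable borel"
  and outside: "z \<notin> cylinder \<Omega> T \<Longrightarrow> u z = 0" "z \<notin> cylinder \<Omega> T \<Longrightarrow> U z = 0"
  and u_Lp: "integrable lborel (\<lambda>z. \<bar>u z\<bar> powr p)" and U_Lp: "integrable lborel (\<lambda>z. norm (U z) powr p)"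
  and weak_eq: "\<gamma> \<in> test_functions (cylinder \<Omega> T) \<Longrightarrow>
    (LBINT z. - b_fun p (u z) * time_deriv \<gamma> z + flux p (U z) \<bullet> space_grad \<gamma> z) = 0"
  and \<psi>_space: "x \<in> \<Omega> \<Longrightarrow> 0 < t \<Longrightarrow> t < T \<Longrightarrow> ((\<lambda>x. \<psi> (x, t)) has_derivative (\<lambda>h. D\<psi> (x, t) \<bullet> h)) (at x)"
   "0 < t \<Longrightarrow> t < T \<Longrightarrow> continuous_on \<Omega> (\<lambda>x. D\<psi> (x, t))"
  and \<psi>_time: "x \<in> \<Omega> \<Longrightarrow> 0 < s \<Longrightarrow> s < T \<Longrightarrow> 0 < t \<Longrightarrow> t < T \<Longrightarrow> \<bar>\<psi> (x, t) - \<psi> (x, s)\<bar> \<le> L * \<bar>t - s\<bar>"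
  and boundary: "AE t in lborel. 0 < t \<and> t < T \<longrightarrow> approximable p \<Omega> (\<lambda>x. u (x, t) - \<psi> (x, t)) (\<lambda>x. U (x, t) - D\<psi> (x, t))"
begin

lemma \<Omega>_borel [measurable]: "\<Omega> \<in> sets borel" using open_\<Omega> by auto

lemma cyl_borel [measurable]: "cylinder \<Omega> T \<in> sets borel"
 by (intro borel_open open_Times open_\<Omega>) auto

lemma cyl_finite: "emeasure lborel (cylinder \<Omega> T) < \<infinity>"
 by (intro emeasure_bounded_finite bounded_Times bounded_\<Omega>) auto

lemma cyl_integrable: "integrable lborel (\<lambda>z. indicator (cylinder \<Omega> T) z :: real)"
 using cyl_finite by (simp add: integrable_real_indicator)

text \<open>
 Since all exponents that occur lie between \<open>0\<close> and \<open>p\<close>, this majorises every term of the equation.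
\<close>

definition env :: "'a \<times> real \<Rightarrow> real" where
 "env z = indicator (cylinder \<Omega> T) z + \<bar>u z\<bar> powr p + norm (U z) powr p"

lemma env_integrable: "integrable lborel env"
 unfolding env_def using cyl_integrable u_Lp U_Lp by auto

lemma env_borel [measurable]: "env \<in> borel_measurable borel"
 using env_integrable by auto

lemma env_bounds: "0 \<le> env z" "\<bar>u z\<bar> powr p \<le> env z" "norm (U z) powr p \<le> env z" "\<bar>b_fun p (u z)\<bar> \<le> env z"
 "norm (flux p (U z)) \<le> env z" "\<bar>u z\<bar> \<le> env z" "norm (U z) \<le> env z" "indicator (cylinder \<Omega> T) z \<le> env z"
proof -
 have *: "y powr q \<le> indicator (cylinder \<Omega> T) z + y powr p" if "z \<notin> cylinder \<Omega> T \<Longrightarrow> y = 0" "0 \<le> y" "0 \<le> q" "q \<le> p" for y q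
  using that powr_le_one_plus[of q p y] by (cases "z \<in> cylinder \<Omega> T") auto
 note ** = *[of "\<bar>u z\<bar>" 1] *[of "norm (U z)" 1] *[of "\<bar>u z\<bar>" "p - 1"] *[of "norm (U z)" "p - 1"]
 have "\<bar>u z\<bar> \<le> indicator (cylinder \<Omega> T) z + \<bar>u z\<bar> powr p" "norm (U z) \<le> indicator (cylinder \<Omega> T) z + norm (U z) powr p"
  "\<bar>u z\<bar> powr (p - 1) \<le> indicator (cylinder \<Omega> T) z + \<bar>u z\<bar> powr p" "norm (U z) powr (p - 1) \<le> indicator (cylinder \<Omega> T) z + norm (U z) powr p"
  using ** outside[of z] p by simp_all
 moreover have "0 \<le> \<bar>u z\<bar> powr p" "0 \<le> norm (U z) powr p" "0 \<le> (indicator (cylinder \<Omega> T) z :: real)" by auto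
 ultimately show "0 \<le> env z" "\<bar>u z\<bar> powr p \<le> env z" "norm (U z) powr p \<le> env z" "\<bar>b_fun p (u z)\<bar> \<le> env z"
  "norm (flux p (U z)) \<le> env z" "\<bar>u z\<bar> \<le> env z" "norm (U z) \<le> env z" "indicator (cylinder \<Omega> T) z \<le> env z"
  unfolding env_def abs_b_fun norm_flux by linarith+
qed

lemma b_integrable: "integrable lborel (\<lambda>z. b_fun p (u z))"
 by (rule integrable_dominated[OF env_integrable]) (measurable, use env_bounds in auto)

lemma flux_integrable: "integrable lborel (\<lambda>z. flux p (U z))"
 by (rule integrable_dominated[OF env_integrable]) (measurable, use env_bounds in auto)

lemma U_integrable: "integrable lborel U" and u_integrable: "integrable lborel u"
 by (rule integrable_dominated[OF env_integrable], measurable, use env_bounds in auto)+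

text \<open>
 The times whose slices are integrable and attain the boundary values.
\<close>

definition good :: "real \<Rightarrow> bool" where
 "good t \<longleftrightarrow> integrable lborel (\<lambda>x. env (x, t)) \<and>
   (0 < t \<and> t < T \<longrightarrow> approximable p \<Omega> (\<lambda>x. u (x, t) - \<psi> (x, t)) (\<lambda>x. U (x, t) - D\<psi> (x, t)))"

theorem good_times:
 obtains N where "N \<in> null_sets lborel" "\<And>t. t \<notin> N \<Longrightarrow> good t"
  "\<And>t1 t2 \<phi>. 0 < t1 \<Longrightarrow> t1 < t2 \<Longrightarrow> t2 < T \<Longrightarrow> t1 \<notin> N \<Longrightarrow> t2 \<notin> N \<Longrightarrow> \<phi> \<in> test_functions \<Omega> \<Longrightarrow>
    Lam (\<lambda>x. b_fun p (u (x, t2)) - b_fun p (u (x, t1))) (\<lambda>x. LBINT r. indicator {t1..t2} r *\<^sub>R flux p (U (x, r))) \<phi> (grad \<phi>) = 0"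
proof -
 obtain N where N: "N \<in> null_sets lborel"
  "\<And>t1 t2 \<phi>. 0 < t1 \<Longrightarrow> t1 < t2 \<Longrightarrow> t2 < T \<Longrightarrow> t1 \<notin> N \<Longrightarrow> t2 \<notin> N \<Longrightarrow> \<phi> \<in> test_functions \<Omega> \<Longrightarrow>
    Lam (\<lambda>x. b_fun p (u (x, t2)) - b_fun p (u (x, t1))) (\<lambda>x. LBINT r. indicator {t1..t2} r *\<^sub>R flux p (U (x, r))) \<phi> (grad \<phi>) = 0"
  by (rule weak_in_time[OF T b_integrable flux_integrable bounded_\<Omega> weak_eq], assumption, rule that)
 have "AE t in lborel. good t" using lborel_Fubini_snd(1)[OF env_integrable] boundary
  by eventually_elim (simp add: good_def)
 then obtain N' where N': "N' \<in> null_sets lborel" "\<And>t. t \<notin> N' \<Longrightarrow> good t" unfolding eventually_ae_filter by auto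
 show thesis by (rule that[of "N \<union> N'"]) (use N N' in auto)
qed

end

section \<open>Two solutions at two times\<close>

locale solution_pair =
 u: borel_solution p T L \<Omega> \<psi> D\<psi> u U + v: borel_solution p T L \<Omega> \<psi> D\<psi> v V
 for p T L :: real and \<Omega> :: "'a::euclidean_space set" and \<psi> D\<psi> u U v V
begin

text \<open>
 The test function, and below its spatial gradient.
\<close>

definition tst :: "real \<Rightarrow> 'a \<times> real \<Rightarrow> 'a \<times> real \<Rightarrow> real" where
 "tst \<epsilon> z z' = step ((u z - v z' - \<epsilon> * L) / \<epsilon>)"

definition tst' :: "real \<Rightarrow> 'a \<times> real \<Rightarrow> 'a \<times> real \<Rightarrow> 'a" where
 "tst' \<epsilon> z z' = (tent ((u z - v z' - \<epsilon> * L) / \<epsilon>) / \<epsilon>) *\<^sub>R (U z - V z')"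

lemma tst_bounds: "0 \<le> tst \<epsilon> z z'" "tst \<epsilon> z z' \<le> 1" by (simp_all add: tst_def step_bounds)

lemma norm_tst': "\<epsilon> > 0 \<Longrightarrow> norm (tst' \<epsilon> z z') \<le> (2 / \<epsilon>) * (norm (U z) + norm (V z'))"
proof -
 assume \<epsilon>: "\<epsilon> > 0"
 have "norm (tst' \<epsilon> z z') = (tent ((u z - v z' - \<epsilon> * L) / \<epsilon>) / \<epsilon>) * norm (U z - V z')"
  unfolding tst'_def using \<epsilon> tent_bounds by simp
 also have "\<dots> \<le> (2 / \<epsilon>) * (norm (U z) + norm (V z'))"
  using \<epsilon> tent_bounds by (intro mult_mono norm_triangle_ineq4 divide_right_mono) auto
 finally show ?thesis .
qed

lemma tst_measurable [measurable]:
 assumes [measurable]: "f \<in> M \<rightarrow>\<^sub>M borel" "g \<in> M \<rightarrow>\<^sub>M borel"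
 shows "(\<lambda>w. tst \<epsilon> (f w) (g w)) \<in> borel_measurable M" "(\<lambda>w. tst' \<epsilon> (f w) (g w)) \<in> borel_measurable M"
 unfolding tst_def tst'_def by measurable

lemma slice_borel: "(\<lambda>x. (x, t)) \<in> borel \<rightarrow>\<^sub>M (borel :: ('a \<times> real) measure)"
 by (intro borel_measurable_continuous_onI continuous_intros)

text \<open>
 The time lag is at most \<open>\<epsilon>\<close>, so \<open>\<psi>(x,t) - \<psi>(x,s) \<le> \<epsilon>L\<close>, and the step function vanishes for arguments up to \<open>\<epsilon>L\<close>.
 Therefore \<open>Lam_zero_chain\<close> applies to the difference of the two solutions.
\<close>

lemma chain_zero:
 assumes \<epsilon>: "\<epsilon> > 0" and t: "0 < t" "t < T" "u.good t" and s: "0 < s" "s < T" "v.good s" and ts: "\<bar>t - s\<bar> \<le> \<epsilon>"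
  and B: "integrable lborel B" and A: "integrable lborel A" "integrable lborel (\<lambda>x. norm (A x) powr (p / (p - 1)))"
  and z: "\<And>\<phi>. \<phi> \<in> test_functions \<Omega> \<Longrightarrow> Lam B A \<phi> (grad \<phi>) = 0"
 shows "Lam B A (\<lambda>x. tst \<epsilon> (x, t) (x, s)) (\<lambda>x. tst' \<epsilon> (x, t) (x, s)) = 0"
proof -
 have p: "p > 1" using u.p by simp
 note [measurable] = slice_borel
 obtain \<phi> where \<phi>: "\<And>k::nat. \<phi> k \<in> test_functions \<Omega>"
   "\<And>k. integrable lborel (\<lambda>x. indicator \<Omega> x * \<bar>\<phi> k x - (u (x, t) - \<psi> (x, t))\<bar> powr p)"
   "(\<lambda>k. LBINT x. indicator \<Omega> x * \<bar>\<phi> k x - (u (x, t) - \<psi> (x, t))\<bar> powr p) \<longlonglongrightarrow> 0"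
   "\<And>k. integrable lborel (\<lambda>x. indicator \<Omega> x * norm (grad (\<phi> k) x - (U (x, t) - D\<psi> (x, t))) powr p)"
   "(\<lambda>k. LBINT x. indicator \<Omega> x * norm (grad (\<phi> k) x - (U (x, t) - D\<psi> (x, t))) powr p) \<longlonglongrightarrow> 0"
  using t unfolding u.good_def approximable_def by blast
 obtain \<kappa> where \<kappa>: "\<And>k::nat. \<kappa> k \<in> test_functions \<Omega>"
   "\<And>k. integrable lborel (\<lambda>x. indicator \<Omega> x * \<bar>\<kappa> k x - (v (x, s) - \<psi> (x, s))\<bar> powr p)"
   "(\<lambda>k. LBINT x. indicator \<Omega> x * \<bar>\<kappa> k x - (v (x, s) - \<psi> (x, s))\<bar> powr p) \<longlonglongrightarrow> 0"
   "\<And>k. integrable lborel (\<lambda>x. indicator \<Omega> x * norm (grad (\<kappa> k) x - (V (x, s) - D\<psi> (x, s))) powr p)"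
   "(\<lambda>k. LBINT x. indicator \<Omega> x * norm (grad (\<kappa> k) x - (V (x, s) - D\<psi> (x, s))) powr p) \<longlonglongrightarrow> 0"
  using s unfolding v.good_def approximable_def by blast
 \<comment> \<open>The approximations of \<open>u - \<psi>\<close> at time \<open>t\<close> and of \<open>v - \<psi>\<close> at time \<open>s\<close>.\<close>
 define \<theta> where "\<theta> k x = \<phi> k x - 1 * \<kappa> k x" for k x
 have \<theta>: "\<theta> k \<in> test_functions \<Omega>" for k unfolding \<theta>_def by (rule test_functions_diff_scaled[OF \<phi>(1) \<kappa>(1)])
 have grad_\<theta>: "grad (\<theta> k) x = grad (\<phi> k) x - grad (\<kappa> k) x" for k x
 proof -
  have "(\<theta> k has_derivative (\<lambda>h. grad (\<phi> k) x \<bullet> h - grad (\<kappa> k) x \<bullet> h)) (at x)"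
   unfolding \<theta>_def using has_derivative_diff[OF test_functions_has_derivative[OF \<phi>(1)[of k]] test_functions_has_derivative[OF \<kappa>(1)[of k]]]
   by (simp add: grad_inner[OF \<phi>(1)] grad_inner[OF \<kappa>(1)])
  then have "(\<lambda>h. grad (\<phi> k) x \<bullet> h - grad (\<kappa> k) x \<bullet> h) = (\<lambda>h. grad (\<theta> k) x \<bullet> h)"
   using frechet_derivative_at grad_inner[OF \<theta>] by metis
  then have "(grad (\<phi> k) x - grad (\<kappa> k) x) \<bullet> h = grad (\<theta> k) x \<bullet> h" for h
   unfolding inner_diff_left by (rule fun_cong)
  then show ?thesis by (metis vector_eq_rdot)
 qed
 define g where "g x = \<psi> (x, t) - \<psi> (x, s)" for x
 define g' where "g' x = D\<psi> (x, t) - D\<psi> (x, s)" for x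
 have gd: "(g has_derivative (\<lambda>h. g' x \<bullet> h)) (at x)" if "x \<in> \<Omega>" for x
  unfolding g_def[abs_def] g'_def inner_diff_left using t s that by (intro has_derivative_diff u.\<psi>_space)
 have g'c: "continuous_on \<Omega> g'" unfolding g'_def[abs_def] using t s by (intro continuous_on_diff u.\<psi>_space)
 have gle: "g x \<le> \<epsilon> * L" if "x \<in> \<Omega>" for x
 proof -
  have "g x \<le> L * \<bar>t - s\<bar>" using u.\<psi>_time[OF that s(1,2) t(1,2)] by (simp add: g_def)
  also have "\<dots> \<le> L * \<epsilon>" using ts u.L by (intro mult_left_mono) auto
  finally show ?thesis by (simp add: mult.commute)
 qed
 have gc: "continuous_on \<Omega> g"
  by (rule continuous_at_imp_continuous_on) (use has_derivative_continuous[OF gd] in simp)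
 have gm[measurable]: "(\<lambda>x. indicator \<Omega> x * g x) \<in> borel_measurable borel"
  using borel_measurable_continuous_on_indicator[OF _ gc] by simp
 have g'm[measurable]: "(\<lambda>x. indicator \<Omega> x *\<^sub>R g' x) \<in> borel_measurable borel"
  using borel_measurable_continuous_on_indicator[OF _ g'c] by simp
 have \<theta>m[measurable]: "\<theta> k \<in> borel_measurable borel" "grad (\<theta> k) \<in> borel_measurable borel" for k
 proof -
  obtain K where K: "C1c K (\<theta> k) (grad (\<theta> k))" using test_functions_C1c[OF \<theta>] by metis
  show "\<theta> k \<in> borel_measurable borel" "grad (\<theta> k) \<in> borel_measurable borel"
   using C1cD(3,5)[OF K] by (auto intro: borel_measurable_continuous_onI)
 qed
 let ?f = "\<lambda>x. u (x, t) - v (x, s)" and ?G = "\<lambda>x. U (x, t) - V (x, s)"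
 have m1: "(\<lambda>x. indicator \<Omega> x * norm (\<theta> k x + g x - ?f x) powr p) \<in> borel_measurable lborel" for k
 proof -
  have "(\<lambda>x. indicator \<Omega> x * norm (\<theta> k x + g x - ?f x) powr p) = (\<lambda>x. indicator \<Omega> x * norm (\<theta> k x + indicator \<Omega> x * g x - ?f x) powr p)"
   by (auto simp: indicator_def fun_eq_iff)
  moreover have "(\<lambda>x. indicator \<Omega> x * norm (\<theta> k x + indicator \<Omega> x * g x - ?f x) powr p) \<in> borel_measurable lborel" by measurable
  ultimately show ?thesis by simp
 qed
 have m2: "(\<lambda>x. indicator \<Omega> x * norm (grad (\<theta> k) x + g' x - ?G x) powr p) \<in> borel_measurable lborel" for k
 proof -
  have "(\<lambda>x. indicator \<Omega> x * norm (grad (\<theta> k) x + g' x - ?G x) powr p) = (\<lambda>x. indicator \<Omega> x * norm (grad (\<theta> k) x + indicator \<Omega> x *\<^sub>R g' x - ?G x) powr p)"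
   by (auto simp: indicator_def fun_eq_iff)
  moreover have "(\<lambda>x. indicator \<Omega> x * norm (grad (\<theta> k) x + indicator \<Omega> x *\<^sub>R g' x - ?G x) powr p) \<in> borel_measurable lborel" by measurable
  ultimately show ?thesis by simp
 qed
 have p0: "p > 0" using p by simp
 have c1: "\<theta> k x + g x - ?f x = (\<phi> k x - (u (x, t) - \<psi> (x, t))) - (\<kappa> k x - (v (x, s) - \<psi> (x, s)))" for k x
  by (simp add: \<theta>_def g_def)
 note conv1 = Lp_conv_diff[OF p0 m1 c1 \<phi>(2)[folded real_norm_def] \<phi>(3)[folded real_norm_def] \<kappa>(2)[folded real_norm_def] \<kappa>(3)[folded real_norm_def]]
 have c2: "grad (\<theta> k) x + g' x - ?G x = (grad (\<phi> k) x - (U (x, t) - D\<psi> (x, t))) - (grad (\<kappa> k) x - (V (x, s) - D\<psi> (x, s)))" for k x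
  by (simp add: grad_\<theta> g'_def)
 note conv2 = Lp_conv_diff[OF p0 m2 c2 \<phi>(4) \<phi>(5) \<kappa>(4) \<kappa>(5)]
 have Gp: "integrable lborel (\<lambda>x. indicator \<Omega> x * norm (?G x) powr p)"
 proof (rule integrable_dominated)
  show "integrable lborel (\<lambda>x. 3 powr p * (u.env (x, t) + v.env (x, s)))" using t s unfolding u.good_def v.good_def by simp
  have "norm (?G x) powr p \<le> 3 powr p * (u.env (x, t) + v.env (x, s))" for x
  proof -
   have "norm (?G x) powr p \<le> 3 powr p * (norm (U (x, t)) powr p + norm (V (x, s)) powr p)" by (rule norm_diff_powr_le[OF p0])
   also have "\<dots> \<le> 3 powr p * (u.env (x, t) + v.env (x, s))"
    using u.env_bounds(3)[of "(x, t)"] v.env_bounds(3)[of "(x, s)"] by (intro mult_left_mono add_mono) auto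
   finally show ?thesis .
  qed
  then show "AE x in lborel. norm (indicator \<Omega> x * norm (?G x) powr p) \<le> norm (3 powr p * (u.env (x, t) + v.env (x, s)))"
   using u.env_bounds(1) v.env_bounds(1) by (auto simp: indicator_def intro!: AE_I2)
 qed measurable
 let ?H = "\<lambda>y. step ((y - \<epsilon> * L) / \<epsilon>)" and ?H' = "\<lambda>y. tent ((y - \<epsilon> * L) / \<epsilon>) / \<epsilon>"
 have H1: "(?H has_real_derivative ?H' y) (at y)" for y
 proof -
  have "((\<lambda>y. (y - \<epsilon> * L) / \<epsilon>) has_real_derivative 1 / \<epsilon>) (at y)" using \<epsilon> by (auto intro!: derivative_eq_intros)
  from DERIV_chain2[where f=step and g="\<lambda>y. (y - \<epsilon> * L) / \<epsilon>", OF step_DERIV this] show ?thesis by simp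
 qed
 have H2: "continuous_on UNIV ?H'"
  by (intro continuous_intros continuous_on_compose2[OF tent_continuous]) (use \<epsilon> in auto)
 have H3: "?H y = 0" if "y \<le> \<epsilon> * L" for y
  by (rule step_le_0) (use that \<epsilon> in \<open>simp add: divide_nonpos_pos\<close>)
 have H4: "\<bar>?H y\<bar> \<le> 1" for y using step_bounds by simp
 have H5: "\<bar>?H' y\<bar> \<le> 2 / \<epsilon>" for y using tent_bounds \<epsilon> by (simp add: divide_right_mono)
 have main: "Lam B A (\<lambda>x. if x \<in> \<Omega> then ?H (?f x) else 0) (\<lambda>x. if x \<in> \<Omega> then ?H' (?f x) *\<^sub>R ?G x else 0) = 0"
  by (rule Lam_zero_chain[OF p u.open_\<Omega> B A z gd g'c gle \<theta> _ _ Gp conv1[unfolded real_norm_def] conv2 H1 H2 H3 H4 H5]) measurable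
 have out: "u (x, t) = 0 \<and> v (x, s) = 0" if "x \<notin> \<Omega>" for x using that by (auto intro: u.outside v.outside)
 have outG: "U (x, t) = 0 \<and> V (x, s) = 0" if "x \<notin> \<Omega>" for x using that by (auto intro: u.outside v.outside)
 have "(\<lambda>x. if x \<in> \<Omega> then ?H (?f x) else 0) = (\<lambda>x. tst \<epsilon> (x, t) (x, s))"
 proof
  fix x
  show "(if x \<in> \<Omega> then ?H (?f x) else 0) = tst \<epsilon> (x, t) (x, s)"
  proof (cases "x \<in> \<Omega>")
   case False
   then have "tst \<epsilon> (x, t) (x, s) = ?H 0" using out by (simp add: tst_def)
   also have "\<dots> = 0" by (rule H3) (use \<epsilon> u.L in simp)
   finally show ?thesis using False by simp
  qed (simp add: tst_def)
 qed
 moreover have "(\<lambda>x. if x \<in> \<Omega> then ?H' (?f x) *\<^sub>R ?G x else 0) = (\<lambda>x. tst' \<epsilon> (x, t) (x, s))"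
  using outG by (auto simp: tst'_def fun_eq_iff)
 ultimately show ?thesis using main by simp
qed

lemma pair_young:
 assumes \<epsilon>: "\<epsilon> > 0"
 shows "norm (X::'a) * norm (tst' \<epsilon> z z') \<le> norm X powr (p / (p - 1)) + (2 / \<epsilon>) powr p * (3 powr p * (u.env z + v.env z'))"
proof -
 have p: "p > 1" using u.p by simp
 have "norm X * norm (tst' \<epsilon> z z') \<le> 1 * norm X powr (p / (p - 1)) + 1 powr (1 - p) * norm (tst' \<epsilon> z z') powr p"
  by (rule young_powr[OF p]) auto
 moreover have "norm (tst' \<epsilon> z z') powr p \<le> (2 / \<epsilon>) powr p * (3 powr p * (u.env z + v.env z'))"
 proof -
  have "norm (tst' \<epsilon> z z') powr p \<le> ((2 / \<epsilon>) * (norm (U z) + norm (V z') + 0)) powr p"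
   using norm_tst'[OF \<epsilon>, of z z'] p by (intro powr_mono2) auto
  also have "\<dots> = (2 / \<epsilon>) powr p * (norm (U z) + norm (V z') + 0) powr p" using \<epsilon> by (intro powr_mult)
  also have "(norm (U z) + norm (V z') + 0) powr p \<le> 3 powr p * (norm (U z) powr p + norm (V z') powr p + 0 powr p)"
   using p by (intro powr_sum3_le) auto
  also have "\<dots> \<le> 3 powr p * (u.env z + v.env z')"
   using u.env_bounds(3)[of z] v.env_bounds(3)[of z'] p by (intro mult_left_mono) auto
  finally show ?thesis by (simp add: mult_left_mono)
 qed
 ultimately show ?thesis by simp
qed

lemma flux_young:
 assumes \<epsilon>: "\<epsilon> > 0"
 shows "\<bar>(flux p X - flux p Y) \<bullet> tst' \<epsilon> z z'\<bar> \<le> norm X powr p + norm Y powr p + 2 * ((2 / \<epsilon>) powr p * (3 powr p * (u.env z + v.env z')))"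
proof -
 have pw: "norm (flux p W) powr (p / (p - 1)) = norm W powr p" for W :: 'a
  using u.p by (simp add: norm_flux powr_powr)
 have "\<bar>(flux p X - flux p Y) \<bullet> tst' \<epsilon> z z'\<bar> \<le> \<bar>flux p X \<bullet> tst' \<epsilon> z z'\<bar> + \<bar>flux p Y \<bullet> tst' \<epsilon> z z'\<bar>"
  by (simp add: inner_diff_left)
 also have "\<dots> \<le> norm (flux p X) * norm (tst' \<epsilon> z z') + norm (flux p Y) * norm (tst' \<epsilon> z z')"
  by (intro add_mono Cauchy_Schwarz_ineq2)
 also have "\<dots> \<le> norm X powr p + norm Y powr p + 2 * ((2 / \<epsilon>) powr p * (3 powr p * (u.env z + v.env z')))"
  using pair_young[OF \<epsilon>, of "flux p X" z z'] pair_young[OF \<epsilon>, of "flux p Y" z z'] unfolding pw by linarith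
 finally show ?thesis .
qed

definition Eu :: "real \<Rightarrow> 'a \<times> real \<Rightarrow> 'a \<times> real \<Rightarrow> real" where "Eu \<epsilon> z z' = ent1 p L \<epsilon> (u z) (v z')"
definition Ev :: "real \<Rightarrow> 'a \<times> real \<Rightarrow> 'a \<times> real \<Rightarrow> real" where "Ev \<epsilon> z z' = ent2 p L \<epsilon> (u z) (v z')"

lemma E_measurable [measurable]:
 assumes [measurable]: "f \<in> M \<rightarrow>\<^sub>M borel" "g \<in> M \<rightarrow>\<^sub>M borel"
 shows "(\<lambda>w. Eu \<epsilon> (f w) (g w)) \<in> borel_measurable M" "(\<lambda>w. Ev \<epsilon> (f w) (g w)) \<in> borel_measurable M"
 unfolding Eu_def Ev_def by measurable

lemma E_bounds:
 assumes \<epsilon>: "\<epsilon> > 0"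
 shows "0 \<le> Eu \<epsilon> z z'" "Eu \<epsilon> z z' \<le> u.env z + v.env z'" "0 \<le> Ev \<epsilon> z z'" "Ev \<epsilon> z z' \<le> u.env z + v.env z'"
proof -
 have L: "L \<ge> 0" using u.L by simp
 have "max 0 (b_fun p (u z) - b_fun p (v z')) \<le> u.env z + v.env z'"
  using u.env_bounds(1,4)[of z] v.env_bounds(1,4)[of z'] by linarith
 then show "0 \<le> Eu \<epsilon> z z'" "Eu \<epsilon> z z' \<le> u.env z + v.env z'" "0 \<le> Ev \<epsilon> z z'" "Ev \<epsilon> z z' \<le> u.env z + v.env z'"
  using ent_bounds[OF u.p L \<epsilon>, of "u z" "v z'"] unfolding Eu_def Ev_def by linarith+
qed

text \<open>
 The equations of \<open>u\<close> between \<open>t1\<close> and \<open>t2\<close> and of \<open>v\<close> between \<open>s1\<close> and \<open>s2\<close> are tested with the same function, formed at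
 the later times \<open>t2\<close> and \<open>s2\<close>. Convexity bounds the parabolic terms from below by increments of the entropies,
 each of them in only one of the two time variables.
\<close>

theorem slice_inequality:
 assumes \<epsilon>: "\<epsilon> > 0"
 obtains N where "N \<in> null_sets lborel" "\<And>t. t \<notin> N \<Longrightarrow> u.good t \<and> v.good t"
  "\<And>t1 t2 s1 s2. 0 < t1 \<Longrightarrow> t1 < t2 \<Longrightarrow> t2 < T \<Longrightarrow> 0 < s1 \<Longrightarrow> s1 < s2 \<Longrightarrow> s2 < T \<Longrightarrow> \<bar>t2 - s2\<bar> \<le> \<epsilon> \<Longrightarrow>
    t1 \<notin> N \<Longrightarrow> t2 \<notin> N \<Longrightarrow> s1 \<notin> N \<Longrightarrow> s2 \<notin> N \<Longrightarrow>
    (LBINT x. Eu \<epsilon> (x, t2) (x, s2) - Eu \<epsilon> (x, t1) (x, s2) + (Ev \<epsilon> (x, t2) (x, s2) - Ev \<epsilon> (x, t2) (x, s1)))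
    \<le> - (LBINT x. ((LBINT r. indicator {t1..t2} r *\<^sub>R flux p (U (x, r))) - (LBINT r. indicator {s1..s2} r *\<^sub>R flux p (V (x, r)))) \<bullet> tst' \<epsilon> (x, t2) (x, s2))"
proof -
 note [measurable] = slice_borel
 have L: "L \<ge> 0" using u.L by simp
 obtain Nu where Nu: "Nu \<in> null_sets lborel" "\<And>t. t \<notin> Nu \<Longrightarrow> u.good t"
  "\<And>t1 t2 \<phi>. 0 < t1 \<Longrightarrow> t1 < t2 \<Longrightarrow> t2 < T \<Longrightarrow> t1 \<notin> Nu \<Longrightarrow> t2 \<notin> Nu \<Longrightarrow> \<phi> \<in> test_functions \<Omega> \<Longrightarrow>
    Lam (\<lambda>x. b_fun p (u (x, t2)) - b_fun p (u (x, t1))) (\<lambda>x. LBINT r. indicator {t1..t2} r *\<^sub>R flux p (U (x, r))) \<phi> (grad \<phi>) = 0"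
  by (rule u.good_times, rule that)
 obtain Nv where Nv: "Nv \<in> null_sets lborel" "\<And>t. t \<notin> Nv \<Longrightarrow> v.good t"
  "\<And>t1 t2 \<phi>. 0 < t1 \<Longrightarrow> t1 < t2 \<Longrightarrow> t2 < T \<Longrightarrow> t1 \<notin> Nv \<Longrightarrow> t2 \<notin> Nv \<Longrightarrow> \<phi> \<in> test_functions \<Omega> \<Longrightarrow>
    Lam (\<lambda>x. b_fun p (v (x, t2)) - b_fun p (v (x, t1))) (\<lambda>x. LBINT r. indicator {t1..t2} r *\<^sub>R flux p (V (x, r))) \<phi> (grad \<phi>) = 0"
  by (rule v.good_times, rule that)
 show thesis
 proof (rule that[of "Nu \<union> Nv"])
  show "Nu \<union> Nv \<in> null_sets lborel" using Nu Nv by auto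
  show "u.good t \<and> v.good t" if "t \<notin> Nu \<union> Nv" for t using that Nu Nv by auto
  fix t1 t2 s1 s2 assume t: "0 < t1" "t1 < t2" "t2 < T" and s: "0 < s1" "s1 < s2" "s2 < T" and ts: "\<bar>t2 - s2\<bar> \<le> \<epsilon>"
   and N: "t1 \<notin> Nu \<union> Nv" "t2 \<notin> Nu \<union> Nv" "s1 \<notin> Nu \<union> Nv" "s2 \<notin> Nu \<union> Nv"
  have g: "u.good t1" "u.good t2" "v.good s1" "v.good s2" using N Nu(2) Nv(2) by auto
  have env: "integrable lborel (\<lambda>x. u.env (x, t1))" "integrable lborel (\<lambda>x. u.env (x, t2))"
   "integrable lborel (\<lambda>x. v.env (x, s1))" "integrable lborel (\<lambda>x. v.env (x, s2))" using g by (simp_all add: u.good_def v.good_def)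
  have bu: "integrable lborel (\<lambda>x. b_fun p (u (x, t)))" if "integrable lborel (\<lambda>x. u.env (x, t))" for t
   by (rule integrable_dominated[OF that]) (measurable, use u.env_bounds in auto)
  have bv: "integrable lborel (\<lambda>x. b_fun p (v (x, t)))" if "integrable lborel (\<lambda>x. v.env (x, t))" for t
   by (rule integrable_dominated[OF that]) (measurable, use v.env_bounds in auto)
  define Bu where "Bu x = b_fun p (u (x, t2)) - b_fun p (u (x, t1))" for x
  define Bv where "Bv x = b_fun p (v (x, s2)) - b_fun p (v (x, s1))" for x
  define Au where "Au x = (LBINT r. indicator {t1..t2} r *\<^sub>R flux p (U (x, r)))" for x
  define Av where "Av x = (LBINT r. indicator {s1..s2} r *\<^sub>R flux p (V (x, r)))" for x
  define w where "w x = tst \<epsilon> (x, t2) (x, s2)" for x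
  define W where "W x = tst' \<epsilon> (x, t2) (x, s2)" for x
  have [measurable]: "w \<in> borel_measurable borel" "W \<in> borel_measurable borel" unfolding w_def[abs_def] W_def[abs_def] by measurable
  have Bui: "integrable lborel Bu" and Bvi: "integrable lborel Bv" unfolding Bu_def[abs_def] Bv_def[abs_def] using bu bv env by auto
  have Aint: "integrable lborel (\<lambda>x. LBINT r. indicator {a..b} r *\<^sub>R F (x, r))" if F: "integrable lborel F" for a b and F :: "'a \<times> real \<Rightarrow> 'a"
  proof -
   have "integrable lborel (\<lambda>z. indicator {a..b} (snd z) *\<^sub>R F z)"
    by (rule integrable_dominated[OF F]) (use F in \<open>auto simp: indicator_def\<close>)
   from lborel_Fubini_fst(2)[OF this] show ?thesis by simp
  qed
  have Aui: "integrable lborel Au" and Avi: "integrable lborel Av"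
   unfolding Au_def[abs_def] Av_def[abs_def] by (rule Aint[OF u.flux_integrable], rule Aint[OF v.flux_integrable])
  have Aup: "integrable lborel (\<lambda>x. norm (Au x) powr (p / (p - 1)))" unfolding Au_def
   by (rule flux_average_Lq[OF u.p u.U_borel u.U_Lp u.flux_integrable t(2)])
  have Avp: "integrable lborel (\<lambda>x. norm (Av x) powr (p / (p - 1)))" unfolding Av_def
   by (rule flux_average_Lq[OF v.p v.U_borel v.U_Lp v.flux_integrable s(2)])
  have zu: "Lam Bu Au w W = 0" unfolding w_def[abs_def] W_def[abs_def]
  proof (rule chain_zero[OF \<epsilon> _ t(3) g(2) _ s(3) g(4) ts Bui Aui Aup])
   show "Lam Bu Au \<phi> (grad \<phi>) = 0" if "\<phi> \<in> test_functions \<Omega>" for \<phi>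
    unfolding Bu_def[abs_def] Au_def[abs_def] using Nu(3)[OF t] N that by blast
  qed (use t s in auto)
  have zv: "Lam Bv Av w W = 0" unfolding w_def[abs_def] W_def[abs_def]
  proof (rule chain_zero[OF \<epsilon> _ t(3) g(2) _ s(3) g(4) ts Bvi Avi Avp])
   show "Lam Bv Av \<phi> (grad \<phi>) = 0" if "\<phi> \<in> test_functions \<Omega>" for \<phi>
    unfolding Bv_def[abs_def] Av_def[abs_def] using Nv(3)[OF s] N that by blast
  qed (use t s in auto)
  have w1: "norm (w x) \<le> 1" for x using tst_bounds by (simp add: w_def)
  have iBu: "integrable lborel (\<lambda>x. Bu x * w x)" using integrable_mult_bounded[OF Bui _ w1] by simp
  have iBv: "integrable lborel (\<lambda>x. Bv x * w x)" using integrable_mult_bounded[OF Bvi _ w1] by simp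
  have iAW: "integrable lborel (\<lambda>x. X x \<bullet> W x)" if X: "integrable lborel X" "integrable lborel (\<lambda>x. norm (X x) powr (p / (p - 1)))" for X
  proof (rule integrable_dominated)
   show "integrable lborel (\<lambda>x. norm (X x) powr (p / (p - 1)) + (2 / \<epsilon>) powr p * (3 powr p * (u.env (x, t2) + v.env (x, s2))))"
    using X env by auto
   have [measurable]: "X \<in> borel_measurable borel" using X by auto
   show "(\<lambda>x. X x \<bullet> W x) \<in> borel_measurable lborel" by measurable
   show "AE x in lborel. norm (X x \<bullet> W x) \<le> norm (norm (X x) powr (p / (p - 1)) + (2 / \<epsilon>) powr p * (3 powr p * (u.env (x, t2) + v.env (x, s2))))"
   proof (rule AE_I2)
    fix x
    have "\<bar>X x \<bullet> W x\<bar> \<le> norm (X x) * norm (W x)" by (rule Cauchy_Schwarz_ineq2)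
    then show "norm (X x \<bullet> W x) \<le> norm (norm (X x) powr (p / (p - 1)) + (2 / \<epsilon>) powr p * (3 powr p * (u.env (x, t2) + v.env (x, s2))))"
     using pair_young[OF \<epsilon>, of "X x" "(x, t2)" "(x, s2)"] unfolding W_def real_norm_def by linarith
   qed
  qed
  have eu: "(LBINT x. Bu x * w x) = - (LBINT x. Au x \<bullet> W x)"
   using zu iBu iAW[OF Aui Aup] unfolding Lam_def by simp
  have ev: "(LBINT x. Bv x * w x) = - (LBINT x. Av x \<bullet> W x)"
   using zv iBv iAW[OF Avi Avp] unfolding Lam_def by simp
  have Ei: "integrable lborel (\<lambda>x. Eu \<epsilon> (x, t) (x, s))" "integrable lborel (\<lambda>x. Ev \<epsilon> (x, t) (x, s))"
   if "integrable lborel (\<lambda>x. u.env (x, t))" "integrable lborel (\<lambda>x. v.env (x, s))" for t s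
  proof -
   have i: "integrable lborel (\<lambda>x. u.env (x, t) + v.env (x, s))" using that by auto
   have b1: "AE x in lborel. norm (Eu \<epsilon> (x, t) (x, s)) \<le> norm (u.env (x, t) + v.env (x, s))"
    "AE x in lborel. norm (Ev \<epsilon> (x, t) (x, s)) \<le> norm (u.env (x, t) + v.env (x, s))"
    using E_bounds[OF \<epsilon>] u.env_bounds(1) v.env_bounds(1) by (auto intro!: AE_I2)
   show "integrable lborel (\<lambda>x. Eu \<epsilon> (x, t) (x, s))" by (rule integrable_dominated[OF i _ b1(1)]) measurable
   show "integrable lborel (\<lambda>x. Ev \<epsilon> (x, t) (x, s))" by (rule integrable_dominated[OF i _ b1(2)]) measurable
  qed
  have "(LBINT x. Eu \<epsilon> (x, t2) (x, s2) - Eu \<epsilon> (x, t1) (x, s2) + (Ev \<epsilon> (x, t2) (x, s2) - Ev \<epsilon> (x, t2) (x, s1)))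
   \<le> (LBINT x. Bu x * w x - Bv x * w x)"
  proof (rule integral_mono)
   show "integrable lborel (\<lambda>x. Eu \<epsilon> (x, t2) (x, s2) - Eu \<epsilon> (x, t1) (x, s2) + (Ev \<epsilon> (x, t2) (x, s2) - Ev \<epsilon> (x, t2) (x, s1)))"
    by (intro Bochner_Integration.integrable_add Bochner_Integration.integrable_diff Ei env)
   show "integrable lborel (\<lambda>x. Bu x * w x - Bv x * w x)" using iBu iBv by (rule Bochner_Integration.integrable_diff)
   fix x
   show "Eu \<epsilon> (x, t2) (x, s2) - Eu \<epsilon> (x, t1) (x, s2) + (Ev \<epsilon> (x, t2) (x, s2) - Ev \<epsilon> (x, t2) (x, s1)) \<le> Bu x * w x - Bv x * w x"
    using ent1_convexity[OF u.p L \<epsilon>, of "u (x, t2)" "v (x, s2)" "u (x, t1)"] ent2_convexity[OF u.p L \<epsilon>, of "u (x, t2)" "v (x, s2)" "v (x, s1)"]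
    unfolding Eu_def Ev_def Bu_def Bv_def w_def tst_def by (simp only: minus_mult_left[symmetric])
  qed
  also have "\<dots> = - (LBINT x. (Au x - Av x) \<bullet> W x)"
   unfolding inner_diff_left using iBu iBv iAW[OF Aui Aup] iAW[OF Avi Avp] eu ev by simp
  finally show "(LBINT x. Eu \<epsilon> (x, t2) (x, s2) - Eu \<epsilon> (x, t1) (x, s2) + (Ev \<epsilon> (x, t2) (x, s2) - Ev \<epsilon> (x, t2) (x, s1)))
    \<le> - (LBINT x. ((LBINT r. indicator {t1..t2} r *\<^sub>R flux p (U (x, r))) - (LBINT r. indicator {s1..s2} r *\<^sub>R flux p (V (x, r)))) \<bullet> tst' \<epsilon> (x, t2) (x, s2))"
   unfolding Au_def Av_def W_def .
 qed
qed

end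

section \<open>Cutoffs in time and in the time lag\<close>

lemma AE_lborel_shift:
 fixes c :: "'y::euclidean_space"
 assumes "AE y in lborel. P y" shows "AE y in lborel. P (y + c)"
proof -
 obtain N where N: "N \<in> null_sets lborel" "\<And>y. y \<notin> N \<Longrightarrow> P y" using assms unfolding eventually_ae_filter by auto
 have [measurable]: "N \<in> sets borel" using N by auto
 have "emeasure lborel ((+) c -` N) = emeasure (distr lborel borel ((+) c)) N"
  by (subst emeasure_distr) auto
 also have "\<dots> = 0" using N(1) by (simp add: lborel_distr_plus null_setsD1)
 finally have "(+) c -` N \<in> null_sets lborel"
  by (intro null_setsI) (auto intro!: measurable_sets_borel[of "(+) c" borel N])
 from AE_not_in[OF this] show ?thesis by eventually_elim (auto intro!: N(2) simp: add.commute)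
qed

lemma AE_lborel_shear:
 fixes c :: "'p::euclidean_space \<Rightarrow> 'y::euclidean_space"
 assumes c[measurable]: "c \<in> borel_measurable borel" and P: "AE y in lborel. P y"
 shows "AE w in lborel. P (snd w + c (fst w))"
proof -
 obtain N where N: "N \<in> null_sets lborel" "\<And>y. y \<notin> N \<Longrightarrow> P y" using P unfolding eventually_ae_filter by auto
 have [measurable]: "N \<in> sets borel" using N by auto
 have "AE w in lborel \<Otimes>\<^sub>M lborel. snd w + c (fst w) \<notin> N"
 proof (rule lborel_pair.AE_pair_measure)
  show "{w \<in> space (lborel \<Otimes>\<^sub>M lborel). snd w + c (fst w) \<notin> N} \<in> sets (lborel \<Otimes>\<^sub>M lborel)" by measurable
  show "AE \<tau> in lborel. AE y in lborel. snd (\<tau>, y) + c (fst (\<tau>, y)) \<notin> N"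
   using AE_lborel_shift[OF AE_not_in[OF N(1)]] by simp
 qed
 then have "AE w in lborel. snd w + c (fst w) \<notin> N" unfolding lborel_prod .
 then show ?thesis by eventually_elim (rule N(2))
qed

lemma double_shear_integral:
 fixes g :: "'z::euclidean_space \<Rightarrow> real" and b :: "real \<times> real \<Rightarrow> 'z"
 assumes g: "integrable lborel g" and b[measurable]: "b \<in> borel_measurable borel"
  and S[measurable]: "S1 \<in> sets borel" "S2 \<in> sets borel" and Sf: "emeasure lborel S1 < \<infinity>" "emeasure lborel S2 < \<infinity>"
 shows "integrable lborel (\<lambda>q. indicator S1 (fst q) * (indicator S2 (fst (snd q)) * g (snd (snd q) + b (fst q, fst (snd q)))))"
  and "(LBINT q. indicator S1 (fst q) * (indicator S2 (fst (snd q)) * g (snd (snd q) + b (fst q, fst (snd q)))))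
    = measure lborel S1 * (measure lborel S2 * (LBINT z. g z))"
proof -
 have [measurable]: "g \<in> borel_measurable borel" using g by auto
 have bs[measurable]: "(\<lambda>\<rho>. b (\<tau>, \<rho>)) \<in> borel_measurable borel" for \<tau> by measurable
 have ga: "integrable lborel (\<lambda>z. \<bar>g z\<bar>)" using g by auto
 note I = shear_integral[OF g bs S(2) Sf(2)] and Ia = shear_integral[OF ga bs S(2) Sf(2)]
 let ?F = "\<lambda>q. indicator S1 (fst q) * (indicator S2 (fst (snd q)) * g (snd (snd q) + b (fst q, fst (snd q))))"
 have Si: "integrable lborel (\<lambda>\<tau>. indicator S1 \<tau> * (C::real))" for C
  using Sf by (auto simp: integrable_real_indicator)
 have "integrable (lborel \<Otimes>\<^sub>M lborel) ?F"
 proof (rule lborel_pair.Fubini_integrable)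
  show "?F \<in> borel_measurable (lborel \<Otimes>\<^sub>M lborel)" by measurable
  have "(\<lambda>\<tau>. LBINT y. norm (?F (\<tau>, y))) = (\<lambda>\<tau>. indicator S1 \<tau> * (measure lborel S2 * (LBINT z. \<bar>g z\<bar>)))"
   using Ia(2) by (simp add: abs_mult)
  then show "integrable lborel (\<lambda>\<tau>. LBINT y. norm (?F (\<tau>, y)))" using Si by simp
  show "AE \<tau> in lborel. integrable lborel (\<lambda>y. ?F (\<tau>, y))" using I(1) by simp
 qed
 then show i: "integrable lborel ?F" by (simp add: lborel_prod)
 have "(LBINT q. ?F q) = (LBINT \<tau>. LBINT y. ?F (\<tau>, y))" using lborel_Fubini_fst(3)[OF i] by simp
 also have "\<dots> = (LBINT \<tau>. indicator S1 \<tau> * (measure lborel S2 * (LBINT z. g z)))" using I(2) by simp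
 finally show "(LBINT q. ?F q) = measure lborel S1 * (measure lborel S2 * (LBINT z. g z))" by simp
qed

definition delay :: "real \<Rightarrow> 'a::euclidean_space \<times> real \<Rightarrow> 'a \<times> real" where
 "delay c z = (fst z, snd z - c)"

lemma delay_eq: "delay c z = z + (0, - c)" by (cases z) (simp add: delay_def)

lemma delay_delay [simp]: "delay c (delay d z) = delay (c + d) z" by (simp add: delay_def)

lemma delay_0 [simp]: "delay 0 z = z" by (simp add: delay_def)

lemma delay_simps [simp]: "fst (delay c z) = fst z" "snd (delay c z) = snd z - c" "delay c (x, t) = (x, t - c)" by (simp_all add: delay_def)

lemma delay_measurable [measurable]:
 assumes [measurable]: "f \<in> borel_measurable M" "g \<in> M \<rightarrow>\<^sub>M borel"
 shows "(\<lambda>w. delay (f w) (g w :: 'a::euclidean_space \<times> real)) \<in> M \<rightarrow>\<^sub>M borel"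
 unfolding delay_eq by measurable

lemma time_pair_measurable [measurable]: "(\<lambda>c. (0, c)) \<in> borel \<rightarrow>\<^sub>M (borel :: ('a::euclidean_space \<times> real) measure)"
 by (intro borel_measurable_continuous_onI continuous_intros)

text \<open>
 \<open>\<omega>\<close> localises the time \<open>t\<close>, and \<open>\<eta>\<close> the time lag \<open>t - s\<close> in units of \<open>\<epsilon>\<close>.
\<close>

locale cutoffs =
 fixes \<omega> \<omega>' \<eta> \<eta>' :: "real \<Rightarrow> real" and a b X X' E' :: real
 assumes \<omega>_DERIV: "\<And>t. (\<omega> has_real_derivative \<omega>' t) (at t)" and \<omega>_bounds: "\<And>t. 0 \<le> \<omega> t" "\<And>t. \<omega> t \<le> X" "\<And>t. \<bar>\<omega>' t\<bar> \<le> X'"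
  and \<omega>_outside: "\<And>t. t \<notin> {a..b} \<Longrightarrow> \<omega> t = 0"
  and \<eta>_DERIV: "\<And>t. (\<eta> has_real_derivative \<eta>' t) (at t)" and \<eta>_bounds: "\<And>t. 0 \<le> \<eta> t" "\<And>t. \<eta> t \<le> 1" "\<And>t. \<bar>\<eta>' t\<bar> \<le> E'"
  and \<eta>_outside: "\<And>t. t \<notin> {-1..1} \<Longrightarrow> \<eta> t = 0" "\<And>t. t \<notin> {-1..1} \<Longrightarrow> \<eta>' t = 0"
  and [measurable]: "\<omega>' \<in> borel_measurable borel" "\<eta>' \<in> borel_measurable borel"
begin

lemma cut_measurable [measurable]: "\<omega> \<in> borel_measurable borel" "\<eta> \<in> borel_measurable borel"
proof -
 have "continuous_on UNIV \<omega>" "continuous_on UNIV \<eta>"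
  using \<omega>_DERIV \<eta>_DERIV DERIV_isCont continuous_at_imp_continuous_on by blast+
 then show "\<omega> \<in> borel_measurable borel" "\<eta> \<in> borel_measurable borel" by (auto intro: borel_measurable_continuous_onI)
qed

lemma cut_nonneg: "0 \<le> X" "0 \<le> X'" "0 \<le> E'"
 using \<omega>_bounds[of 0] \<eta>_bounds[of 0] by linarith+

lemma lipschitz_of_DERIV:
 assumes "\<And>t. (f has_real_derivative f' t) (at t)" "\<And>t. \<bar>f' t\<bar> \<le> (C::real)"
 shows "\<bar>f y - f x\<bar> \<le> C * \<bar>y - x\<bar>"
 using field_differentiable_bound[of UNIV f f' C y x] assms by (simp add: has_field_derivative_at_within)

lemma \<omega>_lip: "\<bar>\<omega> y - \<omega> x\<bar> \<le> X' * \<bar>y - x\<bar>" by (rule lipschitz_of_DERIV[OF \<omega>_DERIV \<omega>_bounds(3)])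
lemma \<eta>_lip: "\<bar>\<eta> y - \<eta> x\<bar> \<le> E' * \<bar>y - x\<bar>" by (rule lipschitz_of_DERIV[OF \<eta>_DERIV \<eta>_bounds(3)])

lemma weight_bound:
 assumes "\<epsilon> > 0"
 shows "\<bar>\<omega> t * \<eta> \<tau> - \<omega> (t + h) * \<eta> (\<tau> + h / \<epsilon>)\<bar> \<le> (X' + X * E' / \<epsilon>) * \<bar>h\<bar>"
  "\<bar>\<omega> t * \<eta> \<tau> - \<omega> t * \<eta> (\<tau> - h / \<epsilon>)\<bar> \<le> (X' + X * E' / \<epsilon>) * \<bar>h\<bar>"
proof -
 have e1: "\<bar>\<eta> (\<tau> + h / \<epsilon>) - \<eta> \<tau>\<bar> \<le> E' / \<epsilon> * \<bar>h\<bar>" "\<bar>\<eta> (\<tau> - h / \<epsilon>) - \<eta> \<tau>\<bar> \<le> E' / \<epsilon> * \<bar>h\<bar>"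
  using \<eta>_lip[of "\<tau> + h / \<epsilon>" \<tau>] \<eta>_lip[of "\<tau> - h / \<epsilon>" \<tau>] assms by (simp_all add: abs_divide)
 have m: "\<bar>c * d\<bar> \<le> C * D" if "\<bar>c\<bar> \<le> C" "\<bar>d\<bar> \<le> D" for c d C D :: real
  using that unfolding abs_mult by (intro mult_mono) auto
 have "\<omega> t * \<eta> \<tau> - \<omega> (t + h) * \<eta> (\<tau> + h / \<epsilon>) = - ((\<omega> (t + h) - \<omega> t) * \<eta> \<tau>) - \<omega> (t + h) * (\<eta> (\<tau> + h / \<epsilon>) - \<eta> \<tau>)"
  by (simp add: algebra_simps)
 moreover have "\<bar>(\<omega> (t + h) - \<omega> t) * \<eta> \<tau>\<bar> \<le> (X' * \<bar>h\<bar>) * 1" using \<omega>_lip[of "t + h" t] \<eta>_bounds[of \<tau>] by (intro m) auto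
 moreover have "\<bar>\<omega> (t + h) * (\<eta> (\<tau> + h / \<epsilon>) - \<eta> \<tau>)\<bar> \<le> X * (E' / \<epsilon> * \<bar>h\<bar>)" using \<omega>_bounds[of "t + h"] e1 by (intro m) auto
 ultimately have "\<bar>\<omega> t * \<eta> \<tau> - \<omega> (t + h) * \<eta> (\<tau> + h / \<epsilon>)\<bar> \<le> X' * \<bar>h\<bar> + X * (E' / \<epsilon> * \<bar>h\<bar>)" by linarith
 then show "\<bar>\<omega> t * \<eta> \<tau> - \<omega> (t + h) * \<eta> (\<tau> + h / \<epsilon>)\<bar> \<le> (X' + X * E' / \<epsilon>) * \<bar>h\<bar>" by (simp add: algebra_simps)
 have "\<omega> t * \<eta> \<tau> - \<omega> t * \<eta> (\<tau> - h / \<epsilon>) = - (\<omega> t * (\<eta> (\<tau> - h / \<epsilon>) - \<eta> \<tau>))" by (simp add: algebra_simps)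
 moreover have "\<bar>\<omega> t * (\<eta> (\<tau> - h / \<epsilon>) - \<eta> \<tau>)\<bar> \<le> X * (E' / \<epsilon> * \<bar>h\<bar>)" using \<omega>_bounds[of t] e1 by (intro m) auto
 moreover have "0 \<le> X' * \<bar>h\<bar>" using cut_nonneg by simp
 ultimately have "\<bar>\<omega> t * \<eta> \<tau> - \<omega> t * \<eta> (\<tau> - h / \<epsilon>)\<bar> \<le> X' * \<bar>h\<bar> + X * (E' / \<epsilon> * \<bar>h\<bar>)" by linarith
 then show "\<bar>\<omega> t * \<eta> \<tau> - \<omega> t * \<eta> (\<tau> - h / \<epsilon>)\<bar> \<le> (X' + X * E' / \<epsilon>) * \<bar>h\<bar>" by (simp add: algebra_simps)
qed

text \<open>
 The weight as a function of \<open>(t, s)\<close> is \<open>\<omega>(t) \<eta>((t - s)/\<epsilon>)\<close>; the limits are minus its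
 partial derivatives in \<open>t\<close> and in \<open>s\<close>.
\<close>

lemma weight_limits:
 assumes \<epsilon>: "\<epsilon> > 0" and h: "h \<longlonglongrightarrow> 0" "\<And>k::nat. h k > 0"
 shows "(\<lambda>k. (\<omega> t * \<eta> \<tau> - \<omega> (t + h k) * \<eta> (\<tau> + h k / \<epsilon>)) / h k) \<longlonglongrightarrow> - (\<omega>' t * \<eta> \<tau> + \<omega> t * \<eta>' \<tau> / \<epsilon>)"
  "(\<lambda>k. (\<omega> t * \<eta> \<tau> - \<omega> t * \<eta> (\<tau> - h k / \<epsilon>)) / h k) \<longlonglongrightarrow> \<omega> t * \<eta>' \<tau> / \<epsilon>"
proof -
 have hf: "filterlim h (at 0) sequentially"
  using h(1) by (rule filterlim_atI) (use h(2) in \<open>auto intro!: always_eventually simp: less_imp_neq[symmetric]\<close>)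
 have d\<omega>: "((\<lambda>s. \<omega> (t + s)) has_real_derivative \<omega>' t) (at 0)"
 proof -
  have "((\<lambda>s. t + s) has_real_derivative 1) (at 0)" by (auto intro!: derivative_eq_intros)
  from DERIV_chain2[where f=\<omega> and g="\<lambda>s. t + s", OF \<omega>_DERIV this] show ?thesis by simp
 qed
 have d\<eta>: "((\<lambda>s. \<eta> (\<tau> + s / \<epsilon>)) has_real_derivative \<eta>' \<tau> * (1 / \<epsilon>)) (at 0)"
 proof -
  have "((\<lambda>s. \<tau> + s / \<epsilon>) has_real_derivative 1 / \<epsilon>) (at 0)" using \<epsilon> by (auto intro!: derivative_eq_intros)
  from DERIV_chain2[where f=\<eta> and g="\<lambda>s. \<tau> + s / \<epsilon>", OF \<eta>_DERIV this] show ?thesis by simp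
 qed
 have d\<eta>2: "((\<lambda>s. \<eta> (\<tau> - s / \<epsilon>)) has_real_derivative \<eta>' \<tau> * (- 1 / \<epsilon>)) (at 0)"
 proof -
  have "((\<lambda>s. \<tau> - s / \<epsilon>) has_real_derivative - 1 / \<epsilon>) (at 0)" using \<epsilon> by (auto intro!: derivative_eq_intros)
  from DERIV_chain2[where f=\<eta> and g="\<lambda>s. \<tau> - s / \<epsilon>", OF \<eta>_DERIV this] show ?thesis by simp
 qed
 have q: "(\<lambda>k. (F 0 - F (h k)) / h k) \<longlonglongrightarrow> - D" if "(F has_real_derivative D) (at 0)" for F D
 proof -
  have "((\<lambda>y. (F y - F 0) / (y - 0)) \<longlongrightarrow> D) (at 0)" using that by (simp add: has_field_derivative_iff)
  from tendsto_minus[OF filterlim_compose[OF this hf]] show ?thesis by (simp add: minus_divide_left)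
 qed
 have "((\<lambda>s. \<omega> (t + s) * \<eta> (\<tau> + s / \<epsilon>)) has_real_derivative \<omega>' t * \<eta> \<tau> + (\<eta>' \<tau> * (1 / \<epsilon>)) * \<omega> t) (at 0)"
  using DERIV_mult[OF d\<omega> d\<eta>] by simp
 from q[OF this] show "(\<lambda>k. (\<omega> t * \<eta> \<tau> - \<omega> (t + h k) * \<eta> (\<tau> + h k / \<epsilon>)) / h k) \<longlonglongrightarrow> - (\<omega>' t * \<eta> \<tau> + \<omega> t * \<eta>' \<tau> / \<epsilon>)"
  by (simp add: mult.commute)
 have "((\<lambda>s. \<omega> t * \<eta> (\<tau> - s / \<epsilon>)) has_real_derivative \<omega> t * (\<eta>' \<tau> * (- 1 / \<epsilon>))) (at 0)"
  using DERIV_cmult[OF d\<eta>2] by simp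
 from q[OF this] show "(\<lambda>k. (\<omega> t * \<eta> \<tau> - \<omega> t * \<eta> (\<tau> - h k / \<epsilon>)) / h k) \<longlonglongrightarrow> \<omega> t * \<eta>' \<tau> / \<epsilon>"
  by simp
qed

end

section \<open>The doubled time variable\<close>

text \<open>
 Rescaling a time average to the unit interval turns the limit \<open>h \<rightarrow> 0\<close> into a limit of translations.
\<close>

lemma reverse_affine_integral:
 fixes F :: "real \<Rightarrow> 'b::euclidean_space"
 assumes F: "integrable lborel F" and h: "h > 0"
 shows "integrable lborel (\<lambda>\<rho>. indicator {0..1} \<rho> *\<^sub>R F (t - h * \<rho>))"
  "(LBINT r. indicator {t - h..t} r *\<^sub>R F r) = h *\<^sub>R (LBINT \<rho>. indicator {0..1} \<rho> *\<^sub>R F (t - h * \<rho>))"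
proof -
 have i: "integrable lborel (\<lambda>r. indicator {t - h..t} r *\<^sub>R F r)" by (rule integrable_mult_indicator) (use F in auto)
 have eq: "(\<lambda>\<rho>. indicator {t - h..t} (t + (- h) * \<rho>) *\<^sub>R F (t + (- h) * \<rho>)) = (\<lambda>\<rho>. indicator {0..1} \<rho> *\<^sub>R F (t - h * \<rho>))"
  using h by (auto simp: indicator_def fun_eq_iff mult_le_cancel_left2 zero_le_mult_iff)
 show "integrable lborel (\<lambda>\<rho>. indicator {0..1} \<rho> *\<^sub>R F (t - h * \<rho>))"
  using lborel_integrable_real_affine[OF i, of "- h" t] h unfolding eq by simp
 show "(LBINT r. indicator {t - h..t} r *\<^sub>R F r) = h *\<^sub>R (LBINT \<rho>. indicator {0..1} \<rho> *\<^sub>R F (t - h * \<rho>))"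
  using lborel_integral_real_affine[of "- h" "\<lambda>r. indicator {t - h..t} r *\<^sub>R F r" t] h unfolding eq by simp
qed

locale entropy_setting = solution_pair p T L \<Omega> \<psi> D\<psi> u U v V + cutoffs \<omega> \<omega>' \<eta> \<eta>' a b X X' E'
 for p T L :: real and \<Omega> :: "'a::euclidean_space set" and \<psi> D\<psi> u U v V and \<omega> \<omega>' \<eta> \<eta>' a b X X' E'
begin

text \<open>
 The variable is \<open>w = (\<tau>, (x, t))\<close>, and this is the point \<open>(x, s)\<close> with \<open>s = t - \<epsilon>\<tau>\<close>.
\<close>

definition sep :: "real \<Rightarrow> real \<times> ('a \<times> real) \<Rightarrow> 'a \<times> real" where
 "sep \<epsilon> w = delay (\<epsilon> * fst w) (snd w)"

lemma sep_measurable [measurable]: "f \<in> M \<rightarrow>\<^sub>M borel \<Longrightarrow> (\<lambda>w. sep \<epsilon> (f w)) \<in> M \<rightarrow>\<^sub>M borel"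
 unfolding sep_def by measurable

definition dom :: "real \<Rightarrow> real \<times> ('a \<times> real) \<Rightarrow> real" where
 "dom \<epsilon> w = indicator {-2..2} (fst w) * (u.env (snd w) + v.env (sep \<epsilon> w))"

lemma dom_integrable: "integrable lborel (dom \<epsilon>)"
proof -
 have "integrable lborel (\<lambda>w::real \<times> ('a \<times> real). indicator {-2..2} (fst w) * u.env (snd w + (\<lambda>_. 0) (fst w)))"
  by (rule shear_integral(1)[OF u.env_integrable]) auto
 moreover have "integrable lborel (\<lambda>w::real \<times> ('a \<times> real). indicator {-2..2} (fst w) * v.env (snd w + (\<lambda>\<tau>. (0, - (\<epsilon> * \<tau>))) (fst w)))"
  by (rule shear_integral(1)[OF v.env_integrable]) auto
 ultimately have "integrable lborel (\<lambda>w::real \<times> ('a \<times> real). indicator {-2..2} (fst w) * u.env (snd w)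
   + indicator {-2..2} (fst w) * v.env (sep \<epsilon> w))"
  by (intro Bochner_Integration.integrable_add) (simp_all add: sep_def delay_eq)
 then show ?thesis by (simp add: dom_def[abs_def] distrib_left)
qed

lemma dom_nonneg: "0 \<le> dom \<epsilon> w" using u.env_bounds(1) v.env_bounds(1) by (simp add: dom_def)

definition EU where "EU \<epsilon> w = Eu \<epsilon> (snd w) (sep \<epsilon> w)"
definition EV where "EV \<epsilon> w = Ev \<epsilon> (snd w) (sep \<epsilon> w)"

lemma EUV_measurable [measurable]: "EU \<epsilon> \<in> borel_measurable borel" "EV \<epsilon> \<in> borel_measurable borel"
 unfolding EU_def[abs_def] EV_def[abs_def] by measurable

lemma EUV_dom:
 assumes "\<epsilon> > 0" "\<bar>fst w\<bar> \<le> 2" shows "\<bar>EU \<epsilon> w\<bar> \<le> dom \<epsilon> w" "\<bar>EV \<epsilon> w\<bar> \<le> dom \<epsilon> w"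
 using E_bounds[OF assms(1), of "snd w" "sep \<epsilon> w"] assms(2) by (auto simp: EU_def EV_def dom_def indicator_def)

lemma weighted_EUV_integrable:
 assumes \<epsilon>: "\<epsilon> > 0" and [measurable]: "c \<in> borel_measurable borel" and c: "\<And>w. \<bar>c w\<bar> \<le> C" "\<And>w. \<bar>fst w\<bar> > 2 \<Longrightarrow> c w = 0"
 shows "integrable lborel (\<lambda>w. c w * EU \<epsilon> w)" "integrable lborel (\<lambda>w. c w * EV \<epsilon> w)"
proof -
 have b: "\<bar>c w * e\<bar> \<le> C * dom \<epsilon> w" if "\<bar>fst w\<bar> \<le> 2 \<Longrightarrow> \<bar>e\<bar> \<le> dom \<epsilon> w" for w e
 proof (cases "\<bar>fst w\<bar> \<le> 2")
  case True
  then show ?thesis unfolding abs_mult using c(1)[of w] that by (intro mult_mono) auto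
 next
  case False
  then show ?thesis using c[of w] dom_nonneg[of \<epsilon> w] by simp
 qed
 have i: "integrable lborel (\<lambda>w. C * dom \<epsilon> w)" using dom_integrable by auto
 show "integrable lborel (\<lambda>w. c w * EU \<epsilon> w)" "integrable lborel (\<lambda>w. c w * EV \<epsilon> w)"
  by (rule integrable_dominated[OF i], measurable,
    use b EUV_dom[OF \<epsilon>] in \<open>auto intro!: AE_I2 order_trans[OF _ abs_ge_self]\<close>)+
qed

text \<open>
 The weighted increments of the entropies over a time step \<open>h\<close>.
\<close>

definition Fpar :: "real \<Rightarrow> real \<Rightarrow> real \<times> ('a \<times> real) \<Rightarrow> real" where
 "Fpar \<epsilon> h w = \<omega> (snd (snd w)) * \<eta> (fst w) * ((EU \<epsilon> w - Eu \<epsilon> (delay h (snd w)) (sep \<epsilon> w)) + (EV \<epsilon> w - Ev \<epsilon> (snd w) (delay h (sep \<epsilon> w))))"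

text \<open>
 The same with the time differences moved to the weights, by a change of variables.
\<close>

definition Apar :: "real \<Rightarrow> real \<Rightarrow> real \<times> ('a \<times> real) \<Rightarrow> real" where
 "Apar \<epsilon> h w = (\<omega> (snd (snd w)) * \<eta> (fst w) - \<omega> (snd (snd w) + h) * \<eta> (fst w + h / \<epsilon>)) * EU \<epsilon> w
   + (\<omega> (snd (snd w)) * \<eta> (fst w) - \<omega> (snd (snd w)) * \<eta> (fst w - h / \<epsilon>)) * EV \<epsilon> w"

lemma prod_bound: "\<bar>\<omega> t * \<eta> \<tau>\<bar> \<le> X"
 using mult_mono[OF \<omega>_bounds(2)[of t] \<eta>_bounds(2)[of \<tau>]] \<omega>_bounds(1)[of t] \<eta>_bounds(1)[of \<tau>] cut_nonneg by (simp add: abs_mult)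

lemma parabolic_shift:
 assumes \<epsilon>: "\<epsilon> > 0" and h: "0 < h" "h \<le> \<epsilon>"
 shows "integrable lborel (Fpar \<epsilon> h)" "(LBINT w. Fpar \<epsilon> h w) = (LBINT w. Apar \<epsilon> h w)"
proof -
 let ?P1 = "\<lambda>w. \<omega> (snd (snd w)) * \<eta> (fst w) * EU \<epsilon> w"
 let ?P2 = "\<lambda>w. \<omega> (snd (snd w)) * \<eta> (fst w) * Eu \<epsilon> (delay h (snd w)) (sep \<epsilon> w)"
 let ?P3 = "\<lambda>w. \<omega> (snd (snd w)) * \<eta> (fst w) * EV \<epsilon> w"
 let ?P4 = "\<lambda>w. \<omega> (snd (snd w)) * \<eta> (fst w) * Ev \<epsilon> (snd w) (delay h (sep \<epsilon> w))"
 let ?G2 = "\<lambda>w. \<omega> (snd (snd w) + h) * \<eta> (fst w + h / \<epsilon>) * EU \<epsilon> w"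
 let ?G4 = "\<lambda>w. \<omega> (snd (snd w)) * \<eta> (fst w - h / \<epsilon>) * EV \<epsilon> w"
 have he: "0 \<le> h / \<epsilon>" "h / \<epsilon> \<le> 1" using h \<epsilon> by auto
 have z: "\<eta> (\<tau> + d) = 0" if "\<bar>\<tau>\<bar> > 2" "\<bar>d\<bar> \<le> 1" for \<tau> d by (rule \<eta>_outside) (use that in auto)
 have i1: "integrable lborel ?P1" and i3: "integrable lborel ?P3"
  using weighted_EUV_integrable[OF \<epsilon>, of "\<lambda>w. \<omega> (snd (snd w)) * \<eta> (fst w)" X] prod_bound z[of _ 0] by auto
 have j2: "integrable lborel ?G2"
  using weighted_EUV_integrable(1)[OF \<epsilon>, of "\<lambda>w. \<omega> (snd (snd w) + h) * \<eta> (fst w + h / \<epsilon>)" X] prod_bound z[of _ "h / \<epsilon>"] he by auto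
 have j4: "integrable lborel ?G4"
  using weighted_EUV_integrable(2)[OF \<epsilon>, of "\<lambda>w. \<omega> (snd (snd w)) * \<eta> (fst w - h / \<epsilon>)" X] prod_bound z[of _ "- (h / \<epsilon>)"] he by auto
 let ?c2 = "(- (h / \<epsilon>), (0, - h)) :: real \<times> ('a \<times> real)" and ?c4 = "(h / \<epsilon>, (0, 0)) :: real \<times> ('a \<times> real)"
 have s2: "?G2 (w + ?c2) = ?P2 w" for w
 proof -
  have "sep \<epsilon> (w + ?c2) = sep \<epsilon> w" using \<epsilon> by (simp add: sep_def delay_def algebra_simps)
  moreover have "snd (w + ?c2) = delay h (snd w)" by (simp add: delay_eq)
  ultimately show ?thesis by (simp add: EU_def)
 qed
 have s4: "?G4 (w + ?c4) = ?P4 w" for w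
 proof -
  have "sep \<epsilon> (w + ?c4) = delay h (sep \<epsilon> w)" using \<epsilon> by (simp add: sep_def delay_def algebra_simps)
  moreover have "snd (w + ?c4) = snd w" by (simp add: zero_prod_def[symmetric])
  ultimately show ?thesis by (simp add: EV_def)
 qed
 have [measurable]: "?G2 \<in> borel_measurable borel" "?G4 \<in> borel_measurable borel" by measurable
 have i2: "integrable lborel ?P2" and e2: "(LBINT w. ?P2 w) = (LBINT w. ?G2 w)"
  using lborel_integrable_shift[OF j2, of ?c2] lborel_integral_shift[of ?G2 ?c2] unfolding s2 by auto
 have i4: "integrable lborel ?P4" and e4: "(LBINT w. ?P4 w) = (LBINT w. ?G4 w)"
  using lborel_integrable_shift[OF j4, of ?c4] lborel_integral_shift[of ?G4 ?c4] unfolding s4 by auto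
 have F: "Fpar \<epsilon> h = (\<lambda>w. (?P1 w - ?P2 w) + (?P3 w - ?P4 w))" by (auto simp: Fpar_def fun_eq_iff algebra_simps)
 have A: "Apar \<epsilon> h = (\<lambda>w. (?P1 w - ?G2 w) + (?P3 w - ?G4 w))" by (auto simp: Apar_def fun_eq_iff algebra_simps)
 show "integrable lborel (Fpar \<epsilon> h)" unfolding F using i1 i2 i3 i4 by (intro Bochner_Integration.integrable_add Bochner_Integration.integrable_diff)
 show "(LBINT w. Fpar \<epsilon> h w) = (LBINT w. Apar \<epsilon> h w)"
  unfolding F A using i1 i2 i3 i4 j2 j4 e2 e4 by simp
qed

text \<open>
 The elliptic term. In \<open>q = (\<tau>, (\<rho>, (x, t)))\<close> the number \<open>\<rho>\<close> is the position inside the time step over which the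
 fluxes are averaged; for \<open>h = 0\<close> fluxes and test function are taken at the same points.
\<close>

definition Fell :: "real \<Rightarrow> real \<Rightarrow> real \<times> (real \<times> ('a \<times> real)) \<Rightarrow> real" where
 "Fell \<epsilon> h q = \<omega> (snd (snd (snd q))) * \<eta> (fst q) * (indicator {0..1} (fst (snd q)) *
   ((flux p (U (delay (h * fst (snd q)) (snd (snd q)))) - flux p (V (delay (\<epsilon> * fst q + h * fst (snd q)) (snd (snd q)))))
    \<bullet> tst' \<epsilon> (snd (snd q)) (delay (\<epsilon> * fst q) (snd (snd q)))))"

text \<open>
 A majorant whose integral does not depend on \<open>h\<close>.
\<close>

definition Gell :: "real \<Rightarrow> real \<Rightarrow> real \<times> (real \<times> ('a \<times> real)) \<Rightarrow> real" where
 "Gell \<epsilon> h q = X * (indicator {-1..1} (fst q) * (indicator {0..1} (fst (snd q)) *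
   (norm (U (delay (h * fst (snd q)) (snd (snd q)))) powr p + norm (V (delay (\<epsilon> * fst q + h * fst (snd q)) (snd (snd q)))) powr p
   + 2 * ((2 / \<epsilon>) powr p * (3 powr p * (u.env (snd (snd q)) + v.env (delay (\<epsilon> * fst q) (snd (snd q)))))))))"

lemma Fell_measurable [measurable]: "Fell \<epsilon> h \<in> borel_measurable borel"
 unfolding Fell_def[abs_def] by measurable

lemma Fell_le_Gell: assumes \<epsilon>: "\<epsilon> > 0" shows "\<bar>Fell \<epsilon> h q\<bar> \<le> Gell \<epsilon> h q"
proof -
 let ?\<tau> = "fst q" and ?\<rho> = "fst (snd q)" and ?z = "snd (snd q)"
 let ?B = "norm (U (delay (h * ?\<rho>) ?z)) powr p + norm (V (delay (\<epsilon> * ?\<tau> + h * ?\<rho>) ?z)) powr p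
   + 2 * ((2 / \<epsilon>) powr p * (3 powr p * (u.env ?z + v.env (delay (\<epsilon> * ?\<tau>) ?z))))"
 have B: "\<bar>(flux p (U (delay (h * ?\<rho>) ?z)) - flux p (V (delay (\<epsilon> * ?\<tau> + h * ?\<rho>) ?z))) \<bullet> tst' \<epsilon> ?z (delay (\<epsilon> * ?\<tau>) ?z)\<bar> \<le> ?B"
  by (rule flux_young[OF \<epsilon>])
 show ?thesis
 proof (cases "?\<tau> \<in> {-1..1}")
  case True
  have "\<bar>Fell \<epsilon> h q\<bar> = \<bar>\<omega> (snd ?z) * \<eta> ?\<tau>\<bar> * (indicator {0..1} ?\<rho> * \<bar>(flux p (U (delay (h * ?\<rho>) ?z)) - flux p (V (delay (\<epsilon> * ?\<tau> + h * ?\<rho>) ?z))) \<bullet> tst' \<epsilon> ?z (delay (\<epsilon> * ?\<tau>) ?z)\<bar>)"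
   unfolding Fell_def abs_mult by simp
  also have "\<dots> \<le> X * (indicator {0..1} ?\<rho> * ?B)"
   by (intro mult_mono prod_bound mult_left_mono B) (use cut_nonneg in auto)
  also have "\<dots> = Gell \<epsilon> h q" using True by (simp add: Gell_def)
  finally show ?thesis .
 next
  case False
  then show ?thesis using \<eta>_outside[of ?\<tau>] by (simp add: Fell_def Gell_def)
 qed
qed

lemma Gell_integral:
 "integrable lborel (Gell \<epsilon> h)"
 "(LBINT q. Gell \<epsilon> h q) = (LBINT q. Gell \<epsilon> 0 q)"
proof -
 let ?w = "\<lambda>b g (q::real \<times> (real \<times> ('a \<times> real))). indicator {-1..1} (fst q) * (indicator {0..1} (fst (snd q)) * (g (snd (snd q) + b (fst q, fst (snd q))) :: real))"
 have I: "integrable lborel (?w b g)" "(LBINT q. ?w b g q) = 2 * (LBINT z. g z)"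
  if "integrable lborel g" "b \<in> borel_measurable borel" for b and g :: "'a \<times> real \<Rightarrow> real"
  using double_shear_integral[OF that, of "{-1..1}" "{0..1}"] by auto
 let ?b1 = "\<lambda>h (\<tau>\<rho>::real\<times>real). (0::'a, - (h * snd \<tau>\<rho>))" and ?b2 = "\<lambda>h (\<tau>\<rho>::real\<times>real). (0::'a, - (\<epsilon> * fst \<tau>\<rho> + h * snd \<tau>\<rho>))"
 have bm: "?b1 h \<in> borel_measurable borel" "?b2 h \<in> borel_measurable borel" for h by measurable
 let ?c = "2 * ((2 / \<epsilon>) powr p * 3 powr p)"
 have eq: "Gell \<epsilon> h = (\<lambda>q. X * ((?w (?b1 h) (\<lambda>z. norm (U z) powr p) q + ?w (?b2 h) (\<lambda>z. norm (V z) powr p) q)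
    + ?c * (?w (?b1 0) u.env q + ?w (?b2 0) v.env q)))" for h
  by (auto simp: Gell_def fun_eq_iff delay_eq algebra_simps zero_prod_def[symmetric])
 note II = I[OF u.U_Lp bm(1)] I[OF v.U_Lp bm(2)] I[OF u.env_integrable bm(1)] I[OF v.env_integrable bm(2)]
 show "integrable lborel (Gell \<epsilon> h)" unfolding eq
  by (intro integrable_mult_right Bochner_Integration.integrable_add II)
 have val: "(LBINT q. Gell \<epsilon> h q) = X * ((2 * (LBINT z. norm (U z) powr p) + 2 * (LBINT z. norm (V z) powr p))
    + ?c * (2 * (LBINT z. u.env z) + 2 * (LBINT z. v.env z)))" for h
  unfolding eq integral_mult_right_zero
  by (subst Bochner_Integration.integral_add, (intro integrable_mult_right Bochner_Integration.integrable_add II)+)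
   (simp only: integral_mult_right_zero II Bochner_Integration.integral_add)
 show "(LBINT q. Gell \<epsilon> h q) = (LBINT q. Gell \<epsilon> 0 q)" unfolding val ..
qed

lemma Fell_integrable: "\<epsilon> > 0 \<Longrightarrow> integrable lborel (Fell \<epsilon> h)"
 by (rule integrable_dominated[OF Gell_integral(1)])
  (measurable, use Fell_le_Gell in \<open>auto intro!: AE_I2 order_trans[OF _ abs_ge_self]\<close>)

text \<open>
 Here the gradient of the test function is a nonnegative multiple of the difference of the two gradients,
 so monotonicity of the flux applies.
\<close>

lemma Fell_limit_nonneg: "\<epsilon> > 0 \<Longrightarrow> 0 \<le> Fell \<epsilon> 0 q"
proof -
 assume \<epsilon>: "\<epsilon> > 0"
 let ?z = "snd (snd q)" and ?s = "delay (\<epsilon> * fst q) (snd (snd q))"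
 have "0 \<le> (tent ((u ?z - v ?s - \<epsilon> * L) / \<epsilon>) / \<epsilon>) * ((flux p (U ?z) - flux p (V ?s)) \<bullet> (U ?z - V ?s))"
  using flux_monotone[OF u.p] tent_bounds \<epsilon> by (intro mult_nonneg_nonneg divide_nonneg_pos) auto
 then have "0 \<le> (flux p (U ?z) - flux p (V ?s)) \<bullet> tst' \<epsilon> ?z ?s" by (simp add: tst'_def)
 then show ?thesis unfolding Fell_def using \<omega>_bounds \<eta>_bounds by (intro mult_nonneg_nonneg) auto
qed

text \<open>
 The gradients converge almost everywhere along a subsequence by continuity of translations, and so do
 the majorants, which makes generalised dominated convergence applicable.
\<close>

lemma Fell_subseq_limit:
 assumes \<epsilon>: "\<epsilon> > 0" and h: "h \<longlonglongrightarrow> (0::real)"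
 obtains r :: "nat \<Rightarrow> nat" where "strict_mono r" "(\<lambda>k. LBINT q. Fell \<epsilon> (h (r k)) q) \<longlonglongrightarrow> (LBINT q. Fell \<epsilon> 0 q)"
proof -
 have lim0: "(\<lambda>k. (0::'a, - (h (r k) * \<rho>))) \<longlonglongrightarrow> 0" if "strict_mono r" for r :: "nat \<Rightarrow> nat" and \<rho>
 proof -
  have "(\<lambda>k. - (h (r k) * \<rho>)) \<longlonglongrightarrow> - (0 * \<rho>)" using LIMSEQ_subseq_LIMSEQ[OF h that] unfolding o_def by (intro tendsto_intros)
  then have "(\<lambda>k. (0::'a, - (h (r k) * \<rho>))) \<longlonglongrightarrow> (0, - (0 * \<rho>))" by (intro tendsto_Pair tendsto_const)
  then show ?thesis by (simp add: zero_prod_def)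
 qed
 have sub: "\<exists>r. strict_mono (r::nat\<Rightarrow>nat) \<and> (AE y in lborel. fst y \<in> {0..1} \<longrightarrow> (\<lambda>k. F (delay (h (r0 (r k)) * fst y) (snd y))) \<longlonglongrightarrow> F (snd y))"
  if F: "integrable lborel F" and r0: "strict_mono (r0::nat\<Rightarrow>nat)" for F :: "'a \<times> real \<Rightarrow> 'a" and r0
 proof -
  have m: "(\<lambda>\<rho>::real. (0::'a, - (h (r0 k) * \<rho>))) \<in> borel_measurable borel" for k by measurable
  obtain r where r: "strict_mono (r::nat\<Rightarrow>nat)"
   "AE y in lborel. fst y \<in> {0..1} \<longrightarrow> (\<lambda>k. F (snd y + (\<lambda>_. 0) (fst y) + (\<lambda>k \<rho>. (0, - (h (r0 k) * \<rho>))) (r k) (fst y))) \<longlonglongrightarrow> F (snd y + (\<lambda>_. 0) (fst y))"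
   by (rule shear_AE_subseq[OF F, of "\<lambda>_. 0" "\<lambda>k \<rho>. (0, - (h (r0 k) * \<rho>))" "{0..1::real}"]) (use m lim0[OF r0] in auto)
  then show ?thesis by (auto simp: delay_eq)
 qed
 obtain r1 where r1: "strict_mono (r1::nat\<Rightarrow>nat)" "AE y in lborel. fst y \<in> {0..1} \<longrightarrow> (\<lambda>k. U (delay (h (r1 k) * fst y) (snd y))) \<longlonglongrightarrow> U (snd y)"
  using sub[OF u.U_integrable strict_mono_id] by auto
 obtain r2 where r2: "strict_mono (r2::nat\<Rightarrow>nat)" "AE y in lborel. fst y \<in> {0..1} \<longrightarrow> (\<lambda>k. V (delay (h (r1 (r2 k)) * fst y) (snd y))) \<longlonglongrightarrow> V (snd y)"
  using sub[OF v.U_integrable r1(1)] by auto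
 let ?r = "\<lambda>k. r1 (r2 k)"
 have rm: "strict_mono ?r" using strict_mono_o[OF r1(1) r2(1)] by (simp add: o_def)
 have aeU: "AE q in (lborel :: (real \<times> (real \<times> ('a \<times> real))) measure). fst (snd q) \<in> {0..1} \<longrightarrow> (\<lambda>k. U (delay (h (?r k) * fst (snd q)) (snd (snd q)))) \<longlonglongrightarrow> U (snd (snd q))"
 proof -
  have m: "(\<lambda>_::real. 0 :: real \<times> ('a \<times> real)) \<in> borel_measurable borel" by simp
  from AE_lborel_shear[OF m r1(2)] show ?thesis
  proof eventually_elim
   case (elim q)
   show ?case
   proof
    assume "fst (snd q) \<in> {0..1}"
    then have "(\<lambda>k. U (delay (h (r1 k) * fst (snd q)) (snd (snd q)))) \<longlonglongrightarrow> U (snd (snd q))" using elim by simp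
    from LIMSEQ_subseq_LIMSEQ[OF this r2(1)] show "(\<lambda>k. U (delay (h (?r k) * fst (snd q)) (snd (snd q)))) \<longlonglongrightarrow> U (snd (snd q))"
     by (simp add: o_def)
   qed
  qed
 qed
 have aeV: "AE q in lborel. fst (snd q) \<in> {0..1} \<longrightarrow>
   (\<lambda>k. V (delay (\<epsilon> * fst q + h (?r k) * fst (snd q)) (snd (snd q)))) \<longlonglongrightarrow> V (delay (\<epsilon> * fst q) (snd (snd q)))"
 proof -
  have m: "(\<lambda>\<tau>::real. (0, (0, - (\<epsilon> * \<tau>))) :: real \<times> ('a \<times> real)) \<in> borel_measurable borel"
   by (intro borel_measurable_continuous_onI continuous_intros)
  from AE_lborel_shear[OF m r2(2)] show ?thesis
  proof eventually_elim
   case (elim q)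
   then show ?case by (simp add: delay_eq[symmetric] add.commute)
  qed
 qed
 have lim: "(\<lambda>k. LBINT q. Fell \<epsilon> (h (?r k)) q) \<longlonglongrightarrow> (LBINT q. Fell \<epsilon> 0 q)"
 proof (rule generalized_dominated_convergence(4)[where g="Gell \<epsilon> 0" and G="\<lambda>k. Gell \<epsilon> (h (?r k))"])
  show "Fell \<epsilon> 0 \<in> borel_measurable lborel" "\<And>k. Fell \<epsilon> (h (?r k)) \<in> borel_measurable lborel" by measurable
  show "integrable lborel (Gell \<epsilon> 0)" "\<And>k. integrable lborel (Gell \<epsilon> (h (?r k)))" by (rule Gell_integral)+
  show "AE q in lborel. norm (Fell \<epsilon> (h (?r k)) q) \<le> Gell \<epsilon> (h (?r k)) q" for k using Fell_le_Gell[OF \<epsilon>] by simp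
  show "(\<lambda>k. LBINT q. Gell \<epsilon> (h (?r k)) q) \<longlonglongrightarrow> (LBINT q. Gell \<epsilon> 0 q)"
   unfolding Gell_integral(2)[of \<epsilon> "h _"] by simp
  have p0: "p > 0" using u.p by simp
  show "AE q in lborel. (\<lambda>k. Fell \<epsilon> (h (?r k)) q) \<longlonglongrightarrow> Fell \<epsilon> 0 q" using aeU aeV
  proof eventually_elim
   case (elim q)
   show ?case
   proof (cases "fst (snd q) \<in> {0..1}")
    case True
    note lU = isCont_tendsto_compose[OF flux_isCont[OF u.p] elim(1)[rule_format, OF True]]
     and lV = isCont_tendsto_compose[OF flux_isCont[OF u.p] elim(2)[rule_format, OF True]]
    show ?thesis unfolding Fell_def by (intro tendsto_intros) (use lU lV in simp_all)
   qed (simp add: Fell_def)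
  qed
  show "AE q in lborel. (\<lambda>k. Gell \<epsilon> (h (?r k)) q) \<longlonglongrightarrow> Gell \<epsilon> 0 q" using aeU aeV
  proof eventually_elim
   case (elim q)
   show ?case
   proof (cases "fst (snd q) \<in> {0..1}")
    case True
    show ?thesis unfolding Gell_def
     by (intro tendsto_intros) (use elim(1)[rule_format, OF True] elim(2)[rule_format, OF True] p0 in simp_all)
   qed (simp add: Gell_def)
  qed
 qed
 show thesis by (rule that[OF rm lim])
qed


text \<open>
 Integration of the slice inequality for the times \<open>t - h, t\<close> and \<open>s - h, s\<close> against the weight.
\<close>

lemma Fpar_le_Fell:
 assumes \<epsilon>: "\<epsilon> > 0" "\<epsilon> < a" "b + \<epsilon> < T" and h: "0 < h" "h \<le> \<epsilon>" "h < a - \<epsilon>"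
 shows "(LBINT w. Fpar \<epsilon> h w) \<le> - (h * (LBINT q. Fell \<epsilon> h q))"
proof -
 note [measurable] = slice_borel
 obtain N where N: "N \<in> null_sets lborel"
  "\<And>t1 t2 s1 s2. 0 < t1 \<Longrightarrow> t1 < t2 \<Longrightarrow> t2 < T \<Longrightarrow> 0 < s1 \<Longrightarrow> s1 < s2 \<Longrightarrow> s2 < T \<Longrightarrow> \<bar>t2 - s2\<bar> \<le> \<epsilon> \<Longrightarrow>
    t1 \<notin> N \<Longrightarrow> t2 \<notin> N \<Longrightarrow> s1 \<notin> N \<Longrightarrow> s2 \<notin> N \<Longrightarrow>
    (LBINT x. Eu \<epsilon> (x, t2) (x, s2) - Eu \<epsilon> (x, t1) (x, s2) + (Ev \<epsilon> (x, t2) (x, s2) - Ev \<epsilon> (x, t2) (x, s1)))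
    \<le> - (LBINT x. ((LBINT r. indicator {t1..t2} r *\<^sub>R flux p (U (x, r))) - (LBINT r. indicator {s1..s2} r *\<^sub>R flux p (V (x, r)))) \<bullet> tst' \<epsilon> (x, t2) (x, s2))"
  by (rule slice_inequality[OF \<epsilon>(1)], rule that)
 have Fi: "integrable lborel (Fpar \<epsilon> h)" by (rule parabolic_shift(1)[OF \<epsilon>(1) h(1,2)])
 have Gi: "integrable lborel (Fell \<epsilon> h)" by (rule Fell_integrable[OF \<epsilon>(1)])
 define G where "G \<tau> z = (LBINT \<rho>. Fell \<epsilon> h (\<tau>, (\<rho>, z)))" for \<tau> z
 have flux_slices: "AE x in lborel. integrable lborel (\<lambda>r. flux p (U (x, r))) \<and> integrable lborel (\<lambda>r. flux p (V (x, r)))"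
  using lborel_Fubini_fst(1)[OF u.flux_integrable] lborel_Fubini_fst(1)[OF v.flux_integrable] by eventually_elim simp
 have slice: "(LBINT x. Fpar \<epsilon> h (\<tau>, (x, t))) \<le> - h * (LBINT x. G \<tau> (x, t))"
  if \<tau>: "\<tau> \<in> {-1..1}" and t: "t \<in> {a..b}" and n: "t \<notin> N" "t - h \<notin> N" "t - \<epsilon> * \<tau> \<notin> N" "t - \<epsilon> * \<tau> - h \<notin> N" for \<tau> t
 proof -
  let ?s = "t - \<epsilon> * \<tau>" and ?c = "\<omega> t * \<eta> \<tau>"
  let ?Au = "\<lambda>x. LBINT r. indicator {t - h..t} r *\<^sub>R flux p (U (x, r))"
  let ?Av = "\<lambda>x. LBINT r. indicator {?s - h..?s} r *\<^sub>R flux p (V (x, r))"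
  let ?W = "\<lambda>x. tst' \<epsilon> (x, t) (x, ?s)"
  have c0: "0 \<le> ?c" using \<omega>_bounds \<eta>_bounds by simp
  have \<epsilon>\<tau>: "\<bar>\<epsilon> * \<tau>\<bar> \<le> \<epsilon>" using mult_left_mono[of "\<bar>\<tau>\<bar>" 1 \<epsilon>] \<tau> \<epsilon>(1) by (auto simp: abs_mult)
  have "(LBINT x. Eu \<epsilon> (x, t) (x, ?s) - Eu \<epsilon> (x, t - h) (x, ?s) + (Ev \<epsilon> (x, t) (x, ?s) - Ev \<epsilon> (x, t) (x, ?s - h)))
    \<le> - (LBINT x. (?Au x - ?Av x) \<bullet> ?W x)"
  proof (rule N(2))
   show "0 < t - h" "t - h < t" "t < T" using t h \<epsilon> by auto
   show "0 < ?s - h" "?s - h < ?s" "?s < T" using t h \<epsilon> \<epsilon>\<tau> by auto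
   show "\<bar>t - ?s\<bar> \<le> \<epsilon>" using \<epsilon>\<tau> by simp
  qed (use n in simp_all)
  then have le: "?c * (LBINT x. Eu \<epsilon> (x, t) (x, ?s) - Eu \<epsilon> (x, t - h) (x, ?s) + (Ev \<epsilon> (x, t) (x, ?s) - Ev \<epsilon> (x, t) (x, ?s - h)))
    \<le> ?c * (- (LBINT x. (?Au x - ?Av x) \<bullet> ?W x))" using c0 by (rule mult_left_mono)
  have l: "(LBINT x. Fpar \<epsilon> h (\<tau>, (x, t))) = ?c * (LBINT x. Eu \<epsilon> (x, t) (x, ?s) - Eu \<epsilon> (x, t - h) (x, ?s) + (Ev \<epsilon> (x, t) (x, ?s) - Ev \<epsilon> (x, t) (x, ?s - h)))"
   unfolding integral_mult_right_zero[symmetric] by (simp add: Fpar_def EU_def EV_def sep_def)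
  have g: "h * (LBINT x. G \<tau> (x, t)) = ?c * (LBINT x. (?Au x - ?Av x) \<bullet> ?W x)"
   unfolding integral_mult_right_zero[symmetric]
  proof (rule integral_cong_AE)
   show "(\<lambda>x. h * G \<tau> (x, t)) \<in> borel_measurable lborel" unfolding G_def by measurable
   show "(\<lambda>x. ?c * ((?Au x - ?Av x) \<bullet> ?W x)) \<in> borel_measurable lborel" by measurable
   show "AE x in lborel. h * G \<tau> (x, t) = ?c * ((?Au x - ?Av x) \<bullet> ?W x)" using flux_slices
   proof eventually_elim
    case (elim x)
    note ru = reverse_affine_integral[OF conjunct1[OF elim] h(1), of t]
    note rv = reverse_affine_integral[OF conjunct2[OF elim] h(1), of ?s]
    let ?fu = "\<lambda>\<rho>. indicator {0..1} \<rho> *\<^sub>R flux p (U (x, t - h * \<rho>))" and ?fv = "\<lambda>\<rho>. indicator {0..1} \<rho> *\<^sub>R flux p (V (x, ?s - h * \<rho>))"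
    have "G \<tau> (x, t) = (LBINT \<rho>. ?c * ((?fu \<rho> - ?fv \<rho>) \<bullet> ?W x))"
     unfolding G_def by (rule Bochner_Integration.integral_cong) (simp_all add: Fell_def diff_diff_eq inner_diff_left right_diff_distrib)
    also have "\<dots> = ?c * (LBINT \<rho>. (?fu \<rho> - ?fv \<rho>) \<bullet> ?W x)" by (rule integral_mult_right_zero)
    also have "(LBINT \<rho>. (?fu \<rho> - ?fv \<rho>) \<bullet> ?W x) = (LBINT \<rho>. ?fu \<rho> - ?fv \<rho>) \<bullet> ?W x"
     by (rule integral_inner_left) (rule Bochner_Integration.integrable_diff[OF ru(1) rv(1)])
    also have "(LBINT \<rho>. ?fu \<rho> - ?fv \<rho>) = (LBINT \<rho>. ?fu \<rho>) - (LBINT \<rho>. ?fv \<rho>)"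
     by (rule Bochner_Integration.integral_diff[OF ru(1) rv(1)])
    finally show ?case unfolding ru(2) rv(2) by (simp add: inner_diff_left right_diff_distrib)
   qed
  qed
  show ?thesis using le l g by simp
 qed
 have main: "AE \<tau> in lborel. (LBINT z. Fpar \<epsilon> h (\<tau>, z)) \<le> - h * (LBINT y. Fell \<epsilon> h (\<tau>, y))"
  using lborel_Fubini_fst(1)[OF Fi] lborel_Fubini_fst(1)[OF Gi]
 proof eventually_elim
  case (elim \<tau>)
  show ?case
  proof (cases "\<tau> \<in> {-1..1}")
   case False
   then show ?thesis using \<eta>_outside by (simp add: Fpar_def Fell_def)
  next
   case True
   have Gint: "integrable lborel (G \<tau>)" unfolding G_def[abs_def] by (rule lborel_Fubini_snd(2)[OF elim(2)])
   have l: "(LBINT z. Fpar \<epsilon> h (\<tau>, z)) = (LBINT t. LBINT x. Fpar \<epsilon> h (\<tau>, (x, t)))"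
    by (rule lborel_Fubini_snd(3)[OF elim(1), symmetric])
   have r: "(LBINT y. Fell \<epsilon> h (\<tau>, y)) = (LBINT t. LBINT x. G \<tau> (x, t))"
    unfolding lborel_Fubini_snd(3)[OF elim(2), symmetric] G_def[symmetric] lborel_Fubini_snd(3)[OF Gint] ..
   have "(LBINT t. LBINT x. Fpar \<epsilon> h (\<tau>, (x, t))) \<le> (LBINT t. - h * (LBINT x. G \<tau> (x, t)))"
   proof (rule integral_mono_AE)
    show "integrable lborel (\<lambda>t. LBINT x. Fpar \<epsilon> h (\<tau>, (x, t)))" by (rule lborel_Fubini_snd(2)[OF elim(1)])
    show "integrable lborel (\<lambda>t. - h * (LBINT x. G \<tau> (x, t)))" by (rule integrable_mult_right[OF lborel_Fubini_snd(2)[OF Gint]])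
    have n: "AE t in lborel. t + c \<notin> N" for c by (rule AE_lborel_shift[OF AE_not_in[OF N(1)]])
    show "AE t in lborel. (LBINT x. Fpar \<epsilon> h (\<tau>, (x, t))) \<le> - h * (LBINT x. G \<tau> (x, t))"
     using n[of 0] n[of "- h"] n[of "- (\<epsilon> * \<tau>)"] n[of "- (\<epsilon> * \<tau>) - h"]
    proof eventually_elim
     case (elim t)
     show ?case
     proof (cases "t \<in> {a..b}")
      case False
      then show ?thesis using \<omega>_outside by (simp add: Fpar_def G_def Fell_def)
     next
      case t: True
      show ?thesis by (rule slice[OF True t]) (use elim in \<open>simp_all add: algebra_simps\<close>)
     qed
    qed
   qed
   also have "\<dots> = - h * (LBINT t. LBINT x. G \<tau> (x, t))" by (rule integral_mult_right_zero)
   finally show ?thesis unfolding l r .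
  qed
 qed
 have "(LBINT w. Fpar \<epsilon> h w) = (LBINT \<tau>. LBINT z. Fpar \<epsilon> h (\<tau>, z))" by (rule lborel_Fubini_fst(3)[OF Fi, symmetric])
 also have "\<dots> \<le> (LBINT \<tau>. - h * (LBINT y. Fell \<epsilon> h (\<tau>, y)))"
  by (rule integral_mono_AE[OF lborel_Fubini_fst(2)[OF Fi] integrable_mult_right[OF lborel_Fubini_fst(2)[OF Gi]] main])
 also have "\<dots> = - h * (LBINT \<tau>. LBINT y. Fell \<epsilon> h (\<tau>, y))" by (rule integral_mult_right_zero)
 also have "(LBINT \<tau>. LBINT y. Fell \<epsilon> h (\<tau>, y)) = (LBINT q. Fell \<epsilon> h q)" by (rule lborel_Fubini_fst(3)[OF Gi])
 finally show ?thesis by simp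
qed

text \<open>
 Divide by the length \<open>h\<close> of the time step and let it tend to zero.
\<close>

theorem entropy_inequality:
 assumes \<epsilon>: "\<epsilon> > 0" "\<epsilon> < a" "b + \<epsilon> < T"
 shows "0 \<le> (LBINT w. EU \<epsilon> w * (\<omega>' (snd (snd w)) * \<eta> (fst w)) + (EU \<epsilon> w - EV \<epsilon> w) / \<epsilon> * (\<omega> (snd (snd w)) * \<eta>' (fst w)))"
proof -
 \<comment> \<open>All times \<open>t - h\<close> and \<open>s - h\<close> stay positive, and shifted lags stay within \<open>[-2, 2]\<close>.\<close>
 define h0 where "h0 = min (a - \<epsilon>) \<epsilon>"
 define h where "h k = h0 / real (k + 2)" for k
 have h0: "h0 > 0" using \<epsilon> by (simp add: h0_def)
 have hpos: "h k > 0" for k using h0 by (simp add: h_def)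
 have hlt: "h k < h0" for k using h0 by (simp add: h_def divide_less_eq)
 have hb: "h k \<le> \<epsilon>" "h k < a - \<epsilon>" for k using hlt[of k] by (auto simp: h0_def)
 have hlim: "h \<longlonglongrightarrow> 0"
 proof -
  have "(\<lambda>k. h0 * inverse (real (k + 2))) \<longlonglongrightarrow> h0 * 0"
   by (intro tendsto_mult tendsto_const LIMSEQ_ignore_initial_segment[OF lim_inverse_n])
  then show ?thesis by (simp add: h_def[abs_def] divide_inverse)
 qed
 obtain r :: "nat \<Rightarrow> nat" where r: "strict_mono r" "(\<lambda>k. LBINT q. Fell \<epsilon> (h (r k)) q) \<longlonglongrightarrow> (LBINT q. Fell \<epsilon> 0 q)"
  using Fell_subseq_limit[OF \<epsilon>(1) hlim] by metis
 have hr: "(\<lambda>k. h (r k)) \<longlonglongrightarrow> 0" using LIMSEQ_subseq_LIMSEQ[OF hlim r(1)] by (simp add: o_def)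
 let ?C = "X' + X * E' / \<epsilon>"
 let ?A = "\<lambda>w. - (\<omega>' (snd (snd w)) * \<eta> (fst w) + \<omega> (snd (snd w)) * \<eta>' (fst w) / \<epsilon>) * EU \<epsilon> w + (\<omega> (snd (snd w)) * \<eta>' (fst w) / \<epsilon>) * EV \<epsilon> w"
 have Aq: "Apar \<epsilon> d w / d = (\<omega> (snd (snd w)) * \<eta> (fst w) - \<omega> (snd (snd w) + d) * \<eta> (fst w + d / \<epsilon>)) / d * EU \<epsilon> w
   + (\<omega> (snd (snd w)) * \<eta> (fst w) - \<omega> (snd (snd w)) * \<eta> (fst w - d / \<epsilon>)) / d * EV \<epsilon> w" for d w
  by (simp add: Apar_def add_divide_distrib)
 have lim: "(\<lambda>k. LBINT w. Apar \<epsilon> (h (r k)) w / h (r k)) \<longlonglongrightarrow> (LBINT w. ?A w)"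
 proof (rule integral_dominated_convergence[where w="\<lambda>w. 2 * (?C * dom \<epsilon> w)"])
  show "integrable lborel (\<lambda>w. 2 * (?C * dom \<epsilon> w))" using dom_integrable by auto
  show "?A \<in> borel_measurable lborel" by measurable
  have [measurable]: "Apar \<epsilon> d \<in> borel_measurable borel" for d unfolding Apar_def[abs_def] by measurable
  show "(\<lambda>w. Apar \<epsilon> (h (r k)) w / h (r k)) \<in> borel_measurable lborel" for k by measurable
  show "AE w in lborel. (\<lambda>k. Apar \<epsilon> (h (r k)) w / h (r k)) \<longlonglongrightarrow> ?A w"
  proof (rule AE_I2)
   fix w
   show "(\<lambda>k. Apar \<epsilon> (h (r k)) w / h (r k)) \<longlonglongrightarrow> ?A w"
    unfolding Aq by (intro tendsto_add tendsto_mult tendsto_const weight_limits[OF \<epsilon>(1) hr hpos])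
  qed
  show "AE w in lborel. norm (Apar \<epsilon> (h (r k)) w / h (r k)) \<le> 2 * (?C * dom \<epsilon> w)" for k
  proof (rule AE_I2)
   fix w
   let ?d = "h (r k)"
   have C0: "0 \<le> ?C" using cut_nonneg \<epsilon> by simp
   show "norm (Apar \<epsilon> ?d w / ?d) \<le> 2 * (?C * dom \<epsilon> w)"
   proof (cases "\<bar>fst w\<bar> \<le> 2")
    case True
    have q: "\<bar>c / ?d * e\<bar> \<le> ?C * dom \<epsilon> w" if "\<bar>c\<bar> \<le> ?C * \<bar>?d\<bar>" "\<bar>e\<bar> \<le> dom \<epsilon> w" for c e
    proof -
     have "\<bar>c / ?d\<bar> \<le> ?C" using that(1) hpos[of "r k"] by (simp add: abs_divide pos_divide_le_eq)
     then show ?thesis unfolding abs_mult using that(2) C0 by (intro mult_mono) auto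
    qed
    show ?thesis unfolding Aq real_norm_def
     using q[OF weight_bound(1)[OF \<epsilon>(1), of "snd (snd w)" "fst w" ?d] EUV_dom(1)[OF \<epsilon>(1) True]]
      q[OF weight_bound(2)[OF \<epsilon>(1), of "snd (snd w)" "fst w" ?d] EUV_dom(2)[OF \<epsilon>(1) True]]
     by (intro order_trans[OF abs_triangle_ineq]) linarith
   next
    case False
    have "?d / \<epsilon> \<le> 1" "0 \<le> ?d / \<epsilon>" using hb(1)[of "r k"] hpos[of "r k"] \<epsilon> by auto
    then have "\<eta> (fst w) = 0" "\<eta> (fst w + ?d / \<epsilon>) = 0" "\<eta> (fst w - ?d / \<epsilon>) = 0" using False by (auto intro!: \<eta>_outside)
    then show ?thesis using C0 dom_nonneg[of \<epsilon> w] by (simp add: Apar_def)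
   qed
  qed
 qed
 have le: "(LBINT w. Apar \<epsilon> (h k) w / h k) \<le> - (LBINT q. Fell \<epsilon> (h k) q)" for k
 proof -
  have "(LBINT w. Apar \<epsilon> (h k) w) \<le> - (h k * (LBINT q. Fell \<epsilon> (h k) q))"
   using Fpar_le_Fell[OF \<epsilon> hpos hb] parabolic_shift(2)[OF \<epsilon>(1) hpos hb(1)] by simp
  then show ?thesis unfolding integral_divide_zero using hpos[of k] by (simp add: pos_divide_le_eq mult.commute)
 qed
 have "(LBINT w. ?A w) \<le> - (LBINT q. Fell \<epsilon> 0 q)"
  by (rule LIMSEQ_le[OF lim tendsto_minus[OF r(2)]]) (use le in blast)
 moreover have "0 \<le> (LBINT q. Fell \<epsilon> 0 q)" by (rule Bochner_Integration.integral_nonneg) (rule Fell_limit_nonneg[OF \<epsilon>(1)])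
 ultimately have "0 \<le> - (LBINT w. ?A w)" by simp
 also have "- (LBINT w. ?A w) = (LBINT w. - ?A w)" by (rule Bochner_Integration.integral_minus[symmetric])
 also have "\<dots> = (LBINT w. EU \<epsilon> w * (\<omega>' (snd (snd w)) * \<eta> (fst w)) + (EU \<epsilon> w - EV \<epsilon> w) / \<epsilon> * (\<omega> (snd (snd w)) * \<eta>' (fst w)))"
  using \<epsilon> by (intro Bochner_Integration.integral_cong) (auto simp: field_simps)
 finally show ?thesis .
qed

end

section \<open>Vanishing time lag\<close>

lemma lborel_product_integral:
 fixes f :: "'p::euclidean_space \<Rightarrow> real" and g :: "'z::euclidean_space \<Rightarrow> real"
 assumes f: "integrable lborel f" and g: "integrable lborel g"
 shows "integrable lborel (\<lambda>w. f (fst w) * g (snd w))" "(LBINT w. f (fst w) * g (snd w)) = (LBINT x. f x) * (LBINT z. g z)"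
proof -
 have [measurable]: "f \<in> borel_measurable borel" "g \<in> borel_measurable borel" using f g by auto
 have "integrable (lborel \<Otimes>\<^sub>M lborel) (\<lambda>w. f (fst w) * g (snd w))"
 proof (rule lborel_pair.Fubini_integrable)
  show "(\<lambda>w. f (fst w) * g (snd w)) \<in> borel_measurable (lborel \<Otimes>\<^sub>M lborel)" by measurable
  have "integrable lborel (\<lambda>x. \<bar>f x\<bar> * (LBINT z. \<bar>g z\<bar>))" using f by (intro integrable_mult_left integrable_abs)
  then show "integrable lborel (\<lambda>x. LBINT z. norm (f (fst (x, z)) * g (snd (x, z))))" by (simp add: abs_mult)
  show "AE x in lborel. integrable lborel (\<lambda>z. f (fst (x, z)) * g (snd (x, z)))" using g by simp
 qed
 then show i: "integrable lborel (\<lambda>w. f (fst w) * g (snd w))" unfolding lborel_prod .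
 show "(LBINT w. f (fst w) * g (snd w)) = (LBINT x. f x) * (LBINT z. g z)"
  using lborel_Fubini_fst(3)[OF i] by simp
qed

context solution_pair
begin

definition excess :: "'a \<times> real \<Rightarrow> real" where "excess z = max 0 (b_fun p (u z) - b_fun p (v z))"

lemma excess_borel [measurable]: "excess \<in> borel_measurable borel"
 unfolding excess_def[abs_def] by measurable

lemma excess_bounds: "0 \<le> excess z" "excess z \<le> \<bar>b_fun p (u z) - b_fun p (v z)\<bar>" "excess z \<le> u.env z + v.env z"
 using u.env_bounds(1,4)[of z] v.env_bounds(1,4)[of z] by (auto simp: excess_def)

lemma excess_integrable: "integrable lborel excess"
proof (rule integrable_dominated)
 show "integrable lborel (\<lambda>z. u.env z + v.env z)" using u.env_integrable v.env_integrable by auto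
 show "AE z in lborel. norm (excess z) \<le> norm (u.env z + v.env z)"
  using excess_bounds by (auto intro!: AE_I2 order_trans[OF _ abs_ge_self])
qed measurable

lemma jump_integrable: "integrable lborel (\<lambda>z. jump p (u z) (v z))"
proof (rule integrable_dominated)
 show "integrable lborel (\<lambda>z. p * 2 * (u.env z + v.env z))" using u.env_integrable v.env_integrable by auto
 have "\<bar>jump p (u z) (v z)\<bar> \<le> p * 2 * (u.env z + v.env z)" for z
 proof (cases "z \<in> cylinder \<Omega> T")
  case True
  have "b_deriv p (u z) \<le> p * (1 + \<bar>u z\<bar> powr p)" "b_deriv p (v z) \<le> p * (1 + \<bar>v z\<bar> powr p)" by (rule b_deriv_le[OF u.p], simp)+
  moreover have "1 + \<bar>u z\<bar> powr p \<le> 2 * u.env z" "1 + \<bar>v z\<bar> powr p \<le> 2 * v.env z"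
   using u.env_bounds(2,8)[of z] v.env_bounds(2,8)[of z] True by auto
  then have "p * (1 + \<bar>u z\<bar> powr p) \<le> p * (2 * u.env z)" "p * (1 + \<bar>v z\<bar> powr p) \<le> p * (2 * v.env z)" using u.p by (auto intro!: mult_left_mono)
  moreover have "p * 2 * (u.env z + v.env z) = p * (2 * u.env z) + p * (2 * v.env z)" by (simp add: algebra_simps)
  moreover have "\<bar>jump p (u z) (v z)\<bar> \<le> b_deriv p (u z) + b_deriv p (v z)"
   using b_deriv_nonneg[OF u.p, of "u z"] b_deriv_nonneg[OF u.p, of "v z"] by (auto simp: jump_def)
  ultimately show ?thesis by linarith
 next
  case False
  then have "u z = 0" "v z = 0" using u.outside v.outside by auto
  then show ?thesis using u.env_bounds(1)[of z] v.env_bounds(1)[of z] u.p by (simp add: jump_def)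
 qed
 then show "AE z in lborel. norm (jump p (u z) (v z)) \<le> norm (p * 2 * (u.env z + v.env z))"
  by (auto intro!: AE_I2 order_trans[OF _ abs_ge_self])
qed measurable

end

context entropy_setting
begin

lemma \<omega>'_outside: assumes "t \<notin> {a..b}" shows "\<omega>' t = 0"
proof -
 have "(\<omega> has_real_derivative 0) (at t)"
  by (rule has_field_derivative_transform_within_open[where f="\<lambda>_. 0" and S="- {a..b}"]) (use assms \<omega>_outside in auto)
 then show ?thesis using \<omega>_DERIV DERIV_unique by blast
qed

lemma \<eta>_integrable: "integrable lborel \<eta>" "integrable lborel \<eta>'"
proof -
 have i: "integrable lborel (\<lambda>\<tau>::real. indicator {-1..1} \<tau> * C)" for C :: real by (intro integrable_mult_left integrable_real_indicator) auto
 show "integrable lborel \<eta>"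
  by (rule integrable_dominated[OF i[of 1]]) (measurable, use \<eta>_bounds \<eta>_outside in \<open>auto simp: indicator_def intro!: AE_I2\<close>)
 show "integrable lborel \<eta>'"
  by (rule integrable_dominated[OF i[of E']]) (measurable, use \<eta>_bounds \<eta>_outside cut_nonneg in \<open>auto simp: indicator_def intro!: AE_I2\<close>)
qed

text \<open>
 A majorant with integral independent of \<open>\<epsilon>\<close>.
\<close>

definition envk :: "real \<Rightarrow> real \<times> ('a \<times> real) \<Rightarrow> real" where
 "envk \<epsilon> w = indicator {-1..1} (fst w) * (u.env (snd w) + \<bar>v (sep \<epsilon> w)\<bar> powr p)"

lemma envk_integral: "integrable lborel (envk \<epsilon>)"
 "(LBINT w. envk \<epsilon> w) = 2 * (LBINT z. u.env z) + 2 * (LBINT z. \<bar>v z\<bar> powr p)"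
proof -
 have b2: "(\<lambda>\<tau>::real. (0::'a, - (\<epsilon> * \<tau>))) \<in> borel_measurable borel" by measurable
 have b1: "(\<lambda>\<tau>::real. 0::'a \<times> real) \<in> borel_measurable borel" by simp
 note I1 = shear_integral[OF u.env_integrable b1, of "{-1..1}"] and I2 = shear_integral[OF v.u_Lp b2, of "{-1..1}"]
 have eq: "envk \<epsilon> = (\<lambda>w. indicator {-1..1} (fst w) * u.env (snd w + 0) + indicator {-1..1} (fst w) * \<bar>v (snd w + (0, - (\<epsilon> * fst w)))\<bar> powr p)"
  by (auto simp: envk_def sep_def delay_eq fun_eq_iff distrib_left)
 show "integrable lborel (envk \<epsilon>)" unfolding eq using I1(1) I2(1) by (intro Bochner_Integration.integrable_add) auto
 show "(LBINT w. envk \<epsilon> w) = 2 * (LBINT z. u.env z) + 2 * (LBINT z. \<bar>v z\<bar> powr p)"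
  unfolding eq using I1 I2 by (subst Bochner_Integration.integral_add) auto
qed

lemma integrand_bound:
 obtains C where "C \<ge> 0" "\<And>\<epsilon> w. 0 < \<epsilon> \<Longrightarrow> \<epsilon> \<le> 1 \<Longrightarrow> 0 < a \<Longrightarrow> b < T \<Longrightarrow>
  \<bar>EU \<epsilon> w * (\<omega>' (snd (snd w)) * \<eta> (fst w)) + (EU \<epsilon> w - EV \<epsilon> w) / \<epsilon> * (\<omega> (snd (snd w)) * \<eta>' (fst w))\<bar> \<le> C * envk \<epsilon> w"
proof -
 define C2 where "C2 = 2 * (L + 1) * p"
 define C3 where "C3 = C2 * (1 + 3 powr p * (1 + (L + 1) powr p))"
 define C where "C = 3 * X' + C3 * (X * E')"
 have C2: "C2 \<ge> 0" using u.p u.L by (simp add: C2_def)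
 have C3: "C3 \<ge> 0" using C2 by (simp add: C3_def)
 have C: "C \<ge> 0" using C3 cut_nonneg by (simp add: C_def)
 have L0: "L \<ge> 0" using u.L by simp
 show thesis
 proof (rule that[OF C])
  fix \<epsilon> :: real and w :: "real \<times> ('a \<times> real)" assume \<epsilon>: "0 < \<epsilon>" "\<epsilon> \<le> 1" and ab: "0 < a" "b < T"
  obtain \<tau> x t where w: "w = (\<tau>, (x, t))" by (metis surj_pair)
  let ?z = "(x, t)" and ?s = "sep \<epsilon> w"
  let ?I = "EU \<epsilon> w * (\<omega>' (snd (snd w)) * \<eta> (fst w)) + (EU \<epsilon> w - EV \<epsilon> w) / \<epsilon> * (\<omega> (snd (snd w)) * \<eta>' (fst w))"
  have nn: "0 \<le> C * envk \<epsilon> w" using C u.env_bounds(1) by (simp add: envk_def)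
  show "\<bar>?I\<bar> \<le> C * envk \<epsilon> w"
  proof (cases "\<tau> \<in> {-1..1} \<and> t \<in> {a..b} \<and> x \<in> \<Omega>")
   case False
   have "?I = 0"
   proof (cases "\<tau> \<in> {-1..1}")
    case \<tau>: True
    show ?thesis
    proof (cases "t \<in> {a..b}")
     case True
     then have "x \<notin> \<Omega>" using False \<tau> by simp
     then have "u ?z = 0" "v ?s = 0" by (auto simp: w sep_def intro!: u.outside v.outside)
     then have "EU \<epsilon> w = 0" "EV \<epsilon> w = 0"
      using ent_bounds[OF u.p L0 \<epsilon>(1), of 0 0] by (simp_all add: EU_def EV_def Eu_def Ev_def w)
     then show ?thesis by simp
    next
     case False then show ?thesis using \<omega>_outside \<omega>'_outside by (simp add: w)
    qed
   next
    case False then show ?thesis using \<eta>_outside by (simp add: w)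
   qed
   then show ?thesis using nn by simp
  next
   case True
   define R where "R = u.env ?z + \<bar>v ?s\<bar> powr p"
   have cyl: "?z \<in> cylinder \<Omega> T" using True ab by auto
   have env: "1 + \<bar>u ?z\<bar> powr p \<le> u.env ?z" using cyl by (simp add: u.env_def)
   have R1: "1 \<le> R" "\<bar>u ?z\<bar> powr p + \<bar>v ?s\<bar> powr p \<le> R"
    unfolding R_def using env powr_ge_zero[of "\<bar>u ?z\<bar>" p] powr_ge_zero[of "\<bar>v ?s\<bar>" p] by linarith+
   have e1: "\<bar>EU \<epsilon> w\<bar> \<le> 3 * R"
   proof -
    have "\<bar>EU \<epsilon> w\<bar> \<le> \<bar>b_fun p (u ?z)\<bar> + \<bar>b_fun p (v ?s)\<bar>"
     using ent_bounds(1,2)[OF u.p L0 \<epsilon>(1), of "u ?z" "v ?s"] by (simp add: EU_def Eu_def w)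
    then show ?thesis using abs_b_fun_le[OF u.p, of "u ?z"] abs_b_fun_le[OF u.p, of "v ?s"] R1 by linarith
   qed
   have e2: "\<bar>(EU \<epsilon> w - EV \<epsilon> w) / \<epsilon>\<bar> \<le> C3 * R"
   proof -
    have "\<bar>(EU \<epsilon> w - EV \<epsilon> w) / \<epsilon>\<bar> \<le> C2 * (1 + (\<bar>u ?z\<bar> + \<bar>v ?s\<bar> + (L + 1)) powr p)"
     using ent_diff_bound[OF u.p u.L \<epsilon>, of "u ?z" "v ?s"] by (simp add: EU_def EV_def Eu_def Ev_def w C2_def)
    also have "\<dots> \<le> C2 * (R + 3 powr p * ((1 + (L + 1) powr p) * R))"
    proof (intro mult_left_mono add_mono R1(1) C2)
     have "(\<bar>u ?z\<bar> + \<bar>v ?s\<bar> + (L + 1)) powr p \<le> 3 powr p * (\<bar>u ?z\<bar> powr p + \<bar>v ?s\<bar> powr p + (L + 1) powr p)"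
      using u.p L0 by (intro powr_sum3_le) auto
     also have "\<dots> \<le> 3 powr p * ((1 + (L + 1) powr p) * R)"
     proof (rule mult_left_mono)
      have "(L + 1) powr p * 1 \<le> (L + 1) powr p * R" by (rule mult_left_mono[OF R1(1)]) simp
      then show "\<bar>u ?z\<bar> powr p + \<bar>v ?s\<bar> powr p + (L + 1) powr p \<le> (1 + (L + 1) powr p) * R"
       using R1(2) by (simp add: distrib_right)
     qed simp
     finally show "(\<bar>u ?z\<bar> + \<bar>v ?s\<bar> + (L + 1)) powr p \<le> 3 powr p * ((1 + (L + 1) powr p) * R)" .
    qed
    also have "\<dots> = C3 * R" by (simp add: C3_def algebra_simps)
    finally show ?thesis .
   qed
   have m: "\<bar>c * d\<bar> \<le> A * B" if "\<bar>c\<bar> \<le> A" "\<bar>d\<bar> \<le> B" for c d A B :: real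
    using that unfolding abs_mult by (intro mult_mono) auto
   have w1: "\<bar>\<omega>' t * \<eta> \<tau>\<bar> \<le> X' * 1" using \<omega>_bounds(3)[of t] \<eta>_bounds[of \<tau>] by (intro m) auto
   have w2: "\<bar>\<omega> t * \<eta>' \<tau>\<bar> \<le> X * E'" using \<omega>_bounds[of t] \<eta>_bounds[of \<tau>] by (intro m) auto
   have "\<bar>?I\<bar> \<le> \<bar>EU \<epsilon> w * (\<omega>' t * \<eta> \<tau>)\<bar> + \<bar>(EU \<epsilon> w - EV \<epsilon> w) / \<epsilon> * (\<omega> t * \<eta>' \<tau>)\<bar>"
    unfolding w fst_conv snd_conv by (rule abs_triangle_ineq)
   also have "\<dots> \<le> (3 * R) * (X' * 1) + (C3 * R) * (X * E')" by (intro add_mono m e1 e2 w1 w2)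
   also have "\<dots> = C * R" by (simp add: C_def algebra_simps)
   also have "\<dots> = C * envk \<epsilon> w" using True by (simp add: envk_def R_def w)
   finally show ?thesis .
  qed
 qed
qed

text \<open>
 The limit \<open>\<epsilon> \<rightarrow> 0\<close> of the entropy inequality. The limit of the integrand is a product of functions of \<open>\<tau>\<close> and of
 \<open>(x, t)\<close>, and the part carrying \<open>\<eta>'\<close> has integral zero.
\<close>

theorem time_inequality:
 assumes ab: "0 < a" "b < T" and \<eta>1: "(LBINT \<tau>. \<eta>' \<tau>) = 0" "(LBINT \<tau>. \<eta> \<tau>) > 0"
 shows "0 \<le> (LBINT z. excess z * \<omega>' (snd z))"
proof -
 \<comment> \<open>The lag must not lead out of the time interval.\<close>
 define e0 where "e0 = min (min a (T - b)) 1 / 2"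
 define e where "e k = e0 / real (Suc k)" for k
 have e0: "0 < e0" "e0 < a" "b + e0 < T" "e0 < 1"
 proof -
  have "e0 \<le> a / 2" "e0 \<le> (T - b) / 2" "e0 \<le> 1 / 2" unfolding e0_def by (simp_all add: min_def)
  note le = this
  show "e0 < a" using le(1) ab by linarith
  show "b + e0 < T" using le(2) ab by (simp add: field_simps)
  show "e0 < 1" using le(3) by linarith
  show "0 < e0" using ab by (simp add: e0_def)
 qed
 have epos: "e k > 0" for k using e0 by (simp add: e_def)
 have ele: "e k \<le> e0" for k using e0 by (simp add: e_def divide_le_eq)
 have elim: "e \<longlonglongrightarrow> 0"
 proof -
  have "(\<lambda>k. e0 * inverse (real (Suc k))) \<longlonglongrightarrow> e0 * 0" by (intro tendsto_mult tendsto_const LIMSEQ_inverse_real_of_nat)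
  then show ?thesis by (simp add: e_def[abs_def] divide_inverse)
 qed
 have cm: "(\<lambda>\<tau>::real. (0::'a, - (e k * \<tau>))) \<in> borel_measurable borel" for k by measurable
 have clim: "(\<lambda>k. (0::'a, - (e k * \<tau>))) \<longlonglongrightarrow> 0" for \<tau>
 proof -
  have "(\<lambda>k. (0::'a, - (e k * \<tau>))) \<longlonglongrightarrow> (0, - (0 * \<tau>))" by (intro tendsto_Pair tendsto_const tendsto_minus tendsto_mult elim)
  then show ?thesis by (simp add: zero_prod_def)
 qed
 obtain r where r: "strict_mono (r::nat\<Rightarrow>nat)"
  "AE w in lborel. fst w \<in> {-1..1} \<longrightarrow> (\<lambda>k. v (snd w + (\<lambda>_. 0) (fst w) + (\<lambda>k \<tau>. (0, - (e k * \<tau>))) (r k) (fst w))) \<longlonglongrightarrow> v (snd w + (\<lambda>_. 0) (fst w))"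
  by (rule shear_AE_subseq[OF v.u_integrable, of "\<lambda>_. 0" "\<lambda>k \<tau>. (0, - (e k * \<tau>))" "{-1..1::real}"]) (use cm clim in auto)
 have ae: "AE w in lborel. fst w \<in> {-1..1} \<longrightarrow> (\<lambda>k. v (sep (e (r k)) w)) \<longlonglongrightarrow> v (snd w)"
  using r(2) by eventually_elim (simp add: sep_def delay_eq)
 have er: "(\<lambda>k. e (r k)) \<longlonglongrightarrow> 0" using LIMSEQ_subseq_LIMSEQ[OF elim r(1)] by (simp add: o_def)
 have er1: "e (r k) > 0" "e (r k) \<le> 1" for k using epos ele[of "r k"] e0 by auto
 obtain C where C: "C \<ge> 0" "\<And>\<epsilon> w. 0 < \<epsilon> \<Longrightarrow> \<epsilon> \<le> 1 \<Longrightarrow> 0 < a \<Longrightarrow> b < T \<Longrightarrow>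
  \<bar>EU \<epsilon> w * (\<omega>' (snd (snd w)) * \<eta> (fst w)) + (EU \<epsilon> w - EV \<epsilon> w) / \<epsilon> * (\<omega> (snd (snd w)) * \<eta>' (fst w))\<bar> \<le> C * envk \<epsilon> w"
  by (rule integrand_bound, rule that)
 define cL where "cL = (LBINT \<sigma>. tent \<sigma> * (L + \<sigma>))"
 define sk where "sk k w = EU (e (r k)) w * (\<omega>' (snd (snd w)) * \<eta> (fst w)) + (EU (e (r k)) w - EV (e (r k)) w) / e (r k) * (\<omega> (snd (snd w)) * \<eta>' (fst w))" for k w
 define sl where "sl w = excess (snd w) * (\<omega>' (snd (snd w)) * \<eta> (fst w)) + (cL * jump p (u (snd w)) (v (snd w))) * (\<omega> (snd (snd w)) * \<eta>' (fst w))" for w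
 have L0: "L \<ge> 0" using u.L by simp
 have p0: "p > 0" using u.p by simp
 have lim: "(\<lambda>k. LBINT w. sk k w) \<longlonglongrightarrow> (LBINT w. sl w)"
 proof (rule generalized_dominated_convergence(4)[where g="\<lambda>w. C * (indicator {-1..1::real} (fst w) * (u.env (snd w) + \<bar>v (snd w)\<bar> powr p))" and G="\<lambda>k w. C * envk (e (r k)) w"])
  show "sl \<in> borel_measurable lborel" unfolding sl_def by measurable
  show "sk k \<in> borel_measurable lborel" for k unfolding sk_def by measurable
  have g0: "(\<lambda>w. C * (indicator {-1..1::real} (fst w) * (u.env (snd w) + \<bar>v (snd w)\<bar> powr p))) = (\<lambda>w. C * envk 0 w)"
   by (simp add: envk_def sep_def)
  show "integrable lborel (\<lambda>w. C * (indicator {-1..1::real} (fst w) * (u.env (snd w) + \<bar>v (snd w)\<bar> powr p)))"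
   unfolding g0 by (rule integrable_mult_right[OF envk_integral(1)])
  show "integrable lborel (\<lambda>w. C * envk (e (r k)) w)" for k by (rule integrable_mult_right[OF envk_integral(1)])
  show "(\<lambda>k. LBINT w. C * envk (e (r k)) w) \<longlonglongrightarrow> (LBINT w. C * (indicator {-1..1::real} (fst w) * (u.env (snd w) + \<bar>v (snd w)\<bar> powr p)))"
   unfolding g0 integral_mult_right_zero envk_integral(2) by simp
  show "AE w in lborel. norm (sk k w) \<le> C * envk (e (r k)) w" for k unfolding sk_def using C(2)[OF er1 ab] by simp
  show "AE w in lborel. (\<lambda>k. sk k w) \<longlonglongrightarrow> sl w" using ae
  proof eventually_elim
   case (elim w)
   show ?case
   proof (cases "fst w \<in> {-1..1}")
    case True
    then have vl: "(\<lambda>k. v (sep (e (r k)) w)) \<longlonglongrightarrow> v (snd w)" using elim by blast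
    show ?thesis unfolding sk_def sl_def EU_def EV_def Eu_def Ev_def excess_def cL_def
     by (intro tendsto_add tendsto_mult tendsto_const ent1_tendsto[OF u.p L0 er1(1) er vl] ent_diff_tendsto[OF u.p u.L er1 er vl])
   next
    case False then show ?thesis using \<eta>_outside by (simp add: sk_def sl_def)
   qed
  qed
  show "AE w in lborel. (\<lambda>k. C * envk (e (r k)) w) \<longlonglongrightarrow> C * (indicator {-1..1::real} (fst w) * (u.env (snd w) + \<bar>v (snd w)\<bar> powr p))" using ae
  proof eventually_elim
   case (elim w)
   show ?case
   proof (cases "fst w \<in> {-1..1}")
    case True
    then have vl: "(\<lambda>k. v (sep (e (r k)) w)) \<longlonglongrightarrow> v (snd w)" using elim by blast
    have "(\<lambda>k. \<bar>v (sep (e (r k)) w)\<bar> powr p) \<longlonglongrightarrow> \<bar>v (snd w)\<bar> powr p"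
     by (rule tendsto_powr'[OF tendsto_rabs[OF vl] tendsto_const]) (use p0 in auto)
    then show ?thesis unfolding envk_def by (intro tendsto_mult tendsto_add tendsto_const)
   next
    case False then show ?thesis by (simp add: envk_def)
   qed
  qed
 qed
 have "0 \<le> (LBINT w. sk k w)" for k
  unfolding sk_def using ele[of "r k"] e0 by (intro entropy_inequality er1) auto
 then have "0 \<le> (LBINT w. sl w)" using LIMSEQ_le_const[OF lim] by blast
 also have "(LBINT w. sl w) = (LBINT w. \<eta> (fst w) * (excess (snd w) * \<omega>' (snd (snd w))) + \<eta>' (fst w) * (cL * (jump p (u (snd w)) (v (snd w)) * \<omega> (snd (snd w)))))"
  by (simp add: sl_def algebra_simps)
 also have "\<dots> = (LBINT \<tau>. \<eta> \<tau>) * (LBINT z. excess z * \<omega>' (snd z)) + (LBINT \<tau>. \<eta>' \<tau>) * (LBINT z. cL * (jump p (u z) (v z) * \<omega> (snd z)))"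
 proof -
  have i1: "integrable lborel (\<lambda>z. excess z * \<omega>' (snd z))"
   using integrable_mult_bounded[OF excess_integrable, of "\<lambda>z. \<omega>' (snd z)" X'] \<omega>_bounds by simp
  have i2: "integrable lborel (\<lambda>z. cL * (jump p (u z) (v z) * \<omega> (snd z)))"
   using integrable_mult_bounded[OF jump_integrable, of "\<lambda>z. \<omega> (snd z)" X] \<omega>_bounds by simp
  show ?thesis
   using lborel_product_integral[OF \<eta>_integrable(1) i1] lborel_product_integral[OF \<eta>_integrable(2) i2]
   by (subst Bochner_Integration.integral_add) auto
 qed
 finally show ?thesis using \<eta>1 by (simp add: zero_le_mult_iff)
qed

end

section \<open>Comparison\<close>

text \<open>
 A cutoff for the time lag. Its derivative is odd and so has integral zero.
\<close>

definition mound :: "real \<Rightarrow> real" where "mound \<tau> = pos2 (1 - \<tau>\<^sup>2)"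

definition mound' :: "real \<Rightarrow> real" where "mound' \<tau> = 2 * max 0 (1 - \<tau>\<^sup>2) * (- 2 * \<tau>)"

lemma mound_DERIV: "(mound has_real_derivative mound' \<tau>) (at \<tau>)"
proof -
 have "((\<lambda>\<tau>. 1 - \<tau>\<^sup>2) has_real_derivative - 2 * \<tau>) (at \<tau>)" by (auto intro!: derivative_eq_intros)
 from DERIV_chain2[where f=pos2, OF pos2_DERIV this] show ?thesis by (simp add: mound_def[abs_def] mound'_def)
qed

lemma mound_outside: assumes "\<tau> \<notin> {-1..1}" shows "mound \<tau> = 0" "mound' \<tau> = 0"
proof -
 have "1 < \<bar>\<tau>\<bar>" using assms by auto
 then have "1 < \<tau>\<^sup>2" using one_less_power[of "\<bar>\<tau>\<bar>" 2] by simp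
 then show "mound \<tau> = 0" "mound' \<tau> = 0" by (simp_all add: mound_def mound'_def pos2_def)
qed

lemma mound_bounds: "0 \<le> mound \<tau>" "mound \<tau> \<le> 1" "\<bar>mound' \<tau>\<bar> \<le> 4"
proof -
 have m: "0 \<le> max 0 (1 - \<tau>\<^sup>2)" "max 0 (1 - \<tau>\<^sup>2) \<le> 1" by simp_all
 show "0 \<le> mound \<tau>" by (simp add: mound_def pos2_def)
 show "mound \<tau> \<le> 1" unfolding mound_def pos2_def using m by (rule power_le_one)
 show "\<bar>mound' \<tau>\<bar> \<le> 4"
 proof (cases "\<tau> \<in> {-1..1}")
  case True
  have "\<bar>mound' \<tau>\<bar> = 4 * (max 0 (1 - \<tau>\<^sup>2) * \<bar>\<tau>\<bar>)" by (simp add: mound'_def abs_mult)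
  moreover have "max 0 (1 - \<tau>\<^sup>2) * \<bar>\<tau>\<bar> \<le> 1 * 1" using m True by (intro mult_mono) auto
  ultimately show ?thesis by simp
 next
  case False then show ?thesis by (simp add: mound_outside)
 qed
qed

lemma mound_measurable [measurable]: "mound \<in> borel_measurable borel" "mound' \<in> borel_measurable borel"
proof -
 have "continuous_on UNIV mound" by (auto intro!: continuous_at_imp_continuous_on DERIV_isCont mound_DERIV)
 then show "mound \<in> borel_measurable borel" by (rule borel_measurable_continuous_onI)
 show "mound' \<in> borel_measurable borel" unfolding mound'_def[abs_def] by measurable
qed

lemma mound_integral: "(LBINT \<tau>. mound' \<tau>) = 0" "(LBINT \<tau>. mound \<tau>) > 0"
proof -
 have "(LBINT \<tau>. mound' (0 - \<tau>)) = (LBINT \<tau>. mound' \<tau>)" by (rule lborel_integral_reflect) measurable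
 moreover have "(\<lambda>\<tau>. mound' (0 - \<tau>)) = (\<lambda>\<tau>. - mound' \<tau>)" by (simp add: mound'_def fun_eq_iff)
 ultimately show "(LBINT \<tau>. mound' \<tau>) = 0" by simp
 have i: "integrable lborel (\<lambda>\<tau>. indicator {c..d} \<tau> * C)" for c d C :: real
  by (intro integrable_mult_left integrable_real_indicator) (auto simp: emeasure_lborel_Icc_eq)
 have m: "integrable lborel mound"
  by (rule integrable_dominated[OF i[of "-1" 1 1]]) (measurable, use mound_bounds mound_outside in \<open>auto simp: indicator_def intro!: AE_I2\<close>)
 have "indicator {-1/2..1/2} \<tau> * (9/16) \<le> mound \<tau>" for \<tau> :: real
 proof (cases "\<tau> \<in> {-1/2..1/2}")
  case True
  then have "\<bar>\<tau>\<bar> \<le> 1/2" by auto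
  then have "\<tau>\<^sup>2 \<le> (1/2)\<^sup>2" by (metis abs_ge_zero power2_abs power_mono)
  then have "3/4 \<le> 1 - \<tau>\<^sup>2" by (simp add: power2_eq_square)
  then have "(3/4)\<^sup>2 \<le> (max 0 (1 - \<tau>\<^sup>2))\<^sup>2" by (intro power_mono) auto
  then show ?thesis using True by (simp add: mound_def pos2_def power2_eq_square)
 next
  case False then show ?thesis using mound_bounds by simp
 qed
 then have "(LBINT \<tau>. indicator {-1/2..1/2::real} \<tau> * (9/16)) \<le> (LBINT \<tau>. mound \<tau>)" by (intro integral_mono i m)
 then show "(LBINT \<tau>. mound \<tau>) > 0" by simp
qed

lemma window_bounds:
 assumes T': "0 < T'" and \<sigma>: "0 < \<sigma>"
 shows "0 \<le> 2 * max 0 (T' - t) * step ((t - \<sigma>) / \<sigma>)" "2 * max 0 (T' - t) * step ((t - \<sigma>) / \<sigma>) \<le> 2 * T'"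
  "0 \<le> pos2 (T' - t) * (tent ((t - \<sigma>) / \<sigma>) / \<sigma>)" "pos2 (T' - t) * (tent ((t - \<sigma>) / \<sigma>) / \<sigma>) \<le> T'\<^sup>2 * (2 / \<sigma>)"
  "0 \<le> pos2 (T' - t) * step ((t - \<sigma>) / \<sigma>)" "pos2 (T' - t) * step ((t - \<sigma>) / \<sigma>) \<le> T'\<^sup>2"
proof -
 define m S q where "m = max 0 (T' - t)" and "S = step ((t - \<sigma>) / \<sigma>)" and "q = tent ((t - \<sigma>) / \<sigma>) / \<sigma>"
 have nn: "0 \<le> m" "0 \<le> S" "S \<le> 1" "0 \<le> q" "q \<le> 2 / \<sigma>"
  using step_bounds tent_bounds \<sigma> by (auto simp: m_def S_def q_def intro!: divide_right_mono)
 have "0 \<le> 2 * m * S \<and> 2 * m * S \<le> 2 * T' \<and> 0 \<le> m\<^sup>2 * q \<and> m\<^sup>2 * q \<le> T'\<^sup>2 * (2 / \<sigma>) \<and> 0 \<le> m\<^sup>2 * S \<and> m\<^sup>2 * S \<le> T'\<^sup>2"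
 proof (cases "t \<le> \<sigma>")
  case True
  then have "(t - \<sigma>) / \<sigma> \<le> 0" using \<sigma> by (simp add: divide_le_0_iff)
  then have "S = 0" "q = 0" by (simp_all add: S_def q_def step_le_0 tent_outside)
  then show ?thesis using T' \<sigma> by simp
 next
  case False
  then have m: "m \<le> T'" using T' \<sigma> by (simp add: m_def)
  have m2: "m\<^sup>2 \<le> T'\<^sup>2" using m nn(1) by (rule power_mono)
  have "m * S \<le> T' * 1" using m nn T' by (intro mult_mono) auto
  moreover have "m\<^sup>2 * S \<le> T'\<^sup>2 * 1" using m2 nn by (intro mult_mono) auto
  moreover have "m\<^sup>2 * q \<le> T'\<^sup>2 * (2 / \<sigma>)" using m2 nn by (intro mult_mono) auto
  moreover have "0 \<le> m * S" "0 \<le> m\<^sup>2 * q" "0 \<le> m\<^sup>2 * S" using nn by auto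
  ultimately show ?thesis by linarith
 qed
 then show "0 \<le> 2 * max 0 (T' - t) * step ((t - \<sigma>) / \<sigma>)" "2 * max 0 (T' - t) * step ((t - \<sigma>) / \<sigma>) \<le> 2 * T'"
  "0 \<le> pos2 (T' - t) * (tent ((t - \<sigma>) / \<sigma>) / \<sigma>)" "pos2 (T' - t) * (tent ((t - \<sigma>) / \<sigma>) / \<sigma>) \<le> T'\<^sup>2 * (2 / \<sigma>)"
  "0 \<le> pos2 (T' - t) * step ((t - \<sigma>) / \<sigma>)" "pos2 (T' - t) * step ((t - \<sigma>) / \<sigma>) \<le> T'\<^sup>2"
  unfolding m_def S_def q_def pos2_def by blast+
qed

context solution_pair
begin

text \<open>
 The time inequality for the cutoff \<open>\<omega>(t) = ((T' - t)\<^sup>+)\<^sup>2 step((t - \<sigma>)/\<sigma>)\<close>, with the two parts of \<open>\<omega>'\<close> on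
 different sides.
\<close>

lemma cutoff_inequality:
 assumes T': "0 < T'" "T' < T" and \<sigma>: "0 < \<sigma>"
 shows "(LBINT z. excess z * (2 * max 0 (T' - snd z) * step ((snd z - \<sigma>) / \<sigma>)))
   \<le> (LBINT z. excess z * (pos2 (T' - snd z) * (tent ((snd z - \<sigma>) / \<sigma>) / \<sigma>)))"
proof -
 define \<omega> where "\<omega> t = pos2 (T' - t) * step ((t - \<sigma>) / \<sigma>)" for t
 define A where "A t = 2 * max 0 (T' - t) * step ((t - \<sigma>) / \<sigma>)" for t
 define B where "B t = pos2 (T' - t) * (tent ((t - \<sigma>) / \<sigma>) / \<sigma>)" for t
 have bd: "0 \<le> A t \<and> A t \<le> 2 * T'" "0 \<le> B t \<and> B t \<le> T'\<^sup>2 * (2 / \<sigma>)" "0 \<le> \<omega> t \<and> \<omega> t \<le> T'\<^sup>2" for t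
  unfolding A_def B_def \<omega>_def using window_bounds[OF T'(1) \<sigma>] by blast+
 have [measurable]: "A \<in> borel_measurable borel" "B \<in> borel_measurable borel"
  unfolding A_def[abs_def] B_def[abs_def] pos2_def[abs_def] by measurable
 interpret E: entropy_setting p T L \<Omega> \<psi> D\<psi> u U v V \<omega> "\<lambda>t. B t - A t" mound mound' \<sigma> T' "T'\<^sup>2" "2 * T' + T'\<^sup>2 * (2 / \<sigma>)" 4
 proof unfold_locales
  fix t
  show "(\<omega> has_real_derivative B t - A t) (at t)"
  proof -
   have d1: "((\<lambda>t. T' - t) has_real_derivative -1) (at t)" by (auto intro!: derivative_eq_intros)
   have d2: "((\<lambda>t. (t - \<sigma>) / \<sigma>) has_real_derivative 1 / \<sigma>) (at t)" using \<sigma> by (auto intro!: derivative_eq_intros)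
   have "(\<omega> has_real_derivative 2 * max 0 (T' - t) * -1 * step ((t - \<sigma>) / \<sigma>) + tent ((t - \<sigma>) / \<sigma>) * (1 / \<sigma>) * pos2 (T' - t)) (at t)"
    unfolding \<omega>_def[abs_def]
    by (rule DERIV_mult[OF DERIV_chain2[where f=pos2, OF pos2_DERIV d1] DERIV_chain2[where f=step, OF step_DERIV d2]])
   then show ?thesis by (simp add: A_def B_def mult.commute)
  qed
  show "0 \<le> \<omega> t" "\<omega> t \<le> T'\<^sup>2" using bd(3) by auto
  show "\<bar>B t - A t\<bar> \<le> 2 * T' + T'\<^sup>2 * (2 / \<sigma>)" using bd(1,2)[of t] by linarith
  show "\<omega> t = 0" if "t \<notin> {\<sigma>..T'}"
  proof (cases "t < \<sigma>")
   case True
   then have "(t - \<sigma>) / \<sigma> \<le> 0" using \<sigma> by (simp add: divide_le_0_iff)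
   then show ?thesis by (simp add: \<omega>_def step_le_0)
  next
   case False then show ?thesis using that by (auto simp: \<omega>_def pos2_def)
  qed
  show "(\<lambda>t. B t - A t) \<in> borel_measurable borel" by measurable
 qed (use mound_DERIV mound_bounds mound_outside in auto)
 have i: "integrable lborel (\<lambda>z. excess z * A (snd z))" "integrable lborel (\<lambda>z. excess z * B (snd z))"
  using integrable_mult_bounded[OF excess_integrable, of "\<lambda>z. A (snd z)" "2 * T'"]
   integrable_mult_bounded[OF excess_integrable, of "\<lambda>z. B (snd z)" "T'\<^sup>2 * (2 / \<sigma>)"] bd by auto
 have "0 \<le> (LBINT z. excess z * (B (snd z) - A (snd z)))" by (rule E.time_inequality[OF \<sigma> T'(2) mound_integral])
 also have "\<dots> = (LBINT z. excess z * B (snd z)) - (LBINT z. excess z * A (snd z))"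
  using Bochner_Integration.integral_diff[OF i(2,1)] by (simp add: right_diff_distrib)
 finally show ?thesis unfolding A_def B_def by simp
qed

text \<open>
 The weight is at most \<open>2 T'\<^sup>2 / \<sigma>\<close> and lives on an interval of length \<open>\<sigma>\<close>.
\<close>

lemma initial_layer_bound:
 assumes T': "0 < T'" "T' < T" and \<sigma>: "0 < \<sigma>" "2 * \<sigma> \<le> d" and e: "0 \<le> e"
  and init: "AE t in lborel. 0 < t \<and> t < d \<longrightarrow> (\<integral>\<^sup>+x. ennreal \<bar>b_fun p (u (x, t)) - b_fun p (v (x, t))\<bar> \<partial>lborel) \<le> ennreal e"
 shows "(LBINT z. excess z * (pos2 (T' - snd z) * (tent ((snd z - \<sigma>) / \<sigma>) / \<sigma>))) \<le> 2 * T'\<^sup>2 * e"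
proof -
 define B where "B t = pos2 (T' - t) * (tent ((t - \<sigma>) / \<sigma>) / \<sigma>)" for t
 have out: "B t = 0" if "\<not> (\<sigma> < t \<and> t < 2 * \<sigma>)" for t
 proof -
  have "(t - \<sigma>) / \<sigma> \<le> 0 \<or> 1 \<le> (t - \<sigma>) / \<sigma>" using that \<sigma> by (auto simp: divide_le_0_iff pos_le_divide_eq)
  then show ?thesis by (simp add: B_def tent_outside)
 qed
 have bd: "0 \<le> B t \<and> B t \<le> T'\<^sup>2 * (2 / \<sigma>)" for t
  unfolding B_def using window_bounds[OF T'(1) \<sigma>(1)] by blast
 have [measurable]: "B \<in> borel_measurable borel" unfolding B_def[abs_def] pos2_def[abs_def] by measurable
 have i: "integrable lborel (\<lambda>z. excess z * B (snd z))"
  using integrable_mult_bounded[OF excess_integrable, of "\<lambda>z. B (snd z)" "T'\<^sup>2 * (2 / \<sigma>)"] bd by auto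
 have "(LBINT z. excess z * B (snd z)) = (LBINT t. LBINT x. excess (x, t) * B t)"
  using lborel_Fubini_snd(3)[OF i] by simp
 also have "\<dots> \<le> (LBINT t. indicator {\<sigma>..2 * \<sigma>} t * (T'\<^sup>2 * (2 / \<sigma>) * e))"
 proof (rule integral_mono_AE)
  show "integrable lborel (\<lambda>t. LBINT x. excess (x, t) * B t)" using lborel_Fubini_snd(2)[OF i] by simp
  show "integrable lborel (\<lambda>t. indicator {\<sigma>..2 * \<sigma>} t * (T'\<^sup>2 * (2 / \<sigma>) * e))"
   by (intro integrable_mult_left integrable_real_indicator) (auto simp: emeasure_lborel_Icc_eq)
  show "AE t in lborel. (LBINT x. excess (x, t) * B t) \<le> indicator {\<sigma>..2 * \<sigma>} t * (T'\<^sup>2 * (2 / \<sigma>) * e)"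
   using init lborel_Fubini_snd(1)[OF excess_integrable]
  proof eventually_elim
   case (elim t)
   show ?case
   proof (cases "\<sigma> < t \<and> t < 2 * \<sigma>")
    case True
    have "ennreal (LBINT x. excess (x, t)) = (\<integral>\<^sup>+x. ennreal (excess (x, t)) \<partial>lborel)"
     by (rule nn_integral_eq_integral[symmetric, OF elim(2)]) (simp add: excess_bounds)
    also have "\<dots> \<le> (\<integral>\<^sup>+x. ennreal \<bar>b_fun p (u (x, t)) - b_fun p (v (x, t))\<bar> \<partial>lborel)"
     by (intro nn_integral_mono ennreal_leI excess_bounds)
    also have "\<dots> \<le> ennreal e" using elim(1) True \<sigma> by auto
    finally have "(LBINT x. excess (x, t)) \<le> e" using e by (simp add: ennreal_le_iff)
    then have "B t * (LBINT x. excess (x, t)) \<le> (T'\<^sup>2 * (2 / \<sigma>)) * e"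
     using bd[of t] \<sigma> e by (intro mult_mono) (auto intro!: Bochner_Integration.integral_nonneg excess_bounds)
    then show ?thesis using True by (simp add: mult.commute)
   next
    case False
    then show ?thesis using out[OF False] e \<sigma> by simp
   qed
  qed
 qed
 also have "\<dots> = 2 * T'\<^sup>2 * e" using \<sigma> by simp
 finally show ?thesis unfolding B_def .
qed

text \<open>
 As \<open>\<sigma> \<rightarrow> 0\<close>, the cutoff inequality becomes \<open>\<integral> (b(u) - b(v))\<^sup>+ 2 (T' - t)\<^sup>+ \<le> 0\<close> by the initial condition.
\<close>

theorem comparison:
 assumes init: "\<And>e. e > 0 \<Longrightarrow> \<exists>d>0. AE t in lborel. 0 < t \<and> t < d \<longrightarrow>
   (\<integral>\<^sup>+x. ennreal \<bar>b_fun p (u (x, t)) - b_fun p (v (x, t))\<bar> \<partial>lborel) \<le> ennreal e"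
 shows "AE z in lborel. u z \<le> v z"
proof -
 have ex0: "excess z = 0" if "\<not> (0 < snd z \<and> snd z < T)" for z :: "'a \<times> real"
  using that u.outside(1)[of z] v.outside(1)[of z] by (auto simp: excess_def mem_Times_iff)
 have before: "AE z in lborel. snd z < T' \<longrightarrow> excess z = 0" if T': "0 < T'" "T' < T" for T'
 proof -
  define w where "w z = excess z * (2 * max 0 (T' - snd z))" for z
  define \<sigma> where "\<sigma> k = inverse (real (Suc k))" for k
  have \<sigma>: "\<sigma> k > 0" for k by (simp add: \<sigma>_def)
  have \<sigma>0: "\<sigma> \<longlonglongrightarrow> 0" unfolding \<sigma>_def[abs_def] by (rule LIMSEQ_inverse_real_of_nat)
  define I where "I k = (LBINT z. excess z * (2 * max 0 (T' - snd z) * step ((snd z - \<sigma> k) / \<sigma> k)))" for k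
  have wb: "0 \<le> w z" "w z \<le> excess z * (2 * T')" for z
  proof -
   have "0 \<le> w z \<and> w z \<le> excess z * (2 * T')"
   proof (cases "0 < snd z")
    case True
    then have "2 * max 0 (T' - snd z) \<le> 2 * T'" using T' by simp
    then show ?thesis unfolding w_def using excess_bounds(1)[of z] by (intro conjI mult_left_mono mult_nonneg_nonneg) simp_all
   next
    case False then show ?thesis using ex0[of z] by (simp add: w_def)
   qed
   then show "0 \<le> w z" "w z \<le> excess z * (2 * T')" by auto
  qed
  have [measurable]: "w \<in> borel_measurable borel" unfolding w_def[abs_def] by measurable
  have wi: "integrable lborel w"
  proof (rule integrable_dominated)
   show "integrable lborel (\<lambda>z. excess z * (2 * T'))" by (rule integrable_mult_left[OF excess_integrable])
   show "AE z in lborel. norm (w z) \<le> norm (excess z * (2 * T'))"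
   proof (rule AE_I2)
    fix z :: "'a \<times> real"
    have "norm (w z) = w z" using wb(1)[of z] by simp
    then show "norm (w z) \<le> norm (excess z * (2 * T'))" using wb(2)[of z] abs_ge_self[of "excess z * (2 * T')"] unfolding real_norm_def by linarith
   qed
  qed measurable
  have lim: "I \<longlonglongrightarrow> (LBINT z. w z)" unfolding I_def
  proof (rule integral_dominated_convergence[OF _ _ wi])
   show "w \<in> borel_measurable lborel" by measurable
   show "(\<lambda>z. excess z * (2 * max 0 (T' - snd z) * step ((snd z - \<sigma> k) / \<sigma> k))) \<in> borel_measurable lborel" for k by measurable
   show "AE z in lborel. norm (excess z * (2 * max 0 (T' - snd z) * step ((snd z - \<sigma> k) / \<sigma> k))) \<le> w z" for k
   proof (rule AE_I2)
    fix z :: "'a \<times> real"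
    have s: "0 \<le> step ((snd z - \<sigma> k) / \<sigma> k)" "step ((snd z - \<sigma> k) / \<sigma> k) \<le> 1" by (simp_all add: step_bounds)
    have "w z * step ((snd z - \<sigma> k) / \<sigma> k) \<le> w z * 1" using s wb by (intro mult_left_mono) auto
    then show "norm (excess z * (2 * max 0 (T' - snd z) * step ((snd z - \<sigma> k) / \<sigma> k))) \<le> w z"
     using s excess_bounds(1)[of z] by (simp add: w_def abs_mult mult.assoc)
   qed
   show "AE z in lborel. (\<lambda>k. excess z * (2 * max 0 (T' - snd z) * step ((snd z - \<sigma> k) / \<sigma> k))) \<longlonglongrightarrow> w z"
   proof (rule AE_I2)
    fix z :: "'a \<times> real"
    show "(\<lambda>k. excess z * (2 * max 0 (T' - snd z) * step ((snd z - \<sigma> k) / \<sigma> k))) \<longlonglongrightarrow> w z"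
    proof (cases "0 < snd z")
     case True
     then have "eventually (\<lambda>k. \<sigma> k < snd z / 2) sequentially" using order_tendstoD(2)[OF \<sigma>0, of "snd z / 2"] by simp
     then have "eventually (\<lambda>k. w z = excess z * (2 * max 0 (T' - snd z) * step ((snd z - \<sigma> k) / \<sigma> k))) sequentially"
     proof eventually_elim
      case (elim k)
      then have "1 \<le> (snd z - \<sigma> k) / \<sigma> k" using \<sigma>[of k] by (simp add: pos_le_divide_eq)
      then show ?case by (simp add: w_def step_ge_1)
     qed
     then show ?thesis by (rule Lim_transform_eventually[OF tendsto_const])
    next
     case False then show ?thesis using ex0[of z] by (simp add: w_def)
    qed
   qed
  qed
  have "(LBINT z. w z) \<le> 0 + e" if e: "e > 0" for e
  proof -
   define e' where "e' = e / (2 * T'\<^sup>2)"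
   have e': "e' > 0" using e T' by (simp add: e'_def)
   obtain d where d: "d > 0" "AE t in lborel. 0 < t \<and> t < d \<longrightarrow>
    (\<integral>\<^sup>+x. ennreal \<bar>b_fun p (u (x, t)) - b_fun p (v (x, t))\<bar> \<partial>lborel) \<le> ennreal e'" using init[OF e'] by blast
   have "eventually (\<lambda>k. \<sigma> k < d / 2) sequentially" using order_tendstoD(2)[OF \<sigma>0, of "d / 2"] d by simp
   then have "eventually (\<lambda>k. I k \<le> e) sequentially"
   proof eventually_elim
    case (elim k)
    have "I k \<le> 2 * T'\<^sup>2 * e'" unfolding I_def
     by (rule order_trans[OF cutoff_inequality[OF T' \<sigma>] initial_layer_bound[OF T' \<sigma> _ _ d(2)]]) (use elim e' in auto)
    then show ?case using T' by (simp add: e'_def)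
   qed
   then show ?thesis using tendsto_upperbound[OF lim] by simp
  qed
  then have "(LBINT z. w z) \<le> 0" by (rule field_le_epsilon)
  then have "(LBINT z. w z) = 0" using wb by (intro antisym Bochner_Integration.integral_nonneg) auto
  then have "AE z in lborel. w z = 0" using integral_nonneg_eq_0_iff_AE[OF wi] wb by auto
  then show ?thesis by eventually_elim (auto simp: w_def)
 qed
 \<comment> \<open>The cutoff needs a final time below \<open>T\<close>; countably many of them exhaust the interval.\<close>
 define \<theta> where "\<theta> n = T - T / real (n + 2)" for n
 have \<theta>: "0 < \<theta> n" "\<theta> n < T" for n using u.T by (auto simp: \<theta>_def divide_less_eq)
 have "AE z in lborel. \<forall>n. snd z < \<theta> n \<longrightarrow> excess z = 0" unfolding AE_all_countable using before[OF \<theta>] by blast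
 then show ?thesis
 proof eventually_elim
  case (elim z)
  have "excess z = 0"
  proof (cases "snd z < T")
   case True
   have "(\<lambda>n. T - T * inverse (real (n + 2))) \<longlonglongrightarrow> T - T * 0"
    by (intro tendsto_intros LIMSEQ_ignore_initial_segment[OF lim_inverse_n])
   then have "\<theta> \<longlonglongrightarrow> T" by (simp add: \<theta>_def[abs_def] divide_inverse)
   from order_tendstoD(1)[OF this True] obtain n where "snd z < \<theta> n" by (auto simp: eventually_sequentially)
   then show ?thesis using elim by blast
  next
   case False then show ?thesis using ex0 by simp
  qed
  then have "b_fun p (u z) \<le> b_fun p (v z)" by (simp add: excess_def max_def split: if_splits)
  then show ?case using b_fun_le_iff[OF u.p] by simp
 qed
qed

end

section \<open>Weak gradients and Borel representatives\<close>

lemma borel_restrict_lebesgue_on: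
 "f \<in> borel_measurable borel \<Longrightarrow> f \<in> borel_measurable (lebesgue_on S)"
 by (intro measurable_restrict_space1 measurable_completion) simp

lemma lebesgue_on_borel_representative:
 fixes f :: "'a::euclidean_space \<Rightarrow> 'b::euclidean_space"
 assumes f: "f \<in> borel_measurable (lebesgue_on S)" and S: "S \<in> sets borel"
 obtains g where "g \<in> borel_measurable borel" "\<And>x. x \<notin> S \<Longrightarrow> g x = 0" "AE x in lborel. x \<in> S \<longrightarrow> g x = f x"
proof -
 have fm: "(\<lambda>x. if x \<in> S then f x else 0) \<in> borel_measurable lebesgue" using f S by (intro borel_measurable_if_I) auto
 have "\<exists>h. h \<in> borel_measurable lborel \<and> (AE x in lborel. (if x \<in> S then f x else 0) \<bullet> b = h x)" for b
 proof -
  have "(\<lambda>x. (if x \<in> S then f x else 0) \<bullet> b) \<in> borel_measurable lebesgue" using fm by measurable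
  from completion_ex_borel_measurable_real[OF this] show ?thesis by blast
 qed
 then obtain h where h: "\<And>b. h b \<in> borel_measurable lborel" "\<And>b. AE x in lborel. (if x \<in> S then f x else 0) \<bullet> b = h b x" by metis
 define g where "g x = (if x \<in> S then \<Sum>b\<in>Basis. h b x *\<^sub>R b else 0)" for x
 show thesis
 proof (rule that)
  have [measurable]: "h b \<in> borel_measurable borel" for b using h(1)[of b] by simp
  show "g \<in> borel_measurable borel" unfolding g_def[abs_def] using S by measurable
  show "g x = 0" if "x \<notin> S" for x using that by (simp add: g_def)
  have "AE x in lborel. \<forall>b\<in>Basis. (if x \<in> S then f x else 0) \<bullet> b = h b x" using h(2) by (intro AE_finite_allI) auto
  then show "AE x in lborel. x \<in> S \<longrightarrow> g x = f x"
  proof eventually_elim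
   case (elim x)
   show ?case
   proof
    assume x: "x \<in> S"
    have "g x = (\<Sum>b\<in>Basis. (f x \<bullet> b) *\<^sub>R b)" unfolding g_def using elim x by (simp cong: sum.cong)
    then show "g x = f x" by (simp add: euclidean_representation)
   qed
  qed
 qed
qed

text \<open>
 Lebesgue integrals over a Borel set and Borel integrals over the whole space are exchanged by means of
 Borel representatives.
\<close>

lemma lebesgue_on_transfer:
 fixes f g :: "'a::euclidean_space \<Rightarrow> 'b::{banach, second_countable_topology}"
 assumes S: "S \<in> sets borel" and f: "f \<in> borel_measurable (lebesgue_on S)" and g: "g \<in> borel_measurable borel"
  and out: "\<And>x. x \<notin> S \<Longrightarrow> g x = 0" and ae: "AE x in lborel. x \<in> S \<longrightarrow> g x = f x"
 shows "integrable (lebesgue_on S) f \<longleftrightarrow> integrable lborel g" "(LINT x|lebesgue_on S. f x) = (LBINT x. g x)"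
proof -
 have S': "S \<inter> space lebesgue \<in> sets lebesgue" using S by auto
 have m: "(\<lambda>x. indicator S x *\<^sub>R f x) \<in> borel_measurable lebesgue"
  using f unfolding borel_measurable_restrict_space_iff[OF S'] .
 have g': "g \<in> borel_measurable lborel" using g by simp
 then have gl: "g \<in> borel_measurable lebesgue" by (rule measurable_completion)
 have a: "AE x in lebesgue. indicator S x *\<^sub>R f x = g x"
 proof (rule AE_completion)
  show "AE x in lborel. indicator S x *\<^sub>R f x = g x" using ae by eventually_elim (use out in \<open>auto simp: indicator_def\<close>)
 qed
 show "integrable (lebesgue_on S) f \<longleftrightarrow> integrable lborel g"
  unfolding integrable_restrict_space[OF S'] using integrable_cong_AE[OF m gl a] integrable_completion[OF g'] by simp
 show "(LINT x|lebesgue_on S. f x) = (LBINT x. g x)"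
  unfolding integral_restrict_space[OF S'] using integral_cong_AE[OF m gl a] integral_completion[OF g'] by simp
qed

lemma nn_integral_lebesgue_on:
 assumes S: "S \<in> sets borel"
 shows "(\<integral>\<^sup>+x. f x \<partial>lebesgue_on S) = (\<integral>\<^sup>+x. f x * indicator S x \<partial>lborel)"
 using S by (subst nn_integral_restrict_space) (auto simp: nn_integral_completion)

lemma AE_lebesgue_on_iff:
 assumes S: "S \<in> sets borel"
 shows "(AE x in lebesgue_on S. P x) \<longleftrightarrow> (AE x in lborel. x \<in> S \<longrightarrow> P x)"
 using S by (subst AE_restrict_space_iff) (auto simp: AE_completion_iff)

lemma AE_lborel_slices:
 fixes P :: "'a::euclidean_space \<times> 'b::euclidean_space \<Rightarrow> bool"
 assumes "AE z in lborel. P z" shows "AE t in lborel. AE x in lborel. P (x, t)"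
proof -
 obtain N where N: "N \<in> null_sets lborel" "\<And>z. z \<notin> N \<Longrightarrow> P z" using assms unfolding eventually_ae_filter by auto
 have [measurable]: "N \<in> sets (lborel \<Otimes>\<^sub>M lborel)" using N(1) unfolding lborel_prod by auto
 have "AE z in lborel \<Otimes>\<^sub>M lborel. z \<notin> N" unfolding lborel_prod by (rule AE_not_in[OF N(1)])
 then have "AE x in lborel. AE t in lborel. (x, t) \<notin> N" by (rule lborel_pair.AE_pair)
 moreover have "(AE x in lborel. AE t in lborel. (x, t) \<notin> N) \<longleftrightarrow> (AE t in lborel. AE x in lborel. (x, t) \<notin> N)"
  by (rule lborel_pair.AE_commute) (simp only: prod.collapse, measurable)
 ultimately have "AE t in lborel. AE x in lborel. (x, t) \<notin> N" by simp
 then show ?thesis using N(2) by (elim AE_mp) (auto elim!: AE_mp)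
qed

lemma AE_lborel_from_slices:
 fixes P :: "'a::euclidean_space \<times> 'b::euclidean_space \<Rightarrow> bool"
 assumes P[measurable]: "Measurable.pred borel P" and ae: "AE t in lborel. AE x in lborel. P (x, t)"
 shows "AE z in lborel. P z"
proof -
 have s: "{z \<in> space (lborel \<Otimes>\<^sub>M lborel). P z} \<in> sets (lborel \<Otimes>\<^sub>M lborel)" unfolding lborel_prod by simp
 have "(AE x in lborel. AE t in lborel. P (x, t)) \<longleftrightarrow> (AE t in lborel. AE x in lborel. P (x, t))"
  by (rule lborel_pair.AE_commute) (use s in simp)
 then have "AE z in lborel \<Otimes>\<^sub>M lborel. P z" using ae by (intro lborel_pair.AE_pair_measure[OF s]) simp
 then show ?thesis unfolding lborel_prod .
qed

lemma integrable_mult_compact_support: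
 fixes f h :: "'a::euclidean_space \<Rightarrow> real"
 assumes S: "S \<in> sets borel" and K: "compact K" "K \<subseteq> S" and f: "integrable (lebesgue_on K) f"
  and h: "continuous_on UNIV h" "\<And>x. x \<notin> K \<Longrightarrow> h x = 0"
 shows "integrable (lebesgue_on S) (\<lambda>x. f x * h x)" "integrable lebesgue (\<lambda>x. f x * h x)"
  "(LINT x|lebesgue_on S. f x * h x) = (LINT x|lebesgue. f x * h x)"
proof -
 have Ks: "K \<inter> space lebesgue \<in> sets lebesgue" using compact_imp_closed[OF K(1)] by auto
 have Ss: "S \<inter> space lebesgue \<in> sets lebesgue" using S by auto
 obtain C where C: "\<And>x. \<bar>h x\<bar> \<le> C"
 proof -
  obtain C where "\<And>x. x \<in> K \<Longrightarrow> \<bar>h x\<bar> \<le> C"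
   using compact_imp_bounded[OF compact_continuous_image[OF continuous_on_subset[OF h(1)] K(1)]] by (auto simp: bounded_iff)
  then have "\<bar>h x\<bar> \<le> \<bar>C\<bar>" for x using h(2)[of x] by (cases "x \<in> K") (auto intro: order_trans[OF _ abs_ge_self])
  then show thesis by (rule that)
 qed
 have fi: "integrable lebesgue (\<lambda>x. indicator K x *\<^sub>R f x)" using f unfolding integrable_restrict_space[OF Ks] .
 have hm: "h \<in> borel_measurable lebesgue" using borel_measurable_continuous_onI[OF h(1)] by (intro measurable_completion) simp
 have eq: "(\<lambda>x. f x * h x) = (\<lambda>x. (indicator K x *\<^sub>R f x) * h x)" using h(2) by (auto simp: indicator_def fun_eq_iff)
 show i: "integrable lebesgue (\<lambda>x. f x * h x)" unfolding eq
 proof (rule integrable_dominated)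
  show "integrable lebesgue (\<lambda>x. (indicator K x *\<^sub>R f x) * C)" by (rule integrable_mult_left[OF fi])
  show "(\<lambda>x. (indicator K x *\<^sub>R f x) * h x) \<in> borel_measurable lebesgue" using fi hm by (intro borel_measurable_times) auto
  have "\<bar>h x\<bar> \<le> \<bar>C\<bar>" for x using C[of x] by linarith
  then show "AE x in lebesgue. norm (indicator K x *\<^sub>R f x * h x) \<le> norm (indicator K x *\<^sub>R f x * C)"
   by (auto simp: abs_mult intro!: AE_I2 mult_left_mono)
 qed
 have eq2: "(\<lambda>x. indicator S x *\<^sub>R (f x * h x)) = (\<lambda>x. f x * h x)" using h(2) K(2) by (auto simp: indicator_def fun_eq_iff)
 show "integrable (lebesgue_on S) (\<lambda>x. f x * h x)" "(LINT x|lebesgue_on S. f x * h x) = (LINT x|lebesgue. f x * h x)"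
  unfolding integrable_restrict_space[OF Ss] integral_restrict_space[OF Ss] eq2 using i by auto
qed

lemma integrable_inner_left_lebesgue_on:
 "integrable (lebesgue_on K) G \<Longrightarrow> integrable (lebesgue_on K) (\<lambda>x. G x \<bullet> (b::'a::euclidean_space))"
 by (rule integrable_inner_left) simp

lemma weak_gradient_diff:
 assumes \<Omega>: "open \<Omega>" and f: "has_weak_gradient \<Omega> f F" and g: "has_weak_gradient \<Omega> g G"
 shows "has_weak_gradient \<Omega> (\<lambda>x. f x - g x) (\<lambda>x. F x - G x)"
 unfolding has_weak_gradient_def
proof (intro conjI allI impI ballI)
 fix K assume "compact K \<and> K \<subseteq> \<Omega>"
 then show "integrable (lebesgue_on K) (\<lambda>x. f x - g x)" "integrable (lebesgue_on K) (\<lambda>x. F x - G x)"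
  using f g unfolding has_weak_gradient_def by auto
next
 fix \<phi> :: "'a \<Rightarrow> real" and b :: 'a assume \<phi>: "\<phi> \<in> test_functions \<Omega>" and b: "b \<in> Basis"
 obtain K where K: "compact K" "K \<subseteq> \<Omega>" "\<And>x. x \<notin> K \<Longrightarrow> \<phi> x = 0" "\<And>x. x \<notin> K \<Longrightarrow> grad \<phi> x = 0" "continuous_on UNIV (grad \<phi>)"
  using test_functions_C1c[OF \<phi>] C1cD C1c_grad_outside by metis
 have d: "frechet_derivative \<phi> (at x) b = grad \<phi> x \<bullet> b" for x using grad_inner[OF \<phi>] by simp
 have dc: "continuous_on UNIV (\<lambda>x. grad \<phi> x \<bullet> b)" by (intro continuous_on_inner K continuous_on_const)
 have \<Omega>b: "\<Omega> \<in> sets borel" using \<Omega> by auto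
 have fi: "integrable (lebesgue_on K) f" "integrable (lebesgue_on K) (\<lambda>x. F x \<bullet> b)" using f K unfolding has_weak_gradient_def by (auto intro: integrable_inner_left_lebesgue_on)
 have gi: "integrable (lebesgue_on K) g" "integrable (lebesgue_on K) (\<lambda>x. G x \<bullet> b)" using g K unfolding has_weak_gradient_def by (auto intro: integrable_inner_left_lebesgue_on)
 note i = integrable_mult_compact_support(1)[OF \<Omega>b K(1,2) _ dc] integrable_mult_compact_support(1)[OF \<Omega>b K(1,2) _ test_functions_continuous[OF \<phi>] K(3)]
 have "(LINT x|lebesgue_on \<Omega>. (f x - g x) * frechet_derivative \<phi> (at x) b)
   = (LINT x|lebesgue_on \<Omega>. f x * frechet_derivative \<phi> (at x) b) - (LINT x|lebesgue_on \<Omega>. g x * frechet_derivative \<phi> (at x) b)"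
  unfolding d left_diff_distrib by (rule Bochner_Integration.integral_diff) (use i(1)[OF fi(1)] i(1)[OF gi(1)] K(4) in auto)
 also have "\<dots> = - (LINT x|lebesgue_on \<Omega>. (F x \<bullet> b) * \<phi> x) + (LINT x|lebesgue_on \<Omega>. (G x \<bullet> b) * \<phi> x)"
  using f g \<phi> b unfolding has_weak_gradient_def by simp
 also have "\<dots> = - ((LINT x|lebesgue_on \<Omega>. (F x \<bullet> b) * \<phi> x) - (LINT x|lebesgue_on \<Omega>. (G x \<bullet> b) * \<phi> x))" by simp
 also have "(LINT x|lebesgue_on \<Omega>. (F x \<bullet> b) * \<phi> x) - (LINT x|lebesgue_on \<Omega>. (G x \<bullet> b) * \<phi> x) = (LINT x|lebesgue_on \<Omega>. ((F x - G x) \<bullet> b) * \<phi> x)"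
  unfolding inner_diff_left left_diff_distrib by (rule Bochner_Integration.integral_diff[symmetric, OF i(2)[OF fi(2)] i(2)[OF gi(2)]])
 finally show "(LINT x|lebesgue_on \<Omega>. (f x - g x) * frechet_derivative \<phi> (at x) b) = - (LINT x|lebesgue_on \<Omega>. ((F x - G x) \<bullet> b) * \<phi> x)" .
qed

text \<open>
 The difference of two weak gradients is a weak gradient of zero, to which the fundamental lemma applies.
\<close>

lemma weak_gradient_unique:
 assumes \<Omega>: "open \<Omega>" and F: "has_weak_gradient \<Omega> f F" and G: "has_weak_gradient \<Omega> f G"
 shows "AE x in lborel. x \<in> \<Omega> \<longrightarrow> F x = G x"
proof -
 have w: "has_weak_gradient \<Omega> (\<lambda>x. f x - f x) (\<lambda>x. F x - G x)" by (rule weak_gradient_diff[OF \<Omega> F G])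
 have "AE x in lebesgue. x \<in> \<Omega> \<longrightarrow> (F x - G x) \<bullet> b = 0" if b: "b \<in> Basis" for b
 proof (rule fundamental_lemma[OF \<Omega>])
  have i: "integrable (lebesgue_on K) (\<lambda>x. (F x - G x) \<bullet> b)" if "compact K" "K \<subseteq> \<Omega>" for K
   using w that unfolding has_weak_gradient_def by (auto intro: integrable_inner_left_lebesgue_on)
  show "set_integrable lebesgue K (\<lambda>x. (F x - G x) \<bullet> b)" if K: "compact K" "K \<subseteq> \<Omega>" for K
  proof -
   have Ks: "K \<inter> space lebesgue \<in> sets lebesgue" using compact_imp_closed[OF K(1)] by auto
   show ?thesis using i[OF K] unfolding integrable_restrict_space[OF Ks] set_integrable_def .
  qed
  fix \<phi> :: "'a \<Rightarrow> real" assume \<phi>: "\<phi> \<in> test_functions \<Omega>"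
  obtain K where K: "compact K" "K \<subseteq> \<Omega>" "\<And>x. x \<notin> K \<Longrightarrow> \<phi> x = 0" using \<phi> by (auto elim: test_functionsE)
  have \<Omega>b: "\<Omega> \<in> sets borel" using \<Omega> by auto
  have "(LINT x|lebesgue. ((F x - G x) \<bullet> b) * \<phi> x) = (LINT x|lebesgue_on \<Omega>. ((F x - G x) \<bullet> b) * \<phi> x)"
   by (rule integrable_mult_compact_support(3)[OF \<Omega>b K(1,2) i[OF K(1,2)] test_functions_continuous[OF \<phi>] K(3), symmetric])
  also have "\<dots> = - (LINT x|lebesgue_on \<Omega>. (f x - f x) * frechet_derivative \<phi> (at x) b)" using w \<phi> b unfolding has_weak_gradient_def by simp
  also have "\<dots> = 0" by simp
  finally show "(LINT x|lebesgue. ((F x - G x) \<bullet> b) * \<phi> x) = 0" .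
 qed
 then have "AE x in lborel. x \<in> \<Omega> \<longrightarrow> (F x - G x) \<bullet> b = 0" if "b \<in> Basis" for b using that unfolding AE_completion_iff by blast
 then have "AE x in lborel. \<forall>b\<in>Basis. x \<in> \<Omega> \<longrightarrow> (F x - G x) \<bullet> b = 0" by (intro AE_finite_allI finite_Basis)
 then show ?thesis
 proof eventually_elim
  case (elim x)
  show ?case
  proof
   assume "x \<in> \<Omega>"
   then have "F x \<bullet> b = G x \<bullet> b" if "b \<in> Basis" for b using elim that by (simp add: inner_diff_left)
   then show "F x = G x" by (rule euclidean_eqI)
  qed
 qed
qed

text \<open>
 The product of the function with a test function is continuously differentiable with compact support, so
 its gradient has integral zero.
\<close>

lemma classical_weak_gradient:
 assumes \<Omega>: "open \<Omega>" and d: "\<And>x. x \<in> \<Omega> \<Longrightarrow> (f has_derivative (\<lambda>h. D x \<bullet> h)) (at x)" and c: "continuous_on \<Omega> D"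
 shows "has_weak_gradient \<Omega> f D"
 unfolding has_weak_gradient_def
proof (intro conjI allI impI ballI)
 have fc: "continuous_on \<Omega> f" by (rule continuous_at_imp_continuous_on) (use has_derivative_continuous[OF d] in simp)
 have ci: "integrable (lebesgue_on K) g" if K: "compact K" "K \<subseteq> \<Omega>" and g: "continuous_on \<Omega> g" for K and g :: "'a \<Rightarrow> 'b::euclidean_space"
 proof -
  have Ks: "K \<inter> space lebesgue \<in> sets lebesgue" using compact_imp_closed[OF K(1)] by auto
  have "integrable lborel (\<lambda>x. indicator K x *\<^sub>R g x)" by (rule borel_integrable_compact[OF K(1) continuous_on_subset[OF g K(2)]])
  from integrable_completion[OF borel_measurable_integrable[OF this]] this
  have "integrable lebesgue (\<lambda>x. indicator K x *\<^sub>R g x)" by simp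
  then show ?thesis unfolding integrable_restrict_space[OF Ks] .
 qed
 fix K assume "compact K \<and> K \<subseteq> \<Omega>"
 then show "integrable (lebesgue_on K) f" "integrable (lebesgue_on K) D" using ci fc c by auto
next
 fix \<phi> :: "'a \<Rightarrow> real" and b :: 'a assume \<phi>: "\<phi> \<in> test_functions \<Omega>" and b: "b \<in> Basis"
 have fc: "continuous_on \<Omega> f" by (rule continuous_at_imp_continuous_on) (use has_derivative_continuous[OF d] in simp)
 obtain K where K: "K \<subseteq> \<Omega>" "C1c K \<phi> (grad \<phi>)" by (rule test_functions_C1c[OF \<phi>])
 have Kc: "compact K" and \<phi>d: "(\<phi> has_derivative (\<lambda>h. grad \<phi> x \<bullet> h)) (at x)" and gc: "continuous_on UNIV (grad \<phi>)"
  and \<phi>0: "x \<notin> K \<Longrightarrow> \<phi> x = 0" and \<phi>c: "continuous_on UNIV \<phi>" for x using C1cD[OF K(2)] by auto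
 have g0: "x \<notin> K \<Longrightarrow> grad \<phi> x = 0" for x by (rule C1c_grad_outside[OF K(2)])
 define P where "P x = (if x \<in> \<Omega> then \<phi> x *\<^sub>R D x + f x *\<^sub>R grad \<phi> x else 0)" for x
 have P: "C1c K (\<lambda>x. f x * \<phi> x) P"
  unfolding C1c_def
 proof (intro conjI allI impI)
  show "compact K" by (rule Kc)
  show "f x * \<phi> x = 0" if "x \<notin> K" for x using \<phi>0[OF that] by simp
  show "((\<lambda>x. f x * \<phi> x) has_derivative (\<lambda>h. P x \<bullet> h)) (at x)" for x
  proof (cases "x \<in> \<Omega>")
   case True
   have "(\<lambda>h. f x * (grad \<phi> x \<bullet> h) + (D x \<bullet> h) * \<phi> x) = (\<lambda>h. P x \<bullet> h)" using True by (simp add: P_def inner_add_left fun_eq_iff)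
   then show ?thesis using has_derivative_mult[OF d[OF True] \<phi>d[of x]] by simp
  next
   case False
   then have x: "x \<in> - K" using K by auto
   have "((\<lambda>x. f x * \<phi> x) has_derivative (\<lambda>h. 0)) (at x)"
    by (rule has_derivative_transform_within_open[OF has_derivative_const[of 0] _ x])
     (use compact_imp_closed[OF Kc] \<phi>0 in auto)
   then show ?thesis using False by (simp add: P_def)
  qed
  show "continuous_on UNIV P"
  proof -
   have "continuous_on \<Omega> (\<lambda>x. \<phi> x *\<^sub>R D x + f x *\<^sub>R grad \<phi> x)"
    by (intro continuous_on_add continuous_on_scaleR c fc continuous_on_subset[OF \<phi>c] continuous_on_subset[OF gc]) auto
   then have 1: "continuous_on \<Omega> P" by (rule continuous_on_eq) (simp add: P_def)
   have 2: "continuous_on (- K) P" by (rule continuous_on_eq[OF continuous_on_const[of _ 0]]) (use \<phi>0 g0 in \<open>auto simp: P_def\<close>)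
   have "continuous_on (\<Omega> \<union> - K) P" by (rule continuous_on_open_Un[OF \<Omega> _ 1 2]) (use compact_imp_closed[OF Kc] in auto)
   moreover have "\<Omega> \<union> - K = UNIV" using K(1) by auto
   ultimately show ?thesis by simp
  qed
 qed
 have \<Omega>b: "\<Omega> \<in> sets borel" using \<Omega> by auto
 have Ks: "K \<inter> space lebesgue \<in> sets lebesgue" using compact_imp_closed[OF Kc] by auto
 have ci: "integrable (lebesgue_on K) g" if g: "continuous_on \<Omega> g" for g :: "'a \<Rightarrow> real"
 proof -
  have "integrable lborel (\<lambda>x. indicator K x *\<^sub>R g x)" by (rule borel_integrable_compact[OF Kc continuous_on_subset[OF g K(1)]])
  from integrable_completion[OF borel_measurable_integrable[OF this]] this
  have "integrable lebesgue (\<lambda>x. indicator K x *\<^sub>R g x)" by simp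
  then show ?thesis unfolding integrable_restrict_space[OF Ks] .
 qed
 have db: "frechet_derivative \<phi> (at x) b = grad \<phi> x \<bullet> b" for x using grad_inner[OF \<phi>] by simp
 have dc: "continuous_on UNIV (\<lambda>x. grad \<phi> x \<bullet> b)" by (intro continuous_on_inner gc continuous_on_const)
 have Dc: "continuous_on \<Omega> (\<lambda>x. D x \<bullet> b)" by (intro continuous_on_inner c continuous_on_const)
 have g0b: "x \<notin> K \<Longrightarrow> grad \<phi> x \<bullet> b = 0" for x using g0 by simp
 note i1 = integrable_mult_compact_support[OF \<Omega>b Kc K(1) ci[OF fc] dc g0b] and i2 = integrable_mult_compact_support[OF \<Omega>b Kc K(1) ci[OF Dc] \<phi>c \<phi>0]
 have Pb: "(\<lambda>x. P x \<bullet> b) = (\<lambda>x. f x * (grad \<phi> x \<bullet> b) + (D x \<bullet> b) * \<phi> x)"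
 proof
  fix x
  show "P x \<bullet> b = f x * (grad \<phi> x \<bullet> b) + (D x \<bullet> b) * \<phi> x"
  proof (cases "x \<in> \<Omega>")
   case False
   then have "x \<notin> K" using K(1) by blast
   then show ?thesis using \<phi>0 g0 False by (simp add: P_def)
  qed (simp add: P_def inner_add_left)
 qed
 have "(\<lambda>x. P x \<bullet> b) \<in> borel_measurable lborel"
  using borel_measurable_continuous_onI[OF C1cD(3)[OF P]] by simp
 from integral_completion[OF this] C1c_integral_gradient_zero[OF P, of b]
 have "(LINT x|lebesgue. P x \<bullet> b) = 0" by simp
 then have "(LINT x|lebesgue. f x * (grad \<phi> x \<bullet> b)) + (LINT x|lebesgue. (D x \<bullet> b) * \<phi> x) = 0"
  unfolding Pb using Bochner_Integration.integral_add[OF i1(2) i2(2)] by simp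
 then show "(LINT x|lebesgue_on \<Omega>. f x * frechet_derivative \<phi> (at x) b) = - (LINT x|lebesgue_on \<Omega>. (D x \<bullet> b) * \<phi> x)"
  unfolding db using i1(3) i2(3) by simp
qed

lemma Ck_on_differentiable: "f \<in> Ck_on (Suc k) S \<Longrightarrow> x \<in> S \<Longrightarrow> f differentiable at x"
 unfolding Ck_on_def by (auto dest: spec[of _ "[]"])

lemma Ck_on_partial_continuous: "f \<in> Ck_on (Suc k) S \<Longrightarrow> b \<in> Basis \<Longrightarrow> continuous_on S (\<lambda>x. frechet_derivative f (at x) b)"
 unfolding Ck_on_def by (auto dest: spec[of _ "[b]"])

lemma Pair_Basis: "b \<in> Basis \<Longrightarrow> (b, 0::real) \<in> Basis" "((0::'a::euclidean_space), 1::real) \<in> Basis"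
 by (auto simp: Basis_prod_def)

lemma space_derivative:
 assumes "f differentiable at (x, t)"
 shows "((\<lambda>x. f (x, t)) has_derivative (\<lambda>h. space_grad f (x, t) \<bullet> h)) (at x)"
proof -
 have fd: "(f has_derivative frechet_derivative f (at (x, t))) (at (x, t))" using assms by (simp add: frechet_derivative_works)
 have "((\<lambda>x. (x, t)) has_derivative (\<lambda>h. (h, 0))) (at x)" by (auto intro!: derivative_eq_intros)
 from has_derivative_compose[OF this fd]
 have d: "((\<lambda>x. f (x, t)) has_derivative (\<lambda>h. frechet_derivative f (at (x, t)) (h, 0))) (at x)" .
 interpret linear "\<lambda>h. frechet_derivative f (at (x, t)) (h, 0)" by (rule has_derivative_linear[OF d])
 have "frechet_derivative f (at (x, t)) (h, 0) = space_grad f (x, t) \<bullet> h" for h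
 proof -
  have "frechet_derivative f (at (x, t)) (h, 0) = frechet_derivative f (at (x, t)) ((\<Sum>b\<in>Basis. (h \<bullet> b) *\<^sub>R b), 0)"
   by (simp add: euclidean_representation)
  also have "\<dots> = (\<Sum>b\<in>Basis. frechet_derivative f (at (x, t)) ((h \<bullet> b) *\<^sub>R b, 0))" by (rule sum)
  also have "\<dots> = (\<Sum>b\<in>Basis. (h \<bullet> b) * frechet_derivative f (at (x, t)) (b, 0))" using scale by (intro Groups_Big.sum.cong) auto
  also have "\<dots> = space_grad f (x, t) \<bullet> h"
   unfolding space_grad_def inner_sum_left by (intro Groups_Big.sum.cong) (auto simp: inner_commute mult.commute)
  finally show ?thesis .
 qed
 then show ?thesis using d by simp
qed

lemma time_derivative:
 assumes "f differentiable at (x, t)"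
 shows "((\<lambda>t. f (x, t)) has_real_derivative time_deriv f (x, t)) (at t)"
proof -
 have fd: "(f has_derivative frechet_derivative f (at (x, t))) (at (x, t))" using assms by (simp add: frechet_derivative_works)
 have "((\<lambda>t. (x, t)) has_derivative (\<lambda>h. (0, h))) (at t)" by (auto intro!: derivative_eq_intros)
 from has_derivative_compose[OF this fd]
 have d: "((\<lambda>t. f (x, t)) has_derivative (\<lambda>h. frechet_derivative f (at (x, t)) (0, h))) (at t)" .
 interpret linear "\<lambda>h. frechet_derivative f (at (x, t)) (0, h)" by (rule has_derivative_linear[OF d])
 have "frechet_derivative f (at (x, t)) (0, h) = time_deriv f (x, t) * h" for h
  using scale[of h 1] by (simp add: time_deriv_def)
 then show ?thesis using d by (simp add: has_field_derivative_def)
qed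

text \<open>
 The time derivative is bounded, since it extends continuously to a compact set, and segments in the
 time direction stay inside the cylinder.
\<close>

lemma Ck_closure_time_Lipschitz:
 assumes \<Omega>: "bounded \<Omega>" and \<psi>: "\<psi> \<in> Ck_closure (Suc k) (cylinder \<Omega> T)"
 obtains L where "L \<ge> 1" "\<forall>x\<in>\<Omega>. \<forall>s\<in>{0<..<T}. \<forall>t\<in>{0<..<T}. \<bar>\<psi> (x, t) - \<psi> (x, s)\<bar> \<le> L * \<bar>t - s\<bar>"
proof -
 have Ck: "\<psi> \<in> Ck_on (Suc k) (cylinder \<Omega> T)" using \<psi> unfolding Ck_closure_def by simp
 have "\<forall>bs. set bs \<subseteq> Basis \<and> length bs \<le> Suc k \<longrightarrow>
   (\<exists>g. continuous_on (closure (cylinder \<Omega> T)) g \<and> (\<forall>z\<in>cylinder \<Omega> T. g z = partials bs \<psi> z))"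
  using \<psi> unfolding Ck_closure_def by blast
 then obtain g where g: "continuous_on (closure (cylinder \<Omega> T)) g" "\<forall>z\<in>cylinder \<Omega> T. g z = partials [(0, 1)] \<psi> z"
  using Pair_Basis(2) by (metis empty_set empty_subsetI insert_subset length_Cons le_numeral_extra(4) list.simps(15) list.size(3) Suc_le_mono le0)
 then have gt: "g z = time_deriv \<psi> z" if "z \<in> cylinder \<Omega> T" for z using bspec[OF g(2) that] by (simp add: time_deriv_def)
 have "compact (closure (cylinder \<Omega> T))" using \<Omega> by (simp add: bounded_Times)
 then obtain C where C: "\<And>z. z \<in> closure (cylinder \<Omega> T) \<Longrightarrow> \<bar>g z\<bar> \<le> C"
  using compact_imp_bounded[OF compact_continuous_image[OF g(1)]] by (auto simp: bounded_iff)
 show thesis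
 proof (rule that[of "max 1 C"], safe)
  fix x s t assume x: "x \<in> \<Omega>" and s: "s \<in> {0<..<T}" and t: "t \<in> {0<..<T}"
  have "norm (\<psi> (x, t) - \<psi> (x, s)) \<le> max 1 C * norm (t - s)"
  proof (rule field_differentiable_bound[where S="{0<..<T}" and f'="\<lambda>t. time_deriv \<psi> (x, t)"])
   fix r assume r: "r \<in> {0<..<T}"
   then have z: "(x, r) \<in> cylinder \<Omega> T" using x by simp
   show "((\<lambda>t. \<psi> (x, t)) has_field_derivative time_deriv \<psi> (x, r)) (at r within {0<..<T})"
    using time_derivative[OF Ck_on_differentiable[OF Ck z]] by (rule has_field_derivative_at_within)
   show "norm (time_deriv \<psi> (x, r)) \<le> max 1 C" using C[of "(x, r)"] gt[OF z] subsetD[OF closure_subset z] by simp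
  qed (use s t in auto)
  then show "\<bar>\<psi> (x, t) - \<psi> (x, s)\<bar> \<le> max 1 C * \<bar>t - s\<bar>" by simp
 qed simp
qed

section \<open>Reduction of weak solutions to Borel representatives\<close>

lemma space_time_derivatives_measurable:
 assumes "\<gamma> \<in> test_functions S"
 shows "time_deriv \<gamma> \<in> borel_measurable borel" "space_grad \<gamma> \<in> borel_measurable borel"
proof -
 note c = test_functions_frechet_derivative_continuous[OF assms]
 show "time_deriv \<gamma> \<in> borel_measurable borel"
  unfolding time_deriv_def[abs_def] by (rule borel_measurable_continuous_onI[OF c[OF Pair_Basis(2)]])
 show "space_grad \<gamma> \<in> borel_measurable borel"
  unfolding space_grad_def[abs_def]
  by (intro borel_measurable_continuous_onI continuous_on_sum continuous_on_scaleR c Pair_Basis continuous_on_const)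
qed

lemma Lp_distance_transfer:
 fixes f f' h :: "'a::euclidean_space \<Rightarrow> 'b::euclidean_space"
 assumes p: "p > 0" and \<Omega>: "\<Omega> \<in> sets borel" and f: "f \<in> Lp_on p \<Omega>"
  and f': "(\<lambda>x. indicator \<Omega> x *\<^sub>R f' x) \<in> borel_measurable borel" and ae: "AE x in lborel. x \<in> \<Omega> \<longrightarrow> f' x = f x"
  and h: "continuous_on UNIV h" "compact K" "\<And>x. x \<notin> K \<Longrightarrow> h x = 0"
 shows "integrable lborel (\<lambda>x. indicator \<Omega> x * norm (h x - f' x) powr p)"
  "(LINT x|lebesgue_on \<Omega>. norm (h x - f x) powr p) = (LBINT x. indicator \<Omega> x * norm (h x - f' x) powr p)"
proof -
 have hm [measurable]: "h \<in> borel_measurable borel" using h(1) by (rule borel_measurable_continuous_onI)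
 have hl: "h \<in> borel_measurable (lebesgue_on \<Omega>)" by (rule borel_restrict_lebesgue_on[OF hm])
 have fm: "f \<in> borel_measurable (lebesgue_on \<Omega>)" and fi: "integrable (lebesgue_on \<Omega>) (\<lambda>x. norm (f x) powr p)"
  using f unfolding Lp_on_def by auto
 note [measurable] = f' \<Omega>
 have m1: "(\<lambda>x. indicator \<Omega> x * norm (h x - f' x) powr p) \<in> borel_measurable borel"
 proof -
  have "(\<lambda>x. indicator \<Omega> x * norm (h x - f' x) powr p) = (\<lambda>x. indicator \<Omega> x * norm (h x - indicator \<Omega> x *\<^sub>R f' x) powr p)"
   by (auto simp: indicator_def fun_eq_iff)
  then show ?thesis by simp
 qed
 have m2: "(\<lambda>x. indicator \<Omega> x * norm (f' x) powr p) \<in> borel_measurable borel"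
 proof -
  have "(\<lambda>x. indicator \<Omega> x * norm (f' x) powr p) = (\<lambda>x. indicator \<Omega> x * norm (indicator \<Omega> x *\<^sub>R f' x) powr p)"
   by (auto simp: indicator_def fun_eq_iff)
  also have "\<dots> \<in> borel_measurable borel" by measurable
  finally show ?thesis .
 qed
 have ae2: "AE x in lborel. x \<in> \<Omega> \<longrightarrow> indicator \<Omega> x * norm (f' x) powr p = norm (f x) powr p" using ae by eventually_elim simp
 have fi': "integrable lborel (\<lambda>x. indicator \<Omega> x * norm (f' x) powr p)"
  using lebesgue_on_transfer(1)[OF \<Omega> borel_measurable_integrable[OF fi] m2 _ ae2] fi by simp
 have hc: "continuous_on UNIV (\<lambda>x. norm (h x) powr p)"
  by (intro continuous_on_powr' continuous_on_norm h continuous_on_const) (use p in auto)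
 have hi: "integrable lborel (\<lambda>x. norm (h x) powr p)"
  by (rule integrable_continuous_compact_support[OF hc h(2)]) (use h(3) in simp)
 show i: "integrable lborel (\<lambda>x. indicator \<Omega> x * norm (h x - f' x) powr p)"
 proof (rule integrable_dominated)
  show "integrable lborel (\<lambda>x. 3 powr p * (norm (h x) powr p + indicator \<Omega> x * norm (f' x) powr p))"
   by (intro integrable_mult_right Bochner_Integration.integrable_add hi fi')
  show "(\<lambda>x. indicator \<Omega> x * norm (h x - f' x) powr p) \<in> borel_measurable lborel" using m1 by simp
  show "AE x in lborel. norm (indicator \<Omega> x * norm (h x - f' x) powr p) \<le> norm (3 powr p * (norm (h x) powr p + indicator \<Omega> x * norm (f' x) powr p))"
  proof (rule AE_I2)
   fix x
   show "norm (indicator \<Omega> x * norm (h x - f' x) powr p) \<le> norm (3 powr p * (norm (h x) powr p + indicator \<Omega> x * norm (f' x) powr p))"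
    using norm_diff_powr_le[OF p, of "h x" "f' x"] by (cases "x \<in> \<Omega>") (simp_all add: abs_mult)
  qed
 qed
 have m3: "(\<lambda>x. norm (h x - f x) powr p) \<in> borel_measurable (lebesgue_on \<Omega>)"
  using hl fm by measurable
 have ae3: "AE x in lborel. x \<in> \<Omega> \<longrightarrow> indicator \<Omega> x * norm (h x - f' x) powr p = norm (h x - f x) powr p" using ae by eventually_elim simp
 show "(LINT x|lebesgue_on \<Omega>. norm (h x - f x) powr p) = (LBINT x. indicator \<Omega> x * norm (h x - f' x) powr p)"
  by (rule lebesgue_on_transfer(2)[OF \<Omega> m3 m1 _ ae3]) simp
qed

lemma approximableI:
 fixes f f' :: "'a::euclidean_space \<Rightarrow> real"
 assumes p: "p > 0" and \<Omega>: "\<Omega> \<in> sets borel" and f: "f \<in> Lp_on p \<Omega>" and G: "G \<in> Lp_on p \<Omega>"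
  and \<phi>: "\<And>k::nat. \<phi> k \<in> test_functions \<Omega>"
  and lim: "(\<lambda>k. LINT x|lebesgue_on \<Omega>. \<bar>\<phi> k x - f x\<bar> powr p) \<longlonglongrightarrow> 0"
   "(\<lambda>k. LINT x|lebesgue_on \<Omega>. norm (grad (\<phi> k) x - G x) powr p) \<longlonglongrightarrow> 0"
  and f': "(\<lambda>x. indicator \<Omega> x *\<^sub>R f' x) \<in> borel_measurable borel" "AE x in lborel. x \<in> \<Omega> \<longrightarrow> f' x = f x"
  and G': "(\<lambda>x. indicator \<Omega> x *\<^sub>R G' x) \<in> borel_measurable borel" "AE x in lborel. x \<in> \<Omega> \<longrightarrow> G' x = G x"
 shows "approximable p \<Omega> f' G'"
proof -
 have *: "integrable lborel (\<lambda>x. indicator \<Omega> x * norm (\<phi> k x - f' x) powr p)"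
  "(LINT x|lebesgue_on \<Omega>. norm (\<phi> k x - f x) powr p) = (LBINT x. indicator \<Omega> x * norm (\<phi> k x - f' x) powr p)"
  "integrable lborel (\<lambda>x. indicator \<Omega> x * norm (grad (\<phi> k) x - G' x) powr p)"
  "(LINT x|lebesgue_on \<Omega>. norm (grad (\<phi> k) x - G x) powr p) = (LBINT x. indicator \<Omega> x * norm (grad (\<phi> k) x - G' x) powr p)" for k
 proof -
  obtain K where K: "C1c K (\<phi> k) (grad (\<phi> k))" using test_functions_C1c[OF \<phi>] by metis
  note 1 = Lp_distance_transfer[OF p \<Omega> f f' C1cD(5)[OF K] C1cD(1)[OF K] C1cD(4)[OF K]]
  note 2 = Lp_distance_transfer[OF p \<Omega> G G' C1cD(3)[OF K] C1cD(1)[OF K] C1c_grad_outside[OF K]]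
  show "integrable lborel (\<lambda>x. indicator \<Omega> x * norm (\<phi> k x - f' x) powr p)" by (rule 1(1))
  show "(LINT x|lebesgue_on \<Omega>. norm (\<phi> k x - f x) powr p) = (LBINT x. indicator \<Omega> x * norm (\<phi> k x - f' x) powr p)" by (rule 1(2))
  show "integrable lborel (\<lambda>x. indicator \<Omega> x * norm (grad (\<phi> k) x - G' x) powr p)" by (rule 2(1))
  show "(LINT x|lebesgue_on \<Omega>. norm (grad (\<phi> k) x - G x) powr p) = (LBINT x. indicator \<Omega> x * norm (grad (\<phi> k) x - G' x) powr p)" by (rule 2(2))
 qed
 show ?thesis unfolding approximable_def
  using \<phi> lim *(1,3) unfolding *(4) *(2)[unfolded real_norm_def] real_norm_def by (intro exI[of _ \<phi>]) blast
qed

text \<open>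
 The spatial gradient occurs three times in the notion of a weak solution: in the integrability condition,
 in the equation, and, through \<open>u - \<psi>\<close>, in the boundary condition. Uniqueness of weak gradients on almost
 all time slices identifies the three.
\<close>

theorem borel_representative:
 fixes u :: "'a::euclidean_space \<times> real \<Rightarrow> real"
 assumes p: "p \<ge> 2" and T: "T > 0" and L: "L \<ge> 1" and \<Omega>: "open \<Omega>" "bounded \<Omega>"
  and \<psi>: "\<psi> \<in> Ck_on (Suc k) (cylinder \<Omega> T)"
  and \<psi>L: "\<forall>x\<in>\<Omega>. \<forall>s\<in>{0<..<T}. \<forall>t\<in>{0<..<T}. \<bar>\<psi> (x, t) - \<psi> (x, s)\<bar> \<le> L * \<bar>t - s\<bar>"
  and u: "trudinger_weak_solution p \<Omega> T \<psi> u"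
 obtains u' U' where "borel_solution p T L \<Omega> \<psi> (space_grad \<psi>) u' U'" "AE z in lborel. z \<in> cylinder \<Omega> T \<longrightarrow> u' z = u z"
proof -
 have p0: "p > 0" using p by simp
 have oc: "open (cylinder \<Omega> T)" using \<Omega> by (intro open_Times) auto
 have cyl: "cylinder \<Omega> T \<in> sets borel" using oc by auto
 have \<Omega>b: "\<Omega> \<in> sets borel" using \<Omega> by auto
 have I: "{0<..<T} \<in> sets borel" by simp
 from u have um: "u \<in> borel_measurable (lebesgue_on (cylinder \<Omega> T))" unfolding trudinger_weak_solution_def Lp_time_def by blast
 from u obtain D0 where D0: "has_spatial_gradient \<Omega> T u D0"
  "integrable (lebesgue_on (cylinder \<Omega> T)) (\<lambda>z. \<bar>u z\<bar> powr p + norm (D0 z) powr p)" unfolding trudinger_weak_solution_def Lp_time_def by blast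
 from u obtain D1 where D1: "has_spatial_gradient \<Omega> T u D1" and weak: "\<And>\<gamma>. \<gamma> \<in> test_functions (cylinder \<Omega> T) \<Longrightarrow>
   (LINT z|lebesgue_on (cylinder \<Omega> T). - b_fun p (u z) * time_deriv \<gamma> z + (norm (D1 z) powr (p - 2) *\<^sub>R D1 z) \<bullet> space_grad \<gamma> z) = 0"
  unfolding trudinger_weak_solution_def by blast
 from u have bdry: "AE t in lebesgue_on {0<..<T}. (\<lambda>x. u (x, t) - \<psi> (x, t)) \<in> W1p_0 p \<Omega>"
  unfolding trudinger_weak_solution_def Lp_time_def by blast
 have D0m: "D0 \<in> borel_measurable (lebesgue_on (cylinder \<Omega> T))" and D1m: "D1 \<in> borel_measurable (lebesgue_on (cylinder \<Omega> T))"
  using D0(1) D1 unfolding has_spatial_gradient_def by auto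
 obtain u' where u': "u' \<in> borel_measurable borel" "\<And>z. z \<notin> cylinder \<Omega> T \<Longrightarrow> u' z = 0" "AE z in lborel. z \<in> cylinder \<Omega> T \<longrightarrow> u' z = u z"
  using lebesgue_on_borel_representative[OF um cyl] by blast
 obtain U0 where U0: "U0 \<in> borel_measurable borel" "\<And>z. z \<notin> cylinder \<Omega> T \<Longrightarrow> U0 z = 0" "AE z in lborel. z \<in> cylinder \<Omega> T \<longrightarrow> U0 z = D0 z"
  using lebesgue_on_borel_representative[OF D0m cyl] by blast
 obtain U where U: "U \<in> borel_measurable borel" "\<And>z. z \<notin> cylinder \<Omega> T \<Longrightarrow> U z = 0" "AE z in lborel. z \<in> cylinder \<Omega> T \<longrightarrow> U z = D1 z"
  using lebesgue_on_borel_representative[OF D1m cyl] by blast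
 note [measurable] = u'(1) U0(1) U(1) \<Omega>b
 have G0: "AE t in lborel. t \<in> {0<..<T} \<longrightarrow> has_weak_gradient \<Omega> (\<lambda>x. u (x, t)) (\<lambda>x. D0 (x, t))"
  and G1: "AE t in lborel. t \<in> {0<..<T} \<longrightarrow> has_weak_gradient \<Omega> (\<lambda>x. u (x, t)) (\<lambda>x. D1 (x, t))"
  using D0(1) D1 unfolding has_spatial_gradient_def AE_lebesgue_on_iff[OF I] by auto
 \<comment> \<open>\<open>U0\<close> is the integrable gradient, and \<open>U\<close> the one in the equation.\<close>
 have UU: "AE z in lborel. U0 z = U z"
 proof (rule AE_lborel_from_slices)
  show "Measurable.pred borel (\<lambda>z. U0 z = U z)" by measurable
  show "AE t in lborel. AE x in lborel. U0 (x, t) = U (x, t)"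
   using AE_lborel_slices[OF U0(3)] AE_lborel_slices[OF U(3)] G0 G1
  proof eventually_elim
   case (elim t)
   show ?case
   proof (cases "t \<in> {0<..<T}")
    case True
    have "AE x in lborel. x \<in> \<Omega> \<longrightarrow> D0 (x, t) = D1 (x, t)"
     by (rule weak_gradient_unique[OF \<Omega>(1)]) (use elim True in blast)+
    then show ?thesis using elim(1,2)
    proof eventually_elim
     case (elim x)
     then show ?case using True U0(2)[of "(x, t)"] U(2)[of "(x, t)"] by (cases "x \<in> \<Omega>") auto
    qed
   next
    case False
    then show ?thesis using U0(2) U(2) by (intro AE_I2) simp
   qed
  qed
 qed
 have Lp: "integrable lborel (\<lambda>z. \<bar>u' z\<bar> powr p + norm (U0 z) powr p)"
 proof -
  have ae: "AE z in lborel. z \<in> cylinder \<Omega> T \<longrightarrow> \<bar>u' z\<bar> powr p + norm (U0 z) powr p = \<bar>u z\<bar> powr p + norm (D0 z) powr p"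
   using u'(3) U0(3) by eventually_elim auto
  have m: "(\<lambda>z. \<bar>u' z\<bar> powr p + norm (U0 z) powr p) \<in> borel_measurable borel" by measurable
  show ?thesis
   using lebesgue_on_transfer(1)[OF cyl borel_measurable_integrable[OF D0(2)] m _ ae] D0(2) u'(2) U0(2) by simp
 qed
 show thesis
 proof (rule that[OF _ u'(3)], unfold_locales)
  show "p \<ge> 2" "T > 0" "L \<ge> 1" "open \<Omega>" "bounded \<Omega>" "u' \<in> borel_measurable borel" "U \<in> borel_measurable borel" by (fact p T L \<Omega> u'(1) U(1))+
  show "u' z = 0" "U z = 0" if "z \<notin> cylinder \<Omega> T" for z using u'(2) U(2) that by auto
  show "integrable lborel (\<lambda>z. \<bar>u' z\<bar> powr p)"
   by (rule integrable_dominated[OF Lp]) auto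
  have U0p: "integrable lborel (\<lambda>z. norm (U0 z) powr p)"
   by (rule integrable_dominated[OF Lp]) auto
  have "AE z in lborel. norm (U0 z) powr p = norm (U z) powr p" using UU by eventually_elim simp
  then show "integrable lborel (\<lambda>z. norm (U z) powr p)" by (intro integrable_cong_AE_imp[OF U0p]) measurable
  show "\<bar>\<psi> (x, t) - \<psi> (x, s)\<bar> \<le> L * \<bar>t - s\<bar>" if "x \<in> \<Omega>" "0 < s" "s < T" "0 < t" "t < T" for x s t using \<psi>L that by simp
  show \<psi>d: "((\<lambda>x. \<psi> (x, t)) has_derivative (\<lambda>h. space_grad \<psi> (x, t) \<bullet> h)) (at x)" if "x \<in> \<Omega>" "0 < t" "t < T" for x t
   by (rule space_derivative[OF Ck_on_differentiable[OF \<psi>]]) (use that in auto)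
  show \<psi>c: "continuous_on \<Omega> (\<lambda>x. space_grad \<psi> (x, t))" if "0 < t" "t < T" for t
  proof -
   have "continuous_on \<Omega> (\<lambda>x. frechet_derivative \<psi> (at (x, t)) (b, 0))" if "b \<in> Basis" for b
    by (rule continuous_on_compose2[OF Ck_on_partial_continuous[OF \<psi> Pair_Basis(1)[OF that]]])
     (use \<open>0 < t\<close> \<open>t < T\<close> in \<open>auto intro!: continuous_intros\<close>)
   then show ?thesis unfolding space_grad_def by (intro continuous_on_sum continuous_on_scaleR continuous_on_const)
  qed
  show "(LBINT z. - b_fun p (u' z) * time_deriv \<gamma> z + flux p (U z) \<bullet> space_grad \<gamma> z) = 0" if \<gamma>: "\<gamma> \<in> test_functions (cylinder \<Omega> T)" for \<gamma>
  proof -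
   note [measurable] = space_time_derivatives_measurable[OF \<gamma>] b_fun_measurable
   note l = borel_restrict_lebesgue_on[OF space_time_derivatives_measurable(1)[OF \<gamma>]] borel_restrict_lebesgue_on[OF space_time_derivatives_measurable(2)[OF \<gamma>]]
   have bm: "(\<lambda>z. b_fun p (u z)) \<in> borel_measurable (lebesgue_on (cylinder \<Omega> T))" unfolding b_fun_def using um by measurable
   have fm: "(\<lambda>z. norm (D1 z) powr (p - 2) *\<^sub>R D1 z) \<in> borel_measurable (lebesgue_on (cylinder \<Omega> T))" using D1m by measurable
   have m1: "(\<lambda>z. - b_fun p (u z) * time_deriv \<gamma> z + (norm (D1 z) powr (p - 2) *\<^sub>R D1 z) \<bullet> space_grad \<gamma> z) \<in> borel_measurable (lebesgue_on (cylinder \<Omega> T))"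
    by (intro borel_measurable_add borel_measurable_times borel_measurable_uminus borel_measurable_inner bm fm l)
   have m2: "(\<lambda>z. - b_fun p (u' z) * time_deriv \<gamma> z + flux p (U z) \<bullet> space_grad \<gamma> z) \<in> borel_measurable borel"
    unfolding b_fun_def flux_def by measurable
   have ae: "AE z in lborel. z \<in> cylinder \<Omega> T \<longrightarrow> - b_fun p (u' z) * time_deriv \<gamma> z + flux p (U z) \<bullet> space_grad \<gamma> z
     = - b_fun p (u z) * time_deriv \<gamma> z + (norm (D1 z) powr (p - 2) *\<^sub>R D1 z) \<bullet> space_grad \<gamma> z"
    using u'(3) U(3) by eventually_elim (simp add: flux_def)
   have "(LBINT z. - b_fun p (u' z) * time_deriv \<gamma> z + flux p (U z) \<bullet> space_grad \<gamma> z)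
    = (LINT z|lebesgue_on (cylinder \<Omega> T). - b_fun p (u z) * time_deriv \<gamma> z + (norm (D1 z) powr (p - 2) *\<^sub>R D1 z) \<bullet> space_grad \<gamma> z)"
    by (rule lebesgue_on_transfer(2)[OF cyl m1 m2 _ ae, symmetric]) (use u'(2) U(2) in \<open>simp add: b_fun_def flux_def\<close>)
   then show ?thesis using weak[OF \<gamma>] by simp
  qed
  have bdry': "AE t in lborel. t \<in> {0<..<T} \<longrightarrow> (\<lambda>x. u (x, t) - \<psi> (x, t)) \<in> W1p_0 p \<Omega>" using bdry unfolding AE_lebesgue_on_iff[OF I] .
  show "AE t in lborel. 0 < t \<and> t < T \<longrightarrow> approximable p \<Omega> (\<lambda>x. u' (x, t) - \<psi> (x, t)) (\<lambda>x. U (x, t) - space_grad \<psi> (x, t))"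
   using AE_lborel_slices[OF u'(3)] AE_lborel_slices[OF U(3)] G1 bdry'
  proof eventually_elim
   case (elim t)
   show ?case
   proof
    assume t: "0 < t \<and> t < T"
    then have w: "(\<lambda>x. u (x, t) - \<psi> (x, t)) \<in> W1p_0 p \<Omega>" and g: "has_weak_gradient \<Omega> (\<lambda>x. u (x, t)) (\<lambda>x. D1 (x, t))" using elim by auto
    from w obtain G \<phi> where G: "G \<in> Lp_on p \<Omega>" "has_weak_gradient \<Omega> (\<lambda>x. u (x, t) - \<psi> (x, t)) G" "\<And>k::nat. \<phi> k \<in> test_functions \<Omega>"
     "(\<lambda>k. LINT x|lebesgue_on \<Omega>. \<bar>\<phi> k x - (u (x, t) - \<psi> (x, t))\<bar> powr p) \<longlonglongrightarrow> 0"
     "(\<lambda>k. LINT x|lebesgue_on \<Omega>. norm (grad (\<phi> k) x - G x) powr p) \<longlonglongrightarrow> 0" unfolding W1p_0_def by blast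
    have wL: "(\<lambda>x. u (x, t) - \<psi> (x, t)) \<in> Lp_on p \<Omega>" using w unfolding W1p_0_def by blast
    have "has_weak_gradient \<Omega> (\<lambda>x. \<psi> (x, t)) (\<lambda>x. space_grad \<psi> (x, t))"
     by (rule classical_weak_gradient[OF \<Omega>(1) \<psi>d \<psi>c]) (use t in auto)
    from weak_gradient_unique[OF \<Omega>(1) G(2) weak_gradient_diff[OF \<Omega>(1) g this]]
    have GG: "AE x in lborel. x \<in> \<Omega> \<longrightarrow> G x = D1 (x, t) - space_grad \<psi> (x, t)" .
    have \<psi>1: "continuous_on \<Omega> (\<lambda>x. \<psi> (x, t))"
     by (rule continuous_at_imp_continuous_on) (use has_derivative_continuous[OF \<psi>d] t in blast)
    note ind = borel_measurable_continuous_on_indicator[OF \<Omega>b]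
    have \<psi>m: "(\<lambda>x. indicator \<Omega> x *\<^sub>R \<psi> (x, t)) \<in> borel_measurable borel" by (rule ind[OF \<psi>1])
    have \<psi>gm: "(\<lambda>x. indicator \<Omega> x *\<^sub>R space_grad \<psi> (x, t)) \<in> borel_measurable borel" by (rule ind[OF \<psi>c]) (use t in auto)
    show "approximable p \<Omega> (\<lambda>x. u' (x, t) - \<psi> (x, t)) (\<lambda>x. U (x, t) - space_grad \<psi> (x, t))"
    proof (rule approximableI[OF p0 \<Omega>b wL G(1,3,4,5)])
     have [measurable]: "(\<lambda>x. indicator \<Omega> x *\<^sub>R u' (x, t)) \<in> borel_measurable borel" "(\<lambda>x. indicator \<Omega> x *\<^sub>R U (x, t)) \<in> borel_measurable borel" by measurable
     show "(\<lambda>x. indicator \<Omega> x *\<^sub>R (u' (x, t) - \<psi> (x, t))) \<in> borel_measurable borel"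
      unfolding scaleR_diff_right by (rule borel_measurable_diff[OF _ \<psi>m]) measurable
     show "(\<lambda>x. indicator \<Omega> x *\<^sub>R (U (x, t) - space_grad \<psi> (x, t))) \<in> borel_measurable borel"
      unfolding scaleR_diff_right by (rule borel_measurable_diff[OF _ \<psi>gm]) measurable
     show "AE x in lborel. x \<in> \<Omega> \<longrightarrow> u' (x, t) - \<psi> (x, t) = u (x, t) - \<psi> (x, t)"
      using elim(1) by eventually_elim (use t in auto)
     show "AE x in lborel. x \<in> \<Omega> \<longrightarrow> U (x, t) - space_grad \<psi> (x, t) = G x"
      using elim(2) GG by eventually_elim (use t in auto)
    qed
   qed
  qed
 qed
qed

lemma initial_slices:
 fixes u :: "'a::euclidean_space \<times> real \<Rightarrow> real"
 assumes \<Omega>: "open \<Omega>" and ae: "AE z in lborel. z \<in> cylinder \<Omega> T \<longrightarrow> u' z = u z"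
 shows "AE t in lborel. 0 < t \<and> t < T \<longrightarrow> (\<integral>\<^sup>+x. ennreal \<bar>b_fun p (u (x, t)) - b_fun p (\<psi> (x, t))\<bar> \<partial>lebesgue_on \<Omega>)
   = (\<integral>\<^sup>+x. ennreal \<bar>b_fun p (u' (x, t)) - b_fun p (\<psi> (x, t))\<bar> * indicator \<Omega> x \<partial>lborel)"
 using AE_lborel_slices[OF ae]
proof eventually_elim
 case (elim t)
 have \<Omega>b: "\<Omega> \<in> sets borel" using \<Omega> by auto
 show ?case
 proof
  assume t: "0 < t \<and> t < T"
  show "(\<integral>\<^sup>+x. ennreal \<bar>b_fun p (u (x, t)) - b_fun p (\<psi> (x, t))\<bar> \<partial>lebesgue_on \<Omega>)
    = (\<integral>\<^sup>+x. ennreal \<bar>b_fun p (u' (x, t)) - b_fun p (\<psi> (x, t))\<bar> * indicator \<Omega> x \<partial>lborel)"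
   unfolding nn_integral_lebesgue_on[OF \<Omega>b]
  proof (rule nn_integral_cong_AE)
   show "AE x in lborel. ennreal \<bar>b_fun p (u (x, t)) - b_fun p (\<psi> (x, t))\<bar> * indicator \<Omega> x
     = ennreal \<bar>b_fun p (u' (x, t)) - b_fun p (\<psi> (x, t))\<bar> * indicator \<Omega> x"
    using elim by eventually_elim (use t in \<open>auto simp: indicator_def\<close>)
  qed
 qed
qed

text \<open>
 The triangle inequality through \<open>\<psi>\<close>.
\<close>

lemma initial_values_agree:
 fixes u v :: "'a::euclidean_space \<times> real \<Rightarrow> real"
 assumes \<Omega>: "open \<Omega>" and T: "T > 0" and \<psi>: "\<And>t. 0 < t \<Longrightarrow> t < T \<Longrightarrow> continuous_on \<Omega> (\<lambda>x. \<psi> (x, t))"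
  and m: "u' \<in> borel_measurable borel" "v' \<in> borel_measurable borel"
  and out: "\<And>z. z \<notin> cylinder \<Omega> T \<Longrightarrow> u' z = 0" "\<And>z. z \<notin> cylinder \<Omega> T \<Longrightarrow> v' z = 0"
  and ae: "AE z in lborel. z \<in> cylinder \<Omega> T \<longrightarrow> u' z = u z" "AE z in lborel. z \<in> cylinder \<Omega> T \<longrightarrow> v' z = v z"
  and lim: "((\<lambda>t. \<integral>\<^sup>+x. ennreal \<bar>b_fun p (u (x, t)) - b_fun p (\<psi> (x, t))\<bar> \<partial>lebesgue_on \<Omega>) \<longlongrightarrow> 0) (at_right 0)"
   "((\<lambda>t. \<integral>\<^sup>+x. ennreal \<bar>b_fun p (v (x, t)) - b_fun p (\<psi> (x, t))\<bar> \<partial>lebesgue_on \<Omega>) \<longlongrightarrow> 0) (at_right 0)"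
  and e: "e > 0"
 shows "\<exists>d>0. AE t in lborel. 0 < t \<and> t < d \<longrightarrow> (\<integral>\<^sup>+x. ennreal \<bar>b_fun p (u' (x, t)) - b_fun p (v' (x, t))\<bar> \<partial>lborel) \<le> ennreal e"
proof -
 have e2: "ennreal (e / 2) > 0" using e by simp
 obtain d1 where d1: "d1 > 0" "\<And>t. 0 < t \<Longrightarrow> t < d1 \<Longrightarrow> (\<integral>\<^sup>+x. ennreal \<bar>b_fun p (u (x, t)) - b_fun p (\<psi> (x, t))\<bar> \<partial>lebesgue_on \<Omega>) < ennreal (e / 2)"
  using order_tendstoD(2)[OF lim(1) e2] unfolding eventually_at_right_field by blast
 obtain d2 where d2: "d2 > 0" "\<And>t. 0 < t \<Longrightarrow> t < d2 \<Longrightarrow> (\<integral>\<^sup>+x. ennreal \<bar>b_fun p (v (x, t)) - b_fun p (\<psi> (x, t))\<bar> \<partial>lebesgue_on \<Omega>) < ennreal (e / 2)"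
  using order_tendstoD(2)[OF lim(2) e2] unfolding eventually_at_right_field by blast
 have \<Omega>b [measurable]: "\<Omega> \<in> sets borel" using \<Omega> by auto
 note [measurable] = m b_fun_measurable
 show ?thesis
 proof (intro exI[of _ "min (min d1 d2) T"] conjI)
  show "0 < min (min d1 d2) T" using d1 d2 T by simp
  show "AE t in lborel. 0 < t \<and> t < min (min d1 d2) T \<longrightarrow> (\<integral>\<^sup>+x. ennreal \<bar>b_fun p (u' (x, t)) - b_fun p (v' (x, t))\<bar> \<partial>lborel) \<le> ennreal e"
   using initial_slices[OF \<Omega> ae(1), of p \<psi>] initial_slices[OF \<Omega> ae(2), of p \<psi>]
  proof eventually_elim
   case (elim t)
   show ?case
   proof
    assume t: "0 < t \<and> t < min (min d1 d2) T"
    define A where "A w x = ennreal \<bar>b_fun p (w (x, t)) - b_fun p (\<psi> (x, t))\<bar> * indicator \<Omega> x" for w :: "'a \<times> real \<Rightarrow> real" and x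
    have [measurable]: "(\<lambda>x. indicator \<Omega> x *\<^sub>R \<psi> (x, t)) \<in> borel_measurable borel"
     by (rule borel_measurable_continuous_on_indicator[OF \<Omega>b \<psi>]) (use t in auto)
    have Am: "A w \<in> borel_measurable lborel" if [measurable]: "w \<in> borel_measurable borel" for w
    proof -
     have "A w = (\<lambda>x. ennreal \<bar>b_fun p (w (x, t)) - b_fun p (indicator \<Omega> x *\<^sub>R \<psi> (x, t))\<bar> * indicator \<Omega> x)"
      by (auto simp: A_def indicator_def fun_eq_iff)
     also have "\<dots> \<in> borel_measurable lborel" unfolding b_fun_def by measurable
     finally show ?thesis .
    qed
    have "(\<integral>\<^sup>+x. ennreal \<bar>b_fun p (u' (x, t)) - b_fun p (v' (x, t))\<bar> \<partial>lborel) \<le> (\<integral>\<^sup>+x. A u' x + A v' x \<partial>lborel)"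
    proof (rule nn_integral_mono)
     fix x
     show "ennreal \<bar>b_fun p (u' (x, t)) - b_fun p (v' (x, t))\<bar> \<le> A u' x + A v' x"
     proof (cases "x \<in> \<Omega>")
      case True
      have "ennreal \<bar>b_fun p (u' (x, t)) - b_fun p (v' (x, t))\<bar>
       \<le> ennreal (\<bar>b_fun p (u' (x, t)) - b_fun p (\<psi> (x, t))\<bar> + \<bar>b_fun p (v' (x, t)) - b_fun p (\<psi> (x, t))\<bar>)"
       by (rule ennreal_leI) linarith
      then show ?thesis using True by (simp add: A_def)
     next
      case False
      then have "u' (x, t) = 0" "v' (x, t) = 0" by (auto intro!: out)
      then show ?thesis by simp
     qed
    qed
    also have "\<dots> = (\<integral>\<^sup>+x. A u' x \<partial>lborel) + (\<integral>\<^sup>+x. A v' x \<partial>lborel)" by (rule nn_integral_add[OF Am[OF m(1)] Am[OF m(2)]])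
    also have "\<dots> \<le> ennreal (e / 2) + ennreal (e / 2)"
    proof (rule add_mono)
     show "(\<integral>\<^sup>+x. A u' x \<partial>lborel) \<le> ennreal (e / 2)" using elim(1) d1(2)[of t] t unfolding A_def by auto
     show "(\<integral>\<^sup>+x. A v' x \<partial>lborel) \<le> ennreal (e / 2)" using elim(2) d2(2)[of t] t unfolding A_def by auto
    qed
    also have "\<dots> = ennreal e" using e by (simp flip: ennreal_plus)
    finally show "(\<integral>\<^sup>+x. ennreal \<bar>b_fun p (u' (x, t)) - b_fun p (v' (x, t))\<bar> \<partial>lborel) \<le> ennreal e" .
   qed
  qed
 qed
qed

section \<open>Uniqueness\<close>

theorem theorem4p1:
 fixes p T :: real
  and \<Omega> :: "(real ^ 'n) set"
  and \<psi> u v :: "(real ^ 'n) \<times> real \<Rightarrow> real"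
 assumes "p \<ge> 2" and "T > 0"
  and "bounded \<Omega>" and "lipschitz_domain \<Omega>"
  and "\<psi> \<in> Ck_closure 2 (cylinder \<Omega> T)"
  and "trudinger_weak_solution p \<Omega> T \<psi> u"
  and "trudinger_weak_solution p \<Omega> T \<psi> v"
 shows "AE z in lebesgue_on (cylinder \<Omega> T). u z = v z"
proof -
 have \<Omega>: "open \<Omega>" using assms(4) unfolding lipschitz_domain_def by blast
 have \<psi>2: "\<psi> \<in> Ck_closure (Suc 1) (cylinder \<Omega> T)" using assms(5) by (simp add: numeral_2_eq_2)
 then have \<psi>C: "\<psi> \<in> Ck_on (Suc 1) (cylinder \<Omega> T)" unfolding Ck_closure_def by blast
 obtain L where L: "L \<ge> 1" "\<forall>x\<in>\<Omega>. \<forall>s\<in>{0<..<T}. \<forall>t\<in>{0<..<T}. \<bar>\<psi> (x, t) - \<psi> (x, s)\<bar> \<le> L * \<bar>t - s\<bar>"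
  by (rule Ck_closure_time_Lipschitz[OF assms(3) \<psi>2], rule that)
 obtain u' U where u': "borel_solution p T L \<Omega> \<psi> (space_grad \<psi>) u' U" "AE z in lborel. z \<in> cylinder \<Omega> T \<longrightarrow> u' z = u z"
  by (rule borel_representative[OF assms(1,2) L(1) \<Omega> assms(3) \<psi>C L(2) assms(6)], rule that)
 obtain v' V where v': "borel_solution p T L \<Omega> \<psi> (space_grad \<psi>) v' V" "AE z in lborel. z \<in> cylinder \<Omega> T \<longrightarrow> v' z = v z"
  by (rule borel_representative[OF assms(1,2) L(1) \<Omega> assms(3) \<psi>C L(2) assms(7)], rule that)
 interpret u: borel_solution p T L \<Omega> \<psi> "space_grad \<psi>" u' U by (rule u'(1))
 interpret v: borel_solution p T L \<Omega> \<psi> "space_grad \<psi>" v' V by (rule v'(1))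
 interpret uv: solution_pair p T L \<Omega> \<psi> "space_grad \<psi>" u' U v' V ..
 interpret vu: solution_pair p T L \<Omega> \<psi> "space_grad \<psi>" v' V u' U ..
 have \<psi>c: "continuous_on \<Omega> (\<lambda>x. \<psi> (x, t))" if "0 < t" "t < T" for t
  by (rule continuous_at_imp_continuous_on) (use has_derivative_continuous[OF u.\<psi>_space(1)] that in blast)
 have lim: "((\<lambda>t. \<integral>\<^sup>+x. ennreal \<bar>b_fun p (u (x, t)) - b_fun p (\<psi> (x, t))\<bar> \<partial>lebesgue_on \<Omega>) \<longlongrightarrow> 0) (at_right 0)"
  "((\<lambda>t. \<integral>\<^sup>+x. ennreal \<bar>b_fun p (v (x, t)) - b_fun p (\<psi> (x, t))\<bar> \<partial>lebesgue_on \<Omega>) \<longlongrightarrow> 0) (at_right 0)"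
  using assms(6,7) unfolding trudinger_weak_solution_def by blast+
 have "AE z in lborel. u' z \<le> v' z"
  by (rule uv.comparison, rule initial_values_agree[OF \<Omega> assms(2) \<psi>c u.u_borel v.u_borel u.outside(1) v.outside(1) u'(2) v'(2) lim])
 moreover have "AE z in lborel. v' z \<le> u' z"
  by (rule vu.comparison, rule initial_values_agree[OF \<Omega> assms(2) \<psi>c v.u_borel u.u_borel v.outside(1) u.outside(1) v'(2) u'(2) lim(2,1)])
 ultimately have "AE z in lborel. z \<in> cylinder \<Omega> T \<longrightarrow> u z = v z" using u'(2) v'(2) by eventually_elim auto
 then show ?thesis using AE_lebesgue_on_iff[OF u.cyl_borel] by blast
qed

end
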